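(* Let $\nu>0$, $g\in L^\infty_\nu(\mathbb{R}^N)$ and $f\in L^{2^\#}(\Omega)$. Then there exists $$(\lambda,u)\in L^\infty(\mathbb{R}^N)'\times\Upsilon^\sigma_\infty(\Omega)$$ such that $$\langle\lambda D^\sigma u,D^\sigma v\rangle_{(L^\infty(\mathbb{R}^N)^N)'\times L^\infty(\mathbb{R}^N)^N}+\int_{\mathbb{R}^N}AD^\sigma u\cdot D^\sigma v\,dx=\int_\Omega fv\,dx\qquad\text{for all }v\in\Upsilon^\sigma_\infty(\Omega),$$ $$|D^\sigma u|\le g\ \text{ a.e. in }\mathbb{R}^N,\qquad \lambda\ge0\quad\text{and}\quad\lambda(|D^\sigma u|-g)=0\ \text{ in }L^\infty(\mathbb{R}^N)'.$$
   Context: Let $0<\sigma<1$ and let $\Omega\subset\mathbb{R}^N$ be a bounded domain with Lipschitz boundary. Functions on $\Omega$ are extended by zero outside $\Omega$, with the same notation. The $\sigma$-gradient (distributional Riesz fractional gradient) of $u\in L^p(\mathbb{R}^N)$, $1<p<\infty$, is $D^\sigma u=D(I_{1-\sigma}u)$, i.e. $(D^\sigma u)_j=\frac{\partial}{\partial x_j}I_{1-\sigma}u$ in the sense of distributions, where for $0<\alpha<1$, $I_\alpha u(x)=\gamma_{N,\alpha}\int_{\mathbb{R}^N}\frac{u(y)}{|x-y|^{N-\alpha}}dy$ and $\gamma_{N,\alpha}=\frac{\Gamma(\frac{N-\alpha}{2})}{\pi^{N/2}2^\alpha\Gamma(\frac\alpha2)}$. $H^\sigma_0(\Omega)$ is the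 closure of $C^\infty_0(\Omega)$ in $H^\sigma(\mathbb{R}^N)$, with the (equivalent) norm $\|u\|_{H^\sigma_0(\Omega)}=\|D^\sigma u\|_{L^2(\mathbb{R}^N)^N}$. $\Upsilon^\sigma_\infty(\Omega)=\{v\in H^\sigma_0(\Omega):D^\sigma v\in L^\infty(\mathbb{R}^N)^N\}$. For $\nu>0$, $L^\infty_\nu(\mathbb{R}^N)=\{v\in L^\infty(\mathbb{R}^N):v(x)\ge\nu\text{ for a.e. }x\in\mathbb{R}^N\}$. The matrix $A:\mathbb{R}^N\to\mathbb{R}^{N\times N}$ is bounded, measurable and positive definite (not necessarily symmetric): for some $a_*,a^*>0$, for a.e. $x\in\mathbb{R}^N$ and all $\xi,\eta\in\mathbb{R}^N$, $a_*|\xi|^2\le A(x)\xi\cdot\xi$ and $A(x)\xi\cdot\eta\le a^*|\xi||\eta|$. $2^\#=\frac{2N}{N+2\sigma}$ when $\sigma<\frac N2$; if $N=1$ and $\sigma=\frac12$, $2^\#=q'=\frac q{q-1}$ for an arbitrary fixed $q\in(1,\infty)$; if $N=1$ and $\sigma>\frac12$, $2^\#=1$. A prime denotes the topological dual. For $\lambda\in L^\infty(\mathbb{R}^N)'$ and $\alpha,\beta\in L^\infty(\mathbb{R}^N)^N$, $\lambda\alpha\in(L^\infty(\mathbb{R}^N)^N)'$ is defined by $\langle\lambda\alpha,\beta\rangle=\langle\lambda,\alpha\cdot\beta\rangle_{L^\infty(\mathbb{R}^N)'\times L^\infty(\mathbb{R}^N)}$; similarly, for scalar $h\in L^\infty(\mathbb{R}^N)$,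 $\lambda h\in L^\infty(\mathbb{R}^N)'$ is $\langle\lambda h,w\rangle=\langle\lambda,hw\rangle$ for all $w\in L^\infty(\mathbb{R}^N)$. $\lambda\ge0$ means $\langle\lambda,w\rangle\ge0$ for all $w\in L^\infty(\mathbb{R}^N)$ with $w\ge0$ a.e. *)

theory Defs
  imports "HOL-Analysis.Analysis" "HOL-Probability.Essential_Supremum"
begin

text \<open>
  Elements of Lebesgue and Sobolev spaces are represented by functions on the whole space,
  measurable with respect to the Lebesgue sigma-algebra; equality of elements is equality almost
  everywhere, and every notion below is invariant under changes on null sets.
\<close>

section \<open>Lipschitz domains\<close>

text \<open>
  Near each boundary point the set is the strict epigraph, in some unit direction \<open>e\<close>, of a
  Lipschitz function of the component orthogonal to \<open>e\<close>. Only the restriction of \<open>h\<close> to the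
  hyperplane orthogonal to \<open>e\<close> is used; every Lipschitz function on that hyperplane arises so.
\<close>

definition lipschitz_boundary :: "'a::euclidean_space set \<Rightarrow> bool" where
  "lipschitz_boundary \<Omega> \<longleftrightarrow>
     (\<forall>p\<in>frontier \<Omega>. \<exists>e r L. \<exists>h :: 'a \<Rightarrow> real.
        norm e = 1 \<and> r > 0 \<and> L-lipschitz_on UNIV h \<and>
        \<Omega> \<inter> ball p r = {x \<in> ball p r. h (x - (x \<bullet> e) *\<^sub>R e) < x \<bullet> e})"

definition bounded_lipschitz_domain :: "'a::euclidean_space set \<Rightarrow> bool" where
  "bounded_lipschitz_domain \<Omega> \<longleftrightarrow>
     open \<Omega> \<and> connected \<Omega> \<and> \<Omega> \<noteq> {} \<and> bounded \<Omega> \<and> lipschitz_boundary \<Omega>"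

section \<open>Test functions\<close>

definition partial_deriv :: "'n::finite \<Rightarrow> (real^'n \<Rightarrow> real) \<Rightarrow> real^'n \<Rightarrow> real" where
  "partial_deriv j \<phi> = (\<lambda>x. frechet_derivative \<phi> (at x) (axis j 1))"

text \<open>
  Iterated partial derivatives of all orders exist and are (Frechet) differentiable, hence
  continuous.
\<close>

definition smooth :: "(real^'n::finite \<Rightarrow> real) \<Rightarrow> bool" where
  "smooth \<phi> \<longleftrightarrow> (\<forall>js::'n list. foldr partial_deriv js \<phi> differentiable_on UNIV)"

definition test_functions :: "(real^'n::finite) set \<Rightarrow> (real^'n \<Rightarrow> real) set" where
  "test_functions \<Omega> =
     {\<phi>. smooth \<phi> \<and> compact (closure {x. \<phi> x \<noteq> 0}) \<and> closure {x. \<phi> x \<noteq> 0} \<subseteq> \<Omega>}"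

section \<open>Lebesgue spaces\<close>

definition Lp :: "real \<Rightarrow> 'a::euclidean_space set \<Rightarrow> ('a \<Rightarrow> real) set" where
  "Lp p S = {f \<in> borel_measurable (lebesgue_on S).
               integrable (lebesgue_on S) (\<lambda>x. \<bar>f x\<bar> powr p)}"

definition Linf_norm :: "('a::euclidean_space \<Rightarrow> 'b::euclidean_space) \<Rightarrow> ennreal" where
  "Linf_norm f = esssup lebesgue (\<lambda>x. ennreal (norm (f x)))"

definition Linf :: "('a::euclidean_space \<Rightarrow> 'b::euclidean_space) set" where
  "Linf = {f \<in> borel_measurable lebesgue. Linf_norm f < \<infinity>}"

definition Linf_ge :: "real \<Rightarrow> ('a::euclidean_space \<Rightarrow> real) set" where
  "Linf_ge \<nu> = {g \<in> Linf. AE x in lebesgue. \<nu> \<le> g x}"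

section \<open>The dual of the space of essentially bounded functions\<close>

text \<open>
  A bounded linear functional is a function on representatives. The norm bound makes it
  agree on functions that are equal almost everywhere. Its values outside \<^const>\<open>Linf\<close> are
  irrelevant.
\<close>

definition Linf_dual :: "(('a::euclidean_space \<Rightarrow> 'b::euclidean_space) \<Rightarrow> real) set" where
  "Linf_dual = {\<Lambda>.
     (\<forall>v\<in>Linf. \<forall>w\<in>Linf. \<Lambda> (\<lambda>x. v x + w x) = \<Lambda> v + \<Lambda> w) \<and>
     (\<forall>c. \<forall>w\<in>Linf. \<Lambda> (\<lambda>x. c *\<^sub>R w x) = c * \<Lambda> w) \<and>
     (\<exists>C. \<forall>w\<in>Linf. \<bar>\<Lambda> w\<bar> \<le> C * enn2real (Linf_norm w))}"

definition dual_vec_mult ::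
  "(('a::euclidean_space \<Rightarrow> real) \<Rightarrow> real) \<Rightarrow> ('a \<Rightarrow> 'b::euclidean_space) \<Rightarrow> ('a \<Rightarrow> 'b) \<Rightarrow> real" where
  "dual_vec_mult \<Lambda> \<alpha> = (\<lambda>\<beta>. \<Lambda> (\<lambda>x. \<alpha> x \<bullet> \<beta> x))"

definition dual_mult ::
  "(('a::euclidean_space \<Rightarrow> real) \<Rightarrow> real) \<Rightarrow> ('a \<Rightarrow> real) \<Rightarrow> ('a \<Rightarrow> real) \<Rightarrow> real" where
  "dual_mult \<Lambda> h = (\<lambda>w. \<Lambda> (\<lambda>x. h x * w x))"

definition dual_eq_zero :: "(('a::euclidean_space \<Rightarrow> real) \<Rightarrow> real) \<Rightarrow> bool" where
  "dual_eq_zero \<Lambda> \<longleftrightarrow> (\<forall>w\<in>Linf. \<Lambda> w = 0)"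

definition dual_nonneg :: "(('a::euclidean_space \<Rightarrow> real) \<Rightarrow> real) \<Rightarrow> bool" where
  "dual_nonneg \<Lambda> \<longleftrightarrow> (\<forall>w\<in>Linf. (AE x in lebesgue. 0 \<le> w x) \<longrightarrow> 0 \<le> \<Lambda> w)"

section \<open>The distributional Riesz fractional gradient\<close>

definition riesz_const :: "real \<Rightarrow> real \<Rightarrow> real" where
  "riesz_const N \<alpha> = Gamma ((N - \<alpha>) / 2) / (pi powr (N / 2) * 2 powr \<alpha> * Gamma (\<alpha> / 2))"

definition riesz_potential :: "real \<Rightarrow> (real^'n::finite \<Rightarrow> real) \<Rightarrow> real^'n \<Rightarrow> real" where
  "riesz_potential \<alpha> u = (\<lambda>x. riesz_const (real CARD('n)) \<alpha> *
     (LINT y|lebesgue. u y / norm (x - y) powr (real CARD('n) - \<alpha>)))"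

definition locally_integrable ::
  "('a::euclidean_space \<Rightarrow> 'b::euclidean_space) \<Rightarrow> bool" where
  "locally_integrable f \<longleftrightarrow> (\<forall>K. compact K \<longrightarrow> set_integrable lebesgue K f)"

definition has_distributional_gradient ::
  "(real^'n::finite \<Rightarrow> real) \<Rightarrow> (real^'n \<Rightarrow> real^'n) \<Rightarrow> bool" where
  "has_distributional_gradient F G \<longleftrightarrow>
     locally_integrable F \<and> locally_integrable G \<and>
     (\<forall>\<phi>\<in>test_functions UNIV. \<forall>j.
        (LINT x|lebesgue. F x * partial_deriv j \<phi> x) = - (LINT x|lebesgue. (G x $ j) * \<phi> x))"

definition has_sigma_gradient ::
  "real \<Rightarrow> (real^'n::finite \<Rightarrow> real) \<Rightarrow> (real^'n \<Rightarrow> real^'n) \<Rightarrow> bool" where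
  "has_sigma_gradient \<sigma> u G \<longleftrightarrow> has_distributional_gradient (riesz_potential (1 - \<sigma>) u) G"

text \<open>
  A representative of the fractional gradient, which is unique up to null sets; the value is
  meaningful only if the distributional gradient is a locally integrable function.
\<close>

definition sigma_gradient ::
  "real \<Rightarrow> (real^'n::finite \<Rightarrow> real) \<Rightarrow> real^'n \<Rightarrow> real^'n" where
  "sigma_gradient \<sigma> u = (SOME G. has_sigma_gradient \<sigma> u G)"

section \<open>Fractional Sobolev spaces\<close>

text \<open>
  The square of the Sobolev--Slobodeckij norm, with values in the extended reals.
\<close>

definition Hsigma_sqnorm :: "real \<Rightarrow> (real^'n::finite \<Rightarrow> real) \<Rightarrow> ennreal" where
  "Hsigma_sqnorm \<sigma> u =
     (\<integral>\<^sup>+x. ennreal (\<bar>u x\<bar>\<^sup>2) \<partial>lebesgue) +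
     (\<integral>\<^sup>+x. (\<integral>\<^sup>+y. ennreal (\<bar>u x - u y\<bar>\<^sup>2 / norm (x - y) powr (real CARD('n) + 2 * \<sigma>))
        \<partial>lebesgue) \<partial>lebesgue)"

definition Hsigma :: "real \<Rightarrow> (real^'n::finite \<Rightarrow> real) set" where
  "Hsigma \<sigma> = {u \<in> borel_measurable lebesgue. Hsigma_sqnorm \<sigma> u < \<infinity>}"

definition Hsigma0 :: "real \<Rightarrow> (real^'n::finite) set \<Rightarrow> (real^'n \<Rightarrow> real) set" where
  "Hsigma0 \<sigma> \<Omega> = {u \<in> Hsigma \<sigma>.
     \<forall>\<epsilon>>0. \<exists>\<phi>\<in>test_functions \<Omega>. Hsigma_sqnorm \<sigma> (\<lambda>x. u x - \<phi> x) < \<epsilon>}"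

definition Upsilon_inf :: "real \<Rightarrow> (real^'n::finite) set \<Rightarrow> (real^'n \<Rightarrow> real) set" where
  "Upsilon_inf \<sigma> \<Omega> = {v \<in> Hsigma0 \<sigma> \<Omega>. \<exists>G\<in>Linf. has_sigma_gradient \<sigma> v G}"

section \<open>Data of the problem\<close>

definition bounded_measurable_elliptic ::
  "real \<Rightarrow> real \<Rightarrow> (real^'n::finite \<Rightarrow> real^'n^'n) \<Rightarrow> bool" where
  "bounded_measurable_elliptic a_low a_up A \<longleftrightarrow>
     A \<in> borel_measurable lebesgue \<and>
     (AE x in lebesgue. \<forall>\<xi> \<eta>.
        a_low * (norm \<xi>)\<^sup>2 \<le> (A x *v \<xi>) \<bullet> \<xi> \<and> (A x *v \<xi>) \<bullet> \<eta> \<le> a_up * norm \<xi> * norm \<eta>)"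

text \<open>
  For \<open>0 < \<sigma> < 1\<close> the last two cases occur only in dimension \<open>N = 1\<close>, for \<open>\<sigma> = 1/2\<close>
  and \<open>\<sigma> > 1/2\<close> respectively; the parameter \<open>q\<close> matters only in the former.
\<close>

definition two_sharp :: "nat \<Rightarrow> real \<Rightarrow> real \<Rightarrow> real" where
  "two_sharp N \<sigma> q =
     (if \<sigma> < real N / 2 then 2 * real N / (real N + 2 * \<sigma>)
      else if \<sigma> = real N / 2 then q / (q - 1)
      else 1)"

end

theory Submission
  imports Defs "HOL-Probability.Distributions"
begin

text \<open>
  The solution \<open>u\<close> comes from a variational inequality. On the closed convex set \<open>K\<close> of the
  fractional gradients \<open>G\<close> with \<open>\<bar>G\<bar> \<le> g\<close>, a part of the Hilbert space \<open>L\<^sup>2\<close>, the matrix \<open>A\<close> acts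
  as a bounded coercive operator, and Stampacchia's theorem gives \<open>u\<close> in \<open>K\<close> with
  \<open>\<integral> A Du \<cdot> D(v - u) \<ge> \<integral> f (v - u)\<close> for every \<open>v\<close> in \<open>K\<close>
  (\<open>gradient_constraint_variational_inequality\<close>). So \<open>u\<close> minimises an affine cost on
  \<open>\<Upsilon>\<close> under the convex constraint \<open>(\<bar>Dv\<bar>\<^sup>2 - g\<^sup>2) / 2 \<le> 0\<close>. Since \<open>g \<ge> \<nu> > 0\<close>, the function \<open>0\<close>
  satisfies this constraint with a uniform margin. This is Slater's condition, and the
  Hahn--Banach theorem yields a nonnegative multiplier in the dual of \<open>L\<^sup>\<infinity>\<close>
  (\<open>slater_multiplier\<close>). Varying \<open>u\<close> to \<open>u + t v\<close> and letting \<open>t\<close> tend to \<open>0\<close> gives the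
  equation. At \<open>u\<close> the constraint and the multiplier have pairing zero; as the constraint
  there dominates a multiple of \<open>\<nu> (g - \<bar>Du\<bar>)\<close> in absolute value, complementarity follows.

  Two facts about the fractional gradient are needed: \<open>K\<close> must be closed, and the integral of
  \<open>f v\<close> must be continuous on \<open>K\<close> although \<open>f\<close> is used only as an integrable function.
  Both rest on the heat kernel \<open>p\<^sub>t\<close>, of which the Riesz kernel is a superposition
  \<open>c \<integral> t\<^bsup>\<beta>-1\<^esup> p\<^sub>t dt\<close> with \<open>\<beta> = (1 - \<sigma>) / 2\<close>.

  For the first, the semigroup law turns \<open>\<integral> \<bar>Du\<bar>\<^sup>2\<close> into a time integral of the dissipation
  of the heat flow of \<open>u\<close>, and an integration by parts in time identifies it with a constant
  times the Gagliardo seminorm (\<open>fractional_gradient_exists\<close>). With the Poincare inequality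
  for functions vanishing outside a bounded set, the \<open>L\<^sup>2\<close> norm of \<open>Du\<close> controls the norm of
  \<open>u\<close>, and Fatou's lemma gives closedness (\<open>Hsigma0_gradient_closed\<close>).

  For the second, \<open>\<bar>Dv\<bar> \<le> M\<close> implies \<open>\<bar>v\<bar> \<le> C (M + \<parallel>v\<parallel>\<^sub>1)\<close> almost everywhere
  (\<open>bounded_sigma_gradient_imp_bounded\<close>): pairing \<open>Dv\<close> with the gradient of \<open>p\<^sub>s\<close> bounds an
  Abel-type transform of the time derivative of the heat flow by \<open>M s\<^bsup>-1/2\<^esup>\<close>, and inverting
  the transform bounds the heat flow of \<open>v\<close> uniformly down to time \<open>0\<close>.
\<close>


section \<open>Notation\<close>

abbreviation nn_lborel :: "('a::euclidean_space => ennreal) => ennreal"  (binder "NN " 10)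
 where "nn_lborel f \<equiv> integral\<^sup>N lborel f"

abbreviation lborel2 :: "('a::euclidean_space \<times> 'b::euclidean_space) measure"
 where "lborel2 \<equiv> lborel \<Otimes>\<^sub>M lborel"

abbreviation pos :: "real => real"
 where "pos t \<equiv> indicator {0<..} t"

abbreviation (input) seq_lim :: "(nat => 'a::topological_space) => 'a => bool"  ("(_/ ----> _)" [60, 60] 60)
 where "X ----> L \<equiv> (X \<longlonglongrightarrow> L)"

lemmas bochner_bound = Bochner_Integration.integrable_bound

section \<open>Smooth functions of one variable\<close>

text \<open>
 The derivatives of all orders are listed explicitly, which makes products and compositions
 easy to handle.
\<close>

definition smooth1 :: "(real => real) => bool" where
 "smooth1 f \<longleftrightarrow> (\<exists>d :: nat => real => real. d 0 = f \<and> (\<forall>k x. (d k has_real_derivative d (Suc k) x) (at x)))"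

lemma smooth1I:
 assumes "f \<in> S" "\<And>g. g \<in> S ==> \<exists>g'\<in>S. \<forall>x. (g has_real_derivative g' x) (at x)"
 shows "smooth1 f"
proof -
 obtain D where D: "\<And>g. g \<in> S ==> D g \<in> S" "\<And>g x. g \<in> S ==> (g has_real_derivative D g x) (at x)"
  using assms(2) by metis
 have "(D ^^ k) f \<in> S" for k by (induction k) (use assms(1) D in auto)
 then show ?thesis unfolding smooth1_def
  by (intro exI[of _ "\<lambda>k. (D ^^ k) f"]) (auto intro: D)
qed

lemma smooth1_mult:
 assumes "smooth1 f" "smooth1 g"
 shows "smooth1 (\<lambda>x. f x * g x)"
proof -
 obtain d e where d: "d 0 = f" "\<And>k x. (d k has_real_derivative d (Suc k) x) (at x)"
  and e: "e 0 = g" "\<And>k x. (e k has_real_derivative e (Suc k) x) (at x)"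
  using assms unfolding smooth1_def by blast
 define F where "F xs = (\<lambda>x. \<Sum>(i, j)\<leftarrow>xs. d i x * e j x)" for xs :: "(nat \<times> nat) list"
 show ?thesis
 proof (rule smooth1I[where S="range F"])
  have "(\<lambda>x. f x * g x) = F [(0, 0)]" by (simp add: F_def d e)
  then show "(\<lambda>x. f x * g x) \<in> range F" by blast
  fix h assume "h \<in> range F"
  then obtain xs where h: "h = F xs" by blast
  define ys where "ys = concat (map (\<lambda>(i, j). [(Suc i, j), (i, Suc j)]) xs)"
  have "(F xs has_real_derivative F ys x) (at x)" for x
   unfolding ys_def F_def
   by (induction xs) (auto intro!: derivative_eq_intros d e)
  then show "\<exists>g'\<in>range F. \<forall>x. (h has_real_derivative g' x) (at x)" using h by blast
 qed
qed

lemma smooth1_affine: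
 assumes "smooth1 f"
 shows "smooth1 (\<lambda>x. f (a * x + b))"
proof -
 obtain d where d: "d 0 = f" "\<And>k x. (d k has_real_derivative d (Suc k) x) (at x)"
  using assms unfolding smooth1_def by blast
 have "((\<lambda>x. a ^ k * d k (a * x + b)) has_real_derivative a ^ Suc k * d (Suc k) (a * x + b)) (at x)" for k x
  by (rule derivative_eq_intros DERIV_chain2[OF d(2)] refl | simp)+
 then show ?thesis
  unfolding smooth1_def using d(1) by (intro exI[of _ "\<lambda>k x. a ^ k * d k (a * x + b)"]) auto
qed

text \<open>
 With \<open>p = 1\<close> this is the classical smooth function \<open>exp (-1/x)\<close> that vanishes for \<open>x <= 0\<close>;
 the polynomial in \<open>1/x\<close> makes the family closed under differentiation.
\<close>

definition flat_exp :: "real poly => real => real" where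
 "flat_exp p x = (if x > 0 then poly p (1 / x) * exp (- (1 / x)) else 0)"

lemma flat_exp_limit: "((\<lambda>h. flat_exp p h) \<longlongrightarrow> 0) (at 0)"
proof -
 have "((\<lambda>x. poly p x / exp x) \<longlongrightarrow> 0) at_top"
 proof -
  have "((\<lambda>x::real. \<Sum>i\<le>degree p. coeff p i * (x ^ i / exp x)) \<longlongrightarrow> (\<Sum>i\<le>degree p. coeff p i * 0)) at_top"
   by (intro tendsto_intros tendsto_power_div_exp_0)
  then show ?thesis by (simp add: poly_altdef sum_divide_distrib)
 qed
 then have "((\<lambda>x. poly p (inverse x) / exp (inverse x)) \<longlongrightarrow> 0) (at_right 0)"
  by (rule filterlim_compose[OF _ filterlim_inverse_at_top_right])
 then have "(flat_exp p \<longlongrightarrow> 0) (at_right 0)"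
  by (rule Lim_transform_eventually)
   (auto simp: flat_exp_def eventually_at_filter exp_minus field_simps)
 moreover have "(flat_exp p \<longlongrightarrow> 0) (at_left 0)"
  by (rule tendsto_eventually) (auto simp: flat_exp_def eventually_at_filter)
 ultimately show ?thesis by (simp add: filterlim_split_at)
qed

lemma flat_exp_deriv:
 "(flat_exp p has_real_derivative flat_exp ((p - pderiv p) * [:0, 0, 1:]) x) (at x)"
proof -
 consider "x > 0" | "x < 0" | "x = 0" by linarith
 then show ?thesis
 proof cases
  case 1
  have "((\<lambda>x. poly p (1 / x) * exp (- (1 / x))) has_real_derivative
    flat_exp ((p - pderiv p) * [:0, 0, 1:]) x) (at x)"
   using 1 unfolding flat_exp_def
   by (auto intro!: derivative_eq_intros DERIV_chain2[OF poly_DERIV] simp: field_simps power2_eq_square)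
  then show ?thesis
   by (rule has_field_derivative_transform_within_open[of _ _ _ "{0<..}"]) (use 1 in \<open>auto simp: flat_exp_def\<close>)
 next
  case 2
  have "((\<lambda>x. 0) has_real_derivative flat_exp ((p - pderiv p) * [:0, 0, 1:]) x) (at x)"
   using 2 by (auto simp: flat_exp_def)
  then show ?thesis
   by (rule has_field_derivative_transform_within_open[of _ _ _ "{..<0}"]) (use 2 in \<open>auto simp: flat_exp_def\<close>)
 next
  case 3
  have "((\<lambda>h. flat_exp (p * [:0, 1:]) h) \<longlongrightarrow> 0) (at 0)" by (rule flat_exp_limit)
  then have "((\<lambda>h. (flat_exp p (0 + h) - flat_exp p 0) / h) \<longlongrightarrow> 0) (at 0)"
   by (rule Lim_transform_eventually) (auto simp: flat_exp_def eventually_at_filter)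
  then show ?thesis using 3 by (simp add: DERIV_def flat_exp_def)
 qed
qed

lemma smooth1_flat_exp: "smooth1 (flat_exp p)"
 by (rule smooth1I[where S="range flat_exp"]) (use flat_exp_deriv in blast)+

text \<open>Bumps on the interval between \<open>a\<close> and \<open>b\<close> that increase to its indicator function\<close>

definition bump :: "real => real => nat => real => real" where
 "bump a b k x = flat_exp 1 (real (Suc k) * (x - a)) * flat_exp 1 (real (Suc k) * (b - x))"

lemma smooth1_bump: "smooth1 (bump a b k)"
proof -
 have "smooth1 (\<lambda>x. flat_exp 1 (real (Suc k) * x + - real (Suc k) * a) *
   flat_exp 1 (- real (Suc k) * x + real (Suc k) * b))"
  by (intro smooth1_mult smooth1_affine smooth1_flat_exp)
 moreover have "(\<lambda>x. flat_exp 1 (real (Suc k) * x + - real (Suc k) * a) *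
   flat_exp 1 (- real (Suc k) * x + real (Suc k) * b)) = bump a b k"
  by (rule ext) (simp add: bump_def algebra_simps)
 ultimately show ?thesis by simp
qed

lemma bump_bounds: "0 <= bump a b k x" "bump a b k x <= 1"
 by (auto simp: bump_def flat_exp_def intro!: mult_le_one)

lemma bump_eq_0: "x \<notin> {a<..<b} ==> bump a b k x = 0"
 by (auto simp: bump_def flat_exp_def zero_less_mult_iff)

lemma bump_limit: "(\<lambda>k. bump a b k x) ----> indicator {a<..<b} x"
proof (cases "x \<in> {a<..<b}")
 case True
 have lim: "(\<lambda>k. flat_exp 1 (real (Suc k) * c)) ----> 1" if "c > 0" for c
 proof -
  have "(\<lambda>k. exp (- ((1 / c) * (1 / real (Suc k))))) ----> exp (- ((1 / c) * 0))"
   by (intro tendsto_intros LIMSEQ_Suc[OF lim_1_over_n])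
  then show ?thesis using that by (simp add: flat_exp_def mult.commute)
 qed
 have "(\<lambda>k. bump a b k x) ----> 1 * 1"
  unfolding bump_def using True by (intro tendsto_mult lim) auto
 then show ?thesis using True by simp
qed (simp add: bump_eq_0)

section \<open>Test functions in several variables\<close>

lemma prod_partial_deriv:
 fixes f f' :: "'n::finite => real => real"
 assumes "\<And>i x. (f i has_real_derivative f' i x) (at x)"
 shows "(\<lambda>x. \<Prod>i\<in>UNIV. f i (x $ i)) differentiable at x"
  and "partial_deriv j (\<lambda>x. \<Prod>i\<in>UNIV. f i (x $ i)) x = (\<Prod>i\<in>UNIV. (if i = j then f' i else f i) (x $ i))"
proof -
 have comp: "((\<lambda>x::real^'n. f i (x $ i)) has_derivative (\<lambda>h. f' i (x $ i) * (h $ i))) (at x)" for i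
 proof -
  have "(f i has_derivative (\<lambda>h. f' i (x $ i) * h)) (at (x $ i))"
   using assms by (simp add: has_field_derivative_def)
  from has_derivative_compose[OF bounded_linear.has_derivative[OF bounded_linear_vec_nth has_derivative_ident] this] show ?thesis .
 qed
 have D: "((\<lambda>x. \<Prod>i\<in>UNIV. f i (x $ i)) has_derivative
   (\<lambda>h. \<Sum>i\<in>UNIV. f' i (x $ i) * (h $ i) * (\<Prod>k\<in>UNIV - {i}. f k (x $ k)))) (at x)"
  by (rule has_derivative_prod[OF comp])
 then show "(\<lambda>x. \<Prod>i\<in>UNIV. f i (x $ i)) differentiable at x" by (rule differentiableI)
 have "partial_deriv j (\<lambda>x. \<Prod>i\<in>UNIV. f i (x $ i)) x =
   (\<Sum>i\<in>UNIV. f' i (x $ i) * (axis j 1 $ i) * (\<Prod>k\<in>UNIV - {i}. f k (x $ k)))"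
  unfolding partial_deriv_def by (simp add: frechet_derivative_at[OF D, symmetric])
 also have "... = (\<Sum>i\<in>UNIV. if i = j then f' i (x $ i) * (\<Prod>k\<in>UNIV - {i}. f k (x $ k)) else 0)"
  by (intro sum.cong) (auto simp: axis_def)
 also have "... = f' j (x $ j) * (\<Prod>k\<in>UNIV - {j}. f k (x $ k))" by (simp add: sum.delta)
 also have "... = (\<Prod>i\<in>UNIV. (if i = j then f' i else f i) (x $ i))"
  by (subst prod.remove[of UNIV j]) (auto intro!: prod.cong)
 finally show "partial_deriv j (\<lambda>x. \<Prod>i\<in>UNIV. f i (x $ i)) x =
   (\<Prod>i\<in>UNIV. (if i = j then f' i else f i) (x $ i))" .
qed

text \<open>
 A mixed partial derivative of a product of functions of one coordinate each is again such
 a product.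
\<close>

lemma smooth_prod:
 fixes f :: "'n::finite => real => real"
 assumes "\<And>i. smooth1 (f i)"
 shows "smooth (\<lambda>x. \<Prod>i\<in>UNIV. f i (x $ i))"
proof -
 obtain d where d0: "\<And>i. d i 0 = f i" and d: "\<And>i k x. (d i k has_real_derivative d i (Suc k) x) (at x)"
  using assms unfolding smooth1_def by metis
 define F where "F m = (\<lambda>x::real^'n. \<Prod>i\<in>UNIV. d i (m i) (x $ i))" for m
 have F: "F m differentiable at x" "partial_deriv j (F m) = F (\<lambda>i. if i = j then Suc (m i) else m i)" for m x j
 proof -
  show "F m differentiable at x" unfolding F_def by (rule prod_partial_deriv(1)[OF d])
  have "(\<Prod>i\<in>UNIV. (if i = j then d i (Suc (m i)) else d i (m i)) (x $ i)) =
    (\<Prod>i\<in>UNIV. d i (if i = j then Suc (m i) else m i) (x $ i))" for x :: "real^'n"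
   by (intro prod.cong) auto
  then show "partial_deriv j (F m) = F (\<lambda>i. if i = j then Suc (m i) else m i)"
   unfolding F_def by (intro ext) (simp add: prod_partial_deriv(2)[OF d])
 qed
 have "\<exists>m. foldr partial_deriv js (F (\<lambda>_. 0)) = F m" for js
  by (induction js) (auto simp: F(2))
 then have "foldr partial_deriv js (F (\<lambda>_. 0)) differentiable_on UNIV" for js
  using F(1) by (metis (no_types) differentiable_at_imp_differentiable_on)
 then show ?thesis unfolding smooth_def F_def by (simp add: d0)
qed

lemma test_function_prod:
 fixes f :: "'n::finite => real => real"
 assumes "\<And>i. smooth1 (f i)" "\<And>i x. x \<notin> {a i..b i} ==> f i x = 0"
 shows "(\<lambda>x. \<Prod>i\<in>UNIV. f i (x $ i)) \<in> test_functions UNIV"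
proof -
 have "{x. (\<Prod>i\<in>UNIV. f i (x $ i)) \<noteq> 0} \<subseteq> cbox (\<chi> i. a i) (\<chi> i. b i)"
 proof
  fix x assume "x \<in> {x. (\<Prod>i\<in>UNIV. f i (x $ i)) \<noteq> 0}"
  then have "f i (x $ i) \<noteq> 0" for i by (simp add: prod_zero_iff)
  then have "x $ i \<in> {a i..b i}" for i using assms(2) by blast
  then show "x \<in> cbox (\<chi> i. a i) (\<chi> i. b i)" by (simp add: mem_box_cart)
 qed
 then have "bounded {x. (\<Prod>i\<in>UNIV. f i (x $ i)) \<noteq> 0}" by (rule bounded_subset[OF bounded_cbox])
 then have "compact (closure {x. (\<Prod>i\<in>UNIV. f i (x $ i)) \<noteq> 0})" by simp
 then show ?thesis using smooth_prod[OF assms(1)] by (simp add: test_functions_def)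
qed


lemma partial_deriv_eq: "(f has_derivative f') (at x) ==> partial_deriv j f x = f' (axis j 1)"
 unfolding partial_deriv_def by (metis frechet_derivative_at)

lemma smooth_differentiable: "smooth \<phi> ==> \<phi> differentiable at x"
proof -
 assume "smooth \<phi>"
 then have "foldr partial_deriv [] \<phi> differentiable_on UNIV" unfolding smooth_def by (rule spec)
 then show ?thesis by (simp add: differentiable_on_eq_differentiable_at)
qed

lemma smooth_continuous: "smooth \<phi> ==> continuous_on UNIV \<phi>"
 by (simp add: continuous_at_imp_continuous_on differentiable_imp_continuous_within smooth_differentiable)

lemma smooth_partial_deriv:
 assumes "smooth \<phi>" shows "smooth (partial_deriv j \<phi>)"
 unfolding smooth_def
proof
 fix js
 have "foldr partial_deriv (js @ [j]) \<phi> differentiable_on UNIV" using assms unfolding smooth_def by blast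
 then show "foldr partial_deriv js (partial_deriv j \<phi>) differentiable_on UNIV" by simp
qed

lemma partial_deriv_add:
 "f differentiable at x ==> g differentiable at x ==>
  partial_deriv j (\<lambda>x. f x + g x) x = partial_deriv j f x + partial_deriv j g x"
 unfolding frechet_derivative_works partial_deriv_def
 by (drule (1) has_derivative_add, drule frechet_derivative_at, simp add: fun_eq_iff)

lemma partial_deriv_cmult:
 "f differentiable at x ==> partial_deriv j (\<lambda>x. c * f x) x = c * partial_deriv j f x"
 unfolding frechet_derivative_works partial_deriv_def
 by (drule has_derivative_mult_right[where x=c], drule frechet_derivative_at, simp add: fun_eq_iff)

lemma smooth_lincomb:
 assumes f: "smooth f" and g: "smooth g"
 shows "smooth (\<lambda>x. a * f x + b * g x)"
proof -
 have D: "foldr partial_deriv js f differentiable at x" "foldr partial_deriv js g differentiable at x" for js x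
  using f g unfolding smooth_def by (simp_all add: differentiable_on_eq_differentiable_at)
 have "foldr partial_deriv js (\<lambda>x. a * f x + b * g x) =
   (\<lambda>x. a * foldr partial_deriv js f x + b * foldr partial_deriv js g x)" for js
 proof (induction js)
  case (Cons j js)
  show ?case
   by (rule ext) (simp add: Cons partial_deriv_add partial_deriv_cmult D)
 qed simp
 then show ?thesis unfolding smooth_def
  using D by (auto intro!: differentiable_at_imp_differentiable_on)
qed

lemma test_function_support:
 assumes "\<phi> \<in> test_functions S"
 obtains R where "R > 0" "\<And>x. norm x > R ==> \<phi> x = 0"
proof -
 have "bounded {x. \<phi> x \<noteq> 0}"
  using assms bounded_subset[OF compact_imp_bounded closure_subset] by (auto simp: test_functions_def)
 then obtain R where "R > 0" "\<forall>x\<in>{x. \<phi> x \<noteq> 0}. norm x <= R" by (auto simp: bounded_pos)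
 then show ?thesis using that[of R] by force
qed

lemma test_function_smooth: "\<phi> \<in> test_functions S ==> smooth \<phi>"
 by (simp add: test_functions_def)

lemma compact_closure_subset: "compact C ==> closure X \<subseteq> C ==> compact (closure X)"
 using compact_Int_closed[of C "closure X"] by (simp add: inf.absorb2)

lemma test_functions_lincomb:
 assumes f: "f \<in> test_functions S" and g: "g \<in> test_functions S"
 shows "(\<lambda>x. a * f x + b * g x) \<in> test_functions S"
proof -
 have "closure {x. a * f x + b * g x \<noteq> 0} \<subseteq> closure ({x. f x \<noteq> 0} \<union> {x. g x \<noteq> 0})"
  by (intro closure_mono) auto
 then have "closure {x. a * f x + b * g x \<noteq> 0} \<subseteq> closure {x. f x \<noteq> 0} \<union> closure {x. g x \<noteq> 0}"
  by (simp add: closure_Un)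
 moreover from this have "compact (closure {x. a * f x + b * g x \<noteq> 0})"
  using f g by (intro compact_closure_subset[of "closure {x. f x \<noteq> 0} \<union> closure {x. g x \<noteq> 0}"])
   (auto simp: test_functions_def intro!: compact_Un)
 ultimately show ?thesis
  using f g smooth_lincomb[of f g a b] by (auto simp: test_functions_def)
qed

lemma test_function_partial_deriv:
 assumes "\<phi> \<in> test_functions S"
 shows "partial_deriv j \<phi> \<in> test_functions S"
proof -
 have "{x. partial_deriv j \<phi> x \<noteq> 0} \<subseteq> closure {x. \<phi> x \<noteq> 0}"
 proof (rule ccontr)
  assume "\<not> ?thesis"
  then obtain x where x: "partial_deriv j \<phi> x \<noteq> 0" "x \<notin> closure {x. \<phi> x \<noteq> 0}" by blast
  have "((\<lambda>x. 0) has_derivative (\<lambda>h. 0)) (at x)" by simp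
  then have "(\<phi> has_derivative (\<lambda>h. 0)) (at x)"
   by (rule has_derivative_transform_within_open[where s="- closure {x. \<phi> x \<noteq> 0}"])
    (use x(2) closure_subset[of "{x. \<phi> x \<noteq> 0}"] in auto)
  then show False using x(1) by (simp add: partial_deriv_eq)
 qed
 then have "closure {x. partial_deriv j \<phi> x \<noteq> 0} \<subseteq> closure {x. \<phi> x \<noteq> 0}"
  by (simp add: closure_minimal)
 moreover from this have "compact (closure {x. partial_deriv j \<phi> x \<noteq> 0})"
  using assms by (intro compact_closure_subset) (auto simp: test_functions_def)
 ultimately show ?thesis using assms smooth_partial_deriv by (auto simp: test_functions_def)
qed

lemma test_function_bounded:
 assumes "\<phi> \<in> test_functions S"
 obtains M where "M >= 0" "\<And>x. \<bar>\<phi> x\<bar> <= M"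
proof -
 obtain R where R: "R > 0" "\<And>x. norm x > R ==> \<phi> x = 0" using test_function_support[OF assms] by blast
 have "compact (\<phi> ` cball 0 R)"
  using smooth_continuous[OF test_function_smooth[OF assms]]
  by (intro compact_continuous_image) (auto intro: continuous_on_subset)
 then obtain M where M: "M > 0" "\<forall>y\<in>\<phi> ` cball 0 R. norm y <= M"
  using compact_imp_bounded bounded_pos by blast
 have "\<bar>\<phi> x\<bar> <= M" for x using M R(2)[of x] by (cases "norm x <= R") auto
 then show ?thesis using that[of M] M by auto
qed

lemma test_function_borel: "\<phi> \<in> test_functions S ==> \<phi> \<in> borel_measurable borel"
 by (intro borel_measurable_continuous_onI smooth_continuous test_function_smooth)

lemma locally_integrable_times_bounded:
 fixes f :: "'a::euclidean_space => real"
 assumes f: "locally_integrable f" and w: "w \<in> borel_measurable lebesgue"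
  and M: "\<And>x. \<bar>w x\<bar> <= M" and R: "\<And>x. norm x > R ==> w x = 0"
 shows "integrable lebesgue (\<lambda>x. f x * w x)"
proof -
 have i: "integrable lebesgue (\<lambda>x. indicator (cball 0 R) x *\<^sub>R f x)"
  using f unfolding locally_integrable_def set_integrable_def by auto
 have "integrable lebesgue (\<lambda>x. (indicator (cball 0 R) x *\<^sub>R f x) * w x)"
 proof (rule bochner_bound)
  show "integrable lebesgue (\<lambda>x. M * (indicator (cball 0 R) x *\<^sub>R f x))" using i by simp
  show "(\<lambda>x. (indicator (cball 0 R) x *\<^sub>R f x) * w x) \<in> borel_measurable lebesgue"
   using i w by measurable
  have "\<bar>w x\<bar> <= \<bar>M\<bar>" for x using M[of x] by linarith
  then show "AE x in lebesgue. norm ((indicator (cball 0 R) x *\<^sub>R f x) * w x)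
    <= norm (M * (indicator (cball 0 R) x *\<^sub>R f x))"
   by (intro AE_I2) (auto simp: abs_mult mult.commute intro!: mult_right_mono)
 qed
 moreover have "(\<lambda>x. (indicator (cball 0 R) x *\<^sub>R f x) * w x) = (\<lambda>x. f x * w x)"
  using R by (intro ext) (auto simp: indicator_def)
 ultimately show ?thesis by (simp only:)
qed

lemma locally_integrable_times_test:
 fixes f :: "real^'n::finite => real"
 assumes f: "locally_integrable f" and \<phi>: "\<phi> \<in> test_functions S"
 shows "integrable lebesgue (\<lambda>x. f x * \<phi> x)"
proof -
 obtain M where "M >= 0" "\<And>x. \<bar>\<phi> x\<bar> <= M" using test_function_bounded[OF \<phi>] by blast
 moreover obtain R where "R > 0" "\<And>x. norm x > R ==> \<phi> x = 0" using test_function_support[OF \<phi>] by blast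
 moreover have "\<phi> \<in> borel_measurable lebesgue"
  using test_function_borel[OF \<phi>] by (simp add: measurable_completion)
 ultimately show ?thesis using f by (intro locally_integrable_times_bounded) auto
qed

lemma locally_integrable_nth:
 fixes G :: "real^'n::finite => real^'n"
 assumes "locally_integrable G" shows "locally_integrable (\<lambda>x. G x $ j)"
 unfolding locally_integrable_def set_integrable_def
proof (intro allI impI)
 fix K :: "(real^'n) set" assume "compact K"
 then have "integrable lebesgue (\<lambda>x. indicator K x *\<^sub>R G x)"
  using assms by (auto simp: locally_integrable_def set_integrable_def)
 from integrable_bounded_linear[OF bounded_linear_vec_nth this, of j]
 show "integrable lebesgue (\<lambda>x. indicator K x *\<^sub>R (G x $ j))" by simp
qed

text \<open>
 Balls of integer radius exhaust the space.
\<close>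

lemma locally_integrable_measurable:
 fixes f :: "'a::euclidean_space => 'b::euclidean_space"
 assumes "locally_integrable f" shows "f \<in> borel_measurable lebesgue"
proof (rule borel_measurable_LIMSEQ_metric)
 show "(\<lambda>x. indicator (cball 0 (real n)) x *\<^sub>R f x) \<in> borel_measurable lebesgue" for n
  using assms unfolding locally_integrable_def set_integrable_def
  by (intro borel_measurable_integrable) (meson compact_cball)
 show "(\<lambda>n. indicator (cball 0 (real n)) x *\<^sub>R f x) ----> f x" for x
 proof (rule tendsto_eventually)
  obtain N where N: "norm x <= real N" using real_arch_simple by blast
  show "\<forall>\<^sub>F n in sequentially. indicator (cball 0 (real n)) x *\<^sub>R f x = f x"
   using eventually_ge_at_top[of N] by eventually_elim (use N in auto)
 qed
qed

lemma locally_integrable_lincomb: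
 fixes f g :: "'a::euclidean_space => 'b::euclidean_space"
 assumes "locally_integrable f" "locally_integrable g"
 shows "locally_integrable (\<lambda>x. a *\<^sub>R f x + b *\<^sub>R g x)"
 unfolding locally_integrable_def set_integrable_def
proof (intro allI impI)
 fix K :: "'a set" assume K: "compact K"
 have "integrable lebesgue (\<lambda>x. a *\<^sub>R (indicator K x *\<^sub>R f x) + b *\<^sub>R (indicator K x *\<^sub>R g x))"
  using assms K unfolding locally_integrable_def set_integrable_def
  by (intro Bochner_Integration.integrable_add integrable_scaleR_right) auto
 then show "integrable lebesgue (\<lambda>x. indicator K x *\<^sub>R (a *\<^sub>R f x + b *\<^sub>R g x))"
  by (simp add: scaleR_add_right mult.commute)
qed

text \<open>
 Boxes are limits of products of bumps, and they generate the Borel sets.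
\<close>

lemma integral_box_eq_0:
 fixes f :: "real^'n::finite => real"
 assumes f: "locally_integrable f"
  and test: "\<And>\<phi>. \<phi> \<in> test_functions UNIV ==> (LINT x|lebesgue. f x * \<phi> x) = 0"
 shows "(LINT x|lebesgue. f x * indicator (box a b) x) = 0"
proof -
 define \<phi> where "\<phi> k = (\<lambda>x::real^'n. \<Prod>i\<in>UNIV. bump (a $ i) (b $ i) k (x $ i))" for k
 have \<phi>: "\<phi> k \<in> test_functions UNIV" for k unfolding \<phi>_def
  by (rule test_function_prod[where a="\<lambda>i. a $ i" and b="\<lambda>i. b $ i"]) (auto simp: smooth1_bump bump_eq_0)
 have \<phi>m: "\<phi> k \<in> borel_measurable lebesgue" for k
  using test_function_borel[OF \<phi>] by (simp add: measurable_completion)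
 have lim: "(\<lambda>k. \<phi> k x) ----> indicator (box a b) x" for x
 proof -
  have "(\<lambda>k. \<phi> k x) ----> (\<Prod>i\<in>UNIV. indicator {a $ i<..<b $ i} (x $ i))"
   unfolding \<phi>_def by (intro tendsto_prod bump_limit)
  also have "(\<Prod>i\<in>UNIV. indicator {a $ i<..<b $ i} (x $ i)) = (indicator (box a b) x :: real)"
   by (auto simp: indicator_def mem_box_cart prod_zero_iff)
  finally show ?thesis .
 qed
 have b0: "0 <= \<phi> k x" "\<phi> k x <= 1" for k x
  unfolding \<phi>_def by (auto intro!: prod_nonneg prod_le_1 bump_bounds)
 have b1: "\<bar>\<phi> k x\<bar> <= indicator (box a b) x" for k x
 proof (cases "x \<in> box a b")
  case False
  then obtain i where "x $ i \<notin> {a $ i<..<b $ i}" by (auto simp: mem_box_cart)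
  then have "\<phi> k x = 0" unfolding \<phi>_def by (auto intro!: prod_zero bump_eq_0)
  then show ?thesis by simp
 qed (use b0 in auto)
 obtain B where B: "\<And>x. x \<in> box a b ==> norm x <= B" using bounded_box bounded_iff by metis
 have fI: "integrable lebesgue (\<lambda>x. f x * indicator (box a b) x)"
  using f borel_measurable_indicator[of "box a b" lebesgue]
  by (rule locally_integrable_times_bounded[where M=1 and R=B]) (auto simp: indicator_def dest: B)
 have "(\<lambda>k. LINT x|lebesgue. f x * \<phi> k x) ----> (LINT x|lebesgue. f x * indicator (box a b) x)"
 proof (rule integral_dominated_convergence[where w="\<lambda>x. \<bar>f x * indicator (box a b) x\<bar>"])
  show "AE x in lebesgue. (\<lambda>k. f x * \<phi> k x) ----> f x * indicator (box a b) x"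
   by (intro AE_I2 tendsto_mult tendsto_const lim)
  show "AE x in lebesgue. norm (f x * \<phi> k x) <= \<bar>f x * indicator (box a b) x\<bar>" for k
   using b1[of k] by (intro AE_I2) (auto simp: abs_mult intro!: mult_left_mono)
 qed (use fI \<phi>m locally_integrable_measurable[OF f] in auto)
 then show ?thesis using test[OF \<phi>] by (simp add: LIMSEQ_const_iff)
qed

text \<open>
 By dominated convergence against products of bumps, the function has integral zero over
 every box. Boxes form an intersection-stable generator of the Borel sets, so its integral
 vanishes over all of them.
\<close>

theorem fundamental_lemma_calculus_of_variations:
 fixes f :: "real^'n::finite => real"
 assumes f: "locally_integrable f"
  and test: "\<And>\<phi>. \<phi> \<in> test_functions UNIV ==> (LINT x|lebesgue. f x * \<phi> x) = 0"
 shows "AE x in lebesgue. f x = 0"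
proof -
 have fm: "f \<in> borel_measurable lebesgue" by (rule locally_integrable_measurable[OF f])
 obtain g where g: "g \<in> borel_measurable lborel" "AE x in lborel. f x = g x"
  using completion_ex_borel_measurable_real[OF fm] by blast
 have fg: "AE x in lebesgue. f x = g x" using g(2) by (simp add: AE_completion)
 have "AE x in lborel. g x * indicator (box (-c) c) x = 0" if c: "c = (\<chi> i. real n)" for n and c :: "real^'n"
 proof -
  obtain B where B: "\<And>x. x \<in> box (-c) c ==> norm x <= B" using bounded_box bounded_iff by metis
  define h where "h x = g x * indicator (box (-c) c) x" for x
  have hm: "h \<in> borel_measurable borel" unfolding h_def using g(1) by measurable
  have "integrable lebesgue (\<lambda>x. f x * indicator (box (-c) c) x)"
   using f borel_measurable_indicator[of "box (-c) c" lebesgue]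
   by (rule locally_integrable_times_bounded[where M=1 and R=B]) (auto simp: indicator_def dest: B)
  then have "integrable lebesgue h" unfolding h_def
   by (rule integrable_cong_AE_imp) (use g fg in \<open>auto simp: measurable_completion elim!: eventually_mono\<close>)
  then have hI: "integrable lborel h" using hm by (simp add: integrable_completion)
  have hb: "(LBINT x. indicator (box a b) x *\<^sub>R h x) = 0" for a b
  proof -
   define a' b' where "a' = (\<chi> i. max (a $ i) (- c $ i))" and "b' = (\<chi> i. min (b $ i) (c $ i))"
   have eq: "indicator (box a b) x *\<^sub>R h x = g x * indicator (box a' b') x" for x
    by (auto simp: h_def a'_def b'_def indicator_def mem_box_cart)
   have "(LBINT x. indicator (box a b) x *\<^sub>R h x) = (LINT x|lebesgue. g x * indicator (box a' b') x)"
    unfolding eq using g(1) by (subst integral_completion) auto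
   also have "... = (LINT x|lebesgue. f x * indicator (box a' b') x)"
    by (rule integral_cong_AE)
     (use g fg fm in \<open>auto simp: measurable_completion elim!: eventually_mono intro!: borel_measurable_times\<close>)
   also have "... = 0" by (rule integral_box_eq_0[OF f test])
   finally show ?thesis .
  qed
  let ?G = "range (\<lambda>(a, b). box a b :: (real^'n) set)"
  have sets: "sets borel = sigma_sets UNIV ?G" by (subst borel_eq_box) (simp add: sets_measure_of)
  have tot: "(LBINT x. h x) = 0"
  proof -
   have "(\<lambda>x. indicator (box (-c) c) x *\<^sub>R h x) = h" by (auto simp: h_def indicator_def)
   then show ?thesis using hb[of "-c" c] by (simp only:)
  qed
  have all: "(LBINT x. indicator A x *\<^sub>R h x) = 0" if A: "A \<in> sets borel" for A
  proof -
   have A': "A \<in> sigma_sets UNIV ?G" using A sets by simp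
   have G: "Int_stable ?G" "?G \<subseteq> Pow UNIV" by (auto simp: Int_stable_def box_Int_box)
   show ?thesis using G A'
   proof (induction rule: sigma_sets_induct_disjoint)
    case (compl A)
    have "indicator (UNIV - A) x *\<^sub>R h x = h x - indicator A x *\<^sub>R h x" for x by (auto simp: indicator_def)
    moreover have "integrable lborel (\<lambda>x. indicator A x *\<^sub>R h x)"
     using compl(1) hI sets by (intro integrable_mult_indicator) auto
    ultimately show ?case using compl(2) tot hI by simp
   next
    case (union A)
    have "A i \<in> sets borel" for i using union(2) sets by auto
    then have "(\<Union>i. A i) \<in> sets borel" by blast
    then have "set_integrable lborel (\<Union>i. A i) h" unfolding set_integrable_def
     using hI by (intro integrable_mult_indicator) auto
    then have "(LINT x:(\<Union>i. A i)|lborel. h x) = (\<Sum>i. (LINT x:(A i)|lborel. h x))"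
     using union(1,2) sets by (intro lebesgue_integral_countable_add) (auto simp: disjoint_family_on_def)
    then show ?case using union(3) by (simp add: set_lebesgue_integral_def)
   next
    case (basic A)
    then show ?case using hb by auto
   qed simp
  qed
  have "AE x in lborel. h x = 0"
   by (rule density_unique_real[of lborel h "\<lambda>x. 0"]) (use hI all in \<open>auto simp: set_lebesgue_integral_def\<close>)
  then show ?thesis by (simp add: h_def)
 qed
 then have "AE x in lborel. \<forall>n. g x * indicator (box (- (\<chi> i. real n)) (\<chi> i. real n)) x = 0"
  by (subst AE_all_countable) auto
 then have "AE x in lborel. g x = 0"
 proof eventually_elim
  case (elim x)
  obtain n where n: "norm x < real n" using reals_Archimedean2 by blast
  have "\<bar>x $ i\<bar> < real n" for i using component_le_norm_cart[of x i] n by linarith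
  then have "x \<in> box (- (\<chi> i. real n)) (\<chi> i. real n)"
   by (simp add: mem_box_cart abs_less_iff minus_less_iff)
  then show ?case using elim[rule_format, of n] by simp
 qed
 then have "AE x in lebesgue. g x = 0" by (rule AE_completion)
 with fg show ?thesis by eventually_elim simp
qed

theorem distributional_gradient_unique:
 assumes "has_distributional_gradient F G" "has_distributional_gradient F H"
 shows "AE x in lebesgue. G x = H x"
proof -
 have "AE x in lebesgue. G x $ j - H x $ j = 0" for j
 proof (rule fundamental_lemma_calculus_of_variations)
  have GH: "locally_integrable (\<lambda>x. G x $ j)" "locally_integrable (\<lambda>x. H x $ j)"
   using assms by (auto simp: has_distributional_gradient_def intro: locally_integrable_nth)
  then show "locally_integrable (\<lambda>x. G x $ j - H x $ j)"
   using locally_integrable_lincomb[OF GH, of 1 "-1"] by simp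
  fix \<phi> :: "real^'a => real" assume \<phi>: "\<phi> \<in> test_functions UNIV"
  have "(LINT x|lebesgue. (G x $ j - H x $ j) * \<phi> x) =
    (LINT x|lebesgue. (G x $ j) * \<phi> x) - (LINT x|lebesgue. (H x $ j) * \<phi> x)"
   using locally_integrable_times_test[OF GH(1) \<phi>] locally_integrable_times_test[OF GH(2) \<phi>]
   by (simp add: left_diff_distrib)
  also have "(LINT x|lebesgue. (G x $ j) * \<phi> x) = (LINT x|lebesgue. (H x $ j) * \<phi> x)"
  proof -
   have "(LINT x|lebesgue. F x * partial_deriv j \<phi> x) = - (LINT x|lebesgue. (G x $ j) * \<phi> x)"
    "(LINT x|lebesgue. F x * partial_deriv j \<phi> x) = - (LINT x|lebesgue. (H x $ j) * \<phi> x)"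
    using assms \<phi> unfolding has_distributional_gradient_def by simp_all
   then show ?thesis by simp
  qed
  finally show "(LINT x|lebesgue. (G x $ j - H x $ j) * \<phi> x) = 0" by simp
 qed
 then have "AE x in lebesgue. \<forall>j. G x $ j - H x $ j = 0" by (simp add: AE_all_countable)
 then show ?thesis by eventually_elim (simp add: vec_eq_iff)
qed

section \<open>Integrals over Euclidean space\<close>

lemma lborel_integral_translate:
 fixes f :: "'a::euclidean_space => 'b::{banach, second_countable_topology}"
 assumes "f \<in> borel_measurable borel"
 shows "(LBINT x. f (x - c)) = (LBINT x. f x)"
  and "integrable lborel (\<lambda>x. f (x - c)) \<longleftrightarrow> integrable lborel f"
proof -
 have eq: "(\<lambda>x. f (x - c)) = (\<lambda>x. f ((+) (- c) x))" by (simp add: algebra_simps)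
 have d: "distr lborel borel ((+) (- c)) = (lborel :: 'a measure)" by (rule lborel_distr_plus)
 show "(LBINT x. f (x - c)) = (LBINT x. f x)"
  unfolding eq using assms by (subst integral_distr[symmetric, of _ _ borel]) (auto simp: d)
 show "integrable lborel (\<lambda>x. f (x - c)) \<longleftrightarrow> integrable lborel f"
  unfolding eq using integrable_distr_eq[of "(+) (- c)" lborel borel f] assms d by simp
qed

lemma nn_integral_translate:
 fixes f :: "'a::euclidean_space => ennreal"
 assumes "f \<in> borel_measurable borel"
 shows "(NN x. f (x - c)) = (NN x. f x)"
proof -
 have eq: "(\<lambda>x. f (x - c)) = (\<lambda>x. f ((+) (- c) x))" by (simp add: algebra_simps)
 have d: "distr lborel borel ((+) (- c)) = (lborel :: 'a measure)" by (rule lborel_distr_plus)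
 show ?thesis
  unfolding eq using assms by (subst nn_integral_distr[symmetric, of _ _ borel]) (auto simp: d)
qed

lemma lborel_distr_minus: "distr lborel borel (\<lambda>x::'a::euclidean_space. - x) = lborel"
proof -
 have "lborel = density (distr lborel borel (\<lambda>x::'a. 0 + (-1) *\<^sub>R x)) (\<lambda>_. \<bar>- 1 :: real\<bar> ^ DIM('a))"
  by (rule lborel_affine) simp
 then show ?thesis by (simp add: density_1)
qed

lemma lborel_integral_reflect:
 fixes f :: "'a::euclidean_space => 'b::{banach, second_countable_topology}"
 assumes "f \<in> borel_measurable borel"
 shows "(LBINT x. f (- x)) = (LBINT x. f x)"
  and "integrable lborel (\<lambda>x. f (- x)) \<longleftrightarrow> integrable lborel f"
proof -
 show "(LBINT x. f (- x)) = (LBINT x. f x)"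
  using assms by (subst integral_distr[symmetric, of uminus _ borel f]) (auto simp: lborel_distr_minus)
 show "integrable lborel (\<lambda>x. f (- x)) \<longleftrightarrow> integrable lborel f"
  using integrable_distr_eq[of uminus lborel borel f] assms by (simp add: lborel_distr_minus)
qed

lemma nn_integral_reflect:
 fixes f :: "'a::euclidean_space => ennreal"
 assumes "f \<in> borel_measurable borel"
 shows "(NN x. f (c - x)) = (NN x. f x)"
proof -
 have "(NN x. f (c - x)) = (NN x. f (- (x - c)))" by simp
 also have "... = (NN x. f (- x))" using assms by (intro nn_integral_translate) simp
 also have "... = (NN x. f x)"
  using assms by (subst nn_integral_distr[symmetric, of uminus _ borel f]) (auto simp: lborel_distr_minus)
 finally show ?thesis .
qed

lemma prod_Basis_cart:
 fixes f :: "real^'n::finite => 'c::comm_monoid_mult"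
 shows "(\<Prod>b\<in>Basis. f b) = (\<Prod>i\<in>UNIV. f (axis i 1))"
proof -
 have "(Basis :: (real^'n) set) = range (\<lambda>i. axis i 1)" by (auto simp: Basis_vec_def)
 moreover have "inj (\<lambda>i::'n. axis i (1::real))" by (auto simp: inj_def axis_eq_axis)
 ultimately show ?thesis using prod.reindex[of "\<lambda>i::'n. axis i (1::real)" UNIV f] by (simp add: o_def)
qed

lemma nn_integral_lborel_prod_cart:
 fixes f :: "'n::finite => real => real"
 assumes [measurable]: "\<And>i. f i \<in> borel_measurable borel" and nn: "\<And>i x. 0 <= f i x"
 shows "(NN x. ennreal (\<Prod>i\<in>UNIV. f i ((x::real^'n) $ i))) = (\<Prod>i\<in>UNIV. (NN x. ennreal (f i x)))"
proof -
 define g where "g b = f (SOME i. b = axis i 1)" for b :: "real^'n"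
 have g: "g (axis i 1) = f i" for i
 proof -
  have "(SOME i'. axis i 1 = (axis i' 1 :: real^'n)) = i" by (rule some_equality) (auto simp: axis_eq_axis)
  then show ?thesis by (simp add: g_def)
 qed
 have [measurable]: "g b \<in> borel_measurable borel" for b by (simp add: g_def)
 have "(NN x. ennreal (\<Prod>i\<in>UNIV. f i ((x::real^'n) $ i))) =
   (NN x. (\<Prod>b\<in>Basis. ennreal (g b ((x::real^'n) \<bullet> b))))"
  by (intro nn_integral_cong) (simp add: prod_Basis_cart g inner_axis prod_ennreal[symmetric] nn)
 also have "... = (\<Prod>b\<in>Basis. (NN x. ennreal (g b x)))"
  by (intro nn_integral_lborel_prod) auto
 also have "... = (\<Prod>i\<in>UNIV. (NN x. ennreal (f i x)))" by (simp add: prod_Basis_cart g)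
 finally show ?thesis .
qed

section \<open>The heat kernel\<close>

definition heat :: "real => real^'n::finite => real" where
 "heat t z = (4 * pi * t) powr (- real CARD('n) / 2) * exp (- ((norm z)\<^sup>2 / (4 * t)))"

text \<open>The spatial gradient and the time derivative of the heat kernel\<close>

definition heat_grad :: "real => real^'n::finite => real^'n" where
 "heat_grad t z = - (heat t z / (2 * t)) *\<^sub>R z"

definition heat_dt :: "real => real^'n::finite => real" where
 "heat_dt t z = ((norm z)\<^sup>2 / (4 * t\<^sup>2) - real CARD('n) / (2 * t)) * heat t z"

lemma heat_measurable [measurable]:
 "(\<lambda>p. heat (fst p) (snd p :: real^'n::finite)) \<in> borel_measurable borel"
 "(\<lambda>p. heat_grad (fst p) (snd p :: real^'n::finite)) \<in> borel_measurable borel"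
 "(\<lambda>p. heat_dt (fst p) (snd p :: real^'n::finite)) \<in> borel_measurable borel"
 unfolding heat_def heat_grad_def heat_dt_def borel_prod[symmetric] by measurable

lemma heat_measurable' [measurable (raw)]:
 fixes g :: "'m => real^'n::finite"
 assumes [measurable]: "f \<in> borel_measurable M" "g \<in> borel_measurable M"
 shows "(\<lambda>x. heat (f x) (g x)) \<in> borel_measurable M"
  and "(\<lambda>x. heat_grad (f x) (g x)) \<in> borel_measurable M"
  and "(\<lambda>x. heat_dt (f x) (g x)) \<in> borel_measurable M"
 unfolding heat_def heat_grad_def heat_dt_def by measurable

lemma heat_nonneg [simp]: "0 <= heat t z" by (simp add: heat_def)

lemma heat_minus [simp]: "heat t (- z) = heat t z" by (simp add: heat_def)

lemma heat_dt_minus [simp]: "heat_dt t (- z) = heat_dt t z" by (simp add: heat_dt_def)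

lemma heat_grad_minus [simp]: "heat_grad t (- z) = - heat_grad t z" by (simp add: heat_grad_def)

lemma heat_commute: "heat t (x - y) = heat t (y - x)" using heat_minus[of t "x - y"] by simp

text \<open>
 Every integral of the heat kernel reduces to Gaussian integrals in one variable.
\<close>

lemma heat_eq_prod:
 assumes t: "t > 0"
 shows "heat t (z::real^'n::finite) = (\<Prod>i\<in>UNIV. normal_density 0 (sqrt (2 * t)) (z $ i))"
proof -
 have "(\<Prod>i\<in>UNIV. normal_density 0 (sqrt (2 * t)) (z $ i)) =
   (\<Prod>i\<in>(UNIV::'n set). 1 / sqrt (4 * pi * t)) * (\<Prod>i\<in>UNIV. exp (- ((z $ i)\<^sup>2 / (4 * t))))"
  using t by (subst prod.distrib[symmetric]) (simp add: normal_density_def mult_ac)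
 also have "(\<Prod>i\<in>UNIV. exp (- ((z $ i)\<^sup>2 / (4 * t)))) = exp (- ((norm z)\<^sup>2 / (4 * t)))"
 proof -
  have "(norm z)\<^sup>2 = (\<Sum>i\<in>UNIV. (z $ i)\<^sup>2)"
   by (simp add: power2_norm_eq_inner inner_vec_def) (simp add: power2_eq_square)
  then show ?thesis by (simp add: exp_sum[symmetric] sum_negf sum_divide_distrib[symmetric])
 qed
 also have "(\<Prod>i\<in>(UNIV::'n set). 1 / sqrt (4 * pi * t)) = (4 * pi * t) powr (- real CARD('n) / 2)"
 proof -
  have "1 / sqrt (4 * pi * t) = (4 * pi * t) powr (- (1/2))"
   unfolding powr_minus using t by (simp add: powr_half_sqrt inverse_eq_divide)
  then have "(\<Prod>i\<in>(UNIV::'n set). 1 / sqrt (4 * pi * t)) = ((4 * pi * t) powr (- (1/2))) ^ CARD('n)" by simp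
  also have "... = ((4 * pi * t) powr (- (1/2))) powr real CARD('n)"
   using t by (simp add: powr_realpow)
  finally show ?thesis using t by (simp add: powr_powr mult.commute)
 qed
 finally show ?thesis by (simp add: heat_def)
qed

lemma normal_density_nn_integrals:
 assumes t: "t > 0"
 shows "(NN x. ennreal (normal_density 0 (sqrt (2 * t)) x)) = 1"
  and "(NN x. ennreal (x\<^sup>2 * normal_density 0 (sqrt (2 * t)) x)) = ennreal (2 * t)"
proof -
 have s: "0 < sqrt (2 * t)" using t by simp
 show "(NN x. ennreal (normal_density 0 (sqrt (2 * t)) x)) = 1"
  using integral_normal_density[OF s] by (subst nn_integral_eq_integral[OF integrable_normal_density[OF s]]) auto
 have "has_bochner_integral lborel (\<lambda>x. normal_density 0 (sqrt (2 * t)) x * x\<^sup>2) (2 * t)"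
  using normal_moment_even[OF s, of 0 1] t by (simp add: fact_numeral)
 then show "(NN x. ennreal (x\<^sup>2 * normal_density 0 (sqrt (2 * t)) x)) = ennreal (2 * t)"
  by (subst nn_integral_eq_integral) (auto simp: has_bochner_integral_iff mult.commute)
qed

lemma heat_nn_integral:
 assumes t: "t > 0"
 shows "(NN z. ennreal (heat t (z::real^'n::finite))) = 1"
proof -
 have "(NN z. ennreal (heat t (z::real^'n))) =
   (\<Prod>i\<in>(UNIV::'n set). (NN x. ennreal (normal_density 0 (sqrt (2 * t)) x)))"
  unfolding heat_eq_prod[OF t] by (rule nn_integral_lborel_prod_cart) auto
 then show ?thesis using normal_density_nn_integrals[OF t] by simp
qed

lemma heat_nn_moment:
 assumes t: "t > 0"
 shows "(NN z. ennreal ((norm z)\<^sup>2 * heat t (z::real^'n::finite))) = ennreal (2 * real CARD('n) * t)"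
proof -
 let ?d = "normal_density 0 (sqrt (2 * t))"
 have j: "(NN z. ennreal ((z $ j)\<^sup>2 * heat t (z::real^'n))) = ennreal (2 * t)" for j
 proof -
  define f where "f i x = (if i = j then x\<^sup>2 else 1) * ?d x" for i x
  have [measurable]: "f i \<in> borel_measurable borel" for i unfolding f_def by simp
  have "(z $ j)\<^sup>2 * heat t z = (\<Prod>i\<in>UNIV. f i (z $ i))" for z :: "real^'n"
   using t by (simp add: heat_eq_prod f_def prod.distrib)
  then have "(NN z. ennreal ((z $ j)\<^sup>2 * heat t (z::real^'n))) = (\<Prod>i\<in>UNIV. (NN x. ennreal (f i x)))"
   by (simp, subst nn_integral_lborel_prod_cart) (auto simp: f_def)
  also have "... = (\<Prod>i\<in>UNIV. if i = j then ennreal (2 * t) else 1)"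
   using normal_density_nn_integrals[OF t] by (intro prod.cong) (auto simp: f_def)
  also have "... = ennreal (2 * t)" by simp
  finally show ?thesis .
 qed
 have "(NN z. ennreal ((norm z)\<^sup>2 * heat t (z::real^'n))) =
   (NN z. (\<Sum>j\<in>UNIV. ennreal ((z $ j)\<^sup>2 * heat t (z::real^'n))))"
  by (intro nn_integral_cong)
   (simp add: power2_norm_eq_inner inner_vec_def sum_distrib_right, simp add: power2_eq_square)
 also have "... = (\<Sum>j\<in>(UNIV::'n set). ennreal (2 * t))" by (subst nn_integral_sum) (auto simp: j)
 also have "... = ennreal (2 * real CARD('n) * t)" using t by (simp add: ennreal_of_nat_eq_real_of_nat ennreal_mult mult_ac)
 finally show ?thesis .
qed

lemma heat_integrable: "t > 0 ==> integrable lborel (heat t :: real^'n::finite => real)"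
 and heat_integral: "t > 0 ==> (LBINT z. heat t (z::real^'n::finite)) = 1"
 and heat_moment_integrable: "t > 0 ==> integrable lborel (\<lambda>z. (norm z)\<^sup>2 * heat t (z::real^'n::finite))"
 and heat_moment: "t > 0 ==> (LBINT z. (norm z)\<^sup>2 * heat t (z::real^'n::finite)) = 2 * real CARD('n) * t"
proof -
 show "t > 0 ==> integrable lborel (heat t :: real^'n::finite => real)"
  by (intro integrableI_nn_integral_finite[where x=1]) (auto simp: heat_nn_integral)
 show "t > 0 ==> (LBINT z. heat t (z::real^'n::finite)) = 1"
  by (intro integral_eq_nn_integral[THEN trans]) (auto simp: heat_nn_integral)
 show "t > 0 ==> integrable lborel (\<lambda>z. (norm z)\<^sup>2 * heat t (z::real^'n::finite))"
  by (intro integrableI_nn_integral_finite[where x="2 * real CARD('n) * t"]) (auto simp: heat_nn_moment)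
 show "t > 0 ==> (LBINT z. (norm z)\<^sup>2 * heat t (z::real^'n::finite)) = 2 * real CARD('n) * t"
  by (intro integral_eq_nn_integral[THEN trans]) (auto simp: heat_nn_moment)
qed

lemma heat_quadratic:
 assumes t: "t > 0"
 shows "integrable lborel (\<lambda>z. (a * (norm z)\<^sup>2 + z \<bullet> b + c) * heat t (z::real^'n::finite))"
  and "(LBINT z. (a * (norm z)\<^sup>2 + z \<bullet> b + c) * heat t (z::real^'n::finite)) = a * (2 * real CARD('n) * t) + c"
proof -
 note hi = heat_integrable[OF t, where 'n='n] heat_moment_integrable[OF t, where 'n='n]
 have b: "integrable lborel (\<lambda>z. (z \<bullet> b) * heat t z)"
 proof (rule bochner_bound)
  show "integrable lborel (\<lambda>z::real^'n. norm b * ((norm z)\<^sup>2 * heat t z + heat t z))"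
   using hi by (intro integrable_mult_right) simp
  show "AE z in lborel. norm ((z \<bullet> b) * heat t z) <= norm (norm b * ((norm z)\<^sup>2 * heat t z + heat t z))"
  proof (intro AE_I2)
   fix z :: "real^'n"
   have "\<bar>z \<bullet> b\<bar> <= norm b * norm z" using Cauchy_Schwarz_ineq2[of z b] by (simp add: mult.commute)
   also have "norm z <= (norm z)\<^sup>2 + 1"
   proof -
    have "2 * norm z * 1 <= (norm z)\<^sup>2 + 1\<^sup>2" by (rule sum_squares_bound)
    then have "2 * norm z <= (norm z)\<^sup>2 + 1" by simp
    then show ?thesis using norm_ge_zero[of z] by linarith
   qed
   finally have "\<bar>z \<bullet> b\<bar> * heat t z <= (norm b * ((norm z)\<^sup>2 + 1)) * heat t z"
    by (intro mult_right_mono) (auto simp: mult_left_mono)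
   then show "norm ((z \<bullet> b) * heat t z) <= norm (norm b * ((norm z)\<^sup>2 * heat t z + heat t z))"
    by (simp add: abs_mult algebra_simps)
  qed
 qed simp
 have "(LBINT z. ((- z) \<bullet> b) * heat t (- z)) = (LBINT z. (z \<bullet> b) * heat t z)"
  by (intro lborel_integral_reflect) simp
 then have b0: "(LBINT z. (z \<bullet> b) * heat t z) = 0" by simp
 show "integrable lborel (\<lambda>z. (a * (norm z)\<^sup>2 + z \<bullet> b + c) * heat t z)"
  using b hi
  by (simp add: distrib_right mult.assoc)
 show "(LBINT z. (a * (norm z)\<^sup>2 + z \<bullet> b + c) * heat t z) = a * (2 * real CARD('n) * t) + c"
  using b b0 hi heat_integral[OF t, where 'n='n] heat_moment[OF t, where 'n='n]
  by (simp add: distrib_right mult.assoc)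
qed

text \<open>
 Completing the square: a product of two Gaussians is a Gaussian around the weighted mean
 of the centres.
\<close>

lemma heat_mult_heat:
 fixes x y y' :: "real^'n::finite"
 assumes t: "t > 0" and s: "s > 0"
 shows "heat t (x - y) * heat s (x - y') =
  heat (t + s) (y - y') * heat (t * s / (t + s)) (x - (1 / (t + s)) *\<^sub>R (s *\<^sub>R y + t *\<^sub>R y'))"
proof -
 define a b where "a = x - y" and "b = x - y'"
 have ts: "t + s > 0" "t * s / (t + s) > 0" using t s by auto
 have d: "y - y' = b - a" by (simp add: a_def b_def)
 have m: "x - (1 / (t + s)) *\<^sub>R (s *\<^sub>R y + t *\<^sub>R y') = (1 / (t + s)) *\<^sub>R (s *\<^sub>R a + t *\<^sub>R b)"
 proof -
  have "s *\<^sub>R a + t *\<^sub>R b = (t + s) *\<^sub>R x - (s *\<^sub>R y + t *\<^sub>R y')"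
   by (simp add: a_def b_def algebra_simps)
  then show ?thesis using ts by (simp add: scaleR_diff_right)
 qed
 have sq: "s * (t + s) * (norm a)\<^sup>2 + t * (t + s) * (norm b)\<^sup>2 =
   t * s * (norm (b - a))\<^sup>2 + (norm (s *\<^sub>R a + t *\<^sub>R b))\<^sup>2"
  unfolding power2_norm_eq_inner
  by (simp add: inner_diff_left inner_diff_right inner_add_left inner_add_right inner_commute[of b a] algebra_simps)
 have "(norm a)\<^sup>2 / (4 * t) + (norm b)\<^sup>2 / (4 * s) =
   (s * (t + s) * (norm a)\<^sup>2 + t * (t + s) * (norm b)\<^sup>2) / (4 * t * s * (t + s))"
  using t s ts by (simp add: add_divide_distrib)
 also have "... = (norm (b - a))\<^sup>2 / (4 * (t + s)) + (norm (s *\<^sub>R a + t *\<^sub>R b))\<^sup>2 / (4 * t * s * (t + s))"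
  unfolding sq using t s ts by (simp add: add_divide_distrib)
 also have "(norm (s *\<^sub>R a + t *\<^sub>R b))\<^sup>2 / (4 * t * s * (t + s)) =
   (norm ((1 / (t + s)) *\<^sub>R (s *\<^sub>R a + t *\<^sub>R b)))\<^sup>2 / (4 * (t * s / (t + s)))"
  using t s ts by (simp add: power_divide power2_eq_square)
 finally have e: "exp (- ((norm a)\<^sup>2 / (4 * t))) * exp (- ((norm b)\<^sup>2 / (4 * s))) =
   exp (- ((norm (b - a))\<^sup>2 / (4 * (t + s)))) *
   exp (- ((norm ((1 / (t + s)) *\<^sub>R (s *\<^sub>R a + t *\<^sub>R b)))\<^sup>2 / (4 * (t * s / (t + s)))))"
  unfolding exp_add[symmetric] by (simp add: algebra_simps)
 have "(4 * pi * t) * (4 * pi * s) = (4 * pi * (t + s)) * (4 * pi * (t * s / (t + s)))"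
  using ts(1) by (simp add: field_simps)
 then have p: "(4 * pi * t) powr k * (4 * pi * s) powr k =
   (4 * pi * (t + s)) powr k * (4 * pi * (t * s / (t + s))) powr k" for k
  using t s ts by (simp only: powr_mult[symmetric])
 have gen: "P * u * (Q * v) = R * w * (S * z)" if "u * v = w * z" "P * Q = R * S" for P Q R S u v w z :: real
 proof -
  have "P * u * (Q * v) = (P * Q) * (u * v)" by (simp only: mult_ac)
  also have "... = R * w * (S * z)" unfolding that by (simp only: mult_ac)
  finally show ?thesis .
 qed
 show ?thesis
  unfolding m unfolding d a_def[symmetric] b_def[symmetric] unfolding heat_def
  by (rule gen[OF e p])
qed

text \<open>
 After completing the square, only the zeroth and second moments of one Gaussian remain.
\<close>

lemma heat_convolution_quadratic:
 fixes y y' :: "real^'n::finite"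
 assumes t: "t > 0" and s: "s > 0"
  and F: "\<And>z. F (z + (1 / (t + s)) *\<^sub>R (s *\<^sub>R y + t *\<^sub>R y')) = a * (norm z)\<^sup>2 + z \<bullet> b + c"
 shows "(LBINT x. F x * (heat t (x - y) * heat s (x - y'))) =
   (a * (2 * real CARD('n) * (t * s / (t + s))) + c) * heat (t + s) (y - y')"
proof -
 define m where "m = (1 / (t + s)) *\<^sub>R (s *\<^sub>R y + t *\<^sub>R y')"
 define \<tau> where "\<tau> = t * s / (t + s)"
 have \<tau>: "\<tau> > 0" using t s by (simp add: \<tau>_def)
 have Fx: "F x = a * (norm (x - m))\<^sup>2 + (x - m) \<bullet> b + c" for x
  using F[of "x - m"] by (simp add: m_def)
 have "(LBINT x. F x * (heat t (x - y) * heat s (x - y'))) =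
   (LBINT x. heat (t + s) (y - y') * ((a * (norm (x - m))\<^sup>2 + (x - m) \<bullet> b + c) * heat \<tau> (x - m)))"
  unfolding heat_mult_heat[OF t s] m_def[symmetric] \<tau>_def[symmetric] Fx by (simp add: mult_ac)
 also have "... = heat (t + s) (y - y') * (LBINT x. (a * (norm (x - m))\<^sup>2 + (x - m) \<bullet> b + c) * heat \<tau> (x - m))"
  by (rule integral_mult_right_zero)
 also have "(LBINT x. (a * (norm (x - m))\<^sup>2 + (x - m) \<bullet> b + c) * heat \<tau> (x - m)) =
   (LBINT z. (a * (norm z)\<^sup>2 + z \<bullet> b + c) * heat \<tau> z)"
  by (rule lborel_integral_translate(1)) simp
 also have "... = a * (2 * real CARD('n) * \<tau>) + c" by (rule heat_quadratic(2)[OF \<tau>])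
 finally show ?thesis by (simp add: \<tau>_def mult_ac)
qed

lemma heat_convolution_dt:
 fixes y y' :: "real^'n::finite"
 assumes t: "t > 0" and s: "s > 0"
 shows "(LBINT x. heat t (x - y) * heat_dt s (x - y')) = heat_dt (t + s) (y - y')"
proof -
 define e where "e = (s / (t + s)) *\<^sub>R (y - y')"
 define n where "n = real CARD('n)"
 have ts: "t + s > 0" using t s by simp
 have "s *\<^sub>R y + t *\<^sub>R y' - (t + s) *\<^sub>R y' = s *\<^sub>R (y - y')" by (simp add: algebra_simps)
 then have m: "(1 / (t + s)) *\<^sub>R (s *\<^sub>R y + t *\<^sub>R y') = y' + e"
 proof -
  have "(1 / (t + s)) *\<^sub>R (s *\<^sub>R y + t *\<^sub>R y') = (1 / (t + s)) *\<^sub>R ((t + s) *\<^sub>R y' + s *\<^sub>R (y - y'))"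
   by (simp add: algebra_simps)
  then show ?thesis using ts by (simp add: scaleR_add_right e_def)
 qed
 have F: "(norm ((z + (1 / (t + s)) *\<^sub>R (s *\<^sub>R y + t *\<^sub>R y')) - y'))\<^sup>2 / (4 * s\<^sup>2) - n / (2 * s) =
   (1 / (4 * s\<^sup>2)) * (norm z)\<^sup>2 + z \<bullet> ((1 / (2 * s\<^sup>2)) *\<^sub>R e) + ((norm e)\<^sup>2 / (4 * s\<^sup>2) - n / (2 * s))" for z
 proof -
  have "(norm ((z + (1 / (t + s)) *\<^sub>R (s *\<^sub>R y + t *\<^sub>R y')) - y'))\<^sup>2 = (norm z)\<^sup>2 + 2 * (z \<bullet> e) + (norm e)\<^sup>2"
   unfolding m power2_norm_eq_inner by (simp add: inner_add_left inner_add_right inner_commute[of e z])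
  then show ?thesis by (simp add: add_divide_distrib)
 qed
 have "(LBINT x. heat t (x - y) * heat_dt s (x - y')) =
   (LBINT x. ((norm (x - y'))\<^sup>2 / (4 * s\<^sup>2) - n / (2 * s)) * (heat t (x - y) * heat s (x - y')))"
  by (simp add: heat_dt_def n_def mult_ac)
 also have "... = ((1 / (4 * s\<^sup>2)) * (2 * real CARD('n) * (t * s / (t + s))) + ((norm e)\<^sup>2 / (4 * s\<^sup>2) - n / (2 * s)))
   * heat (t + s) (y - y')"
  by (rule heat_convolution_quadratic[OF t s F])
 also have "(1 / (4 * s\<^sup>2)) * (2 * real CARD('n) * (t * s / (t + s))) + ((norm e)\<^sup>2 / (4 * s\<^sup>2) - n / (2 * s)) =
   (norm (y - y'))\<^sup>2 / (4 * (t + s)\<^sup>2) - n / (2 * (t + s))"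
 proof -
  have "(norm e)\<^sup>2 / (4 * s\<^sup>2) = (norm (y - y'))\<^sup>2 / (4 * (t + s)\<^sup>2)"
   using s ts by (simp add: e_def power_mult_distrib power_divide)
  moreover have "(1 / (4 * s\<^sup>2)) * (2 * n * (t * s / (t + s))) = n / (2 * s) - n / (2 * (t + s))"
   using s ts by (simp add: field_simps power2_eq_square)
  ultimately show ?thesis by (simp add: n_def)
 qed
 finally show ?thesis by (simp add: heat_dt_def n_def)
qed

text \<open>
 The Laplacian of \<open>p\<close> is its time derivative, so the correlation of two gradients is minus
 the time derivative at the sum of the times.
\<close>

lemma heat_convolution_grad:
 fixes y y' :: "real^'n::finite"
 assumes t: "t > 0" and s: "s > 0"
 shows "(LBINT x. heat_grad t (x - y) \<bullet> heat_grad s (x - y')) = - heat_dt (t + s) (y - y')"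
proof -
 define d where "d = y - y'"
 define n where "n = real CARD('n)"
 have ts: "t + s > 0" using t s by simp
 define p where "p = (t / (t + s)) *\<^sub>R d"
 define r where "r = (s / (t + s)) *\<^sub>R d"
 have pr: "p + r = d" unfolding p_def r_def scaleR_add_left[symmetric]
  using ts by (simp add: add_divide_distrib[symmetric])
 have m': "(1 / (t + s)) *\<^sub>R (s *\<^sub>R y + t *\<^sub>R y') = y' + r"
 proof -
  have "(1 / (t + s)) *\<^sub>R (s *\<^sub>R y + t *\<^sub>R y') = (1 / (t + s)) *\<^sub>R ((t + s) *\<^sub>R y' + s *\<^sub>R (y - y'))"
   by (simp add: algebra_simps)
  then show ?thesis using ts by (simp add: scaleR_add_right r_def d_def)
 qed
 have m: "y' + r = y - p" using pr by (simp add: d_def algebra_simps)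
 have F: "(((z + (1 / (t + s)) *\<^sub>R (s *\<^sub>R y + t *\<^sub>R y')) - y) \<bullet> ((z + (1 / (t + s)) *\<^sub>R (s *\<^sub>R y + t *\<^sub>R y')) - y')) / (4 * t * s) =
   (1 / (4 * t * s)) * (norm z)\<^sup>2 + z \<bullet> ((1 / (4 * t * s)) *\<^sub>R (r - p)) + (- (p \<bullet> r) / (4 * t * s))" for z
 proof -
  have 1: "(z + (y' + r)) - y' = z + r" by simp
  have 2: "(z + (y' + r)) - y = z - p" unfolding m by simp
  have "(z - p) \<bullet> (z + r) = (norm z)\<^sup>2 + z \<bullet> (r - p) - p \<bullet> r"
   unfolding power2_norm_eq_inner by (simp add: inner_add_right inner_diff_left inner_diff_right inner_commute[of p z])
  then show ?thesis unfolding m' 1 2 by (simp add: add_divide_distrib diff_divide_distrib)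
 qed
 have "(LBINT x. heat_grad t (x - y) \<bullet> heat_grad s (x - y')) =
   (LBINT x. (((x - y) \<bullet> (x - y')) / (4 * t * s)) * (heat t (x - y) * heat s (x - y')))"
  by (simp add: heat_grad_def mult_ac)
 also have "... = ((1 / (4 * t * s)) * (2 * real CARD('n) * (t * s / (t + s))) + (- (p \<bullet> r) / (4 * t * s)))
   * heat (t + s) (y - y')"
  by (rule heat_convolution_quadratic[OF t s F])
 also have "(1 / (4 * t * s)) * (2 * real CARD('n) * (t * s / (t + s))) + (- (p \<bullet> r) / (4 * t * s)) =
   - ((norm d)\<^sup>2 / (4 * (t + s)\<^sup>2) - n / (2 * (t + s)))"
 proof -
  have "(1 / (4 * t * s)) * (2 * real CARD('n) * (t * s / (t + s))) = n / (2 * (t + s))"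
   using t s ts by (simp add: n_def)
  moreover have "p \<bullet> r / (4 * t * s) = (norm d)\<^sup>2 / (4 * (t + s)\<^sup>2)"
   using t s by (simp add: p_def r_def power2_norm_eq_inner) (simp add: power2_eq_square field_simps)
  ultimately show ?thesis by simp
 qed
 finally show ?thesis by (simp only: heat_dt_def n_def d_def mult_minus_left)
qed


subsection \<open>Bounds\<close>

lemma exp_ge_mult: "0 <= x ==> x * exp (- x) <= (1::real)"
proof -
 have "x <= exp x" using exp_ge_add_one_self[of x] by linarith
 then show ?thesis by (simp add: exp_minus field_simps)
qed

lemma four_pi_powr_le:
 assumes "t > 0" "k >= 0" shows "(4 * pi * t) powr (- k) <= t powr (- k)"
proof -
 have "1 <= 4 * pi" using pi_gt3 by simp
 then have "1 <= (4 * pi) powr k" using assms by (intro ge_one_powr_ge_zero) auto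
 then have "(4 * pi) powr (- k) <= 1" by (simp add: powr_minus inverse_le_1_iff)
 then have "(4 * pi) powr (- k) * t powr (- k) <= 1 * t powr (- k)" by (intro mult_right_mono) auto
 then show ?thesis using assms by (simp add: powr_mult)
qed

lemma heat_le:
 assumes t: "t > 0"
 shows "heat t (z::real^'n::finite) <= t powr (- real CARD('n) / 2)"
proof -
 have "(4 * pi * t) powr (- real CARD('n) / 2) * exp (- ((norm z)\<^sup>2 / (4 * t))) <= t powr (- real CARD('n) / 2) * 1"
  using t four_pi_powr_le[OF t, of "real CARD('n) / 2"] by (intro mult_mono) auto
 then show ?thesis by (simp add: heat_def)
qed

lemma heat_dt_le:
 assumes t: "t > 0"
 shows "\<bar>heat_dt t (z::real^'n::finite)\<bar> <= (1 + real CARD('n) / 2) * t powr (- real CARD('n) / 2 - 1)"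
proof -
 define u where "u = (norm z)\<^sup>2 / (4 * t)"
 define n where "n = real CARD('n)"
 define P where "P = (4 * pi * t) powr (- n / 2)"
 have u: "u >= 0" using t by (simp add: u_def)
 have P: "0 <= P" "P <= t powr (- n / 2)"
  using four_pi_powr_le[OF t, of "n / 2"] by (auto simp: P_def n_def)
 have "heat_dt t z = (u - n / 2) * exp (- u) * (P / t)"
 proof -
  have "(norm z)\<^sup>2 / (4 * t\<^sup>2) - n / (2 * t) = (u - n / 2) / t"
   by (simp add: u_def power2_eq_square diff_divide_distrib)
  then show ?thesis by (simp add: heat_dt_def heat_def u_def[symmetric] n_def[symmetric] P_def)
 qed
 then have "\<bar>heat_dt t z\<bar> = \<bar>u - n / 2\<bar> * exp (- u) * (P / t)" using P t by (simp add: abs_mult)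
 also have "... <= (1 + n / 2) * (P / t)"
 proof (rule mult_right_mono)
  have "\<bar>u - n / 2\<bar> * exp (- u) <= (u + n / 2) * exp (- u)"
   using u by (intro mult_right_mono) (auto simp: n_def)
  also have "... = u * exp (- u) + n / 2 * exp (- u)" by (simp add: distrib_right)
  also have "... <= 1 + n / 2 * 1"
   using u by (intro add_mono exp_ge_mult mult_left_mono) (auto simp: n_def)
  finally show "\<bar>u - n / 2\<bar> * exp (- u) <= 1 + n / 2" by simp
 qed (use P t in simp)
 also have "... <= (1 + n / 2) * (t powr (- n / 2) / t)"
  using P t by (intro mult_left_mono divide_right_mono) (auto simp: n_def)
 also have "t powr (- n / 2) / t = t powr (- n / 2 - 1)"
  using t by (simp add: powr_diff)
 finally show ?thesis by (simp add: n_def)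
qed

lemma heat_grad_le:
 assumes t: "t > 0"
 shows "norm (heat_grad t (z::real^'n::finite)) <= t powr (- real CARD('n) / 2 - 1 / 2)"
proof -
 define n where "n = real CARD('n)"
 define P where "P = (4 * pi * t) powr (- n / 2)"
 define u where "u = norm z / (2 * sqrt t)"
 have u: "u >= 0" "u\<^sup>2 = (norm z)\<^sup>2 / (4 * t)" using t by (auto simp: u_def power_divide power_mult_distrib)
 have P: "0 <= P" "P <= t powr (- n / 2)"
  using four_pi_powr_le[OF t, of "n / 2"] by (auto simp: P_def n_def)
 have uexp: "u * exp (- u\<^sup>2) <= 1"
 proof -
  have "2 * u * 1 <= u\<^sup>2 + 1\<^sup>2" by (rule sum_squares_bound)
  then have "2 * u <= u\<^sup>2 + 1" by simp
  then have "u <= 1 + u\<^sup>2" using u(1) by linarith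
  also have "... <= exp (u\<^sup>2)" by (rule exp_ge_add_one_self)
  finally show ?thesis by (simp add: exp_minus field_simps)
 qed
 have "norm z / (2 * t) = u / sqrt t"
  using t by (simp add: u_def mult.assoc)
 then have "norm (heat_grad t z) = u / sqrt t * (P * exp (- u\<^sup>2))"
 proof -
  assume eq: "norm z / (2 * t) = u / sqrt t"
  have "norm (heat_grad t z) = norm z / (2 * t) * heat t z" using t by (simp add: heat_grad_def abs_mult)
  then show ?thesis unfolding eq by (simp only: heat_def P_def n_def u(2))
 qed
 also have "... = (u * exp (- u\<^sup>2)) * (P / sqrt t)" by simp
 also have "... <= 1 * (t powr (- n / 2) / sqrt t)"
  using P t uexp by (intro mult_mono divide_right_mono) auto
 also have "... = t powr (- n / 2 - 1 / 2)" using t by (simp add: powr_diff powr_half_sqrt)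
 finally show ?thesis by (simp add: n_def)
qed

text \<open>
 The bound \<open>\<bar>z\<bar> <= (\<surd>t + \<bar>z\<bar>\<^sup>2 / \<surd>t) / 2\<close> reduces the first moment to the zeroth and second
 ones.
\<close>

lemma heat_grad_nn_integral:
 assumes t: "t > 0"
 shows "(NN z. ennreal (norm (heat_grad t (z::real^'n::finite)))) <= ennreal ((real CARD('n) + 1) / sqrt t)"
proof -
 define n where "n = real CARD('n)"
 have le: "norm (heat_grad t z) <= (1 / (4 * t * sqrt t)) * ((norm z)\<^sup>2 * heat t z) + (1 / (4 * sqrt t)) * heat t z"
  for z :: "real^'n"
 proof -
  have "2 * norm z * sqrt t <= (norm z)\<^sup>2 + (sqrt t)\<^sup>2" by (rule sum_squares_bound)
  then have "norm z * (2 * sqrt t) <= (norm z)\<^sup>2 + t" using t by (simp add: mult_ac)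
  then have "norm z <= ((norm z)\<^sup>2 + t) / (2 * sqrt t)" using t by (subst pos_le_divide_eq) auto
  then have "norm z * (heat t z / (2 * t)) <= ((norm z)\<^sup>2 + t) / (2 * sqrt t) * (heat t z / (2 * t))"
   using t by (intro mult_right_mono) auto
  also have "... = (1 / (4 * t * sqrt t)) * ((norm z)\<^sup>2 * heat t z) + (1 / (4 * sqrt t)) * heat t z"
   using t by (simp add: add_divide_distrib distrib_right)
  also have "norm z * (heat t z / (2 * t)) = norm (heat_grad t z)" using t by (simp add: heat_grad_def abs_mult)
  finally show ?thesis .
 qed
 have "(NN z. ennreal (norm (heat_grad t (z::real^'n)))) <=
   (NN z. ennreal ((1 / (4 * t * sqrt t)) * ((norm z)\<^sup>2 * heat t (z::real^'n)) + (1 / (4 * sqrt t)) * heat t z))"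
  by (intro nn_integral_mono ennreal_leI le)
 also have "... = ennreal (LBINT z. (1 / (4 * t * sqrt t)) * ((norm z)\<^sup>2 * heat t (z::real^'n)) + (1 / (4 * sqrt t)) * heat t z)"
  using t heat_integrable[OF t, where 'n='n] heat_moment_integrable[OF t, where 'n='n]
  by (intro nn_integral_eq_integral) auto
 also have "(LBINT z. (1 / (4 * t * sqrt t)) * ((norm z)\<^sup>2 * heat t (z::real^'n)) + (1 / (4 * sqrt t)) * heat t z) =
   (1 / (4 * t * sqrt t)) * (2 * n * t) + (1 / (4 * sqrt t)) * 1"
  using heat_integrable[OF t, where 'n='n] heat_moment_integrable[OF t, where 'n='n]
   heat_integral[OF t, where 'n='n] heat_moment[OF t, where 'n='n] by (simp add: n_def)
 also have "... = (n / 2 + 1 / 4) / sqrt t" using t by (simp add: add_divide_distrib)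
 also have "ennreal ... <= ennreal ((n + 1) / sqrt t)"
  using t by (intro ennreal_leI divide_right_mono) (auto simp: n_def)
 finally show ?thesis by (simp add: n_def)
qed

lemma heat_dt_integrable:
 assumes t: "t > 0"
 shows "integrable lborel (heat_dt t :: real^'n::finite => real)"
proof -
 have "integrable lborel (\<lambda>z::real^'n. (1 / (4 * t\<^sup>2) * (norm z)\<^sup>2 + z \<bullet> 0 + - (real CARD('n) / (2 * t))) * heat t z)"
  by (rule heat_quadratic(1)[OF t])
 moreover have "(1 / (4 * t\<^sup>2) * (norm z)\<^sup>2 + z \<bullet> 0 + - (real CARD('n) / (2 * t))) * heat t z = heat_dt t z"
  for z :: "real^'n" by (simp add: heat_dt_def)
 ultimately show ?thesis by simp
qed

subsection \<open>Derivatives\<close>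

lemma heat_has_dt:
 assumes t: "t > 0"
 shows "((\<lambda>t. heat t (z::real^'n::finite)) has_real_derivative heat_dt t z) (at t)"
proof -
 define n where "n = real CARD('n)"
 have "((\<lambda>t. (4 * pi * t) powr (- n / 2)) has_real_derivative (- n / (2 * t)) * (4 * pi * t) powr (- n / 2)) (at t)"
 proof -
  have "((\<lambda>t. (4 * pi * t) powr (- n / 2)) has_real_derivative
    (- n / 2) * (4 * pi * t) powr (- n / 2 - 1) * (4 * pi)) (at t)"
   using DERIV_fun_powr[of "\<lambda>t. 4 * pi * t" "4 * pi" t "- n / 2"] t by (simp add: DERIV_cmult_Id)
  moreover have "(- n / 2) * (4 * pi * t) powr (- n / 2 - 1) * (4 * pi) = (- n / (2 * t)) * (4 * pi * t) powr (- n / 2)"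
   using t by (simp add: powr_diff)
  ultimately show ?thesis by simp
 qed
 moreover have "((\<lambda>t. exp (- ((norm z)\<^sup>2 / (4 * t)))) has_real_derivative
   ((norm z)\<^sup>2 / (4 * t\<^sup>2)) * exp (- ((norm z)\<^sup>2 / (4 * t)))) (at t)"
 proof -
  have "((\<lambda>t. - ((norm z)\<^sup>2 / (4 * t))) has_real_derivative (norm z)\<^sup>2 / (4 * t\<^sup>2)) (at t)"
   using t by (auto intro!: derivative_eq_intros simp: power2_eq_square)
  from DERIV_chain2[OF DERIV_exp this] show ?thesis by (simp only: mult.commute)
 qed
 ultimately have "((\<lambda>t. (4 * pi * t) powr (- n / 2) * exp (- ((norm z)\<^sup>2 / (4 * t)))) has_real_derivative
   (- n / (2 * t)) * (4 * pi * t) powr (- n / 2) * exp (- ((norm z)\<^sup>2 / (4 * t))) +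
   (((norm z)\<^sup>2 / (4 * t\<^sup>2)) * exp (- ((norm z)\<^sup>2 / (4 * t)))) * (4 * pi * t) powr (- n / 2)) (at t)"
  by (rule DERIV_mult)
 moreover have "- n / (2 * t) * P * E + (a * E) * P = (a - n / (2 * t)) * (P * E)" for P E a :: real
  by (simp add: algebra_simps)
 ultimately show ?thesis unfolding heat_def heat_dt_def n_def[symmetric] by metis
qed

lemma heat_has_derivative:
 "(heat t has_derivative (\<lambda>h. heat_grad t z \<bullet> h)) (at (z::real^'n::finite))"
proof -
 define P where "P = (4 * pi * t) powr (- real CARD('n) / 2)"
 define c where "c = - 1 / (4 * t)"
 have h: "heat t z = P * exp (c * (z \<bullet> z))" for z :: "real^'n"
  by (simp add: heat_def P_def c_def power2_norm_eq_inner)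
 have "((\<lambda>z::real^'n. exp (c * (z \<bullet> z))) has_derivative (\<lambda>h. exp (c * (z \<bullet> z)) * (c * (2 * (z \<bullet> h))))) (at z)"
  by (auto intro!: derivative_eq_intros simp: inner_commute)
 from has_derivative_mult_right[OF this, of P]
 have "((\<lambda>z::real^'n. P * exp (c * (z \<bullet> z))) has_derivative
   (\<lambda>h. P * (exp (c * (z \<bullet> z)) * (c * (2 * (z \<bullet> h)))))) (at z)" .
 moreover have "P * (exp (c * (z \<bullet> z)) * (c * (2 * (z \<bullet> h)))) = heat_grad t z \<bullet> h" for h
  unfolding heat_grad_def h by (simp add: c_def)
 moreover have "heat t = (\<lambda>z::real^'n. P * exp (c * (z \<bullet> z)))" by (rule ext) (rule h)
 ultimately show ?thesis by (simp only:)
qed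

section \<open>The space of square-integrable functions\<close>

definition sq_integrable :: "('a::euclidean_space => 'b::euclidean_space) => bool" where
 "sq_integrable f \<longleftrightarrow> f \<in> borel_measurable lebesgue \<and> integrable lebesgue (\<lambda>x. (norm (f x))\<^sup>2)"

lemma sq_integrable_measurable: "sq_integrable f ==> f \<in> borel_measurable lebesgue"
 by (simp add: sq_integrable_def)

lemma sq_integrable_0: "sq_integrable (\<lambda>x. 0)" by (simp add: sq_integrable_def)

lemma sq_integrable_scaleR: "sq_integrable f ==> sq_integrable (\<lambda>x. c *\<^sub>R f x)"
 by (auto simp: sq_integrable_def power_mult_distrib)

lemma sq_integrable_add:
 assumes f: "sq_integrable f" and g: "sq_integrable g"
 shows "sq_integrable (\<lambda>x. f x + g x)"
 unfolding sq_integrable_def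
proof
 show m: "(\<lambda>x. f x + g x) \<in> borel_measurable lebesgue"
  using f g by (auto simp: sq_integrable_def)
 show "integrable lebesgue (\<lambda>x. (norm (f x + g x))\<^sup>2)"
 proof (rule bochner_bound)
  show "integrable lebesgue (\<lambda>x. 2 * (norm (f x))\<^sup>2 + 2 * (norm (g x))\<^sup>2)"
   using f g by (simp add: sq_integrable_def)
  show "(\<lambda>x. (norm (f x + g x))\<^sup>2) \<in> borel_measurable lebesgue" using m by simp
  show "AE x in lebesgue. norm ((norm (f x + g x))\<^sup>2) <= norm (2 * (norm (f x))\<^sup>2 + 2 * (norm (g x))\<^sup>2)"
  proof (intro AE_I2)
   fix x
   have "(norm (f x + g x))\<^sup>2 <= (norm (f x) + norm (g x))\<^sup>2"
    by (intro power_mono norm_triangle_ineq norm_ge_zero)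
   also have "... <= 2 * (norm (f x))\<^sup>2 + 2 * (norm (g x))\<^sup>2"
    using sum_squares_bound[of "norm (f x)" "norm (g x)"] by (simp add: power2_sum)
   finally show "norm ((norm (f x + g x))\<^sup>2) <= norm (2 * (norm (f x))\<^sup>2 + 2 * (norm (g x))\<^sup>2)"
    by simp
  qed
 qed
qed

lemma sq_integrable_diff: "sq_integrable f ==> sq_integrable g ==> sq_integrable (\<lambda>x. f x - g x)"
 using sq_integrable_add[of f "\<lambda>x. (-1) *\<^sub>R g x"] sq_integrable_scaleR[of g "-1"] by simp

lemma sq_integrable_inner:
 assumes f: "sq_integrable f" and g: "sq_integrable g"
 shows "integrable lebesgue (\<lambda>x. f x \<bullet> g x)"
proof (rule bochner_bound)
 show "integrable lebesgue (\<lambda>x. (norm (f x))\<^sup>2 + (norm (g x))\<^sup>2)"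
  using f g by (simp add: sq_integrable_def)
 show "(\<lambda>x. f x \<bullet> g x) \<in> borel_measurable lebesgue"
  using f g by (auto simp add: sq_integrable_def)
 show "AE x in lebesgue. norm (f x \<bullet> g x) <= norm ((norm (f x))\<^sup>2 + (norm (g x))\<^sup>2)"
 proof (intro AE_I2)
  fix x
  have "\<bar>f x \<bullet> g x\<bar> <= norm (f x) * norm (g x)" by (rule Cauchy_Schwarz_ineq2)
  also have "... <= (norm (f x))\<^sup>2 + (norm (g x))\<^sup>2"
   using sum_squares_bound[of "norm (f x)" "norm (g x)"]
    mult_nonneg_nonneg[OF norm_ge_zero norm_ge_zero, of "f x" "g x"] by linarith
  finally show "norm (f x \<bullet> g x) <= norm ((norm (f x))\<^sup>2 + (norm (g x))\<^sup>2)" by simp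
 qed
qed

lemma sq_integrable_cong_AE:
 assumes "sq_integrable f" "g \<in> borel_measurable lebesgue" "AE x in lebesgue. f x = g x"
 shows "sq_integrable g"
proof -
 have "integrable lebesgue (\<lambda>x. (norm (g x))\<^sup>2)"
  by (rule integrable_cong_AE_imp[of _ "\<lambda>x. (norm (f x))\<^sup>2"])
   (use assms in \<open>auto simp: sq_integrable_def\<close>)
 then show ?thesis using assms by (simp add: sq_integrable_def)
qed

lemma sq_integrable_nn:
 assumes "f \<in> borel_measurable lebesgue" "(\<integral>\<^sup>+x. ennreal ((norm (f x))\<^sup>2) \<partial>lebesgue) < \<infinity>"
 shows "sq_integrable f"
 using assms by (auto simp: sq_integrable_def integrable_iff_bounded)

lemma nn_integral_sq_integrable:
 assumes "sq_integrable f"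
 shows "(\<integral>\<^sup>+x. ennreal ((norm (f x))\<^sup>2) \<partial>lebesgue) = ennreal (LINT x|lebesgue. (norm (f x))\<^sup>2)"
 using assms by (intro nn_integral_eq_integral) (auto simp: sq_integrable_def)

text \<open>
 A subsequence whose differences decay geometrically has almost everywhere summable
 increments; its pointwise limit is the limit of the whole sequence by Fatou's lemma.
\<close>

theorem riesz_fischer:
 fixes f :: "nat => 'a::euclidean_space => 'b::euclidean_space"
 assumes f: "\<And>n. sq_integrable (f n)"
  and cauchy: "\<And>\<epsilon>. \<epsilon> > 0 ==> \<exists>N. \<forall>m\<ge>N. \<forall>n\<ge>N. (LINT x|lebesgue. (norm (f m x - f n x))\<^sup>2) < \<epsilon>"
 obtains F r where "sq_integrable F" "strict_mono r" "AE x in lebesgue. (\<lambda>n. f (r n) x) ----> F x"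
  and "(\<lambda>n. LINT x|lebesgue. (norm (f n x - F x))\<^sup>2) ----> 0"
proof -
 let ?I = "\<lambda>m n. LINT x|lebesgue. (norm (f m x - f n x))\<^sup>2"
 have "\<exists>N. \<forall>m\<ge>N. \<forall>n\<ge>N. ?I m n < (1/4)^k" for k :: nat using cauchy[of "(1/4)^k"] by simp
 then obtain M where M: "\<And>k m n. m >= M k ==> n >= M k ==> ?I m n < (1/4)^k" by metis
 define r where "r k = (\<Sum>i\<le>k. M i) + k" for k
 have r: "strict_mono r" unfolding strict_mono_Suc_iff r_def by simp
 have rM: "r k >= M k" for k unfolding r_def by (simp add: trans_le_add1 member_le_sum)
 have fm: "f n \<in> borel_measurable lebesgue" for n using f by (simp add: sq_integrable_def)
 define d where "d k x = norm (f (r (Suc k)) x - f (r k) x)" for k x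
 have dm: "d k \<in> borel_measurable lebesgue" for k unfolding d_def using fm by measurable
 have dI: "(\<integral>\<^sup>+x. ennreal ((d k x)\<^sup>2) \<partial>lebesgue) <= ennreal ((1/4)^k)" for k
 proof -
  have "(\<integral>\<^sup>+x. ennreal ((d k x)\<^sup>2) \<partial>lebesgue) = ennreal (?I (r (Suc k)) (r k))"
   unfolding d_def by (intro nn_integral_sq_integrable sq_integrable_diff f)
  also have "... <= ennreal ((1/4)^k)"
   using M[of k "r (Suc k)" "r k"] rM r by (intro ennreal_leI less_imp_le)
    (meson order_trans strict_mono_less_eq le_SucI order_refl)
  finally show ?thesis .
 qed
 (* weights 2^k turn geometric decay of the squares into summability of the differences *)
 have "(\<integral>\<^sup>+x. (\<Sum>k. ennreal (2^k * (d k x)\<^sup>2)) \<partial>lebesgue) = (\<Sum>k. \<integral>\<^sup>+x. ennreal (2^k * (d k x)\<^sup>2) \<partial>lebesgue)"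
  using dm by (intro nn_integral_suminf) measurable
 also have "... <= (\<Sum>k. ennreal ((1/2)^k))"
 proof (intro suminf_le)
  fix k
  have "(\<integral>\<^sup>+x. ennreal (2^k * (d k x)\<^sup>2) \<partial>lebesgue) = ennreal (2^k) * (\<integral>\<^sup>+x. ennreal ((d k x)\<^sup>2) \<partial>lebesgue)"
   using dm by (subst nn_integral_cmult[symmetric]) (auto simp: ennreal_mult)
  also have "... <= ennreal (2^k) * ennreal ((1/4)^k)" by (intro mult_left_mono dI) auto
  also have "... = ennreal ((1/2)^k)"
   by (subst ennreal_mult[symmetric]) (auto simp: power_mult_distrib[symmetric])
  finally show "(\<integral>\<^sup>+x. ennreal (2^k * (d k x)\<^sup>2) \<partial>lebesgue) <= ennreal ((1/2)^k)" .
 qed auto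
 also have "... = ennreal (\<Sum>k. (1/2)^k)" by (intro suminf_ennreal2) auto
 also have "... < \<infinity>" by simp
 finally have fin: "(\<integral>\<^sup>+x. (\<Sum>k. ennreal (2^k * (d k x)\<^sup>2)) \<partial>lebesgue) < \<infinity>" .
 have "AE x in lebesgue. (\<Sum>k. ennreal (2^k * (d k x)\<^sup>2)) \<noteq> \<infinity>"
  using fin dm by (intro nn_integral_PInf_AE) auto
 then have conv: "AE x in lebesgue. convergent (\<lambda>n. f (r n) x)"
 proof eventually_elim
  case (elim x)
  have s: "summable (\<lambda>k. 2^k * (d k x)\<^sup>2)"
   using elim by (intro summable_suminf_not_top) (auto simp: d_def)
  have "summable (\<lambda>k. d k x)"
  proof (rule summable_comparison_test')
   show "summable (\<lambda>k. 2^k * (d k x)\<^sup>2 + (1/2)^k)" using s by (intro summable_add) auto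
   fix k
   have "2 * (2^k * d k x) * 1 <= (2^k * d k x)\<^sup>2 + 1\<^sup>2" by (rule sum_squares_bound)
   moreover have "0 <= 2^k * d k x" by (simp add: d_def)
   ultimately have "2^k * d k x <= (2^k * d k x)\<^sup>2 + 1" by simp
   then have "(2^k * d k x) / 2^k <= ((2^k * d k x)\<^sup>2 + 1) / 2^k" by (intro divide_right_mono) auto
   also have "... = 2^k * (d k x)\<^sup>2 + (1/2)^k"
    by (simp add: power2_eq_square field_simps)
   finally show "norm (d k x) <= 2^k * (d k x)\<^sup>2 + (1/2)^k" by (simp add: d_def)
  qed
  then have "summable (\<lambda>k. norm (f (r (Suc k)) x - f (r k) x))" unfolding d_def .
  then have "summable (\<lambda>k. f (r (Suc k)) x - f (r k) x)" by (rule summable_norm_cancel)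
  then have "convergent (\<lambda>n. \<Sum>k<n. f (r (Suc k)) x - f (r k) x)" by (simp add: summable_iff_convergent)
  then have "convergent (\<lambda>n. f (r n) x - f (r 0) x)" 
   by (simp add: sum_lessThan_telescope[of "\<lambda>n. f (r n) x"])
  then have "convergent (\<lambda>n. (f (r n) x - f (r 0) x) + f (r 0) x)" by (rule convergent_add[OF _ convergent_const])
  then show ?case by simp
 qed
 define F where "F x = lim (\<lambda>n. f (r n) x)" for x
 have lim: "AE x in lebesgue. (\<lambda>n. f (r n) x) ----> F x"
  using conv by eventually_elim (simp add: F_def convergent_LIMSEQ_iff)
 have Fm: "F \<in> borel_measurable lebesgue"
  unfolding F_def using fm by (intro borel_measurable_lim_metric)
 (* Fatou's lemma along the subsequence *)
 have fatou: "(\<integral>\<^sup>+x. ennreal ((norm (f n x - F x))\<^sup>2) \<partial>lebesgue) <= ennreal \<epsilon>"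
  if N: "\<forall>m\<ge>N. \<forall>n\<ge>N. ?I m n < \<epsilon>" and n: "n >= N" for N n \<epsilon>
 proof -
  have "(\<integral>\<^sup>+x. ennreal ((norm (f n x - F x))\<^sup>2) \<partial>lebesgue)
    = (\<integral>\<^sup>+x. liminf (\<lambda>k. ennreal ((norm (f n x - f (r k) x))\<^sup>2)) \<partial>lebesgue)"
  proof (rule nn_integral_cong_AE)
   show "AE x in lebesgue. ennreal ((norm (f n x - F x))\<^sup>2) = liminf (\<lambda>k. ennreal ((norm (f n x - f (r k) x))\<^sup>2))"
    using lim
   proof eventually_elim
    case (elim x)
    have "(\<lambda>k. ennreal ((norm (f n x - f (r k) x))\<^sup>2)) ----> ennreal ((norm (f n x - F x))\<^sup>2)"
     using elim by (intro tendsto_intros tendsto_ennrealI)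
    then show ?case by (intro lim_imp_Liminf[symmetric]) auto
   qed
  qed
  also have "... <= liminf (\<lambda>k. \<integral>\<^sup>+x. ennreal ((norm (f n x - f (r k) x))\<^sup>2) \<partial>lebesgue)"
   using fm by (intro nn_integral_liminf) measurable
  also have "... <= limsup (\<lambda>k. \<integral>\<^sup>+x. ennreal ((norm (f n x - f (r k) x))\<^sup>2) \<partial>lebesgue)"
   by (intro Liminf_le_Limsup) auto
  also have "... <= ennreal \<epsilon>"
  proof (rule Limsup_bounded)
   show "\<forall>\<^sub>F k in sequentially. (\<integral>\<^sup>+x. ennreal ((norm (f n x - f (r k) x))\<^sup>2) \<partial>lebesgue) <= ennreal \<epsilon>"
    using eventually_ge_at_top[of N]
   proof eventually_elim
    case (elim k)
    have "r k >= N" using elim seq_suble[OF r, of k] by simp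
    then have "?I n (r k) < \<epsilon>" using N n by blast
    then show ?case
     by (subst nn_integral_sq_integrable) (auto intro!: sq_integrable_diff f ennreal_leI)
   qed
  qed
  finally show ?thesis .
 qed
 obtain N1 where N1: "\<forall>m\<ge>N1. \<forall>n\<ge>N1. ?I m n < 1" using cauchy[of 1] by auto
 have "sq_integrable (\<lambda>x. f N1 x - F x)"
  using fatou[OF N1 order_refl] fm Fm by (intro sq_integrable_nn) (auto simp: le_less_trans)
 from sq_integrable_diff[OF f[of N1] this] have F: "sq_integrable F" by simp
 have "(\<lambda>n. LINT x|lebesgue. (norm (f n x - F x))\<^sup>2) ----> 0"
 proof (rule LIMSEQ_I)
  fix e :: real assume e: "e > 0"
  obtain N where N: "\<forall>m\<ge>N. \<forall>n\<ge>N. ?I m n < e / 2" using cauchy[of "e/2"] e by auto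
  have "norm ((LINT x|lebesgue. (norm (f n x - F x))\<^sup>2) - 0) < e" if "n >= N" for n
  proof -
   have "ennreal (LINT x|lebesgue. (norm (f n x - F x))\<^sup>2) <= ennreal (e / 2)"
    using fatou[OF N that] by (subst (asm) nn_integral_sq_integrable) (auto intro: sq_integrable_diff f F)
   then have "(LINT x|lebesgue. (norm (f n x - F x))\<^sup>2) <= e / 2" using e by (simp add: ennreal_le_iff)
   then show ?thesis using e by (simp add: integral_nonneg_AE)
  qed
  then show "\<exists>no. \<forall>n\<ge>no. norm ((LINT x|lebesgue. (norm (f n x - F x))\<^sup>2) - 0) < e" by blast
 qed
 with that F r lim show ?thesis by blast
qed

quotient_type (overloaded) ('a, 'b) L2 = "'a::euclidean_space => 'b::euclidean_space" /
 partial: "\<lambda>f g. sq_integrable f \<and> sq_integrable g \<and> (AE x in lebesgue. f x = g x)"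
proof (rule part_equivpI)
 show "\<exists>f :: 'a => 'b. sq_integrable f \<and> sq_integrable f \<and> (AE x in lebesgue. f x = f x)"
  using sq_integrable_0 by blast
 show "symp (\<lambda>f g :: 'a => 'b. sq_integrable f \<and> sq_integrable g \<and> (AE x in lebesgue. f x = g x))"
  by (auto simp: symp_def eq_commute)
 show "transp (\<lambda>f g :: 'a => 'b. sq_integrable f \<and> sq_integrable g \<and> (AE x in lebesgue. f x = g x))"
  unfolding transp_def by (auto elim: AE_mp)
qed

instantiation L2 :: (euclidean_space, euclidean_space) real_inner
begin

lift_definition zero_L2 :: "('a, 'b) L2" is "\<lambda>x. 0" by (simp add: sq_integrable_0)
lift_definition plus_L2 :: "('a, 'b) L2 => ('a, 'b) L2 => ('a, 'b) L2" is "\<lambda>f g x. f x + g x"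
 by (auto intro: sq_integrable_add)
lift_definition minus_L2 :: "('a, 'b) L2 => ('a, 'b) L2 => ('a, 'b) L2" is "\<lambda>f g x. f x - g x"
 by (auto intro: sq_integrable_diff)
lift_definition uminus_L2 :: "('a, 'b) L2 => ('a, 'b) L2" is "\<lambda>f x. - f x"
 using sq_integrable_scaleR[of _ "-1"] by (auto)
lift_definition scaleR_L2 :: "real => ('a, 'b) L2 => ('a, 'b) L2" is "\<lambda>c f x. c *\<^sub>R f x"
 by (auto intro: sq_integrable_scaleR)
lift_definition inner_L2 :: "('a, 'b) L2 => ('a, 'b) L2 => real" is "\<lambda>f g. LINT x|lebesgue. f x \<bullet> g x"
 by (rule integral_cong_AE) (auto simp: sq_integrable_def)
definition norm_L2 :: "('a, 'b) L2 => real" where "norm_L2 f = sqrt (f \<bullet> f)"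
definition dist_L2 :: "('a, 'b) L2 => ('a, 'b) L2 => real" where "dist_L2 f g = norm (f - g)"
definition sgn_L2 :: "('a, 'b) L2 => ('a, 'b) L2" where "sgn_L2 f = inverse (norm f) *\<^sub>R f"
definition uniformity_L2 :: "(('a, 'b) L2 \<times> ('a, 'b) L2) filter" where
 "uniformity_L2 = (INF e\<in>{0 <..}. principal {(f, g). dist f g < e})"
definition open_L2 :: "('a, 'b) L2 set => bool" where
 "open_L2 U = (\<forall>f\<in>U. eventually (\<lambda>(f', g). f' = f --> g \<in> U) uniformity)"

instance
proof
 fix f g h :: "('a, 'b) L2" and a b :: real
 show "f + g + h = f + (g + h)" by transfer (auto simp: add.assoc intro!: sq_integrable_add)
 show "f + g = g + f" by transfer (auto simp: add.commute intro!: sq_integrable_add)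
 show "0 + f = f" by transfer simp
 show "- f + f = 0" by transfer (simp add: sq_integrable_0)
 show "f - g = f + - g"
  by transfer (auto intro!: sq_integrable_add sq_integrable_diff)
 show "a *\<^sub>R (f + g) = a *\<^sub>R f + a *\<^sub>R g"
  by transfer (auto simp: scaleR_add_right intro!: sq_integrable_add sq_integrable_scaleR)
 show "(a + b) *\<^sub>R f = a *\<^sub>R f + b *\<^sub>R f"
  by transfer (auto simp: scaleR_add_left intro!: sq_integrable_add sq_integrable_scaleR)
 show "a *\<^sub>R b *\<^sub>R f = (a * b) *\<^sub>R f" by transfer (auto intro!: sq_integrable_scaleR)
 show "1 *\<^sub>R f = f" by transfer simp
 show "dist f g = norm (f - g)" by (simp add: dist_L2_def)
 show "sgn f = inverse (norm f) *\<^sub>R f" by (simp add: sgn_L2_def)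
 show "norm f = sqrt (f \<bullet> f)" by (simp add: norm_L2_def)
 show "uniformity = (INF e\<in>{0 <..}. principal {(f, g :: ('a, 'b) L2). dist f g < e})"
  by (simp add: uniformity_L2_def)
 show "open U = (\<forall>f\<in>U. \<forall>\<^sub>F (f', g) in uniformity. f' = f --> g \<in> U)" for U :: "('a, 'b) L2 set"
  by (simp add: open_L2_def)
 show "f \<bullet> g = g \<bullet> f" by transfer (simp add: inner_commute)
 show "(f + g) \<bullet> h = f \<bullet> h + g \<bullet> h"
  by transfer (simp add: inner_add_left sq_integrable_inner)
 show "(a *\<^sub>R f) \<bullet> g = a * (f \<bullet> g)" by transfer simp
 show "0 <= f \<bullet> f" by transfer simp
 show "(f \<bullet> f = 0) = (f = 0)"
 proof transfer
  fix f :: "'a => 'b"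
  assume "sq_integrable f \<and> sq_integrable f \<and> (AE x in lebesgue. f x = f x)"
  then have f: "sq_integrable f" by simp
  have "((LINT x|lebesgue. f x \<bullet> f x) = 0) = (AE x in lebesgue. f x \<bullet> f x = 0)"
   using sq_integrable_inner[OF f f] by (intro integral_nonneg_eq_0_iff_AE) auto
  then show "((LINT x|lebesgue. f x \<bullet> f x) = 0) =
   (sq_integrable f \<and> sq_integrable (\<lambda>x. 0 :: 'b) \<and> (AE x in lebesgue. f x = 0))"
   using f by (simp add: sq_integrable_0)
 qed
qed

end

lemma rep_L2_sq_integrable: "sq_integrable (rep_L2 X)"
 using Quotient3_rep_reflp[OF Quotient3_L2, of X] by simp

lemma abs_rep_L2: "abs_L2 (rep_L2 X) = X"
 by (rule Quotient3_abs_rep[OF Quotient3_L2])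

lemma abs_L2_eq_iff:
 assumes "sq_integrable f" "sq_integrable g"
 shows "abs_L2 f = abs_L2 g \<longleftrightarrow> (AE x in lebesgue. f x = g x)"
 using Quotient3_rel[OF Quotient3_L2, of f g] assms by auto

lemma rep_abs_L2: "sq_integrable f ==> AE x in lebesgue. rep_L2 (abs_L2 f) x = f x"
 using abs_L2_eq_iff[OF rep_L2_sq_integrable, of f "abs_L2 f"] abs_rep_L2 by blast

lemma inner_abs_L2:
 assumes "sq_integrable f" "sq_integrable g"
 shows "abs_L2 f \<bullet> abs_L2 g = (LINT x|lebesgue. f x \<bullet> g x)"
 using assms by (intro inner_L2.abs_eq) auto

lemma norm_abs_L2: "sq_integrable f ==> (norm (abs_L2 f))\<^sup>2 = (LINT x|lebesgue. (norm (f x))\<^sup>2)"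
 by (simp add: power2_norm_eq_inner inner_abs_L2)

lemma sq_integrable_cauchy_schwarz:
 assumes f: "sq_integrable f" and g: "sq_integrable g"
 shows "\<bar>LINT x|lebesgue. f x \<bullet> g x\<bar> <=
  sqrt (LINT x|lebesgue. (norm (f x))\<^sup>2) * sqrt (LINT x|lebesgue. (norm (g x))\<^sup>2)"
 using Cauchy_Schwarz_ineq2[of "abs_L2 f" "abs_L2 g"] assms
 by (simp add: inner_abs_L2 norm_eq_sqrt_inner power2_norm_eq_inner)

lemma abs_L2_add: "sq_integrable f ==> sq_integrable g ==> abs_L2 f + abs_L2 g = abs_L2 (\<lambda>x. f x + g x)"
 by (intro plus_L2.abs_eq) auto

lemma abs_L2_diff: "sq_integrable f ==> sq_integrable g ==> abs_L2 f - abs_L2 g = abs_L2 (\<lambda>x. f x - g x)"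
 by (intro minus_L2.abs_eq) auto

lemma abs_L2_scaleR: "sq_integrable f ==> c *\<^sub>R abs_L2 f = abs_L2 (\<lambda>x. c *\<^sub>R f x)"
 by (intro scaleR_L2.abs_eq) auto

lemma norm_abs_L2_diff:
 assumes "sq_integrable f" "sq_integrable g"
 shows "(norm (abs_L2 f - abs_L2 g))\<^sup>2 = (LINT x|lebesgue. (norm (f x - g x))\<^sup>2)"
 using norm_abs_L2[OF sq_integrable_diff[OF assms]] by (simp add: abs_L2_diff assms)

lemma tendsto_abs_L2:
 assumes "\<And>n. sq_integrable (f n)" "sq_integrable F" "(\<lambda>n. LINT x|lebesgue. (norm (f n x - F x))\<^sup>2) ----> 0"
 shows "(\<lambda>n. abs_L2 (f n)) ----> abs_L2 F"
proof -
 have "(\<lambda>n. (norm (abs_L2 (f n) - abs_L2 F))\<^sup>2) ----> 0"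
  using assms(3) unfolding norm_abs_L2_diff[OF assms(1,2)] .
 from tendsto_real_sqrt[OF this] have "(\<lambda>n. norm (abs_L2 (f n) - abs_L2 F)) ----> 0" by simp
 then show ?thesis by (rule LIM_zero_cancel[OF tendsto_norm_zero_cancel])
qed

instance L2 :: (euclidean_space, euclidean_space) complete_space
proof
 fix X :: "nat => ('a, 'b) L2" assume X: "Cauchy X"
 have d: "(LINT x|lebesgue. (norm (rep_L2 (X m) x - rep_L2 (X n) x))\<^sup>2) = (dist (X m) (X n))\<^sup>2" for m n
  using norm_abs_L2[OF sq_integrable_diff[OF rep_L2_sq_integrable rep_L2_sq_integrable], of "X m" "X n"]
  by (simp add: abs_L2_diff[symmetric] rep_L2_sq_integrable abs_rep_L2 dist_norm)
 have c: "\<exists>N. \<forall>m\<ge>N. \<forall>n\<ge>N. (LINT x|lebesgue. (norm (rep_L2 (X m) x - rep_L2 (X n) x))\<^sup>2) < e"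
  if e: "e > 0" for e
 proof -
  obtain N where "\<forall>m\<ge>N. \<forall>n\<ge>N. dist (X m) (X n) < sqrt e"
   using X e unfolding Cauchy_def by (meson real_sqrt_gt_zero)
  then show ?thesis unfolding d using e
   by (metis abs_of_nonneg less_eq_real_def real_less_lsqrt real_sqrt_abs real_sqrt_less_iff zero_le_dist)
 qed
 from riesz_fischer[OF rep_L2_sq_integrable c] obtain F where F: "sq_integrable F"
  "(\<lambda>n. LINT x|lebesgue. (norm (rep_L2 (X n) x - F x))\<^sup>2) ----> 0" by blast
 have "(LINT x|lebesgue. (norm (rep_L2 (X n) x - F x))\<^sup>2) = (norm (X n - abs_L2 F))\<^sup>2" for n
  using norm_abs_L2[OF sq_integrable_diff[OF rep_L2_sq_integrable F(1)], of "X n"]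
  by (simp add: abs_L2_diff[symmetric] rep_L2_sq_integrable abs_rep_L2 F(1))
 with F(2) have "(\<lambda>n. (norm (X n - abs_L2 F))\<^sup>2) ----> 0" by simp
 then have "(\<lambda>n. norm (X n - abs_L2 F)) ----> 0" using tendsto_real_sqrt by fastforce
 then have "X ----> abs_L2 F" by (rule LIM_zero_cancel[OF tendsto_norm_zero_cancel])
 then show "convergent X" by (auto simp: convergent_def)
qed


section \<open>Variational inequalities\<close>

text \<open>
 The parallelogram law makes a minimising sequence of \<open>\<parallel>v\<parallel>\<^sup>2 / 2 - l v\<close> a Cauchy sequence;
 the linear bound on \<open>l\<close> keeps the infimum finite. The inequality is the first-order
 condition at the minimiser.
\<close>

lemma minimizer_variational_inequality:
 fixes K :: "'h::{real_inner, complete_space} set"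
 assumes K: "K \<noteq> {}" "closed K" "convex K"
  and affine: "\<And>v w t. v \<in> K ==> w \<in> K ==> 0 <= t ==> t <= 1 ==>
   l ((1 - t) *\<^sub>R v + t *\<^sub>R w) = (1 - t) * l v + t * l w"
  and cont: "continuous_on K l"
  and bound: "\<And>v. v \<in> K ==> l v <= C1 + C2 * norm v"
 shows "\<exists>u\<in>K. \<forall>w\<in>K. l w - l u <= u \<bullet> (w - u)"
proof -
 define J where "J v = (v \<bullet> v) / 2 - l v" for v
 have Jb: "- C1 - C2\<^sup>2 / 2 <= J v" if "v \<in> K" for v
 proof -
  have "2 * C2 * norm v <= C2\<^sup>2 + (norm v)\<^sup>2" by (rule sum_squares_bound)
  then show ?thesis using bound[OF that] by (simp add: J_def power2_norm_eq_inner)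
 qed
 define m where "m = Inf (J ` K)"
 have bdd: "bdd_below (J ` K)" using Jb by (intro bdd_belowI2) auto
 have mle: "m <= J v" if "v \<in> K" for v unfolding m_def using that bdd by (intro cInf_lower) auto
 have "\<exists>v\<in>K. J v < m + 1 / real (Suc n)" for n
 proof -
  have "Inf (J ` K) < m + 1 / real (Suc n)" by (simp add: m_def)
  then show ?thesis using cInf_lessD[of "J ` K" "m + 1 / real (Suc n)"] K(1) by auto
 qed
 then obtain v where vK: "\<And>n. v n \<in> K" and Jv: "\<And>n. J (v n) < m + 1 / real (Suc n)" by metis
 have avg: "(norm (a - b))\<^sup>2 <= 4 * ((J a - m) + (J b - m))" if "a \<in> K" "b \<in> K" for a b
 proof -
  let ?c = "(1 - 1/2) *\<^sub>R a + (1/2) *\<^sub>R b"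
  have "?c \<in> K" using K(3) that by (intro convexD) auto
  then have "m <= J ?c" by (rule mle)
  moreover have "l ?c = (1 - 1/2) * l a + (1/2) * l b" using that by (intro affine) auto
  ultimately show ?thesis
   unfolding J_def power2_norm_eq_inner
   by (simp add: inner_simps inner_commute algebra_simps)
 qed
 have "Cauchy v"
 proof (rule metric_CauchyI)
  fix e :: real assume e: "e > 0"
  obtain N where N: "8 / e\<^sup>2 < real (Suc N)"
   by (meson lessI less_trans of_nat_less_iff reals_Archimedean2)
  have "dist (v i) (v j) < e" if ij: "i >= N" "j >= N" for i j
  proof -
   have le: "1 / real (Suc k) <= 1 / real (Suc N)" if "k >= N" for k
    using that by (intro divide_left_mono) auto
   have "(norm (v i - v j))\<^sup>2 <= 4 * ((J (v i) - m) + (J (v j) - m))" by (intro avg vK)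
   also have "... < 8 * (1 / real (Suc N))"
   proof -
    have "J (v k) < m + 1 / real (Suc N)" if "k >= N" for k
     using less_le_trans[OF Jv add_left_mono[OF le[OF that]]] .
    from this[OF ij(1)] this[OF ij(2)] show ?thesis by argo
   qed
   also have "... < e\<^sup>2" using N e by (simp add: field_simps del: of_nat_Suc)
   finally show ?thesis using e by (simp add: dist_norm power_less_imp_less_base)
  qed
  then show "\<exists>M. \<forall>i\<ge>M. \<forall>j\<ge>M. dist (v i) (v j) < e" by blast
 qed
 then obtain u where u: "v ----> u" using Cauchy_convergent convergent_def by blast
 have uK: "u \<in> K" using K(2) vK u closed_sequentially by blast
 have "(\<lambda>n. l (v n)) ----> l u"
  using cont uK u vK by (auto simp: continuous_on_sequentially o_def)
 then have "(\<lambda>n. J (v n)) ----> J u" unfolding J_def by (intro tendsto_intros u) auto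
 moreover have "(\<lambda>n. m + 1 / real (Suc n)) ----> m + 0"
  by (intro tendsto_add tendsto_const LIMSEQ_Suc[OF lim_1_over_n])
 ultimately have Ju: "J u <= m"
  using Jv by (intro LIMSEQ_le[of "\<lambda>n. J (v n)" "J u" "\<lambda>n. m + 1 / real (Suc n)" m]) (auto intro: less_imp_le)
 have "l w - l u <= u \<bullet> (w - u)" if w: "w \<in> K" for w
 proof (rule ccontr)
  assume neg: "\<not> l w - l u <= u \<bullet> (w - u)"
  define \<delta> where "\<delta> = l w - l u - u \<bullet> (w - u)"
  define Q where "Q = (w - u) \<bullet> (w - u)"
  have \<delta>: "\<delta> > 0" using neg by (simp add: \<delta>_def)
  have Q: "Q >= 0" by (simp add: Q_def)
  define t where "t = min 1 (\<delta> / (Q + 1))"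
  have t: "0 < t" "t <= 1" using \<delta> Q by (auto simp: t_def)
  have "(1 - t) *\<^sub>R u + t *\<^sub>R w \<in> K" using K(3) uK w t by (intro convexD) auto
  then have "J u <= J ((1 - t) *\<^sub>R u + t *\<^sub>R w)" using mle Ju by fastforce
  moreover have "(1 - t) *\<^sub>R u + t *\<^sub>R w = u + t *\<^sub>R (w - u)" by (simp add: algebra_simps)
  moreover have "l ((1 - t) *\<^sub>R u + t *\<^sub>R w) = (1 - t) * l u + t * l w"
   using t by (intro affine uK w) auto
  moreover have "(u + t *\<^sub>R (w - u)) \<bullet> (u + t *\<^sub>R (w - u)) = u \<bullet> u + 2 * t * (u \<bullet> (w - u)) + t * t * Q"
   unfolding Q_def by (simp add: inner_add_left inner_add_right inner_commute algebra_simps)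
  ultimately have "0 <= t * (u \<bullet> (w - u)) + t * t * Q / 2 - t * (l w - l u)"
   unfolding J_def by (simp add: algebra_simps)
  also have "... = t * (t * Q / 2 - \<delta>)" by (simp add: \<delta>_def algebra_simps)
  finally have 1: "\<delta> <= t * Q / 2" using t by (simp add: zero_le_mult_iff)
  have "t * Q <= \<delta> / (Q + 1) * Q" using Q by (intro mult_right_mono) (auto simp: t_def)
  also have "... <= \<delta>" using Q \<delta> by (simp add: field_simps)
  finally have "t * Q <= \<delta>" .
  with 1 show False using \<delta> by simp
 qed
 then show ?thesis using uK by blast
qed

text \<open>
 For small \<open>\<rho>\<close> the map \<open>z \<mapsto> z - \<rho> A z\<close> is a strict contraction, and solving the symmetric
 problem with this datum is nonexpansive. The fixed point of the composition solves the
 problem for \<open>A\<close>.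
\<close>

theorem stampacchia:
 fixes K :: "'h::{real_inner, complete_space} set" and A :: "'h => 'h"
 assumes K: "K \<noteq> {}" "closed K" "convex K"
  and A: "linear A" "\<And>x. norm (A x) <= M * norm x" "\<And>x. m * (norm x)\<^sup>2 <= A x \<bullet> x"
  and m: "0 < m" "m <= M"
  and affine: "\<And>v w t. v \<in> K ==> w \<in> K ==> 0 <= t ==> t <= 1 ==>
   l ((1 - t) *\<^sub>R v + t *\<^sub>R w) = (1 - t) * l v + t * l w"
  and cont: "continuous_on K l"
  and bound: "\<And>v. v \<in> K ==> l v <= C1 + C2 * norm v"
 shows "\<exists>u\<in>K. \<forall>w\<in>K. l w - l u <= A u \<bullet> (w - u)"
proof -
 define \<rho> where "\<rho> = m / M\<^sup>2"
 define c where "c = sqrt (1 - m\<^sup>2 / M\<^sup>2)"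
 have M: "M > 0" using m by simp
 have \<rho>: "\<rho> > 0" using m M by (simp add: \<rho>_def)
 have "m\<^sup>2 <= M\<^sup>2" using m by (intro power_mono) auto
 then have "m\<^sup>2 / M\<^sup>2 <= 1" "0 < m\<^sup>2 / M\<^sup>2" using m M by (simp_all add: divide_le_eq_1)
 then have c: "0 <= c" "c < 1" unfolding c_def by simp_all
 (* the contraction constant is the norm of the identity minus rho A *)
 have step: "norm (d - \<rho> *\<^sub>R A d) <= c * norm d" for d
 proof -
  have "(norm (d - \<rho> *\<^sub>R A d))\<^sup>2 = (norm d)\<^sup>2 - 2 * \<rho> * (A d \<bullet> d) + \<rho>\<^sup>2 * (norm (A d))\<^sup>2"
   unfolding power2_norm_eq_inner
   by (simp add: inner_diff_left inner_diff_right inner_commute[of d "A d"] power2_eq_square right_diff_distrib)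
  also have "... <= (norm d)\<^sup>2 - 2 * \<rho> * (m * (norm d)\<^sup>2) + \<rho>\<^sup>2 * (M * norm d)\<^sup>2"
  proof -
   have "2 * \<rho> * (m * (norm d)\<^sup>2) <= 2 * \<rho> * (A d \<bullet> d)" using \<rho> A(3)[of d] by simp
   moreover have "\<rho>\<^sup>2 * (norm (A d))\<^sup>2 <= \<rho>\<^sup>2 * (M * norm d)\<^sup>2"
    using A(2)[of d] by (intro mult_left_mono power_mono) auto
   ultimately show ?thesis by linarith
  qed
  also have "... = (1 - m\<^sup>2 / M\<^sup>2) * (norm d)\<^sup>2"
  proof -
   have "\<rho> * M\<^sup>2 = m" "m\<^sup>2 / M\<^sup>2 = \<rho> * m" using M by (auto simp: \<rho>_def power2_eq_square)
   then have "\<rho>\<^sup>2 * (M * norm d)\<^sup>2 = (\<rho> * m) * (norm d)\<^sup>2"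
    by (simp add: power_mult_distrib power2_eq_square[of \<rho>])
   with \<open>m\<^sup>2 / M\<^sup>2 = \<rho> * m\<close> show ?thesis by (simp add: algebra_simps)
  qed
  also have "... = (c * norm d)\<^sup>2"
   using \<open>m\<^sup>2 / M\<^sup>2 <= 1\<close> by (simp only: c_def power_mult_distrib real_sqrt_pow2 diff_ge_0_iff_ge)
  finally show ?thesis by (rule power2_le_imp_le) (use c in simp)
 qed
 have "\<exists>u\<in>K. \<forall>w\<in>K. ((z - \<rho> *\<^sub>R A z) \<bullet> w + \<rho> * l w) - ((z - \<rho> *\<^sub>R A z) \<bullet> u + \<rho> * l u) <= u \<bullet> (w - u)" for z
 proof (rule minimizer_variational_inequality[OF K])
  show "(z - \<rho> *\<^sub>R A z) \<bullet> v + \<rho> * l v <= \<rho> * C1 + (norm (z - \<rho> *\<^sub>R A z) + \<rho> * C2) * norm v"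
   if "v \<in> K" for v
  proof -
   have "\<rho> * l v <= \<rho> * (C1 + C2 * norm v)" using bound[OF that] \<rho> by simp
   then show ?thesis using norm_cauchy_schwarz[of "z - \<rho> *\<^sub>R A z" v] by (simp add: algebra_simps)
  qed
  show "continuous_on K (\<lambda>w. (z - \<rho> *\<^sub>R A z) \<bullet> w + \<rho> * l w)" by (intro continuous_intros cont)
  show "(z - \<rho> *\<^sub>R A z) \<bullet> ((1 - t) *\<^sub>R v + t *\<^sub>R w) + \<rho> * l ((1 - t) *\<^sub>R v + t *\<^sub>R w) =
    (1 - t) * ((z - \<rho> *\<^sub>R A z) \<bullet> v + \<rho> * l v) + t * ((z - \<rho> *\<^sub>R A z) \<bullet> w + \<rho> * l w)"
   if "v \<in> K" "w \<in> K" "0 <= t" "t <= 1" for v w t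
   unfolding affine[OF that] by (simp add: inner_add_right algebra_simps)
 qed
 then have "\<exists>T. \<forall>z. T z \<in> K \<and> (\<forall>w\<in>K.
   ((z - \<rho> *\<^sub>R A z) \<bullet> w + \<rho> * l w) - ((z - \<rho> *\<^sub>R A z) \<bullet> T z + \<rho> * l (T z)) <= T z \<bullet> (w - T z))"
  unfolding Bex_def by (intro choice allI)
 then obtain T where T': "\<forall>z. T z \<in> K \<and> (\<forall>w\<in>K.
   ((z - \<rho> *\<^sub>R A z) \<bullet> w + \<rho> * l w) - ((z - \<rho> *\<^sub>R A z) \<bullet> T z + \<rho> * l (T z)) <= T z \<bullet> (w - T z))"
  by (elim exE)
 have TK: "T z \<in> K" for z using T' by simp
 have T: "((z - \<rho> *\<^sub>R A z) \<bullet> w + \<rho> * l w) - ((z - \<rho> *\<^sub>R A z) \<bullet> T z + \<rho> * l (T z)) <= T z \<bullet> (w - T z)"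
  if "w \<in> K" for z w using T' that by simp
 have add: "(norm (a - b))\<^sup>2 <= (R - S) \<bullet> (a - b)"
  if "(R \<bullet> b + y) - (R \<bullet> a + x) <= a \<bullet> (b - a)" "(S \<bullet> a + x) - (S \<bullet> b + y) <= b \<bullet> (a - b)"
  for a b R S :: 'h and x y :: real
  using that by (simp add: power2_norm_eq_inner inner_diff_left inner_diff_right inner_commute[of b a])
 have contr: "dist (T y) (T z) <= c * dist y z" for y z
 proof -
  have "(norm (T y - T z))\<^sup>2 <= ((y - z) - \<rho> *\<^sub>R A (y - z)) \<bullet> (T y - T z)"
  proof -
   have eq: "(y - z) - \<rho> *\<^sub>R A (y - z) = (y - \<rho> *\<^sub>R A y) - (z - \<rho> *\<^sub>R A z)"
    by (simp add: linear_diff[OF A(1)] scaleR_diff_right)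
   show ?thesis unfolding eq by (rule add[OF T[OF TK, of y z] T[OF TK, of z y]])
  qed
  also have "... <= norm ((y - z) - \<rho> *\<^sub>R A (y - z)) * norm (T y - T z)" by (rule norm_cauchy_schwarz)
  also have "... <= (c * norm (y - z)) * norm (T y - T z)" by (intro mult_right_mono step) auto
  finally show ?thesis
   by (cases "T y = T z") (use c in \<open>auto simp: dist_norm power2_eq_square\<close>)
 qed
 have "complete K" using K(2) by (simp add: complete_eq_closed)
 moreover have "T ` K \<subseteq> K" using TK by auto
 ultimately have "\<exists>!u\<in>K. T u = u" by (rule Banach_fix[OF _ K(1) c]) (rule contr)
 then obtain u where u: "u \<in> K" "T u = u" by auto
 have "l w - l u <= A u \<bullet> (w - u)" if w: "w \<in> K" for w
 proof -
  have "\<rho> * (l w - l u) <= \<rho> * (A u \<bullet> (w - u))"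
   using T[OF w, of u] u(2) by (simp add: inner_diff_left inner_diff_right right_diff_distrib)
  then show ?thesis using \<rho> by simp
 qed
 then show ?thesis using u(1) by blast
qed

section \<open>Sublinear functionals and Lagrange multipliers\<close>

text \<open>
 Subspaces of functions are sets here, because the essentially bounded functions are a set
 of representatives and not a type.
\<close>

definition fun_subspace :: "('a => real) set => bool" where
 "fun_subspace V \<longleftrightarrow> (\<lambda>x. 0) \<in> V \<and>
  (\<forall>v\<in>V. \<forall>w\<in>V. (\<lambda>x. v x + w x) \<in> V) \<and> (\<forall>c. \<forall>v\<in>V. (\<lambda>x. c * v x) \<in> V)"

definition sublinear_on :: "('a => real) set => (('a => real) => real) => bool" where
 "sublinear_on V p \<longleftrightarrow>
  (\<forall>v\<in>V. \<forall>w\<in>V. p (\<lambda>x. v x + w x) <= p v + p w) \<and>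
  (\<forall>c>0. \<forall>v\<in>V. p (\<lambda>x. c * v x) = c * p v)"

lemma fun_subspace_add: "fun_subspace V ==> v \<in> V ==> w \<in> V ==> (\<lambda>x. v x + w x) \<in> V"
 and fun_subspace_mult: "fun_subspace V ==> v \<in> V ==> (\<lambda>x. c * v x) \<in> V"
 and fun_subspace_0: "fun_subspace V ==> (\<lambda>x. 0) \<in> V"
 by (simp_all add: fun_subspace_def)

lemma fun_subspace_minus: "fun_subspace V ==> v \<in> V ==> (\<lambda>x. - v x) \<in> V"
 using fun_subspace_mult[of V v "-1"] by simp

lemma sublinear_on_add:
  "sublinear_on V p ==> v \<in> V ==> w \<in> V ==> p (\<lambda>x. v x + w x) <= p v + p w"
 and sublinear_on_mult: "sublinear_on V p ==> c > 0 ==> v \<in> V ==> p (\<lambda>x. c * v x) = c * p v"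
 by (simp_all add: sublinear_on_def)

lemma sublinear_on_0:
 assumes "fun_subspace V" "sublinear_on V p"
 shows "p (\<lambda>x. 0) = 0"
 using sublinear_on_mult[OF assms(2) _ fun_subspace_0[OF assms(1)], of 2] by simp

lemma sublinear_on_minus:
 assumes "fun_subspace V" "sublinear_on V p" "v \<in> V"
 shows "- p v <= p (\<lambda>x. - v x)"
 using sublinear_on_add[OF assms(2,3) fun_subspace_minus[OF assms(1,3)]]
  sublinear_on_0[OF assms(1,2)] by simp

text \<open>
 A minimal sublinear functional is linear: lowering \<open>q\<close> in the direction \<open>y\<close> gives again a
 sublinear functional, which minimality forces to be \<open>q\<close> itself.
\<close>

lemma minimal_sublinear_minus:
 assumes V: "fun_subspace V" and q: "sublinear_on V q" and y: "y \<in> V"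
  and min: "\<And>r. sublinear_on V r ==> (\<forall>v\<in>V. r v <= q v) ==> (\<forall>v\<in>V. r v = q v)"
 shows "q (\<lambda>x. - y x) = - q y"
proof -
 have add: "\<And>v w. v \<in> V ==> w \<in> V ==> (\<lambda>x. v x + w x) \<in> V"
  and scl: "\<And>c v. v \<in> V ==> (\<lambda>x. c * v x) \<in> V"
  using fun_subspace_add[OF V] fun_subspace_mult[OF V] by auto
 have qadd: "\<And>v w. v \<in> V ==> w \<in> V ==> q (\<lambda>x. v x + w x) <= q v + q w"
  and qscl: "\<And>c v. c > 0 ==> v \<in> V ==> q (\<lambda>x. c * v x) = c * q v"
  using sublinear_on_add[OF q] sublinear_on_mult[OF q] by auto
 have q0: "q (\<lambda>x. 0) = 0" by (rule sublinear_on_0[OF V q])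
 have qscl0: "q (\<lambda>x. c * v x) = c * q v" if "c >= 0" "v \<in> V" for c v
  using qscl[of c v] that q0 by (cases "c = 0") auto
 have neg: "(\<lambda>x. - v x) \<in> V" if "v \<in> V" for v using fun_subspace_minus[OF V that] .
 define r where "r v = (INF t\<in>{0..}. q (\<lambda>x. v x + t * y x) - t * q y)" for v
 have lb: "- q (\<lambda>x. - v x) <= q (\<lambda>x. v x + t * y x) - t * q y" if "v \<in> V" "t >= 0" for v t
 proof -
  have "q (\<lambda>x. t * y x) = q (\<lambda>x. (v x + t * y x) + - v x)" by simp
  also have "... <= q (\<lambda>x. v x + t * y x) + q (\<lambda>x. - v x)"
   using that y by (intro qadd add scl neg)
  finally show ?thesis using qscl0[OF that(2) y] by simp
 qed
 have bdd: "bdd_below ((\<lambda>t. q (\<lambda>x. v x + t * y x) - t * q y) ` {0..})" if "v \<in> V" for v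
  using lb[OF that] by (intro bdd_belowI2[where m="- q (\<lambda>x. - v x)"]) auto
 have rle: "r v <= q (\<lambda>x. v x + t * y x) - t * q y" if "v \<in> V" "t >= 0" for v t
  unfolding r_def using that by (intro cINF_lower bdd) auto
 have rge: "c <= r v" if "\<And>t. t >= 0 ==> c <= q (\<lambda>x. v x + t * y x) - t * q y" for c v
  unfolding r_def using that by (intro cINF_greatest) auto
 have radd: "r (\<lambda>x. v x + w x) <= r v + r w" if v: "v \<in> V" and w: "w \<in> V" for v w
 proof -
  have "r (\<lambda>x. v x + w x) - (q (\<lambda>x. w x + t * y x) - t * q y) <= r v" if t: "t >= 0" for t
  proof (rule rge)
   fix s :: real assume s: "s >= 0"
   have "r (\<lambda>x. v x + w x) <= q (\<lambda>x. (v x + w x) + (s + t) * y x) - (s + t) * q y"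
    using s t v w by (intro rle add) auto
   also have "(\<lambda>x. (v x + w x) + (s + t) * y x) = (\<lambda>x. (v x + s * y x) + (w x + t * y x))"
    by (simp add: algebra_simps)
   also have "q ... <= q (\<lambda>x. v x + s * y x) + q (\<lambda>x. w x + t * y x)"
    using v w y by (intro qadd add scl)
   finally show "r (\<lambda>x. v x + w x) - (q (\<lambda>x. w x + t * y x) - t * q y)
     <= q (\<lambda>x. v x + s * y x) - s * q y" by (simp add: algebra_simps)
  qed
  then have "r (\<lambda>x. v x + w x) - r v <= r w"
   by (intro rge) (simp add: algebra_simps)
  then show ?thesis by simp
 qed
 have rscl_le: "r (\<lambda>x. c * v x) <= c * r v" if c: "c > 0" and v: "v \<in> V" for c v
 proof -
  have "r (\<lambda>x. c * v x) / c <= r v"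
  proof (rule rge)
   fix t :: real assume t: "t >= 0"
   have "r (\<lambda>x. c * v x) <= q (\<lambda>x. c * v x + (c * t) * y x) - (c * t) * q y"
    using c t v by (intro rle scl) auto
   also have "(\<lambda>x. c * v x + (c * t) * y x) = (\<lambda>x. c * (v x + t * y x))"
    by (simp add: algebra_simps)
   also have "q ... = c * q (\<lambda>x. v x + t * y x)" using c v y by (intro qscl add scl)
   finally show "r (\<lambda>x. c * v x) / c <= q (\<lambda>x. v x + t * y x) - t * q y"
    using c by (simp add: field_simps)
  qed
  then show ?thesis using c by (simp add: field_simps)
 qed
 have rscl: "r (\<lambda>x. c * v x) = c * r v" if c: "c > 0" and v: "v \<in> V" for c v
 proof (rule antisym[OF rscl_le[OF that]])
  have "r (\<lambda>x. (1 / c) * (c * v x)) <= (1 / c) * r (\<lambda>x. c * v x)"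
   using rscl_le[of "1 / c" "\<lambda>x. c * v x"] c v scl by auto
  then show "c * r v <= r (\<lambda>x. c * v x)" using c by (simp add: field_simps)
 qed
 have "sublinear_on V r" unfolding sublinear_on_def using radd rscl by auto
 moreover have "\<forall>v\<in>V. r v <= q v" using rle[of _ 0] by auto
 ultimately have "r (\<lambda>x. - y x) = q (\<lambda>x. - y x)" using min neg[OF y] by blast
 moreover have "r (\<lambda>x. - y x) <= - q y" using rle[OF neg[OF y], of 1] q0 by simp
 ultimately show ?thesis using sublinear_on_minus[OF V q y] by linarith
qed

text \<open>
 The Hahn--Banach theorem in its sublinear form: by Zorn's lemma there is a minimal
 sublinear functional below \<open>p\<close>, and minimal ones are linear.
\<close>

theorem sublinear_has_linear_minorant:
 assumes V: "fun_subspace V" and p: "sublinear_on V p"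
 obtains l where "\<forall>v\<in>V. l v <= p v"
  and "\<forall>v\<in>V. \<forall>w\<in>V. l (\<lambda>x. v x + w x) = l v + l w"
  and "\<forall>c. \<forall>v\<in>V. l (\<lambda>x. c * v x) = c * l v"
proof -
 have add: "\<And>v w. v \<in> V ==> w \<in> V ==> (\<lambda>x. v x + w x) \<in> V"
  and scl: "\<And>c v. v \<in> V ==> (\<lambda>x. c * v x) \<in> V"
  using fun_subspace_add[OF V] fun_subspace_mult[OF V] by auto
 have neg: "(\<lambda>x. - v x) \<in> V" if "v \<in> V" for v using fun_subspace_minus[OF V that] .
 (* functionals are normalised to vanish off V, so that the pointwise order is antisymmetric *)
 define S where "S = {q. sublinear_on V q \<and> (\<forall>v\<in>V. q v <= p v) \<and> (\<forall>v. v \<notin> V --> q v = 0)}"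
 let ?P = "\<lambda>q r :: ('a => real) => real. \<forall>v. r v <= q v"
 have "\<exists>m\<in>S. \<forall>a\<in>S. ?P m a --> a = m"
 proof (rule predicate_Zorn)
  show "partial_order_on S (relation_of ?P S)"
   by (rule partial_order_on_relation_ofI) (simp, meson order_trans, meson ext order_antisym)
 next
  fix C assume C: "C \<in> Chains (relation_of ?P S)"
  have CS: "C \<subseteq> S" using C by (auto simp: Chains_def relation_of_def)
  have tot: "(\<forall>v. q v <= r v) \<or> (\<forall>v. r v <= q v)" if "q \<in> C" "r \<in> C" for q r
   using C that by (auto simp: Chains_def relation_of_def)
  have p': "(\<lambda>v. if v \<in> V then p v else 0) \<in> S"
   using p add scl by (auto simp: S_def sublinear_on_def)
  show "\<exists>u\<in>S. \<forall>a\<in>C. ?P a u"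
  proof (cases "C = {}")
   case True then show ?thesis using p' by auto
  next
   case False
   have Csub: "sublinear_on V q" and Cp: "v \<in> V ==> q v <= p v" and C0: "v \<notin> V ==> q v = 0"
    if "q \<in> C" for q v using that CS by (auto simp: S_def)
   define u where "u v = (INF q\<in>C. q v)" for v
   have bdd: "bdd_below ((\<lambda>q. q v) ` C)" for v
   proof (cases "v \<in> V")
    case True
    have "- p (\<lambda>x. - v x) <= q v" if "q \<in> C" for q
     using sublinear_on_minus[OF V Csub[OF that] neg[OF True]] Cp[OF that neg[OF True]] by simp
    then show ?thesis by (intro bdd_belowI2[where m="- p (\<lambda>x. - v x)"]) auto
   next
    case False show ?thesis by (intro bdd_belowI2[where m=0]) (simp add: C0[OF _ False])
   qed
   have ule: "u v <= q v" if "q \<in> C" for q v unfolding u_def using that by (intro cINF_lower bdd)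
   have uge: "c <= u v" if "\<And>q. q \<in> C ==> c <= q v" for c v
    unfolding u_def using False that by (intro cINF_greatest) auto
   have uadd: "u (\<lambda>x. v x + w x) <= u v + u w" if v: "v \<in> V" and w: "w \<in> V" for v w
   proof -
    have "u (\<lambda>x. v x + w x) - r w <= u v" if r: "r \<in> C" for r
    proof (rule uge)
     fix q assume q: "q \<in> C"
     obtain m where m: "m \<in> C" "\<forall>v. m v <= q v" "\<forall>v. m v <= r v"
      using tot[OF q r] q r by auto
     have "u (\<lambda>x. v x + w x) <= m (\<lambda>x. v x + w x)" by (rule ule[OF m(1)])
     also have "... <= m v + m w" by (rule sublinear_on_add[OF Csub[OF m(1)] v w])
     finally show "u (\<lambda>x. v x + w x) - r w <= q v" using spec[OF m(2), of v] spec[OF m(3), of w] by linarith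
    qed
    then have "u (\<lambda>x. v x + w x) - u v <= u w" by (intro uge) (simp add: algebra_simps)
    then show ?thesis by simp
   qed
   have uscl: "u (\<lambda>x. c * v x) = c * u v" if c: "c > 0" and v: "v \<in> V" for c v
   proof (rule antisym)
    have "u (\<lambda>x. c * v x) / c <= u v"
    proof (rule uge)
     fix q assume q: "q \<in> C"
     have "q (\<lambda>x. c * v x) = c * q v" by (rule sublinear_on_mult[OF Csub[OF q] c v])
     then show "u (\<lambda>x. c * v x) / c <= q v"
      using ule[OF q, of "\<lambda>x. c * v x"] c by (simp add: field_simps)
    qed
    then show "u (\<lambda>x. c * v x) <= c * u v" using c by (simp add: field_simps)
    show "c * u v <= u (\<lambda>x. c * v x)"
    proof (rule uge)
     fix q assume q: "q \<in> C"
     have "q (\<lambda>x. c * v x) = c * q v" by (rule sublinear_on_mult[OF Csub[OF q] c v])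
     then show "c * u v <= q (\<lambda>x. c * v x)" using ule[OF q, of v] c by simp
    qed
   qed
   obtain q0 where q0: "q0 \<in> C" using False by auto
   have "u v <= p v" if "v \<in> V" for v
    by (rule order_trans[OF ule[OF q0] Cp[OF q0 that]])
   moreover have "u v = 0" if "v \<notin> V" for v
    
   proof -
    have "(\<lambda>q. q v) ` C = {0}" using C0[OF _ that] False by force
    then show ?thesis by (simp add: u_def)
   qed
   ultimately have "u \<in> S" unfolding S_def sublinear_on_def
    using uadd uscl by simp
   then show ?thesis using ule by auto
  qed
 qed
 then obtain l where lS: "l \<in> S" and lmin: "\<And>a. a \<in> S ==> \<forall>v. a v <= l v ==> a = l" by auto
 have lsub: "sublinear_on V l" and lp: "\<forall>v\<in>V. l v <= p v" using lS by (auto simp: S_def)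
 have min: "\<forall>v\<in>V. r v = l v" if r: "sublinear_on V r" "\<forall>v\<in>V. r v <= l v" for r
 proof -
  have "(\<lambda>v. if v \<in> V then r v else 0) \<in> S"
   using r lp add scl unfolding S_def sublinear_on_def by (simp, meson order_trans)
  moreover have "\<forall>v. (if v \<in> V then r v else 0) <= l v" using r lS by (auto simp: S_def)
  ultimately have "(\<lambda>v. if v \<in> V then r v else 0) = l" by (rule lmin)
  then have "(if v \<in> V then r v else 0) = l v" for v by (rule fun_cong)
  from this show ?thesis by (metis (full_types))
 qed
 have lneg: "l (\<lambda>x. - v x) = - l v" if "v \<in> V" for v
  by (rule minimal_sublinear_minus[OF V lsub that min])
 have ladd: "l (\<lambda>x. v x + w x) = l v + l w" if "v \<in> V" "w \<in> V" for v w
 proof (rule antisym)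
  show "l (\<lambda>x. v x + w x) <= l v + l w" by (rule sublinear_on_add[OF lsub that])
  have "l (\<lambda>x. - v x + - w x) <= l (\<lambda>x. - v x) + l (\<lambda>x. - w x)"
   by (rule sublinear_on_add[OF lsub neg[OF that(1)] neg[OF that(2)]])
  moreover have "l (\<lambda>x. - v x + - w x) = - l (\<lambda>x. v x + w x)"
   using lneg[OF add[OF that]] by (simp add: algebra_simps)
  ultimately show "l v + l w <= l (\<lambda>x. v x + w x)" using lneg that by simp
 qed
 have lpos: "l (\<lambda>x. c * v x) = c * l v" if "v \<in> V" "c > 0" for c v
  by (rule sublinear_on_mult[OF lsub that(2,1)])
 have lscl: "l (\<lambda>x. c * v x) = c * l v" if v: "v \<in> V" for c v
 proof -
  consider "c > 0" | "c = 0" | "c < 0" by linarith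
  then show ?thesis
  proof cases
   case 2 then show ?thesis using sublinear_on_0[OF V lsub] by simp
  next
   case 3
   have "l (\<lambda>x. (- c) * v x) = (- c) * l v" using lpos[OF v, of "- c"] 3 by auto
   moreover have "l (\<lambda>x. - (c * v x)) = - l (\<lambda>x. c * v x)" by (rule lneg[OF scl[OF v]])
   ultimately show ?thesis by simp
  qed (use lpos v in auto)
 qed
 show ?thesis using that lp ladd lscl by blast
qed

lemma Linf_AE_bound:
 fixes w :: "'a::euclidean_space => 'b::euclidean_space"
 assumes "w \<in> Linf"
 shows "AE x in lebesgue. norm (w x) <= enn2real (Linf_norm w)"
proof -
 have m: "w \<in> borel_measurable lebesgue" and fin: "Linf_norm w < \<infinity>"
  using assms by (auto simp: Linf_def)
 have "AE x in lebesgue. ennreal (norm (w x)) <= Linf_norm w"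
  unfolding Linf_norm_def by (rule esssup_AE)
 then show ?thesis
 proof eventually_elim
  case (elim x)
  then show ?case using fin
   by (metis enn2real_ennreal enn2real_mono norm_ge_zero infinity_ennreal_def)
 qed
qed

lemma LinfI:
 fixes w :: "'a::euclidean_space => 'b::euclidean_space"
 assumes "w \<in> borel_measurable lebesgue" "AE x in lebesgue. norm (w x) <= C"
 shows "w \<in> Linf"
proof -
 have "Linf_norm w <= ennreal C" unfolding Linf_norm_def
 proof (rule esssup_I)
  show "(\<lambda>x. ennreal (norm (w x))) \<in> borel_measurable lebesgue" using assms(1) by measurable
  show "AE x in lebesgue. ennreal (norm (w x)) <= ennreal C"
   using assms(2) by eventually_elim (auto intro: ennreal_leI)
 qed
 also have "... < \<infinity>" by simp
 finally show ?thesis using assms(1) by (auto simp: Linf_def)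
qed

lemma Linf_add: 
 fixes v w :: "'a::euclidean_space => 'b::euclidean_space"
 assumes "v \<in> Linf" "w \<in> Linf" shows "(\<lambda>x. v x + w x) \<in> Linf"
proof (rule LinfI)
 show "(\<lambda>x. v x + w x) \<in> borel_measurable lebesgue" using assms by (auto simp: Linf_def)
 show "AE x in lebesgue. norm (v x + w x) <= enn2real (Linf_norm v) + enn2real (Linf_norm w)"
  using Linf_AE_bound[OF assms(1)] Linf_AE_bound[OF assms(2)]
  by eventually_elim (meson add_mono norm_triangle_le)
qed

lemma Linf_scaleR:
 fixes w :: "'a::euclidean_space => 'b::euclidean_space"
 assumes "w \<in> Linf" shows "(\<lambda>x. c *\<^sub>R w x) \<in> Linf"
proof (rule LinfI)
 show "(\<lambda>x. c *\<^sub>R w x) \<in> borel_measurable lebesgue" using assms by (auto simp: Linf_def)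
 show "AE x in lebesgue. norm (c *\<^sub>R w x) <= \<bar>c\<bar> * enn2real (Linf_norm w)"
  using Linf_AE_bound[OF assms] by eventually_elim (auto intro: mult_left_mono)
qed

lemma Linf_mult:
 fixes v w :: "'a::euclidean_space => real"
 assumes "v \<in> Linf" "w \<in> Linf" shows "(\<lambda>x. v x * w x) \<in> Linf"
proof (rule LinfI)
 show "(\<lambda>x. v x * w x) \<in> borel_measurable lebesgue" using assms by (auto simp: Linf_def)
 show "AE x in lebesgue. norm (v x * w x) <= enn2real (Linf_norm v) * enn2real (Linf_norm w)"
  using Linf_AE_bound[OF assms(1)] Linf_AE_bound[OF assms(2)]
  by eventually_elim (auto simp: abs_mult intro!: mult_mono)
qed

lemma Linf_inner:
 fixes v w :: "'a::euclidean_space => 'b::euclidean_space"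
 assumes "v \<in> Linf" "w \<in> Linf" shows "(\<lambda>x. v x \<bullet> w x) \<in> Linf"
proof (rule LinfI)
 show "(\<lambda>x. v x \<bullet> w x) \<in> borel_measurable lebesgue" using assms by (auto simp: Linf_def)
 show "AE x in lebesgue. norm (v x \<bullet> w x) <= enn2real (Linf_norm v) * enn2real (Linf_norm w)"
  using Linf_AE_bound[OF assms(1)] Linf_AE_bound[OF assms(2)]
  by eventually_elim
   (metis Cauchy_Schwarz_ineq2 mult_mono norm_ge_zero order_trans real_norm_def enn2real_nonneg)
qed

lemma Linf_norm:
 fixes v :: "'a::euclidean_space => 'b::euclidean_space"
 assumes "v \<in> Linf" shows "(\<lambda>x. norm (v x)) \<in> Linf"
proof (rule LinfI)
 show "(\<lambda>x. norm (v x)) \<in> borel_measurable lebesgue" using assms by (auto simp: Linf_def)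
 show "AE x in lebesgue. norm (norm (v x)) <= enn2real (Linf_norm v)"
  using Linf_AE_bound[OF assms] by simp
qed

lemma Linf_const: "(\<lambda>x. c :: 'b::euclidean_space) \<in> (Linf :: ('a::euclidean_space => 'b) set)"
 by (rule LinfI[where C="norm c"]) auto

lemma Linf_fun_subspace: "fun_subspace (Linf :: ('a::euclidean_space => real) set)"
 unfolding fun_subspace_def using Linf_add Linf_scaleR[where 'b=real] Linf_const by auto

text \<open>
 For a constraint relaxed to \<open>w\<close>, let \<open>p w\<close> be the infimum of \<open>s * cost v\<close> over all \<open>s > 0\<close>
 and \<open>v\<close> with \<open>s * cons v <= w\<close> almost everywhere. Convexity makes \<open>p\<close> sublinear. Large
 multiples of Slater's point are admissible for every \<open>w\<close>, and adding them to an admissible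
 \<open>v\<close> gives a feasible point, so optimality keeps \<open>p\<close> finite. The multiplier is the negative
 of a linear functional below \<open>p\<close>.
\<close>

theorem slater_multiplier:
 fixes cost :: "'v => real" and cons :: "'v => 'a::euclidean_space => real"
 assumes cvx: "\<And>v w s t. v \<in> V ==> w \<in> V ==> s > 0 ==> t > 0 ==> s + t = 1 ==>
   \<exists>z\<in>V. cost z <= s * cost v + t * cost w \<and> (AE x in lebesgue. cons z x <= s * cons v x + t * cons w x)"
  and slater: "v0 \<in> V" "\<epsilon> > 0" "AE x in lebesgue. cons v0 x <= - \<epsilon>"
  and feas: "u \<in> V" "cost u <= 0" "AE x in lebesgue. cons u x <= 0"
  and opt: "\<And>v. v \<in> V ==> (AE x in lebesgue. cons v x <= 0) ==> 0 <= cost v"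
  and Linf: "\<And>v. v \<in> V ==> cons v \<in> Linf"
 obtains \<Lambda> where "\<Lambda> \<in> Linf_dual" "dual_nonneg \<Lambda>" "\<And>v. v \<in> V ==> 0 <= cost v + \<Lambda> (cons v)"
proof -
 define A where "A w = {s * cost v | s v. s > 0 \<and> v \<in> V \<and> (AE x in lebesgue. s * cons v x <= w x)}" for w
 define p where "p w = Inf (A w)" for w
 have Aadd: "\<exists>c\<in>A (\<lambda>x. w x + w' x). c <= a + b" if ab: "a \<in> A w" "b \<in> A w'" for a b w w'
 proof -
  obtain s v where 1: "a = s * cost v" "s > 0" "v \<in> V" "AE x in lebesgue. s * cons v x <= w x"
   using ab(1) by (auto simp: A_def)
  obtain t v' where 2: "b = t * cost v'" "t > 0" "v' \<in> V" "AE x in lebesgue. t * cons v' x <= w' x"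
   using ab(2) by (auto simp: A_def)
  have pos: "s / (s + t) > 0" "t / (s + t) > 0" using 1 2 by auto
  have one: "s / (s + t) + t / (s + t) = 1" using 1 2 by (simp add: field_simps add_divide_distrib[symmetric])
  obtain z where z: "z \<in> V" "cost z <= s / (s + t) * cost v + t / (s + t) * cost v'"
    "AE x in lebesgue. cons z x <= s / (s + t) * cons v x + t / (s + t) * cons v' x"
   using cvx[OF 1(3) 2(3) pos one] by blast
  have mul: "(s + t) * c <= s * d + t * e" if "c <= s / (s + t) * d + t / (s + t) * e" for c d e
  proof -
   have "(s + t) * c <= (s + t) * (s / (s + t) * d + t / (s + t) * e)"
    using that 1 2 by (intro mult_left_mono) auto
   also have "... = ((s + t) / (s + t)) * (s * d + t * e)" by (simp add: distrib_left)
   also have "... = s * d + t * e" using 1(2) 2(2) by simp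
   finally show ?thesis .
  qed
  have "AE x in lebesgue. (s + t) * cons z x <= w x + w' x"
   using z(3) 1(4) 2(4)
  proof eventually_elim
   case (elim x) then show ?case using mul[OF elim(1)] by linarith
  qed
  then have "(s + t) * cost z \<in> A (\<lambda>x. w x + w' x)"
   using z(1) 1 2 by (auto simp: A_def intro!: exI[of _ "s + t"] exI[of _ z])
  then show ?thesis using mul[OF z(2)] 1 2 by auto
 qed
 have A0: "0 <= c" if c: "c \<in> A (\<lambda>x. 0)" for c
 proof -
  obtain s v where 1: "c = s * cost v" "s > 0" "v \<in> V" "AE x in lebesgue. s * cons v x <= 0"
   using c unfolding A_def by blast
  have "AE x in lebesgue. cons v x <= 0"
   using 1(4) by eventually_elim (use 1(2) in \<open>simp add: mult_le_0_iff\<close>)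
  then show ?thesis using opt[OF 1(3)] 1(1,2) by simp
 qed
 have Ane: "A w \<noteq> {}" if w: "w \<in> Linf" for w
 proof -
  define K where "K = enn2real (Linf_norm w)"
  have K0: "K >= 0" by (simp add: K_def)
  have "AE x in lebesgue. ((K + 1) / \<epsilon>) * cons v0 x <= w x"
   using slater(3) Linf_AE_bound[OF w]
  proof eventually_elim
   case (elim x)
   have "((K + 1) / \<epsilon>) * cons v0 x <= ((K + 1) / \<epsilon>) * (- \<epsilon>)"
    using elim(1) K0 slater(2) by (intro mult_left_mono) auto
   also have "... = - (K + 1)" using slater(2) by simp
   finally show ?case using elim(2) by (auto simp: K_def)
  qed
  then have "((K + 1) / \<epsilon>) * cost v0 \<in> A w"
   using slater(1,2) K0 by (auto simp: A_def intro!: exI[of _ "(K + 1) / \<epsilon>"])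
  then show ?thesis by auto
 qed
 have Linfneg: "(\<lambda>x. - w x) \<in> Linf" if "w \<in> Linf" for w :: "'a => real"
  using Linf_scaleR[OF that, of "-1"] by simp
 have Abdd: "bdd_below (A w)" if w: "w \<in> Linf" for w
 proof -
  obtain b where b: "b \<in> A (\<lambda>x. - w x)" using Ane[OF Linfneg[OF w]] by auto
  have "- b <= a" if "a \<in> A w" for a
   using Aadd[OF that b] A0 by fastforce
  then show ?thesis by (rule bdd_belowI)
 qed
 have ple: "p w <= c" if "w \<in> Linf" "c \<in> A w" for w c
  unfolding p_def using Abdd that by (intro cInf_lower)
 have pge: "c <= p w" if "w \<in> Linf" "\<And>a. a \<in> A w ==> c <= a" for w c
  unfolding p_def using Ane that by (intro cInf_greatest)
 have padd: "p (\<lambda>x. w x + w' x) <= p w + p w'" if w: "w \<in> Linf" and w': "w' \<in> Linf" for w w'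
 proof -
  have "p (\<lambda>x. w x + w' x) - b <= p w" if b: "b \<in> A w'" for b
  proof (rule pge[OF w])
   fix a assume "a \<in> A w"
   then obtain c where "c \<in> A (\<lambda>x. w x + w' x)" "c <= a + b" using Aadd b by blast
   then show "p (\<lambda>x. w x + w' x) - b <= a" using ple[OF Linf_add[OF w w']] by fastforce
  qed
  then have "p (\<lambda>x. w x + w' x) - p w <= p w'" using w' by (intro pge) (auto simp: algebra_simps)
  then show ?thesis by simp
 qed
 have Ascl: "c * a \<in> A (\<lambda>x. c * w x)" if c: "c > 0" and a: "a \<in> A w" for c a w
 proof -
  obtain s v where 1: "a = s * cost v" "s > 0" "v \<in> V" "AE x in lebesgue. s * cons v x <= w x"
   using a by (auto simp: A_def)
  have "AE x in lebesgue. (c * s) * cons v x <= c * w x"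
   using 1(4) by eventually_elim (use c in \<open>simp add: mult.assoc\<close>)
  then show ?thesis using 1 c by (auto simp: A_def intro!: exI[of _ "c * s"] exI[of _ v])
 qed
 have pscl_le: "p (\<lambda>x. c * w x) <= c * p w" if c: "c > 0" and w: "w \<in> Linf" for c w
 proof -
  have "p (\<lambda>x. c * w x) / c <= p w"
  proof (rule pge[OF w])
   fix a assume "a \<in> A w"
   then have "p (\<lambda>x. c * w x) <= c * a"
    using Ascl[OF c] Linf_scaleR[OF w, of c] by (intro ple) auto
   then show "p (\<lambda>x. c * w x) / c <= a" using c by (simp add: field_simps)
  qed
  then show ?thesis using c by (simp add: field_simps)
 qed
 have pscl: "p (\<lambda>x. c * w x) = c * p w" if c: "c > 0" and w: "w \<in> Linf" for c w
 proof (rule antisym[OF pscl_le[OF that]])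
  have "p (\<lambda>x. (1 / c) * (c * w x)) <= (1 / c) * p (\<lambda>x. c * w x)"
   using pscl_le[of "1 / c" "\<lambda>x. c * w x"] c Linf_scaleR[OF w, of c] by auto
  then show "c * p w <= p (\<lambda>x. c * w x)" using c by (simp add: field_simps)
 qed
 have "sublinear_on Linf p" unfolding sublinear_on_def using padd pscl by auto
 from sublinear_has_linear_minorant[OF Linf_fun_subspace this] obtain l
  where lp: "\<forall>w\<in>Linf. l w <= p w"
  and ladd: "\<forall>v\<in>Linf. \<forall>w\<in>Linf. l (\<lambda>x. v x + w x) = l v + l w"
  and lscl: "\<forall>c. \<forall>w\<in>Linf. l (\<lambda>x. c * w x) = c * l w" .
 have nonneg: "l w <= 0" if w: "w \<in> Linf" "AE x in lebesgue. 0 <= w x" for w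
 proof -
  have "AE x in lebesgue. 1 * cons u x <= w x" using feas(3) w(2) by eventually_elim simp
  then have "1 * cost u \<in> A w" unfolding A_def using feas(1) zero_less_one by blast
  then show ?thesis using ple[OF w(1)] lp w(1) feas(2) by fastforce
 qed
 have one: "(\<lambda>x. 1) \<in> (Linf :: ('a => real) set)" by (rule Linf_const)
 have bound: "\<bar>l w\<bar> <= - l (\<lambda>x. 1) * enn2real (Linf_norm w)" if w: "w \<in> Linf" for w
 proof -
  define K where "K = enn2real (Linf_norm w)"
  have K1: "(\<lambda>x::'a. K) \<in> Linf" and lK: "l (\<lambda>x. K) = K * l (\<lambda>x. 1)"
   using Linf_scaleR[OF one, of K] lscl[rule_format, OF one, of K] by auto
  have "l (\<lambda>x. K + w x) <= 0"
   using Linf_AE_bound[OF w] by (intro nonneg Linf_add K1 w) (auto elim!: eventually_mono simp: K_def)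
  moreover have "l (\<lambda>x. K + - w x) <= 0"
   using Linf_AE_bound[OF w] by (intro nonneg Linf_add K1 Linfneg w) (auto elim!: eventually_mono simp: K_def)
  moreover have "l (\<lambda>x. - w x) = - l w" using lscl[rule_format, OF w, of "-1"] by simp
  ultimately have "K * l (\<lambda>x. 1) + l w <= 0" "K * l (\<lambda>x. 1) - l w <= 0"
   using ladd K1 w Linfneg[OF w] lK by auto
  then show ?thesis unfolding K_def[symmetric] by (simp add: mult.commute)
 qed
 define \<Lambda> where "\<Lambda> w = - l w" for w
 show ?thesis
 proof (rule that)
  have "\<forall>w\<in>Linf. \<bar>\<Lambda> w\<bar> <= - l (\<lambda>x. 1) * enn2real (Linf_norm w)"
   using bound by (simp add: \<Lambda>_def)
  then show "\<Lambda> \<in> Linf_dual"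
   unfolding Linf_dual_def using ladd lscl by (auto simp: \<Lambda>_def intro!: exI[of _ "- l (\<lambda>x. 1)"])
  show "dual_nonneg \<Lambda>" unfolding dual_nonneg_def using nonneg by (auto simp: \<Lambda>_def)
  show "0 <= cost v + \<Lambda> (cons v)" if v: "v \<in> V" for v
  proof -
   have "1 * cost v \<in> A (cons v)" unfolding A_def using v zero_less_one by fastforce
   then have "l (cons v) <= cost v" using ple[OF Linf[OF v]] lp Linf[OF v] by fastforce
   then show ?thesis by (simp add: \<Lambda>_def)
  qed
 qed
qed

section \<open>Iterated integrals\<close>

lemma integrable_pairI:
 fixes f :: "'a::euclidean_space => 'b::euclidean_space => real"
 assumes [measurable]: "case_prod f \<in> borel_measurable lborel2"
  and fin: "(NN x y. ennreal \<bar>f x y\<bar>) < \<infinity>"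
 shows "integrable lborel2 (case_prod f)"
proof (rule integrableI_bounded)
 have "(\<integral>\<^sup>+p. ennreal (norm (case_prod f p)) \<partial>lborel2) = (NN x y. ennreal \<bar>f x y\<bar>)"
  by (subst lborel.nn_integral_fst[symmetric]) auto
 then show "(\<integral>\<^sup>+p. ennreal (norm (case_prod f p)) \<partial>lborel2) < \<infinity>" using fin by simp
qed fact

lemma integrable_pair_fst:
 fixes f :: "'a::euclidean_space => 'b::euclidean_space => real"
 assumes "integrable lborel2 (case_prod f)"
 shows "integrable lborel (\<lambda>x. LBINT y. f x y)" "integrable lborel (\<lambda>y. LBINT x. f x y)"
  and "(LBINT x. LBINT y. f x y) = (LINT p|lborel2. case_prod f p)"
  and "(LBINT y. LBINT x. f x y) = (LBINT x. LBINT y. f x y)"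
 using lborel_pair.integrable_fst[OF assms] lborel_pair.integrable_snd[OF assms]
  lborel_pair.integral_fst[OF assms] lborel_pair.Fubini_integral[OF assms] by auto

text \<open>
 The inner double integral is read as one integral over a product space, to which the
 two-fold theorem applies; the exceptional null set only affects the outermost integral.
\<close>

lemma Fubini_triple:
 fixes f :: "'a::euclidean_space => 'b::euclidean_space => 'c::euclidean_space => real"
 assumes f [measurable]: "(\<lambda>(x, y, z). f x y z) \<in> borel_measurable (lborel \<Otimes>\<^sub>M lborel2)"
  and fin: "(NN x y z. ennreal \<bar>f x y z\<bar>) < \<infinity>"
 shows "integrable lborel2 (\<lambda>(y, z). LBINT x. f x y z)"
  and "integrable lborel (\<lambda>x. LBINT y. LBINT z. f x y z)"
  and "(LBINT x. LBINT y. LBINT z. f x y z) =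
   (LBINT y. LBINT z. LBINT x. f x y z)"
proof -
 let ?g = "\<lambda>x p. f x (fst p) (snd p)"
 have m': "(\<lambda>p. f (fst p) (fst (snd p)) (snd (snd p))) \<in> borel_measurable (lborel \<Otimes>\<^sub>M lborel2)"
  using f by (simp add: case_prod_beta')
 then have m: "case_prod ?g \<in> borel_measurable (lborel \<Otimes>\<^sub>M (lborel :: ('b \<times> 'c) measure))"
  by (simp add: case_prod_beta' lborel_prod[symmetric])
 have mx: "(\<lambda>(y, z). f x y z) \<in> borel_measurable lborel2" for x
  using measurable_compose[OF measurable_Pair1' f, of x] by (simp add: case_prod_beta')
 have "(NN p. ennreal \<bar>?g x p\<bar>) = (NN y z. ennreal \<bar>f x y z\<bar>)" for x
  unfolding lborel_prod[symmetric] using mx[of x]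
  by (subst lborel.nn_integral_fst[symmetric]) (auto simp: case_prod_beta')
 then have I: "integrable (lborel \<Otimes>\<^sub>M (lborel :: ('b \<times> 'c) measure)) (case_prod ?g)"
  using fin by (intro integrable_pairI m) simp
 have sw: "integrable (lborel :: ('b \<times> 'c) measure) (\<lambda>p. LBINT x. ?g x p)"
  by (rule integrable_pair_fst(2)[OF I])
 then show P: "integrable lborel2 (\<lambda>(y, z). LBINT x. f x y z)"
  by (simp add: case_prod_beta' lborel_prod)
 have ae: "AE x in lborel. (LINT p|(lborel :: ('b \<times> 'c) measure). ?g x p) = (LBINT y. LBINT z. f x y z)"
  using lborel_pair.AE_integrable_fst[OF I]
 proof eventually_elim
  case (elim x)
  then have "integrable lborel2 (\<lambda>(y, z). f x y z)" by (simp add: lborel_prod case_prod_beta')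
  from integrable_pair_fst(3)[OF this] show ?case by (simp add: lborel_prod case_prod_beta')
 qed
 have mi: "(\<lambda>x. LBINT y. LBINT z. f x y z) \<in> borel_measurable lborel"
 proof -
  have "(\<lambda>q. f (fst (fst q)) (snd (fst q)) (snd q)) \<in> borel_measurable (lborel2 \<Otimes>\<^sub>M lborel)"
   by (rule measurable_compose[OF _ m', of "\<lambda>q. (fst (fst q), snd (fst q), snd q)", simplified]) measurable
  then have "(\<lambda>q. LBINT z. f (fst q) (snd q) z) \<in> borel_measurable lborel2"
   by (intro lborel.borel_measurable_lebesgue_integral) (simp add: case_prod_beta')
  then show ?thesis
   by (intro lborel.borel_measurable_lebesgue_integral) (simp add: case_prod_beta')
 qed
 show "integrable lborel (\<lambda>x. LBINT y. LBINT z. f x y z)"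
  by (rule integrable_cong_AE_imp[OF integrable_pair_fst(1)[OF I]]) (use mi ae in auto)
 have "(LBINT x. LBINT y. LBINT z. f x y z) = (LBINT x. LBINT p. ?g x p)"
  by (rule integral_cong_AE[symmetric]) (use mi ae integrable_pair_fst(1)[OF I] in auto)
 also have "... = (LBINT p. LBINT x. ?g x p)" by (rule integrable_pair_fst(4)[OF I, symmetric])
 also have "... = (LBINT y. LBINT z. LBINT x. f x y z)"
  using integrable_pair_fst(3)[OF P] by (simp add: lborel_prod case_prod_beta')
 finally show "(LBINT x. LBINT y. LBINT z. f x y z) =
   (LBINT y. LBINT z. LBINT x. f x y z)" .
qed

lemma Tonelli_swap:
 fixes f :: "'a::euclidean_space => 'b::euclidean_space => ennreal"
 assumes "case_prod f \<in> borel_measurable lborel2"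
 shows "(NN x y. f x y) = (NN y x. f x y)"
 by (rule lborel_pair.Fubini'[symmetric, OF assms])

text \<open>
 Fubini's theorem: \<open>u\<close> and \<open>w\<close> are integrable and the kernel is bounded.
\<close>

lemma convolution_pairing:
 fixes a :: "'e::euclidean_space => 'c::euclidean_space"
 assumes u: "integrable lborel u" and w: "integrable lborel w"
  and a: "a \<in> borel_measurable borel" "\<And>z. norm (a z) <= S"
 shows "(LBINT x. (LBINT y. u y *\<^sub>R a (x - y)) \<bullet> w x) = (LBINT y. u y * (LBINT x. a (x - y) \<bullet> w x))"
proof -
 have [measurable]: "u \<in> borel_measurable borel" "w \<in> borel_measurable borel" "a \<in> borel_measurable borel"
  using u w a by auto
 have S0: "S >= 0" using a(2)[of 0] norm_ge_zero[of "a 0"] by linarith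
 have uw: "(NN y. ennreal \<bar>u y\<bar>) < \<infinity>" "(NN x. ennreal (norm (w x))) < \<infinity>"
  using u w by (auto simp: integrable_iff_bounded)
 have le: "\<bar>u y * (a (x - y) \<bullet> w x)\<bar> <= S * norm (w x) * \<bar>u y\<bar>" for x y
 proof -
  have "\<bar>a (x - y) \<bullet> w x\<bar> <= S * norm (w x)"
   by (rule order_trans[OF Cauchy_Schwarz_ineq2]) (intro mult_right_mono a(2) norm_ge_zero)
  from mult_right_mono[OF this abs_ge_zero[of "u y"]] show ?thesis by (simp add: abs_mult mult_ac)
 qed
 have I: "integrable lborel2 (\<lambda>(x, y). u y * (a (x - y) \<bullet> w x))"
 proof (rule integrable_pairI)
  have "(NN x y. ennreal \<bar>u y * (a (x - y) \<bullet> w x)\<bar>) <=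
    (NN x y. ennreal (S * norm (w x) * \<bar>u y\<bar>))"
   by (intro nn_integral_mono ennreal_leI le)
  also have "... = ennreal S * (NN x. ennreal (norm (w x))) * (NN x. ennreal \<bar>u x\<bar>)"
   using S0 by (simp add: ennreal_mult nn_integral_cmult nn_integral_multc)
  also have "... < \<infinity>" using uw by (simp add: ennreal_mult_less_top)
  finally show "(NN x y. ennreal \<bar>u y * (a (x - y) \<bullet> w x)\<bar>) < \<infinity>" .
 qed measurable
 have "(LBINT y. u y * (a (x - y) \<bullet> w x)) = (LBINT y. u y *\<^sub>R a (x - y)) \<bullet> w x" for x
 proof -
  have "integrable lborel (\<lambda>y. u y *\<^sub>R a (x - y))"
  proof (rule bochner_bound)
   show "integrable lborel (\<lambda>y. S * u y)" using u by simp
   show "AE y in lborel. norm (u y *\<^sub>R a (x - y)) <= norm (S * u y)"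
    using mult_left_mono[OF a(2) abs_ge_zero] S0 by (intro AE_I2) (simp add: abs_mult mult.commute[of S])
  qed measurable
  from integral_inner_left[of "w x", OF this] show ?thesis by simp
 qed
 then show ?thesis using integrable_pair_fst(4)[OF I] by simp
qed

section \<open>Integrals of powers\<close>

lemma nn_integral_powr_0:
 assumes "a > -1" "c > 0"
 shows "(NN r. ennreal (indicator {0<..<c} r * r powr a)) <= ennreal (c powr (a + 1) / (a + 1))"
proof -
 have "((\<lambda>r. if r \<in> {0..c} then r powr a else 0) has_integral (c powr (a + 1) / (a + 1))) UNIV"
  using has_integral_powr_from_0[of a c] assms by (subst has_integral_restrict_UNIV) auto
 then have "(NN r. ennreal (if r \<in> {0..c} then r powr a else 0)) = ennreal (c powr (a + 1) / (a + 1))"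
  by (intro nn_integral_has_integral_lborel) auto
 moreover have "(NN r. ennreal (indicator {0<..<c} r * r powr a)) <=
   (NN r. ennreal (if r \<in> {0..c} then r powr a else 0))"
  by (intro nn_integral_mono ennreal_leI) (auto simp: indicator_def)
 ultimately show ?thesis by simp
qed

lemma nn_integral_powr_inf:
 assumes "a < -1" "c > 0"
 shows "(NN r. ennreal (indicator {c..} r * r powr a)) = ennreal (c powr (a + 1) / (- (a + 1)))"
proof -
 have "((\<lambda>r. if r \<in> {c..} then r powr a else 0) has_integral (- (c powr (a + 1)) / (a + 1))) UNIV"
  using has_integral_powr_to_inf[of a c] assms by (subst has_integral_restrict_UNIV) auto
 then have "(NN r. ennreal (if r \<in> {c..} then r powr a else 0)) = ennreal (- (c powr (a + 1)) / (a + 1))"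
  by (intro nn_integral_has_integral_lborel) auto
 moreover have "- (c powr (a + 1)) / (a + 1) = c powr (a + 1) / (- (a + 1))" by (simp only: minus_divide_left[symmetric] minus_divide_right)
 moreover have "(\<lambda>r. ennreal (indicator {c..} r * r powr a)) = (\<lambda>r. ennreal (if r \<in> {c..} then r powr a else 0))"
  by (auto simp: indicator_def)
 ultimately show ?thesis by simp
qed

lemma nn_integral_powers_le:
 assumes "a > -1" "b < -1"
 shows "(NN t. ennreal A * ennreal (indicator {0<..<1} t * t powr a) + ennreal B * ennreal (indicator {1..} t * t powr b))
  <= ennreal A * ennreal (1 / (a + 1)) + ennreal B * ennreal (1 / (- (b + 1)))"
 using nn_integral_powr_inf[of b 1] nn_integral_powr_0[of a 1] assms
 by (subst nn_integral_add) (auto simp: nn_integral_cmult intro!: add_mono mult_left_mono)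

lemma Beta_nonneg: "a > 0 ==> b > 0 ==> Beta a b >= (0::real)"
 by (simp add: Beta_def less_imp_le[OF Gamma_real_pos])

lemma nn_integral_Beta:
 assumes a: "a > 0" and b: "b > 0" and r: "r > 0"
 shows "(NN t. ennreal (indicator {0<..<r} t * (t powr (a - 1) * (r - t) powr (b - 1)))) =
  ennreal (Beta a b * r powr (a + b - 1))"
proof -
 let ?f = "\<lambda>t::real. indicator {0<..<1} t * (t powr (a - 1) * (1 - t) powr (b - 1))"
 have "((\<lambda>t. if t \<in> {0..1} then t powr (a - 1) * (1 - t) powr (b - 1) else 0) has_integral Beta a b) UNIV"
  using has_integral_Beta_real[OF a b] by (subst has_integral_restrict_UNIV)
 moreover have "(\<lambda>t. if t \<in> {0..1} then t powr (a - 1) * (1 - t) powr (b - 1) else 0) = ?f"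
  by (auto simp: indicator_def fun_eq_iff less_le)
 ultimately have "(?f has_integral Beta a b) UNIV" by simp
 then have B: "(NN t. ennreal (?f t)) = ennreal (Beta a b)"
  by (intro nn_integral_has_integral_lborel) auto
 have "(NN t. ennreal (indicator {0<..<r} t * (t powr (a - 1) * (r - t) powr (b - 1)))) =
   ennreal r * (NN t. ennreal (indicator {0<..<r} (r * t) * ((r * t) powr (a - 1) * (r - r * t) powr (b - 1))))"
  using r by (subst nn_integral_real_affine[where c=r and t=0]) auto
 also have "(NN t. ennreal (indicator {0<..<r} (r * t) * ((r * t) powr (a - 1) * (r - r * t) powr (b - 1)))) =
   (NN t. ennreal (r powr (a + b - 2)) * ennreal (?f t))"
 proof (intro nn_integral_cong)
  fix t :: real
  show "ennreal (indicator {0<..<r} (r * t) * ((r * t) powr (a - 1) * (r - r * t) powr (b - 1))) =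
    ennreal (r powr (a + b - 2)) * ennreal (?f t)"
  proof (cases "t \<in> {0<..<1}")
   case True
   have "r - r * t = r * (1 - t)" by (simp add: right_diff_distrib)
   then have "(r * t) powr (a - 1) * (r - r * t) powr (b - 1) =
     (r powr (a - 1) * r powr (b - 1)) * (t powr (a - 1) * (1 - t) powr (b - 1))"
    using True r by (simp add: powr_mult)
   also have "r powr (a - 1) * r powr (b - 1) = r powr (a + b - 2)"
    unfolding powr_add[symmetric] by (simp add: algebra_simps)
   finally show ?thesis using True r by (simp add: ennreal_mult)
  next
   case False
   then have "r * t \<notin> {0<..<r}" using r by (auto simp: zero_less_mult_iff)
   then show ?thesis using False by (simp del: greaterThanLessThan_iff)
  qed
 qed
 also have "... = ennreal (r powr (a + b - 2)) * ennreal (Beta a b)" by (simp add: nn_integral_cmult B)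
 also have "ennreal r * ... = ennreal (Beta a b * (r * r powr (a + b - 2)))"
  using r Beta_nonneg[OF a b] by (simp add: ennreal_mult mult_ac)
 also have "r * r powr (a + b - 2) = r powr (1 + (a + b - 2))" using r by (subst powr_add) simp
 finally show ?thesis by (simp add: algebra_simps)
qed

text \<open>
 The density of the sum of two independent times with power densities is again a power.
\<close>

lemma Beta_Tonelli:
 fixes h :: "real => ennreal"
 assumes a: "a > 0" and b: "b > 0" and [measurable]: "h \<in> borel_measurable borel"
 shows "(NN t s. ennreal (pos t * t powr (a - 1)) * ennreal (pos s * s powr (b - 1)) * h (t + s))
  = (NN r. ennreal (pos r * (Beta a b * r powr (a + b - 1))) * h r)"
proof -
 have "(NN s. ennreal (pos t * t powr (a - 1)) * ennreal (pos s * s powr (b - 1)) * h (t + s))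
  = (NN r. ennreal (pos t * t powr (a - 1)) * ennreal (pos (r - t) * (r - t) powr (b - 1)) * h r)" for t
  by (subst nn_integral_translate[symmetric, where c=t]) auto
 then have "(NN t s. ennreal (pos t * t powr (a - 1)) * ennreal (pos s * s powr (b - 1)) * h (t + s))
  = (NN t r. ennreal (pos t * t powr (a - 1)) * ennreal (pos (r - t) * (r - t) powr (b - 1)) * h r)"
  by simp
 also have "... = (NN r t. ennreal (pos t * t powr (a - 1)) * ennreal (pos (r - t) * (r - t) powr (b - 1)) * h r)"
  by (rule Tonelli_swap) measurable
 also have "... = (NN r. ennreal (pos r * (Beta a b * r powr (a + b - 1))) * h r)"
 proof (intro nn_integral_cong)
  fix r :: real
  have "(NN t. ennreal (pos t * t powr (a - 1)) * ennreal (pos (r - t) * (r - t) powr (b - 1)) * h r)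
   = (NN t. ennreal (indicator {0<..<r} t * (t powr (a - 1) * (r - t) powr (b - 1))) * h r)"
   by (intro nn_integral_cong) (auto simp: indicator_def ennreal_mult[symmetric])
  also have "... = (NN t. ennreal (indicator {0<..<r} t * (t powr (a - 1) * (r - t) powr (b - 1)))) * h r"
   by (rule nn_integral_multc) simp
  also have "... = ennreal (pos r * (Beta a b * r powr (a + b - 1))) * h r"
  proof (cases "r > 0")
   case False
   then have "{0<..<r} = {}" by auto
   then show ?thesis using False by simp
  qed (simp add: nn_integral_Beta[OF a b])
  finally show "(NN t. ennreal (pos t * t powr (a - 1)) * ennreal (pos (r - t) * (r - t) powr (b - 1)) * h r)
   = ennreal (pos r * (Beta a b * r powr (a + b - 1))) * h r" .
 qed
 finally show ?thesis .
qed


section \<open>The Riesz potential as a superposition of heat kernels\<close>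

definition subordination_const :: "real => real => real" where
 "subordination_const n \<gamma> = enn2real (NN t. ennreal (pos t *
  (t powr (\<gamma> - 1) * ((4 * pi * t) powr (- n / 2) * exp (- (1 / (4 * t)))))))"

lemma exp_minus_le_powr:
 fixes y k :: real
 assumes "y > 0" "k > 0" shows "exp (- y) <= (k / y) powr k"
proof -
 have "(y / k) * exp (- (y / k)) <= 1" using assms by (intro exp_ge_mult) auto
 then have "exp (- (y / k)) <= k / y" using assms by (simp add: field_simps)
 then have "exp (- (y / k)) powr k <= (k / y) powr k" using assms by (intro powr_mono2) auto
 also have "exp (- (y / k)) powr k = exp (- y)" using assms by (simp add: powr_def)
 finally show ?thesis .
qed

text \<open>
 The constant is the integral at distance \<open>1\<close>; near time \<open>0\<close> the exponential beats every
 power, and at infinity the power \<open>t\<^bsup>-n/2\<^esup>\<close> of the kernel wins because \<open>\<gamma> < n / 2\<close>.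
\<close>

lemma subordination_const:
 assumes n: "n > 0" and \<gamma>: "\<gamma> < n / 2"
 shows "(NN t. ennreal (pos t * (t powr (\<gamma> - 1) * ((4 * pi * t) powr (- n / 2) * exp (- (1 / (4 * t)))))))
   = ennreal (subordination_const n \<gamma>)"
  and "subordination_const n \<gamma> > 0"
proof -
 let ?f = "\<lambda>t::real. pos t * (t powr (\<gamma> - 1) * ((4 * pi * t) powr (- n / 2) * exp (- (1 / (4 * t)))))"
 define k where "k = n / 2 + 1 - \<gamma>"
 have k: "k > 0" using \<gamma> by (simp add: k_def)
 have le: "?f t <= indicator {0<..<1} t * ((4 * k) powr k * t powr 0) + indicator {1..} t * t powr (- k)" for t
 proof (cases "t > 0")
  case True
  have "t powr (\<gamma> - 1) * ((4 * pi * t) powr (- n / 2) * exp (- (1 / (4 * t)))) <=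
    t powr (\<gamma> - 1) * (t powr (- n / 2) * exp (- (1 / (4 * t))))"
   using four_pi_powr_le[OF True, of "n / 2"] n by (intro mult_left_mono mult_right_mono) auto
  also have "... = t powr (- k) * exp (- (1 / (4 * t)))"
  proof -
   have "t powr (\<gamma> - 1) * t powr (- n / 2) = t powr (- k)"
    unfolding powr_add[symmetric] by (simp add: k_def algebra_simps)
   then show ?thesis by (metis mult.assoc)
  qed
  finally have 1: "?f t <= t powr (- k) * exp (- (1 / (4 * t)))" using True by simp
  show ?thesis
  proof (cases "t < 1")
   case t1: True
   have "exp (- (1 / (4 * t))) <= (k / (1 / (4 * t))) powr k" using True k by (intro exp_minus_le_powr) auto
   also have "... = (4 * k) powr k * t powr k" using True k by (simp add: powr_mult mult_ac)
   finally have "t powr (- k) * exp (- (1 / (4 * t))) <= t powr (- k) * ((4 * k) powr k * t powr k)"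
    by (intro mult_left_mono) auto
   also have "... = (4 * k) powr k * t powr 0"
    using True by (simp add: powr_minus)
   finally have "?f t <= (4 * k) powr k * t powr 0" by (rule order_trans[OF 1])
   moreover have "indicator {0<..<1} t * ((4 * k) powr k * t powr 0) + indicator {1..} t * t powr (- k) =
     (4 * k) powr k * t powr 0" using t1 True by simp
   ultimately show ?thesis by linarith
  next
   case False
   have "t powr (- k) * exp (- (1 / (4 * t))) <= t powr (- k) * 1"
    using True by (intro mult_left_mono) auto
   then have "?f t <= t powr (- k) * 1" by (rule order_trans[OF 1])
   moreover have "indicator {0<..<1} t * ((4 * k) powr k * t powr 0) + indicator {1..} t * t powr (- k) =
     t powr (- k) * 1" using False by simp
   ultimately show ?thesis by linarith
  qed
 qed simp
 have "(NN t. ennreal (?f t)) <=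
   (NN t. ennreal ((4 * k) powr k) * ennreal (indicator {0<..<1} t * t powr 0) + ennreal (indicator {1..} t * t powr (- k)))"
 proof (intro nn_integral_mono)
  fix t :: real
  have "ennreal (?f t) <= ennreal (indicator {0<..<1} t * ((4 * k) powr k * t powr 0) + indicator {1..} t * t powr (- k))"
   by (rule ennreal_leI[OF le])
  also have "... = ennreal ((4 * k) powr k) * ennreal (indicator {0<..<1} t * t powr 0) + ennreal (indicator {1..} t * t powr (- k))"
   by (subst ennreal_plus) (auto simp: ennreal_mult[symmetric] mult_ac)
  finally show "ennreal (?f t) <= ennreal ((4 * k) powr k) * ennreal (indicator {0<..<1} t * t powr 0) + ennreal (indicator {1..} t * t powr (- k))" .
 qed
 also have "... = ennreal ((4 * k) powr k) * (NN t. ennreal (indicator {0<..<1} t * t powr 0)) +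
   (NN t. ennreal (indicator {1..} t * t powr (- k)))"
  by (subst nn_integral_add) (auto simp: nn_integral_cmult)
 also have "... <= ennreal ((4 * k) powr k) * ennreal (1 powr (0 + 1) / (0 + 1)) + ennreal (1 powr (- k + 1) / (- (- k + 1)))"
 proof (intro add_mono mult_left_mono)
  show "(NN t. ennreal (indicator {0<..<1} t * t powr 0)) <= ennreal (1 powr (0 + 1) / (0 + 1))"
   by (rule nn_integral_powr_0) auto
  show "(NN t. ennreal (indicator {1..} t * t powr (- k))) <= ennreal (1 powr (- k + 1) / (- (- k + 1)))"
   by (rule eq_refl, rule nn_integral_powr_inf) (use \<gamma> in \<open>auto simp: k_def\<close>)
 qed auto
 also have "... < \<infinity>" by (simp add: ennreal_mult_less_top)
 finally have fin: "(NN t. ennreal (?f t)) < \<infinity>" .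
 then show eq: "(NN t. ennreal (?f t)) = ennreal (subordination_const n \<gamma>)"
  unfolding subordination_const_def by (simp add: less_top)
 have "(NN t. ennreal (?f t)) \<noteq> 0"
 proof
  assume "(NN t. ennreal (?f t)) = 0"
  then have "AE t in lborel. ennreal (?f t) = 0" by (subst (asm) nn_integral_0_iff_AE) auto
  then have "AE t in lborel. t \<notin> {0<..<1::real}"
  proof eventually_elim
   case (elim t)
   have "0 < ?f t" if "t > 0" using that by simp
   moreover have "?f t <= 0" using elim by (simp only: ennreal_eq_0_iff)
   ultimately have "\<not> t > 0" by linarith
   then show ?case by simp
  qed
  then have "emeasure lborel {0<..<1::real} = 0" by (subst (asm) AE_iff_measurable[where N="{0<..<1}"]) auto
  then show False by simp
 qed
 then show "subordination_const n \<gamma> > 0" unfolding eq by (simp add: ennreal_eq_0_iff not_le)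
qed

text \<open>
 The heat kernel depends on \<open>\<bar>z\<bar>\<^sup>2 / t\<close> up to a power of \<open>t\<close>, so scaling time by \<open>\<bar>z\<bar>\<^sup>2\<close>
 reduces the integral to distance \<open>1\<close>. For \<open>\<gamma> = \<alpha> / 2\<close> this is the Riesz kernel, for
 \<open>\<gamma> = - \<sigma>\<close> the kernel of the Gagliardo seminorm.
\<close>

lemma heat_subordination:
 fixes z :: "real^'n::finite"
 assumes \<gamma>: "\<gamma> < real CARD('n) / 2" and z: "z \<noteq> 0"
 shows "(NN t. ennreal (pos t * (t powr (\<gamma> - 1) * heat t z))) =
  ennreal (subordination_const (real CARD('n)) \<gamma> * norm z powr (2 * \<gamma> - real CARD('n)))"
proof -
 define n where "n = real CARD('n)"
 define c where "c = (norm z)\<^sup>2"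
 have n: "n > 0" by (simp add: n_def)
 have c: "c > 0" using z by (simp add: c_def)
 let ?f = "\<lambda>t::real. pos t * (t powr (\<gamma> - 1) * ((4 * pi * t) powr (- n / 2) * exp (- (1 / (4 * t)))))"
 have "(NN t. ennreal (pos t * (t powr (\<gamma> - 1) * heat t z))) =
   ennreal c * (NN t. ennreal (pos (c * t) * ((c * t) powr (\<gamma> - 1) * heat (c * t) z)))"
  using c by (subst nn_integral_real_affine[where c=c and t=0]) auto
 also have "(NN t. ennreal (pos (c * t) * ((c * t) powr (\<gamma> - 1) * heat (c * t) z))) =
   (NN t. ennreal (c powr (\<gamma> - 1 - n / 2)) * ennreal (?f t))"
 proof (intro nn_integral_cong)
  fix t :: real
  show "ennreal (pos (c * t) * ((c * t) powr (\<gamma> - 1) * heat (c * t) z)) =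
    ennreal (c powr (\<gamma> - 1 - n / 2)) * ennreal (?f t)"
  proof (cases "t > 0")
   case True
   have h: "heat (c * t) z = c powr (- n / 2) * ((4 * pi * t) powr (- n / 2) * exp (- (1 / (4 * t))))"
   proof -
    have "4 * pi * (c * t) = c * (4 * pi * t)" by simp
    then have "(4 * pi * (c * t)) powr (- n / 2) = c powr (- n / 2) * (4 * pi * t) powr (- n / 2)"
     using c True by (simp add: powr_mult)
    moreover have "(norm z)\<^sup>2 / (4 * (c * t)) = 1 / (4 * t)" using c unfolding c_def[symmetric] by simp
    ultimately show ?thesis by (simp add: heat_def n_def mult_ac)
   qed
   have "(c * t) powr (\<gamma> - 1) * heat (c * t) z = (c powr (\<gamma> - 1) * c powr (- n / 2)) *
     (t powr (\<gamma> - 1) * ((4 * pi * t) powr (- n / 2) * exp (- (1 / (4 * t)))))"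
    unfolding h using c True by (simp add: powr_mult mult_ac)
   also have "c powr (\<gamma> - 1) * c powr (- n / 2) = c powr (\<gamma> - 1 - n / 2)"
    unfolding powr_add[symmetric] by simp
   finally show ?thesis using True c by (simp add: ennreal_mult)
  qed (use c in \<open>simp add: zero_less_mult_iff\<close>)
 qed
 also have "... = ennreal (c powr (\<gamma> - 1 - n / 2)) * ennreal (subordination_const n \<gamma>)"
  using subordination_const(1)[OF n] \<gamma> by (simp add: nn_integral_cmult n_def)
 also have "ennreal c * ... = ennreal (subordination_const n \<gamma> * (c * c powr (\<gamma> - 1 - n / 2)))"
  using c subordination_const(2)[OF n, of \<gamma>] \<gamma> by (simp add: ennreal_mult mult_ac n_def)
 also have "c * c powr (\<gamma> - 1 - n / 2) = c powr (1 + (\<gamma> - 1 - n / 2))" using c by (subst powr_add) simp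
 also have "... = norm z powr (2 * \<gamma> - n)"
 proof -
  have c2: "c = norm z powr 2" using z unfolding c_def by simp
  show ?thesis unfolding c2 powr_powr by (simp add: algebra_simps)
 qed
 finally show ?thesis by (simp add: n_def)
qed

text \<open>
 The first bound is used for small times, the second for large ones.
\<close>

lemma heat_pairing_bounds:
 fixes u w :: "real^'n::finite => real"
 assumes u: "integrable lborel u" and w: "integrable lborel w" and B: "\<And>x. \<bar>w x\<bar> <= B" and t: "t > 0"
 shows "(NN x y. ennreal (heat t (x - y) * \<bar>u y\<bar> * \<bar>w x\<bar>)) <= ennreal (B * (LBINT y. \<bar>u y\<bar>))"
  and "(NN x y. ennreal (heat t (x - y) * \<bar>u y\<bar> * \<bar>w x\<bar>)) <=
   ennreal (t powr (- real CARD('n) / 2) * ((LBINT y. \<bar>u y\<bar>) * (LBINT y. \<bar>w y\<bar>)))"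
proof -
 have [measurable]: "u \<in> borel_measurable borel" "w \<in> borel_measurable borel" using u w by auto
 have B0: "B >= 0" using B[of 0] abs_ge_zero[of "w 0"] by linarith
 have N: "(NN x. ennreal \<bar>u x\<bar>) = ennreal (LBINT x. \<bar>u x\<bar>)"
  "(NN x. ennreal \<bar>w x\<bar>) = ennreal (LBINT x. \<bar>w x\<bar>)"
  using u w by (auto intro!: nn_integral_eq_integral)
 have H: "(NN x. ennreal (heat t (x - y))) = 1" for y :: "real^'n"
  using nn_integral_translate[of "\<lambda>x. ennreal (heat t x)" y] heat_nn_integral[OF t] by simp
 have "(NN x y. ennreal (heat t (x - y) * \<bar>u y\<bar> * \<bar>w x\<bar>)) <=
   (NN x y. ennreal (heat t (x - y)) * ennreal (\<bar>u y\<bar> * B))"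
 proof (intro nn_integral_mono)
  fix x y
  have "heat t (x - y) * \<bar>u y\<bar> * \<bar>w x\<bar> <= heat t (x - y) * \<bar>u y\<bar> * B" using B by (intro mult_left_mono) auto
  then show "ennreal (heat t (x - y) * \<bar>u y\<bar> * \<bar>w x\<bar>) <= ennreal (heat t (x - y)) * ennreal (\<bar>u y\<bar> * B)"
   using B0 by (subst ennreal_mult[symmetric]) (auto intro!: ennreal_leI simp: mult.assoc)
 qed
 also have "... = (NN y x. ennreal (heat t (x - y)) * ennreal (\<bar>u y\<bar> * B))"
  by (rule Tonelli_swap) measurable
 also have "... = (NN y. ennreal (\<bar>u y\<bar> * B))" by (simp add: nn_integral_multc H)
 also have "... = ennreal (B * (LBINT y. \<bar>u y\<bar>))"
  using B0 by (simp add: ennreal_mult nn_integral_cmult N mult.commute)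
 finally show "(NN x y. ennreal (heat t (x - y) * \<bar>u y\<bar> * \<bar>w x\<bar>)) <= ennreal (B * (LBINT y. \<bar>u y\<bar>))" .
 have "(NN x y. ennreal (heat t (x - y) * \<bar>u y\<bar> * \<bar>w x\<bar>)) <=
   (NN x y. ennreal (t powr (- real CARD('n) / 2)) * ennreal \<bar>w x\<bar> * ennreal \<bar>u y\<bar>)"
 proof (intro nn_integral_mono)
  fix x y
  have "heat t (x - y) * (\<bar>u y\<bar> * \<bar>w x\<bar>) <= t powr (- real CARD('n) / 2) * (\<bar>u y\<bar> * \<bar>w x\<bar>)"
   using heat_le[OF t, of "x - y"] by (intro mult_right_mono) auto
  then show "ennreal (heat t (x - y) * \<bar>u y\<bar> * \<bar>w x\<bar>) <= ennreal (t powr (- real CARD('n) / 2)) * ennreal \<bar>w x\<bar> * ennreal \<bar>u y\<bar>"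
   by (simp add: ennreal_mult[symmetric] ennreal_leI mult_ac)
 qed
 also have "... = ennreal (t powr (- real CARD('n) / 2) * ((LBINT y. \<bar>u y\<bar>) * (LBINT y. \<bar>w y\<bar>)))"
  by (simp add: nn_integral_cmult nn_integral_multc N ennreal_mult mult_ac)
 finally show "(NN x y. ennreal (heat t (x - y) * \<bar>u y\<bar> * \<bar>w x\<bar>)) <=
   ennreal (t powr (- real CARD('n) / 2) * ((LBINT y. \<bar>u y\<bar>) * (LBINT y. \<bar>w y\<bar>)))" .
qed

text \<open>
 Tested with a bounded integrable function, the Riesz potential is an absolutely convergent
 superposition of heat flows. All identities for Riesz potentials are derived from this
 one, which avoids pointwise questions at points where the potential diverges.
\<close>

lemma riesz_pairing:
 fixes u w :: "real^'n::finite => real"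
 assumes \<alpha>: "0 < \<alpha>" "\<alpha> < 1" and u: "integrable lborel u" and w: "integrable lborel w" and B: "\<And>x. \<bar>w x\<bar> <= B"
 defines "C \<equiv> riesz_const (real CARD('n)) \<alpha> / subordination_const (real CARD('n)) (\<alpha> / 2)"
 defines "J \<equiv> \<lambda>t. pos t * (t powr (\<alpha> / 2 - 1) * (LBINT y. u y * (LBINT x. heat t (x - y) * w x)))"
 shows "integrable lborel (\<lambda>x. riesz_potential \<alpha> u x * w x)"
  and "integrable lborel J"
  and "(LBINT x. riesz_potential \<alpha> u x * w x) = C * (LBINT t. J t)"
proof -
 have [measurable]: "u \<in> borel_measurable borel" "w \<in> borel_measurable borel" using u w by auto
 define n where "n = real CARD('n)"
 have n1: "n >= 1" by (simp add: n_def Suc_leI)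
 define k where "k = subordination_const n (\<alpha> / 2)"
 have k: "k > 0" unfolding k_def using n1 \<alpha> by (intro subordination_const) auto
 have B0: "B >= 0" using B[of 0] abs_ge_zero[of "w 0"] by linarith
 define c where "c t = pos t * t powr (\<alpha> / 2 - 1)" for t :: real
 have c0: "c t >= 0" for t by (simp add: c_def)
 have [measurable]: "c \<in> borel_measurable borel" unfolding c_def by measurable
 define f where "f t x y = c t * (heat t (x - y) * u y * w x)" for t :: real and x y :: "real^'n"
 have m: "(\<lambda>(t, x, y). f t x y) \<in> borel_measurable (lborel \<Otimes>\<^sub>M lborel2)"
  unfolding f_def by measurable
 define U where "U = (LBINT y. \<bar>u y\<bar>)"
 define Wn where "Wn = (LBINT y. \<bar>w y\<bar>)"
 have UW: "U >= 0" "Wn >= 0" by (auto simp: U_def Wn_def)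
 have tb: "(NN x y. ennreal \<bar>f t x y\<bar>) <=
   ennreal (B * U) * ennreal (indicator {0<..<1} t * t powr (\<alpha> / 2 - 1)) +
   ennreal (U * Wn) * ennreal (indicator {1..} t * t powr (\<alpha> / 2 - 1 - n / 2))" for t
 proof (cases "t > 0")
  case True
  have fe: "ennreal \<bar>f t x y\<bar> = ennreal (t powr (\<alpha> / 2 - 1)) * ennreal (heat t (x - y) * \<bar>u y\<bar> * \<bar>w x\<bar>)" for x y
   using True by (simp add: f_def c_def abs_mult ennreal_mult)
  have I: "(NN x y. ennreal \<bar>f t x y\<bar>) = ennreal (t powr (\<alpha> / 2 - 1)) *
    (NN x y. ennreal (heat t (x - y) * \<bar>u y\<bar> * \<bar>w x\<bar>))"
   unfolding fe by (simp add: nn_integral_cmult)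
  note b = heat_pairing_bounds[OF u w B True, folded U_def Wn_def n_def]
  show ?thesis
  proof (cases "t < 1")
   case t1: True
   have "(NN x y. ennreal \<bar>f t x y\<bar>) <= ennreal (t powr (\<alpha> / 2 - 1)) * ennreal (B * U)"
    unfolding I by (intro mult_left_mono b(1)) auto
   then show ?thesis using t1 True by (simp add: mult.commute)
  next
   case False
   have "(NN x y. ennreal \<bar>f t x y\<bar>) <=
     ennreal (t powr (\<alpha> / 2 - 1)) * ennreal (t powr (- n / 2) * (U * Wn))"
    unfolding I by (intro mult_left_mono b(2)) auto
   also have "... = ennreal (U * Wn) * ennreal (t powr (\<alpha> / 2 - 1) * t powr (- n / 2))"
    using UW by (simp add: ennreal_mult[symmetric] mult_ac)
   also have "t powr (\<alpha> / 2 - 1) * t powr (- n / 2) = t powr (\<alpha> / 2 - 1 - n / 2)"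
    unfolding powr_add[symmetric] by simp
   finally show ?thesis using False by simp
  qed
 qed (simp add: f_def c_def)
 have "(NN t x y. ennreal \<bar>f t x y\<bar>) <=
   (NN t. ennreal (B * U) * ennreal (indicator {0<..<1} t * t powr (\<alpha> / 2 - 1)) +
   ennreal (U * Wn) * ennreal (indicator {1..} t * t powr (\<alpha> / 2 - 1 - n / 2)))"
  by (intro nn_integral_mono tb)
 also have "... <= ennreal (B * U) * ennreal (1 / (\<alpha> / 2 - 1 + 1)) + ennreal (U * Wn) * ennreal (1 / (- (\<alpha> / 2 - 1 - n / 2 + 1)))"
  by (rule nn_integral_powers_le) (use \<alpha> n1 in auto)
 also have "... < \<infinity>" by (simp add: ennreal_mult_less_top)
 finally have fin: "(NN t x y. ennreal \<bar>f t x y\<bar>) < \<infinity>" .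
 have time: "(LBINT t. f t x y) = k * (u y / norm (x - y) powr (n - \<alpha>) * w x)" if "y \<noteq> x" for x y
 proof -
  have "(NN t. ennreal (c t * heat t (x - y))) = ennreal (k * norm (x - y) powr (\<alpha> - n))"
  proof -
   have "\<alpha> / 2 < real CARD('n) / 2" using n1 \<alpha> unfolding n_def by linarith
   from heat_subordination[OF this, of "x - y"] that show ?thesis by (simp add: c_def k_def n_def mult.assoc)
  qed
  then have "(LBINT t. c t * heat t (x - y)) = k * norm (x - y) powr (\<alpha> - n)"
   using c0 k by (subst integral_eq_nn_integral) auto
  then have "(LBINT t. (c t * heat t (x - y)) * (u y * w x)) = (k * norm (x - y) powr (\<alpha> - n)) * (u y * w x)"
   by simp
  moreover have "norm (x - y) powr (\<alpha> - n) = 1 / norm (x - y) powr (n - \<alpha>)"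
   using powr_minus_divide[of "norm (x - y)" "n - \<alpha>"] by simp
  ultimately show ?thesis by (simp add: f_def mult_ac)
 qed
 have inner: "(LBINT y. LBINT t. f t x y) = k * ((LBINT y. u y / norm (x - y) powr (n - \<alpha>)) * w x)" for x
 proof -
  have "(LBINT y. LBINT t. f t x y) = (LBINT y. k * (u y / norm (x - y) powr (n - \<alpha>) * w x))"
  proof (rule integral_cong_AE)
   show "(\<lambda>y. LBINT t. f t x y) \<in> borel_measurable lborel" unfolding f_def by measurable
   have "AE y in lborel. y \<noteq> x" by (rule AE_lborel_singleton)
   then show "AE y in lborel. (LBINT t. f t x y) = k * (u y / norm (x - y) powr (n - \<alpha>) * w x)"
    by eventually_elim (rule time)
  qed simp
  also have "... = k * ((LBINT y. u y / norm (x - y) powr (n - \<alpha>)) * w x)"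
   by (simp only: integral_mult_right_zero integral_mult_left_zero)
  finally show ?thesis .
 qed
 have R: "riesz_potential \<alpha> u x = riesz_const n \<alpha> * (LBINT y. u y / norm (x - y) powr (n - \<alpha>))" for x
  unfolding riesz_potential_def n_def by (subst integral_completion) auto
 have Rk: "riesz_potential \<alpha> u x * w x = C * (LBINT y. LBINT t. f t x y)" for x
  unfolding inner R C_def k_def[symmetric] n_def[symmetric] using k by simp
 show "integrable lborel (\<lambda>x. riesz_potential \<alpha> u x * w x)"
  unfolding Rk by (intro integrable_mult_right integrable_pair_fst(1) Fubini_triple(1)[OF m fin])
 have Jf: "(LBINT x. LBINT y. f t x y) = J t" for t
 proof (cases "t > 0")
  case True
  have "(LBINT y. f t x y) = c t * ((LBINT y. u y * heat t (x - y)) * w x)" for x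
  proof -
   have "f t x y = c t * ((u y * heat t (x - y)) * w x)" for y by (simp add: f_def)
   then show ?thesis by (simp only: integral_mult_right_zero integral_mult_left_zero)
  qed
  then have "(LBINT x. LBINT y. f t x y) = c t * (LBINT x. (LBINT y. u y * heat t (x - y)) * w x)"
   by simp
  also have "(LBINT x. (LBINT y. u y * heat t (x - y)) * w x) = (LBINT y. u y * (LBINT x. heat t (x - y) * w x))"
   using convolution_pairing[OF u w, of "heat t" "t powr (- real CARD('n) / 2)"] heat_le[OF True, where 'n='n] by simp
  finally show ?thesis by (simp add: J_def c_def mult.assoc)
 qed (simp add: f_def J_def c_def)
 show "integrable lborel J" using Fubini_triple(2)[OF m fin] by (simp add: Jf)
 have "(LBINT x. riesz_potential \<alpha> u x * w x) = C * (LBINT x. LBINT y. LBINT t. f t x y)"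
  unfolding Rk by simp
 also have "... = C * (LBINT t. J t)" using Fubini_triple(3)[OF m fin] by (simp add: Jf)
 finally show "(LBINT x. riesz_potential \<alpha> u x * w x) = C * (LBINT t. J t)" .
qed

section \<open>The energy of the heat flow\<close>

definition flow_grad :: "(real^'n::finite => real) => real => real^'n => real^'n" where
 "flow_grad u t x = (LBINT y. u y *\<^sub>R heat_grad t (x - y))"

text \<open>
 This equals the square of the \<open>L\<^sup>2\<close> norm of the gradient of the heat flow at time \<open>r / 2\<close>.
\<close>

definition dissipation :: "(real^'n::finite => real) => real => real" where
 "dissipation u r = - (LBINT x. LBINT y. u x * u y * heat_dt r (x - y))"

text \<open>
 The loss of \<open>L\<^sup>2\<close> energy of the heat flow; its derivative in \<open>r\<close> is the dissipation.
\<close>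

definition defect :: "(real^'n::finite => real) => real => real" where
 "defect u r = (LBINT x. (u x)\<^sup>2) - (LBINT x. LBINT y. u x * u y * heat r (x - y))"

definition gagliardo :: "real => (real^'n::finite => real) => ennreal" where
 "gagliardo \<sigma> u = (NN x y. ennreal (\<bar>u x - u y\<bar>\<^sup>2 / norm (x - y) powr (real CARD('n) + 2 * \<sigma>)))"

lemma convolution_integrable:
 fixes a :: "'e::euclidean_space => 'c::euclidean_space"
 assumes u: "integrable lborel u" and [measurable]: "a \<in> borel_measurable borel" and a: "\<And>z. norm (a z) <= S"
 shows "integrable lborel (\<lambda>y. u y *\<^sub>R a (x - y))"
proof (rule bochner_bound)
 have [measurable]: "u \<in> borel_measurable borel" using u by auto
 have S0: "S >= 0" using a[of 0] norm_ge_zero[of "a 0"] by linarith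
 show "integrable lborel (\<lambda>y. S * u y)" using u by simp
 show "AE y in lborel. norm (u y *\<^sub>R a (x - y)) <= norm (S * u y)"
  using a S0 by (intro AE_I2) (auto simp: abs_mult mult.commute[of S] intro!: mult_left_mono)
 show "(\<lambda>y. u y *\<^sub>R a (x - y)) \<in> borel_measurable lborel" by measurable
qed

lemma heat_grad_integrable:
 assumes t: "t > 0" shows "integrable lborel (heat_grad t :: real^'n::finite => real^'n)"
proof (rule integrableI_bounded)
 show "(NN z. ennreal (norm (heat_grad t (z::real^'n)))) < \<infinity>"
  using heat_grad_nn_integral[OF t] by (rule le_less_trans) simp
qed simp

lemma flow_grad_measurable [measurable (raw)]:
 fixes g :: "'m => real^'n::finite"
 assumes [measurable]: "u \<in> borel_measurable borel" "f \<in> borel_measurable M" "g \<in> borel_measurable M"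
 shows "(\<lambda>x. flow_grad u (f x) (g x)) \<in> borel_measurable M"
 unfolding flow_grad_def by measurable

lemma dissipation_measurable [measurable (raw)]:
 assumes [measurable]: "u \<in> borel_measurable borel" "f \<in> borel_measurable M"
 shows "(\<lambda>x. dissipation u (f x)) \<in> borel_measurable M"
 unfolding dissipation_def by measurable

lemma defect_measurable [measurable (raw)]:
 assumes [measurable]: "u \<in> borel_measurable borel" "f \<in> borel_measurable M"
 shows "(\<lambda>x. defect u (f x)) \<in> borel_measurable M"
 unfolding defect_def by measurable

lemma flow_grad_le:
 fixes u :: "real^'n::finite => real"
 assumes u: "integrable lborel u" and t: "t > 0"
 shows "norm (flow_grad u t x) <= t powr (- real CARD('n) / 2 - 1 / 2) * (LBINT y. \<bar>u y\<bar>)"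
proof -
 let ?c = "t powr (- real CARD('n) / 2 - 1 / 2)"
 have "norm (flow_grad u t x) <= (LBINT y. norm (u y *\<^sub>R heat_grad t (x - y)))"
  unfolding flow_grad_def by (rule integral_norm_bound)
 also have "... <= (LBINT y. ?c * \<bar>u y\<bar>)"
 proof (rule integral_mono')
  show "norm (u y *\<^sub>R heat_grad t (x - y)) <= ?c * \<bar>u y\<bar>" for y
  proof -
   have "\<bar>u y\<bar> * norm (heat_grad t (x - y)) <= \<bar>u y\<bar> * ?c"
    by (rule mult_left_mono[OF heat_grad_le[OF t]]) simp
   then show ?thesis unfolding norm_scaleR by (subst mult.commute[of ?c])
  qed
 qed (use u in auto)
 finally show ?thesis by simp
qed

lemma flow_grad_nn_integral:
 fixes u :: "real^'n::finite => real"
 assumes u: "integrable lborel u" and t: "t > 0"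
 shows "(NN x. ennreal (norm (flow_grad u t x))) <=
  ennreal ((LBINT y. \<bar>u y\<bar>) * ((real CARD('n) + 1) / sqrt t))"
proof -
 have [measurable]: "u \<in> borel_measurable borel" using u by auto
 have "(NN x. ennreal (norm (flow_grad u t x))) <=
   (NN x y. ennreal \<bar>u y\<bar> * ennreal (norm (heat_grad t (x - y))))"
 proof (intro nn_integral_mono)
  fix x :: "real^'n"
  have "ennreal (norm (flow_grad u t x)) <= (NN y. ennreal (norm (u y *\<^sub>R heat_grad t (x - y))))"
   unfolding flow_grad_def
   using heat_grad_le[OF t] by (intro integral_norm_bound_ennreal convolution_integrable[OF u]) auto
  then show "ennreal (norm (flow_grad u t x)) <= (NN y. ennreal \<bar>u y\<bar> * ennreal (norm (heat_grad t (x - y))))"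
   by (simp add: ennreal_mult)
 qed
 also have "... = (NN y x. ennreal \<bar>u y\<bar> * ennreal (norm (heat_grad t (x - y))))"
  by (rule Tonelli_swap) measurable
 also have "... = (NN y. ennreal \<bar>u y\<bar> * (NN x. ennreal (norm (heat_grad t (x::real^'n)))))"
 proof (intro nn_integral_cong)
  fix y :: "real^'n"
  have "(NN x. ennreal (norm (heat_grad t (x - y)))) = (NN x. ennreal (norm (heat_grad t (x::real^'n))))"
   by (rule nn_integral_translate) simp
  then show "(NN x. ennreal \<bar>u y\<bar> * ennreal (norm (heat_grad t (x - y)))) =
    ennreal \<bar>u y\<bar> * (NN x. ennreal (norm (heat_grad t (x::real^'n))))"
   by (simp add: nn_integral_cmult)
 qed
 also have "... <= (NN y. ennreal \<bar>u y\<bar> * ennreal ((real CARD('n) + 1) / sqrt t))"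
  by (intro nn_integral_mono mult_left_mono heat_grad_nn_integral[OF t]) auto
 also have "... = ennreal (LBINT y. \<bar>u y\<bar>) * ennreal ((real CARD('n) + 1) / sqrt t)"
  using u by (simp add: nn_integral_multc nn_integral_eq_integral)
 also have "... = ennreal ((LBINT y. \<bar>u y\<bar>) * ((real CARD('n) + 1) / sqrt t))"
  by (rule ennreal_mult[symmetric]) (use t in auto)
 finally show ?thesis .
qed

text \<open>
 The semigroup law: the correlation depends on \<open>t + s\<close> only.
\<close>

lemma flow_grad_inner:
 fixes u :: "real^'n::finite => real"
 assumes u: "integrable lborel u" and t: "t > 0" and s: "s > 0"
 shows "(LBINT x. flow_grad u t x \<bullet> flow_grad u s x) = dissipation u (t + s)"
proof -
 have [measurable]: "u \<in> borel_measurable borel" using u by auto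
 have W: "integrable lborel (flow_grad u s)"
 proof (rule integrableI_bounded)
  show "(NN x. ennreal (norm (flow_grad u s x))) < \<infinity>"
   using flow_grad_nn_integral[OF u s] by (rule le_less_trans) simp
 qed measurable
 have inner: "(LBINT x. heat_grad t (x - y) \<bullet> flow_grad u s x) = - (LBINT y'. u y' * heat_dt (t + s) (y - y'))" for y
 proof -
  have w: "integrable lborel (\<lambda>x. heat_grad t (x - y))"
   using lborel_integral_translate(2)[of "heat_grad t" y] heat_grad_integrable[OF t, where 'n='n] by simp
  have "heat_grad t (x - y) \<bullet> flow_grad u s x = flow_grad u s x \<bullet> heat_grad t (x - y)" for x by (rule inner_commute)
  then have "(LBINT x. heat_grad t (x - y) \<bullet> flow_grad u s x) = (LBINT x. flow_grad u s x \<bullet> heat_grad t (x - y))" by simp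
  also have "... = (LBINT y'. u y' * (LBINT x. heat_grad s (x - y') \<bullet> heat_grad t (x - y)))"
   unfolding flow_grad_def by (rule convolution_pairing[OF u w _ heat_grad_le[OF s]]) measurable
  also have "... = (LBINT y'. - (u y' * heat_dt (t + s) (y - y')))"
   using heat_dt_minus[of "t + s" "y - _"] by (simp add: heat_convolution_grad[OF s t] add.commute)
  finally show ?thesis by simp
 qed
 have "(LBINT x. flow_grad u t x \<bullet> flow_grad u s x) = (LBINT y. u y * (LBINT x. heat_grad t (x - y) \<bullet> flow_grad u s x))"
  unfolding flow_grad_def[of u t] by (rule convolution_pairing[OF u W _ heat_grad_le[OF t]]) measurable
 then show ?thesis by (simp add: inner dissipation_def mult.assoc)
qed

lemma dissipation_nonneg:
 fixes u :: "real^'n::finite => real"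
 assumes u: "integrable lborel u" and r: "r > 0"
 shows "dissipation u r >= 0"
proof -
 have "(LBINT x. flow_grad u (r / 2) x \<bullet> flow_grad u (r / 2) x) = dissipation u r"
  using flow_grad_inner[OF u, of "r / 2" "r / 2"] r by simp
 moreover have "0 <= (LBINT x. flow_grad u (r / 2) x \<bullet> flow_grad u (r / 2) x)"
  by (rule Bochner_Integration.integral_nonneg) simp
 ultimately show ?thesis by simp
qed

lemma heat_pair_integrable:
 fixes u :: "real^'n::finite => real"
 assumes u: "integrable lborel u" and r: "r > 0"
 shows "integrable lborel2 (\<lambda>(x, y). u x * u y * heat r (x - y))"
proof (rule integrable_pairI)
 have [measurable]: "u \<in> borel_measurable borel" using u by auto
 show "(\<lambda>(x, y). u x * u y * heat r (x - y)) \<in> borel_measurable lborel2" by measurable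
 have "(NN x y. ennreal \<bar>u x * u y * heat r (x - y)\<bar>) <=
   (NN x y. ennreal (r powr (- real CARD('n) / 2)) * ennreal \<bar>u x\<bar> * ennreal \<bar>u y\<bar>)"
 proof (intro nn_integral_mono)
  fix x y
  have "\<bar>u x * u y\<bar> * heat r (x - y) <= \<bar>u x * u y\<bar> * r powr (- real CARD('n) / 2)"
   by (intro mult_left_mono heat_le r) auto
  then have "\<bar>u x * u y * heat r (x - y)\<bar> <= r powr (- real CARD('n) / 2) * \<bar>u x\<bar> * \<bar>u y\<bar>"
   by (simp add: abs_mult mult_ac)
  then show "ennreal \<bar>u x * u y * heat r (x - y)\<bar> <= ennreal (r powr (- real CARD('n) / 2)) * ennreal \<bar>u x\<bar> * ennreal \<bar>u y\<bar>"
   by (simp add: ennreal_mult[symmetric] ennreal_leI)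
 qed
 also have "... = ennreal (r powr (- real CARD('n) / 2)) * (NN x. ennreal \<bar>u x\<bar>) * (NN x. ennreal \<bar>u x\<bar>)"
  by (simp add: nn_integral_cmult nn_integral_multc)
 also have "... < \<infinity>" using u by (auto simp: integrable_iff_bounded ennreal_mult_less_top)
 finally show "(NN x y. ennreal \<bar>u x * u y * heat r (x - y)\<bar>) < \<infinity>" .
qed

lemma isCont_heat_dt: "t > 0 ==> isCont (\<lambda>t. heat_dt t (z::real^'n::finite)) t"
 unfolding heat_dt_def heat_def by (auto intro!: continuous_intros)

text \<open>
 The fundamental theorem of calculus for each heat kernel value, integrated against
 \<open>u x * u y\<close>.
\<close>

lemma defect_diff:
 fixes u :: "real^'n::finite => real"
 assumes u: "integrable lborel u" and r: "0 < r" "r <= s"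
 shows "integrable lborel (\<lambda>\<tau>. indicator {r..s} \<tau> * dissipation u \<tau>)"
  and "(LBINT \<tau>. indicator {r..s} \<tau> * dissipation u \<tau>) = defect u s - defect u r"
proof -
 have [measurable]: "u \<in> borel_measurable borel" using u by auto
 define f where "f \<tau> x y = indicator {r..s} \<tau> * (u x * u y * heat_dt \<tau> (x - y))" for \<tau> :: real and x y :: "real^'n"
 have m: "(\<lambda>(\<tau>, x, y). f \<tau> x y) \<in> borel_measurable (lborel \<Otimes>\<^sub>M lborel2)"
  unfolding f_def by measurable
 define M where "M = (1 + real CARD('n) / 2) * r powr (- real CARD('n) / 2 - 1)"
 have M0: "M >= 0" by (simp add: M_def)
 have dtM: "\<bar>heat_dt \<tau> (z::real^'n)\<bar> <= M" if "\<tau> \<in> {r..s}" for \<tau> z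
 proof -
  have "\<bar>heat_dt \<tau> z\<bar> <= (1 + real CARD('n) / 2) * \<tau> powr (- real CARD('n) / 2 - 1)"
   using that r by (intro heat_dt_le) auto
  also have "... <= M" unfolding M_def
   using that r by (intro mult_left_mono powr_mono2') auto
  finally show ?thesis .
 qed
 have fle: "ennreal \<bar>f \<tau> x y\<bar> <= ennreal (M * indicator {r..s} \<tau>) * ennreal \<bar>u x\<bar> * ennreal \<bar>u y\<bar>" for \<tau> x y
 proof -
  have "\<bar>f \<tau> x y\<bar> <= (M * indicator {r..s} \<tau>) * \<bar>u x\<bar> * \<bar>u y\<bar>"
  proof (cases "\<tau> \<in> {r..s}")
   case True
   have "\<bar>u x * u y\<bar> * \<bar>heat_dt \<tau> (x - y)\<bar> <= \<bar>u x * u y\<bar> * M"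
    using dtM[OF True] by (intro mult_left_mono) auto
   then show ?thesis using True by (simp add: f_def abs_mult mult_ac)
  qed (simp add: f_def)
  from ennreal_leI[OF this] show ?thesis using M0 by (simp add: ennreal_mult)
 qed
 have "(NN \<tau> x y. ennreal \<bar>f \<tau> x y\<bar>) <=
   (NN \<tau> x y. ennreal (M * indicator {r..s} \<tau>) * ennreal \<bar>u x\<bar> * ennreal \<bar>u y\<bar>)"
  by (intro nn_integral_mono fle)
 also have "... = (NN \<tau>. ennreal (M * indicator {r..s} \<tau>)) * (NN x. ennreal \<bar>u x\<bar>) * (NN x. ennreal \<bar>u x\<bar>)"
  by (simp add: nn_integral_cmult nn_integral_multc)
 also have "(NN \<tau>. ennreal (M * indicator {r..s} \<tau>)) = ennreal M * ennreal (s - r)"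
  using M0 r by (simp add: ennreal_mult nn_integral_cmult ennreal_indicator)
 also have "ennreal M * ennreal (s - r) * (NN x. ennreal \<bar>u x\<bar>) * (NN x. ennreal \<bar>u x\<bar>) < \<infinity>"
  using u by (auto simp: integrable_iff_bounded ennreal_mult_less_top)
 finally have fin: "(NN \<tau> x y. ennreal \<bar>f \<tau> x y\<bar>) < \<infinity>" .
 have A: "(LBINT x. LBINT y. f \<tau> x y) = - (indicator {r..s} \<tau> * dissipation u \<tau>)" for \<tau>
  by (simp add: f_def dissipation_def)
 show "integrable lborel (\<lambda>\<tau>. indicator {r..s} \<tau> * dissipation u \<tau>)"
  using Fubini_triple(2)[OF m fin] unfolding A by simp
 have T: "(LBINT \<tau>. f \<tau> x y) = u x * u y * heat s (x - y) - u x * u y * heat r (x - y)" for x y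
 proof -
  have "(LBINT \<tau>. heat_dt \<tau> (x - y) * indicator {r..s} \<tau>) = heat s (x - y) - heat r (x - y)"
  proof (rule integral_FTC_Icc_real[OF r(2)])
   show "((\<lambda>t. heat t (x - y)) has_real_derivative heat_dt \<tau> (x - y)) (at \<tau>)" if "r <= \<tau>" "\<tau> <= s" for \<tau>
    using that r by (intro heat_has_dt) auto
   show "isCont (\<lambda>\<tau>. heat_dt \<tau> (x - y)) \<tau>" if "r <= \<tau>" "\<tau> <= s" for \<tau>
    using that r by (intro isCont_heat_dt) auto
  qed
  moreover have "f \<tau> x y = (u x * u y) * (heat_dt \<tau> (x - y) * indicator {r..s} \<tau>)" for \<tau>
   by (simp add: f_def)
  ultimately show ?thesis by (simp add: right_diff_distrib)
 qed
 have "- (LBINT \<tau>. indicator {r..s} \<tau> * dissipation u \<tau>) = (LBINT \<tau>. LBINT x. LBINT y. f \<tau> x y)"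
  unfolding A by simp
 also have "... = (LBINT x. LBINT y. u x * u y * heat s (x - y) - u x * u y * heat r (x - y))"
  unfolding Fubini_triple(3)[OF m fin] T ..
 also have "... = (LBINT x. LBINT y. u x * u y * heat s (x - y)) - (LBINT x. LBINT y. u x * u y * heat r (x - y))"
 proof -
  have s0: "s > 0" using r by simp
  note I = heat_pair_integrable[OF u s0] heat_pair_integrable[OF u r(1)]
  have d: "integrable lborel2 (\<lambda>(x, y). u x * u y * heat s (x - y) - u x * u y * heat r (x - y))"
   using Bochner_Integration.integrable_diff[OF I] by (simp add: case_prod_beta')
  show ?thesis
   using integrable_pair_fst(3)[OF d] integrable_pair_fst(3)[OF I(1)] integrable_pair_fst(3)[OF I(2)]
    Bochner_Integration.integral_diff[OF I] by (simp add: case_prod_beta')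
 qed
 finally show "(LBINT \<tau>. indicator {r..s} \<tau> * dissipation u \<tau>) = defect u s - defect u r"
  by (simp add: defect_def)
qed

lemma defect_mono:
 fixes u :: "real^'n::finite => real"
 assumes u: "integrable lborel u" and r: "0 < r" "r <= s"
 shows "defect u r <= defect u s"
proof -
 have "0 <= (LBINT \<tau>. indicator {r..s} \<tau> * dissipation u \<tau>)"
  using r dissipation_nonneg[OF u] by (intro Bochner_Integration.integral_nonneg) (auto simp: indicator_def)
 then show ?thesis using defect_diff(2)[OF u r] by simp
qed

lemma heat_reflect_integral: "t > 0 ==> (NN y. ennreal (heat t (x - y))) = 1"
 for x :: "real^'n::finite"
 using nn_integral_reflect[of "\<lambda>y. ennreal (heat t y)" x] heat_nn_integral[of t, where 'n='n] by simp

lemma heat_translate_integral: "t > 0 ==> (NN x. ennreal (heat t (x - y))) = 1"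
 for y :: "real^'n::finite"
 using nn_integral_translate[of "\<lambda>y. ennreal (heat t y)" y] heat_nn_integral[of t, where 'n='n] by simp

text \<open>
 The heat kernel has mass \<open>1\<close>, so expanding the square leaves twice the defect.
\<close>

lemma defect_eq:
 fixes u :: "real^'n::finite => real"
 assumes u: "integrable lborel u" and u2: "integrable lborel (\<lambda>x. (u x)\<^sup>2)" and r: "r > 0"
 shows "(NN x y. ennreal ((u x - u y)\<^sup>2 * heat r (x - y))) = ennreal (2 * defect u r)"
  and "defect u r >= 0"
proof -
 have [measurable]: "u \<in> borel_measurable borel" using u by auto
 let ?P = "lborel \<Otimes>\<^sub>M lborel :: ((real^'n) \<times> (real^'n)) measure"
 have U: "(NN x. ennreal ((u x)\<^sup>2)) = ennreal (LBINT x. (u x)\<^sup>2)"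
  using u2 by (intro nn_integral_eq_integral) auto
 have n1: "(NN x y. ennreal ((u x)\<^sup>2 * heat r (x - y))) = ennreal (LBINT x. (u x)\<^sup>2)"
  by (simp add: ennreal_mult nn_integral_cmult heat_reflect_integral[OF r] U)
 have n2: "(NN x y. ennreal ((u y)\<^sup>2 * heat r (x - y))) = ennreal (LBINT x. (u x)\<^sup>2)"
  by (subst Tonelli_swap) (auto simp: ennreal_mult nn_integral_cmult heat_translate_integral[OF r] U)
 have conv: "integrable ?P (case_prod g) \<and> (LINT p|?P. case_prod g p) = c"
  if [measurable]: "case_prod g \<in> borel_measurable ?P" and g0: "\<And>x y. g x y >= 0" and c: "c >= 0"
   and e: "(NN x y. ennreal (g x y)) = ennreal c" for g c
 proof -
  have "(\<integral>\<^sup>+p. ennreal (case_prod g p) \<partial>?P) = ennreal c"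
   using e by (subst lborel.nn_integral_fst[symmetric]) auto
  then have "has_bochner_integral ?P (case_prod g) c"
   using g0 c by (intro has_bochner_integral_nn_integral) auto
  then show ?thesis by (simp add: has_bochner_integral_iff)
 qed
 have I1: "integrable ?P (\<lambda>(x, y). (u x)\<^sup>2 * heat r (x - y)) \<and>
   (LINT p|?P. (case p of (x, y) => (u x)\<^sup>2 * heat r (x - y))) = (LBINT x. (u x)\<^sup>2)"
  using n1 by (intro conv) auto
 have I2: "integrable ?P (\<lambda>(x, y). (u y)\<^sup>2 * heat r (x - y)) \<and>
   (LINT p|?P. (case p of (x, y) => (u y)\<^sup>2 * heat r (x - y))) = (LBINT x. (u x)\<^sup>2)"
  using n2 by (intro conv) auto
 note I3 = heat_pair_integrable[OF u r]
 have eq: "(\<lambda>(x, y). (u x - u y)\<^sup>2 * heat r (x - y)) = (\<lambda>p. (case p of (x, y) => (u x)\<^sup>2 * heat r (x - y)) +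
   (case p of (x, y) => (u y)\<^sup>2 * heat r (x - y)) - 2 * (case p of (x, y) => u x * u y * heat r (x - y)))"
  by (auto simp: fun_eq_iff power2_diff algebra_simps)
 have I: "integrable ?P (\<lambda>(x, y). (u x - u y)\<^sup>2 * heat r (x - y))"
  unfolding eq using I1 I2 I3 by (intro Bochner_Integration.integrable_diff Bochner_Integration.integrable_add integrable_mult_right) auto
 have L: "(LINT p|?P. (case p of (x, y) => (u x - u y)\<^sup>2 * heat r (x - y))) = 2 * defect u r"
  unfolding eq using I1 I2 I3 integrable_pair_fst(3)[OF I3] by (simp add: defect_def)
 have "(NN x y. ennreal ((u x - u y)\<^sup>2 * heat r (x - y))) =
   (\<integral>\<^sup>+p. ennreal (case p of (x, y) => (u x - u y)\<^sup>2 * heat r (x - y)) \<partial>?P)"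
  by (subst lborel.nn_integral_fst[symmetric]) auto
 also have "... = ennreal (2 * defect u r)"
  unfolding L[symmetric] using I by (intro nn_integral_eq_integral) auto
 finally show "(NN x y. ennreal ((u x - u y)\<^sup>2 * heat r (x - y))) = ennreal (2 * defect u r)" .
 have "0 <= (LINT p|?P. (case p of (x, y) => (u x - u y)\<^sup>2 * heat r (x - y)))"
  by (intro Bochner_Integration.integral_nonneg) auto
 then show "defect u r >= 0" using L by simp
qed

text \<open>
 Tonelli's theorem and subordination of the kernel \<open>\<bar>z\<bar>\<^bsup>-n-2\<sigma>\<^esup>\<close>.
\<close>

lemma defect_gagliardo:
 fixes u :: "real^'n::finite => real"
 assumes u: "integrable lborel u" and u2: "integrable lborel (\<lambda>x. (u x)\<^sup>2)" and \<sigma>: "\<sigma> > 0"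
 shows "(NN r. ennreal (pos r * r powr (- \<sigma> - 1)) * ennreal (2 * defect u r)) =
  ennreal (subordination_const (real CARD('n)) (- \<sigma>)) * gagliardo \<sigma> u"
proof -
 have [measurable]: "u \<in> borel_measurable borel" using u by auto
 define k where "k = subordination_const (real CARD('n)) (- \<sigma>)"
 have k: "k > 0" unfolding k_def using \<sigma> by (intro subordination_const) auto
 let ?c = "\<lambda>r::real. pos r * r powr (- \<sigma> - 1)"
 have "(NN r. ennreal (?c r) * ennreal (2 * defect u r)) =
   (NN r x y. ennreal (?c r) * ennreal ((u x - u y)\<^sup>2 * heat r (x - y)))"
 proof (intro nn_integral_cong)
  fix r :: real
  show "ennreal (?c r) * ennreal (2 * defect u r) =
    (NN x y. ennreal (?c r) * ennreal ((u x - u y)\<^sup>2 * heat r (x - y)))"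
   by (cases "r > 0") (simp_all add: nn_integral_cmult defect_eq(1)[OF u u2, symmetric])
 qed
 also have "... = (NN x r y. ennreal (?c r) * ennreal ((u x - u y)\<^sup>2 * heat r (x - y)))"
  by (rule Tonelli_swap) measurable
 also have "... = (NN x y r. ennreal (?c r) * ennreal ((u x - u y)\<^sup>2 * heat r (x - y)))"
  by (intro nn_integral_cong Tonelli_swap) measurable
 also have "... = (NN x y. ennreal k * ennreal (\<bar>u x - u y\<bar>\<^sup>2 / norm (x - y) powr (real CARD('n) + 2 * \<sigma>)))"
 proof (intro nn_integral_cong)
  fix x y :: "real^'n"
  show "(NN r. ennreal (?c r) * ennreal ((u x - u y)\<^sup>2 * heat r (x - y))) =
    ennreal k * ennreal (\<bar>u x - u y\<bar>\<^sup>2 / norm (x - y) powr (real CARD('n) + 2 * \<sigma>))"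
  proof (cases "x = y")
   case False
   have "(NN r. ennreal (?c r) * ennreal ((u x - u y)\<^sup>2 * heat r (x - y))) =
     (NN r. ennreal ((u x - u y)\<^sup>2) * ennreal (pos r * (r powr (- \<sigma> - 1) * heat r (x - y))))"
    by (intro nn_integral_cong) (simp add: ennreal_mult[symmetric] mult_ac)
   also have "... = ennreal ((u x - u y)\<^sup>2) * ennreal (k * norm (x - y) powr (2 * (- \<sigma>) - real CARD('n)))"
    using heat_subordination[of "- \<sigma>" "x - y"] False \<sigma> by (simp add: nn_integral_cmult k_def)
   also have "norm (x - y) powr (2 * (- \<sigma>) - real CARD('n)) = 1 / norm (x - y) powr (real CARD('n) + 2 * \<sigma>)"
   proof -
    have "2 * (- \<sigma>) - real CARD('n) = - (real CARD('n) + 2 * \<sigma>)" by simp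
    then show ?thesis by (simp only: powr_minus_divide)
   qed
   finally show ?thesis using k by (simp add: ennreal_mult[symmetric])
  qed simp
 qed
 also have "... = ennreal k * gagliardo \<sigma> u"
  unfolding gagliardo_def by (simp add: nn_integral_cmult)
 finally show ?thesis by (simp add: k_def)
qed

text \<open>
 The defect is increasing, so its value at \<open>r\<close> is at most its average over \<open>(r, 2r)\<close>, which
 the weighted integral controls. In particular the defect vanishes at time \<open>0\<close>.
\<close>

lemma defect_powr_bound:
 fixes u :: "real^'n::finite => real"
 assumes u: "integrable lborel u" and u2: "integrable lborel (\<lambda>x. (u x)\<^sup>2)" and \<sigma>: "\<sigma> > 0"
  and fin: "gagliardo \<sigma> u < \<infinity>"
 obtains K where "\<And>r. r > 0 ==> defect u r <= K * r powr \<sigma>"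
proof -
 have [measurable]: "u \<in> borel_measurable borel" using u by auto
 define I where "I = (NN r. ennreal (pos r * r powr (- \<sigma> - 1)) * ennreal (2 * defect u r))"
 have "I < \<infinity>" unfolding I_def defect_gagliardo[OF u u2 \<sigma>] using fin by (simp add: ennreal_mult_less_top)
 then obtain K where K: "K >= 0" "I = ennreal K" by (metis ennreal_cases infinity_ennreal_def less_irrefl)
 have "defect u r <= (K * 2 powr \<sigma>) * r powr \<sigma>" if r: "r > 0" for r
 proof -
  have d0: "defect u r >= 0" by (rule defect_eq(2)[OF u u2 r])
  have "ennreal ((2 * r) powr (- \<sigma> - 1) * (2 * defect u r)) * ennreal r =
    (NN \<tau>. ennreal ((2 * r) powr (- \<sigma> - 1) * (2 * defect u r)) * indicator {r..2 * r} \<tau>)"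
   using r by (subst nn_integral_cmult_indicator) auto
  also have "... <= I" unfolding I_def
  proof (intro nn_integral_mono)
   fix \<tau> :: real
   show "ennreal ((2 * r) powr (- \<sigma> - 1) * (2 * defect u r)) * indicator {r..2 * r} \<tau> <=
     ennreal (pos \<tau> * \<tau> powr (- \<sigma> - 1)) * ennreal (2 * defect u \<tau>)"
   proof (cases "\<tau> \<in> {r..2 * r}")
    case True
    have "(2 * r) powr (- \<sigma> - 1) * (2 * defect u r) <= \<tau> powr (- \<sigma> - 1) * (2 * defect u \<tau>)"
     using True r \<sigma> d0 defect_mono[OF u, of r \<tau>] by (intro mult_mono powr_mono2') auto
    then have "ennreal ((2 * r) powr (- \<sigma> - 1) * (2 * defect u r)) <= ennreal (\<tau> powr (- \<sigma> - 1)) * ennreal (2 * defect u \<tau>)"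
     by (subst ennreal_mult[symmetric])
      (use True r defect_eq(2)[OF u u2, of \<tau>] in \<open>auto intro: ennreal_leI\<close>)
    then show ?thesis using True r by simp
   qed simp
  qed
  finally have "ennreal ((2 * r) powr (- \<sigma> - 1) * (2 * defect u r) * r) <= ennreal K"
   using d0 r K by (simp add: ennreal_mult)
  then have le: "(2 * r) powr (- \<sigma> - 1) * (2 * r) * defect u r <= K" using K by (simp add: mult_ac)
  have "(2 * r) powr (- \<sigma> - 1) * (2 * r) = (2 * r) powr (- \<sigma> - 1 + 1)" using r by (subst powr_add) auto
  then have "(2 * r) powr (- \<sigma>) * defect u r <= K" using le by simp
  then have "(2 * r) powr \<sigma> * ((2 * r) powr (- \<sigma>) * defect u r) <= (2 * r) powr \<sigma> * K"
   by (intro mult_left_mono) auto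
  moreover have "(2 * r) powr \<sigma> * (2 * r) powr (- \<sigma>) = 1" using r by (simp add: powr_minus)
  ultimately have "defect u r <= (2 * r) powr \<sigma> * K" by (metis mult.assoc mult_1)
  then show ?thesis using r by (simp add: powr_mult mult_ac)
 qed
 then show ?thesis using that by blast
qed

lemma defect_nn_integral:
 fixes u :: "real^'n::finite => real"
 assumes u: "integrable lborel u" and u2: "integrable lborel (\<lambda>x. (u x)\<^sup>2)" and \<sigma>: "\<sigma> > 0"
  and fin: "gagliardo \<sigma> u < \<infinity>" and s: "s > 0"
 shows "(NN \<tau>. ennreal (indicator {0<..s} \<tau> * dissipation u \<tau>)) = ennreal (defect u s)"
proof -
 have [measurable]: "u \<in> borel_measurable borel" using u by auto
 obtain K where K: "\<And>r. r > 0 ==> defect u r <= K * r powr \<sigma>"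
  using defect_powr_bound[OF u u2 \<sigma> fin] by blast
 define r where "r k = s / real (Suc k)" for k
 have r: "0 < r k" "r k <= s" for k using s by (auto simp: r_def field_simps)
 have r_dec: "r (Suc k) <= r k" for k using s by (auto simp: r_def intro!: divide_left_mono)
 have r_lim: "r ----> 0"
 proof -
  have "(\<lambda>k. s * (1 / real (Suc k))) ----> s * 0" by (intro tendsto_intros LIMSEQ_Suc[OF lim_1_over_n])
  then show ?thesis by (simp add: r_def[abs_def])
 qed
 have d_lim: "(\<lambda>k. defect u (r k)) ----> 0"
 proof (rule tendsto_sandwich[of "\<lambda>_. 0" _ _ "\<lambda>k. K * r k powr \<sigma>"])
  have "(\<lambda>k. r k powr \<sigma>) ----> 0"
   using r_lim \<sigma> r by (intro tendsto_zero_powrI) (auto intro: eventuallyI less_imp_le)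
  then show "(\<lambda>k. K * r k powr \<sigma>) ----> 0" using tendsto_mult_right_zero by blast
 qed (use K r defect_eq(2)[OF u u2] in \<open>auto intro!: eventuallyI\<close>)
 have "(\<lambda>k. (NN \<tau>. ennreal (indicator {r k..s} \<tau> * dissipation u \<tau>))) ---->
   (NN \<tau>. ennreal (indicator {0<..s} \<tau> * dissipation u \<tau>))"
 proof (rule nn_integral_LIMSEQ)
  show "incseq (\<lambda>k \<tau>. ennreal (indicator {r k..s} \<tau> * dissipation u \<tau>))"
  proof (intro incseq_SucI le_funI ennreal_leI)
   fix k and \<tau> :: real
   show "indicator {r k..s} \<tau> * dissipation u \<tau> <= indicator {r (Suc k)..s} \<tau> * dissipation u \<tau>"
    using r_dec[of k] r(1)[of "Suc k"] dissipation_nonneg[OF u, of \<tau>] by (auto simp: indicator_def)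
  qed
  show "(\<lambda>k. ennreal (indicator {r k..s} \<tau> * dissipation u \<tau>)) ----> ennreal (indicator {0<..s} \<tau> * dissipation u \<tau>)" for \<tau>
  proof (cases "\<tau> > 0")
   case True
   have "eventually (\<lambda>k. r k < \<tau>) sequentially" using r_lim True by (rule order_tendstoD)
   then have "eventually (\<lambda>k. ennreal (indicator {r k..s} \<tau> * dissipation u \<tau>) = ennreal (indicator {0<..s} \<tau> * dissipation u \<tau>)) sequentially"
    by eventually_elim (use True in \<open>auto simp: indicator_def\<close>)
   then show ?thesis by (rule tendsto_eventually)
  next
   case False
   have "\<tau> \<notin> {r k..s}" for k using False r(1)[of k] by auto
   then show ?thesis using False by (simp del: atLeastAtMost_iff)
  qed
 qed measurable
 moreover have "(NN \<tau>. ennreal (indicator {r k..s} \<tau> * dissipation u \<tau>)) = ennreal (defect u s - defect u (r k))" for k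
  unfolding defect_diff(2)[OF u r, symmetric]
  using defect_diff(1)[OF u r] r(1)[of k] dissipation_nonneg[OF u]
  by (intro nn_integral_eq_integral AE_I2) (auto simp: indicator_def)
 moreover have "(\<lambda>k. ennreal (defect u s - defect u (r k))) ----> ennreal (defect u s - 0)"
  by (intro tendsto_ennrealI tendsto_intros d_lim)
 ultimately show ?thesis using LIMSEQ_unique by fastforce
qed

text \<open>
 The total dissipation, weighted by a power of time, is the Gagliardo seminorm: integrate by
 parts in time.
\<close>

lemma dissipation_gagliardo:
 fixes u :: "real^'n::finite => real"
 assumes u: "integrable lborel u" and u2: "integrable lborel (\<lambda>x. (u x)\<^sup>2)" and \<sigma>: "\<sigma> > 0"
  and fin: "gagliardo \<sigma> u < \<infinity>"
 shows "(NN r. ennreal (pos r * r powr (- \<sigma>)) * ennreal (dissipation u r)) =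
  ennreal (\<sigma> * subordination_const (real CARD('n)) (- \<sigma>) / 2) * gagliardo \<sigma> u"
proof -
 have [measurable]: "u \<in> borel_measurable borel" using u by auto
 define k where "k = subordination_const (real CARD('n)) (- \<sigma>)"
 have k: "k > 0" unfolding k_def using \<sigma> by (intro subordination_const) auto
 let ?g = "\<lambda>r s. ennreal (\<sigma> * (pos s * s powr (- \<sigma> - 1))) * ennreal (indicator {0<..s} r * dissipation u r)"
 have "(NN r. ennreal (pos r * r powr (- \<sigma>)) * ennreal (dissipation u r)) =
   (NN r s. ?g r s)"
 proof (intro nn_integral_cong)
  fix r :: real
  show "ennreal (pos r * r powr (- \<sigma>)) * ennreal (dissipation u r) = (NN s. ?g r s)"
  proof (cases "r > 0")
   case True
   have "(NN s. ?g r s) = (NN s. ennreal (\<sigma> * dissipation u r) * ennreal (indicator {r..} s * s powr (- \<sigma> - 1)))"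
   proof (intro nn_integral_cong)
    fix s :: real
    show "?g r s = ennreal (\<sigma> * dissipation u r) * ennreal (indicator {r..} s * s powr (- \<sigma> - 1))"
     using True \<sigma> dissipation_nonneg[OF u True]
     by (cases "r <= s") (simp_all add: ennreal_mult[symmetric] mult_ac)
   qed
   also have "... = ennreal (\<sigma> * dissipation u r) * ennreal (r powr (- \<sigma> - 1 + 1) / (- (- \<sigma> - 1 + 1)))"
    using nn_integral_powr_inf[of "- \<sigma> - 1" r] \<sigma> True by (simp add: nn_integral_cmult)
   also have "... = ennreal (r powr (- \<sigma>)) * ennreal (dissipation u r)"
    using \<sigma> dissipation_nonneg[OF u True] by (simp add: ennreal_mult[symmetric] mult_ac)
   finally show ?thesis using True by simp
  qed simp
 qed
 also have "... = (NN s r. ?g r s)"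
  by (rule Tonelli_swap, unfold indicator_def greaterThanAtMost_iff greaterThan_iff case_prod_beta', measurable)
 also have "... = (NN s. ennreal (\<sigma> / 2) * (ennreal (pos s * s powr (- \<sigma> - 1)) * ennreal (2 * defect u s)))"
 proof (intro nn_integral_cong)
  fix s :: real
  show "(NN r. ?g r s) = ennreal (\<sigma> / 2) * (ennreal (pos s * s powr (- \<sigma> - 1)) * ennreal (2 * defect u s))"
  proof (cases "s > 0")
   case True
   have "(NN r. ?g r s) = ennreal (\<sigma> * s powr (- \<sigma> - 1)) * ennreal (defect u s)"
    using True by (simp add: nn_integral_cmult defect_nn_integral[OF u u2 \<sigma> fin True])
   also have "... = ennreal (\<sigma> / 2) * (ennreal (s powr (- \<sigma> - 1)) * ennreal (2 * defect u s))"
    using \<sigma> defect_eq(2)[OF u u2 True] by (simp add: ennreal_mult[symmetric] mult_ac)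
   finally show ?thesis using True by simp
  qed simp
 qed
 also have "... = ennreal (\<sigma> / 2) * (ennreal k * gagliardo \<sigma> u)"
  using defect_gagliardo[OF u u2 \<sigma>] by (simp add: nn_integral_cmult k_def)
 also have "... = ennreal (\<sigma> * k / 2) * gagliardo \<sigma> u"
 proof -
  have "ennreal (\<sigma> / 2) * ennreal k = ennreal (\<sigma> * k / 2)" using \<sigma> k by (simp add: ennreal_mult[symmetric])
  then show ?thesis by (simp add: mult.assoc[symmetric])
 qed
 finally show ?thesis by (simp add: k_def)
qed

section \<open>Integration by parts\<close>

lemma borel_measurable_vec_nth [measurable (raw)]:
 fixes f :: "'m => real^'n::finite"
 assumes [measurable]: "f \<in> borel_measurable M"
 shows "(\<lambda>x. f x $ j) \<in> borel_measurable M"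
proof -
 have "(\<lambda>x. f x \<bullet> axis j 1) \<in> borel_measurable M" by measurable
 then show ?thesis by (simp add: inner_axis)
qed

lemma directional_derivative:
 fixes \<eta> :: "real^'n::finite => real"
 assumes "\<And>x. \<eta> differentiable (at x)"
 shows "((\<lambda>t. \<eta> (x + t *\<^sub>R axis j 1)) has_real_derivative partial_deriv j \<eta> (x + t *\<^sub>R axis j 1)) (at t)"
proof -
 let ?e = "axis j 1 :: real^'n"
 let ?D = "frechet_derivative \<eta> (at (x + t *\<^sub>R ?e))"
 have D: "(\<eta> has_derivative ?D) (at (x + t *\<^sub>R ?e))" using assms frechet_derivative_works by blast
 have "((\<lambda>t. x + t *\<^sub>R ?e) has_derivative (\<lambda>h. h *\<^sub>R ?e)) (at t)" by (auto intro!: derivative_eq_intros)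
 from has_derivative_compose[OF this D]
 have "((\<lambda>t. \<eta> (x + t *\<^sub>R ?e)) has_derivative (\<lambda>h. ?D (h *\<^sub>R ?e))) (at t)" .
 moreover have "?D (h *\<^sub>R ?e) = partial_deriv j \<eta> (x + t *\<^sub>R ?e) * h" for h
  using has_derivative_bounded_linear[OF D] by (simp add: linear_simps partial_deriv_def)
 ultimately show ?thesis by (simp add: has_field_derivative_def)
qed

lemma continuous_support_bounded:
 fixes f :: "'a::euclidean_space => real"
 assumes "continuous_on UNIV f" "\<And>x. norm x > R ==> f x = 0"
 obtains M where "M >= 0" "\<And>x. \<bar>f x\<bar> <= M"
proof -
 have "compact (f ` cball 0 R)"
  using assms(1) by (intro compact_continuous_image) (auto intro: continuous_on_subset)
 then obtain M where M: "M > 0" "\<forall>y\<in>f ` cball 0 R. norm y <= M"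
  using compact_imp_bounded bounded_pos by blast
 have "\<bar>f x\<bar> <= M" for x using M assms(2)[of x] by (cases "norm x <= R") auto
 then show ?thesis using that[of M] M by auto
qed

lemma continuous_support_integrable:
 fixes f :: "'a::euclidean_space => real"
 assumes f: "continuous_on UNIV f" and R: "\<And>x. norm x > R ==> f x = 0"
 shows "integrable lborel f"
proof -
 obtain M where M: "M >= 0" "\<And>x. \<bar>f x\<bar> <= M" using continuous_support_bounded[OF f R] by blast
 show ?thesis
 proof (rule bochner_bound)
  show "integrable lborel (\<lambda>x. M * indicator (cball 0 R) x)"
   by (intro integrable_mult_right integrable_real_indicator emeasure_bounded_finite) auto
  show "f \<in> borel_measurable lborel" using borel_measurable_continuous_onI[OF f] by simp
  show "AE x in lborel. norm (f x) <= norm (M * indicator (cball 0 R) x)"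
   using M R by (intro AE_I2) (auto simp: indicator_def not_le)
 qed
qed

text \<open>
 The integral of the difference quotients vanishes by translation invariance.
\<close>

lemma integral_partial_deriv_eq_0:
 fixes \<eta> :: "real^'n::finite => real"
 assumes d: "\<And>x. \<eta> differentiable (at x)" and c: "continuous_on UNIV (partial_deriv j \<eta>)"
  and R: "\<And>x. norm x > R ==> \<eta> x = 0" "\<And>x. norm x > R ==> partial_deriv j \<eta> x = 0"
 shows "(LBINT x. partial_deriv j \<eta> x) = 0"
proof -
 let ?e = "axis j 1 :: real^'n"
 obtain M where M: "M >= 0" "\<And>x. \<bar>partial_deriv j \<eta> x\<bar> <= M" using continuous_support_bounded[OF c R(2)] by blast
 have cont: "continuous_on UNIV \<eta>"
  using d by (simp add: continuous_at_imp_continuous_on differentiable_imp_continuous_within)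
 have \<eta>I: "integrable lborel \<eta>" by (rule continuous_support_integrable[OF cont R(1)])
 have [measurable]: "\<eta> \<in> borel_measurable borel" using borel_measurable_continuous_onI[OF cont] .
 have [measurable]: "partial_deriv j \<eta> \<in> borel_measurable borel" using borel_measurable_continuous_onI[OF c] .
 define h where "h k = 1 / real (Suc k)" for k
 have h: "0 < h k" "h k <= 1" for k by (auto simp: h_def)
 define f where "f k x = (\<eta> (x + h k *\<^sub>R ?e) - \<eta> x) / h k" for k x
 have f0: "(LBINT x. f k x) = 0" for k
 proof -
  have "(LBINT x. \<eta> (x - (- (h k *\<^sub>R ?e)))) = (LBINT x. \<eta> x)"
   "integrable lborel (\<lambda>x. \<eta> (x - (- (h k *\<^sub>R ?e))))"
   using \<eta>I by (simp_all only: lborel_integral_translate \<open>\<eta> \<in> borel_measurable borel\<close>)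
  then show ?thesis unfolding f_def using \<eta>I by simp
 qed
 have "(\<lambda>k. LBINT x. f k x) ----> (LBINT x. partial_deriv j \<eta> x)"
 proof (rule integral_dominated_convergence[where w="\<lambda>x. M * indicator (cball 0 (R + 1)) x"])
  show "f k \<in> borel_measurable lborel" for k unfolding f_def by measurable
  show "integrable lborel (\<lambda>x::real^'n. M * indicator (cball 0 (R + 1)) x)"
   by (intro integrable_mult_right integrable_real_indicator emeasure_bounded_finite) auto
  show "AE x in lborel. (\<lambda>k. f k x) ----> partial_deriv j \<eta> x"
  proof (intro AE_I2)
   fix x
   have "((\<lambda>t. (\<eta> (x + t *\<^sub>R ?e) - \<eta> x) / t) \<longlongrightarrow> partial_deriv j \<eta> x) (at 0)"
    using directional_derivative[OF d, of x j 0] by (simp add: DERIV_def)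
   moreover have "filterlim h (at 0) sequentially"
    unfolding filterlim_at using h(1) LIMSEQ_Suc[OF lim_1_over_n] by (auto simp: h_def[abs_def])
   ultimately show "(\<lambda>k. f k x) ----> partial_deriv j \<eta> x"
    unfolding f_def by (rule filterlim_compose)
  qed
  show "AE x in lborel. norm (f k x) <= M * indicator (cball 0 (R + 1)) x" for k
  proof (intro AE_I2)
   fix x
   obtain z where z: "\<eta> (x + h k *\<^sub>R ?e) - \<eta> (x + 0 *\<^sub>R ?e) = (h k - 0) * partial_deriv j \<eta> (x + z *\<^sub>R ?e)"
    using MVT2[OF h(1)[of k], of "\<lambda>t. \<eta> (x + t *\<^sub>R ?e)" "\<lambda>t. partial_deriv j \<eta> (x + t *\<^sub>R ?e)"]
     directional_derivative[OF d] by blast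
   then have "f k x = partial_deriv j \<eta> (x + z *\<^sub>R ?e)" using h(1)[of k] by (simp add: f_def)
   then have b: "\<bar>f k x\<bar> <= M" using M by simp
   show "norm (f k x) <= M * indicator (cball 0 (R + 1)) x"
   proof (cases "norm x <= R + 1")
    case False
    have "norm x <= norm (x + h k *\<^sub>R ?e) + norm (h k *\<^sub>R ?e)"
     using norm_triangle_ineq4[of "x + h k *\<^sub>R ?e" "h k *\<^sub>R ?e"] by simp
    then have "norm (x + h k *\<^sub>R ?e) > R" using False h[of k] by (simp add: norm_axis_1)
    then show ?thesis using False R(1) M by (simp add: f_def)
   qed (use b in simp)
  qed
 qed measurable
 then show ?thesis by (simp add: f0 LIMSEQ_const_iff)
qed

lemma test_function_integrable:
 fixes \<phi> :: "real^'n::finite => real"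
 assumes "\<phi> \<in> test_functions S" shows "integrable lborel \<phi>"
proof -
 obtain R where "R > 0" "\<And>x. norm x > R ==> \<phi> x = 0" using test_function_support[OF assms] by blast
 then show ?thesis
  using continuous_support_integrable smooth_continuous[OF test_function_smooth[OF assms]] by blast
qed

lemma continuous_heat: "continuous_on UNIV (\<lambda>x::real^'n::finite. heat t (x - y))"
 "continuous_on UNIV (\<lambda>x::real^'n::finite. heat_grad t (x - y))"
 unfolding heat_grad_def heat_def by (cases "t = 0"; auto intro!: continuous_intros)+

lemma heat_test_by_parts:
 fixes \<phi> :: "real^'n::finite => real"
 assumes \<phi>: "\<phi> \<in> test_functions S"
 shows "(LBINT x. heat t (x - y) * partial_deriv j \<phi> x) = - (LBINT x. (heat_grad t (x - y) $ j) * \<phi> x)"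
proof -
 define \<eta> where "\<eta> x = heat t (x - y) * \<phi> x" for x
 note \<phi>' = test_function_partial_deriv[OF \<phi>, of j]
 have c: "continuous_on UNIV \<phi>" "continuous_on UNIV (partial_deriv j \<phi>)"
  using smooth_continuous[OF test_function_smooth[OF \<phi>]] smooth_continuous[OF test_function_smooth[OF \<phi>']] by auto
 obtain R where R: "\<And>x. norm x > R ==> \<phi> x = 0" using test_function_support[OF \<phi>] by blast
 obtain R' where R': "\<And>x. norm x > R' ==> partial_deriv j \<phi> x = 0" using test_function_support[OF \<phi>'] by blast
 have D: "(\<eta> has_derivative (\<lambda>h. heat t (x - y) * frechet_derivative \<phi> (at x) h + (heat_grad t (x - y) \<bullet> h) * \<phi> x)) (at x)" for x
  unfolding \<eta>_def
 proof (rule has_derivative_mult)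
  have "((\<lambda>x. x - y) has_derivative (\<lambda>h. h)) (at x)" by (auto intro!: derivative_eq_intros)
  from has_derivative_compose[OF this heat_has_derivative]
  show "((\<lambda>x. heat t (x - y)) has_derivative (\<lambda>h. heat_grad t (x - y) \<bullet> h)) (at x)" .
  show "(\<phi> has_derivative frechet_derivative \<phi> (at x)) (at x)"
   using smooth_differentiable[OF test_function_smooth[OF \<phi>]] frechet_derivative_works by blast
 qed
 have pd: "partial_deriv j \<eta> x = heat t (x - y) * partial_deriv j \<phi> x + (heat_grad t (x - y) $ j) * \<phi> x" for x
  unfolding partial_deriv_eq[OF D] by (simp add: partial_deriv_def inner_axis)
 have c1: "continuous_on UNIV (\<lambda>x. heat t (x - y) * partial_deriv j \<phi> x)"
  and c2: "continuous_on UNIV (\<lambda>x. (heat_grad t (x - y) $ j) * \<phi> x)"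
  by (intro continuous_intros c continuous_heat)+
 have "(LBINT x. partial_deriv j \<eta> x) = 0"
 proof (rule integral_partial_deriv_eq_0[where R="max R R'"])
  show "\<eta> differentiable (at x)" for x using D differentiableI by blast
  show "continuous_on UNIV (partial_deriv j \<eta>)"
   unfolding pd[abs_def] by (intro continuous_on_add c1 c2)
 qed (auto simp: pd R R' \<eta>_def)
 moreover have "integrable lborel (\<lambda>x. heat t (x - y) * partial_deriv j \<phi> x)"
  by (rule continuous_support_integrable[OF c1, of R']) (simp add: R')
 moreover have "integrable lborel (\<lambda>x. (heat_grad t (x - y) $ j) * \<phi> x)"
  by (rule continuous_support_integrable[OF c2, of R]) (simp add: R)
 ultimately show ?thesis unfolding pd by simp
qed

section \<open>Superpositions of the heat flow\<close>

text \<open>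
 Truncating to a compact set of positive times makes every integral absolutely convergent,
 so the square of the norm is a double time integral of the dissipation.
\<close>

lemma heat_flow_superposition:
 fixes u :: "real^'n::finite => real"
 assumes u: "integrable lborel u" and [measurable]: "c \<in> borel_measurable borel" and a: "a > 0"
  and c: "\<And>t. t \<notin> {a..b} ==> c t = 0" "\<And>t. \<bar>c t\<bar> <= M"
 defines "V \<equiv> \<lambda>x. LBINT t. c t *\<^sub>R flow_grad u t x"
 shows "integrable lborel (\<lambda>t. c t *\<^sub>R flow_grad u t x)"
  and "integrable lborel (\<lambda>x. V x \<bullet> V x)"
  and "(LBINT x. V x \<bullet> V x) = (LBINT t. LBINT s. c t * c s * dissipation u (t + s))"
  and "integrable lborel2 (\<lambda>(t, s). c t * c s * dissipation u (t + s))"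
  and "integrable lborel2 (\<lambda>(t, x). c t * norm (flow_grad u t x))"
proof -
 have [measurable]: "u \<in> borel_measurable borel" using u by auto
 define U where "U = (LBINT y. \<bar>u y\<bar>)"
 define S where "S = a powr (- real CARD('n) / 2 - 1 / 2) * U"
 define D where "D = U * ((real CARD('n) + 1) / sqrt a)"
 have U: "U >= 0" by (simp add: U_def)
 have S0: "S >= 0" and D0: "D >= 0" using U a by (auto simp: S_def D_def)
 have M0: "M >= 0" using c(2)[of 0] abs_ge_zero[of "c 0"] by linarith
 have WS: "norm (flow_grad u t x) <= S" if "t \<in> {a..b}" for t x
 proof -
  have "norm (flow_grad u t x) <= t powr (- real CARD('n) / 2 - 1 / 2) * U"
   unfolding U_def using that a by (intro flow_grad_le[OF u]) auto
  also have "... <= S" unfolding S_def using that a U by (intro mult_right_mono powr_mono2') auto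
  finally show ?thesis .
 qed
 have WD: "(NN x. ennreal (norm (flow_grad u t x))) <= ennreal D" if "t \<in> {a..b}" for t
 proof -
  have "(NN x. ennreal (norm (flow_grad u t x))) <= ennreal (U * ((real CARD('n) + 1) / sqrt t))"
   unfolding U_def using that a by (intro flow_grad_nn_integral[OF u]) auto
  also have "... <= ennreal D" unfolding D_def
   using that a U by (intro ennreal_leI mult_left_mono divide_left_mono) auto
  finally show ?thesis .
 qed
 have cI: "integrable lborel c"
 proof (rule bochner_bound)
  show "integrable lborel (\<lambda>t. M * indicator {a..b} t)"
   by (intro integrable_mult_right integrable_real_indicator) (auto simp: emeasure_lborel_Icc_eq)
  show "AE t in lborel. norm (c t) <= norm (M * indicator {a..b} t)"
   using c M0 by (intro AE_I2) (metis abs_of_nonneg indicator_simps mult.right_neutral mult_zero_right norm_zero order_refl real_norm_def)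
 qed simp
 define K where "K = (NN t. ennreal \<bar>c t\<bar>)"
 have K: "K < \<infinity>" using cI by (simp add: K_def integrable_iff_bounded)
 have cW: "norm (c t *\<^sub>R flow_grad u t x) <= S * \<bar>c t\<bar>" for t x
  using WS[of t x] c(1)[of t] by (cases "t \<in> {a..b}") (auto simp: mult.commute[of S] intro!: mult_left_mono)
 show tI: "integrable lborel (\<lambda>t. c t *\<^sub>R flow_grad u t x)" for x
 proof (rule bochner_bound)
  show "integrable lborel (\<lambda>t. S * c t)" using cI by simp
  show "AE t in lborel. norm (c t *\<^sub>R flow_grad u t x) <= norm (S * c t)"
   using cW S0 by (intro AE_I2) (simp add: abs_mult)
 qed measurable
 have tx: "(NN t x. ennreal \<bar>c t * norm (flow_grad u t x)\<bar>) <= ennreal D * K"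
 proof -
  have "(NN t x. ennreal \<bar>c t * norm (flow_grad u t x)\<bar>) <=
    (NN t. ennreal D * ennreal \<bar>c t\<bar>)"
  proof (intro nn_integral_mono)
   fix t :: real
   have "(NN x. ennreal \<bar>c t * norm (flow_grad u t x)\<bar>) =
     ennreal \<bar>c t\<bar> * (NN x. ennreal (norm (flow_grad u t x)))"
    by (simp add: abs_mult ennreal_mult nn_integral_cmult)
   also have "... <= ennreal \<bar>c t\<bar> * ennreal D"
    using WD[of t] c(1)[of t] by (cases "t \<in> {a..b}") (auto intro: mult_left_mono)
   finally show "(NN x. ennreal \<bar>c t * norm (flow_grad u t x)\<bar>) <= ennreal D * ennreal \<bar>c t\<bar>"
    by (simp add: mult.commute)
  qed
  also have "... = ennreal D * K" by (simp add: nn_integral_cmult K_def)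
  finally show ?thesis .
 qed
 show "integrable lborel2 (\<lambda>(t, x). c t * norm (flow_grad u t x))"
  by (rule integrable_pairI) (use tx K in \<open>auto simp: ennreal_mult_less_top intro: le_less_trans\<close>)
 define f where "f x t s = (c t *\<^sub>R flow_grad u t x) \<bullet> (c s *\<^sub>R flow_grad u s x)" for x t s
 have m: "(\<lambda>(x, t, s). f x t s) \<in> borel_measurable (lborel \<Otimes>\<^sub>M lborel2)"
  unfolding f_def by measurable
 have fle: "ennreal \<bar>f x t s\<bar> <= ennreal \<bar>c t * norm (flow_grad u t x)\<bar> * (ennreal S * ennreal \<bar>c s\<bar>)" for x t s
 proof -
  have "\<bar>f x t s\<bar> <= norm (c t *\<^sub>R flow_grad u t x) * norm (c s *\<^sub>R flow_grad u s x)"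
   unfolding f_def by (rule Cauchy_Schwarz_ineq2)
  also have "... <= norm (c t *\<^sub>R flow_grad u t x) * (S * \<bar>c s\<bar>)" by (intro mult_left_mono cW) auto
  finally have "\<bar>f x t s\<bar> <= \<bar>c t * norm (flow_grad u t x)\<bar> * (S * \<bar>c s\<bar>)" by (simp add: abs_mult)
  from ennreal_leI[OF this] show ?thesis using S0 by (simp add: ennreal_mult)
 qed
 have "(NN x t s. ennreal \<bar>f x t s\<bar>) <=
   (NN x t s. ennreal \<bar>c t * norm (flow_grad u t x)\<bar> * (ennreal S * ennreal \<bar>c s\<bar>))"
  by (intro nn_integral_mono fle)
 also have "... = (NN x t. ennreal \<bar>c t * norm (flow_grad u t x)\<bar> * (ennreal S * K))"
  by (simp add: nn_integral_cmult K_def)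
 also have "... = (NN t x. ennreal \<bar>c t * norm (flow_grad u t x)\<bar> * (ennreal S * K))"
  by (rule Tonelli_swap) measurable
 also have "... = (NN t x. ennreal \<bar>c t * norm (flow_grad u t x)\<bar>) * (ennreal S * K)"
  by (simp add: nn_integral_multc)
 also have "... <= ennreal D * K * (ennreal S * K)" by (intro mult_right_mono tx) auto
 also have "... < \<infinity>" using K by (simp add: ennreal_mult_less_top)
 finally have fin: "(NN x t s. ennreal \<bar>f x t s\<bar>) < \<infinity>" .
 have A: "(LBINT t. LBINT s. f x t s) = V x \<bullet> V x" for x
 proof -
  have "(LBINT s. f x t s) = (c t *\<^sub>R flow_grad u t x) \<bullet> V x" for t
   unfolding f_def V_def by (rule integral_inner_right) (use tI in simp)
  then have "(LBINT t. LBINT s. f x t s) = (LBINT t. (c t *\<^sub>R flow_grad u t x) \<bullet> V x)"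
   by (simp only:)
  also have "... = V x \<bullet> V x"
   unfolding V_def by (rule integral_inner_left) (use tI in simp)
  finally show ?thesis .
 qed
 have B: "(LBINT x. f x t s) = c t * c s * dissipation u (t + s)" for t s
 proof (cases "t \<in> {a..b} \<and> s \<in> {a..b}")
  case True
  have "f x t s = (c t * c s) * (flow_grad u t x \<bullet> flow_grad u s x)" for x by (simp add: f_def)
  then show ?thesis using True a flow_grad_inner[OF u, of t s] by simp
 next
  case False
  then have "c t * c s = 0" using c(1) by auto
  then show ?thesis by (auto simp: f_def)
 qed
 show "integrable lborel (\<lambda>x. V x \<bullet> V x)" using Fubini_triple(2)[OF m fin] by (simp only: A)
 show "(LBINT x. V x \<bullet> V x) = (LBINT t. LBINT s. c t * c s * dissipation u (t + s))"
  using Fubini_triple(3)[OF m fin] by (simp only: A B)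
 show "integrable lborel2 (\<lambda>(t, s). c t * c s * dissipation u (t + s))"
  using Fubini_triple(1)[OF m fin] by (simp only: B)
qed

section \<open>Existence of the fractional gradient\<close>

text \<open>
 The factor that turns the superposition of heat kernels into the normalised Riesz kernel.
\<close>

definition grad_const :: "real => real => real" where
 "grad_const n \<sigma> = riesz_const n (1 - \<sigma>) / subordination_const n ((1 - \<sigma>) / 2)"

text \<open>
 The ratio of \<open>\<integral> \<bar>Du\<bar>\<^sup>2\<close> and the Gagliardo seminorm squared.
\<close>

definition energy_const :: "real => real => real" where
 "energy_const n \<sigma> = (grad_const n \<sigma>)\<^sup>2 *
  (Beta ((1 - \<sigma>) / 2) ((1 - \<sigma>) / 2) * (\<sigma> * subordination_const n (- \<sigma>) / 2))"

lemma grad_const_pos: "0 < \<sigma> ==> \<sigma> < 1 ==> n >= 1 ==> grad_const n \<sigma> > 0"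
 unfolding grad_const_def riesz_const_def
 by (intro divide_pos_pos mult_pos_pos Gamma_real_pos subordination_const) auto

lemma energy_const_pos: "0 < \<sigma> ==> \<sigma> < 1 ==> n >= 1 ==> energy_const n \<sigma> > 0"
 unfolding energy_const_def Beta_def using grad_const_pos[of \<sigma> n]
 by (intro divide_pos_pos mult_pos_pos Gamma_real_pos subordination_const zero_less_power) auto

lemma lebesgue_integral_lborel:
 fixes f :: "'a::euclidean_space => 'b::{banach, second_countable_topology}"
 assumes "f \<in> borel_measurable borel"
 shows "(LINT x|lebesgue. f x) = (LBINT x. f x)" "integrable lebesgue f \<longleftrightarrow> integrable lborel f"
 using assms by (auto simp: integral_completion integrable_completion)

lemma sq_integrable_locally_integrable:
 fixes G :: "'a::euclidean_space => 'b::euclidean_space"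
 assumes G: "sq_integrable G" shows "locally_integrable G"
 unfolding locally_integrable_def set_integrable_def
proof (intro allI impI)
 fix K :: "'a set" assume K: "compact K"
 have Km: "K \<in> sets lebesgue" using K by (simp add: borel_compact)
 have Kf: "integrable lebesgue (indicator K :: 'a => real)"
  using lmeasurable_compact[OF K] by (simp add: lmeasurable_iff_integrable)
 show "integrable lebesgue (\<lambda>x. indicator K x *\<^sub>R G x)"
 proof (rule bochner_bound)
  show "integrable lebesgue (\<lambda>x. (norm (G x))\<^sup>2 + indicator K x)"
   using G Kf by (simp add: sq_integrable_def)
  show "(\<lambda>x. indicator K x *\<^sub>R G x) \<in> borel_measurable lebesgue"
   using sq_integrable_measurable[OF G] Km by measurable
  show "AE x in lebesgue. norm (indicator K x *\<^sub>R G x) <= norm ((norm (G x))\<^sup>2 + indicator K x)"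
  proof (intro AE_I2)
   fix x
   have "2 * norm (G x) * 1 <= (norm (G x))\<^sup>2 + 1\<^sup>2" by (rule sum_squares_bound)
   then have "2 * norm (G x) <= (norm (G x))\<^sup>2 + 1" by simp
   then have "norm (G x) <= (norm (G x))\<^sup>2 + 1" using norm_ge_zero[of "G x"] by linarith
   then show "norm (indicator K x *\<^sub>R G x) <= norm ((norm (G x))\<^sup>2 + indicator K x)"
    by (cases "x \<in> K") auto
  qed
 qed
qed

lemma riesz_potential_measurable:
 fixes u :: "real^'n::finite => real"
 assumes [measurable]: "u \<in> borel_measurable borel"
 shows "riesz_potential \<alpha> u \<in> borel_measurable borel"
proof -
 have "riesz_potential \<alpha> u = (\<lambda>x. riesz_const (real CARD('n)) \<alpha> * (LBINT y. u y / norm (x - y) powr (real CARD('n) - \<alpha>)))"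
  unfolding riesz_potential_def by (intro ext, subst integral_completion) auto
 then show ?thesis by simp
qed

lemma riesz_potential_locally_integrable:
 fixes u :: "real^'n::finite => real"
 assumes \<alpha>: "0 < \<alpha>" "\<alpha> < 1" and u: "integrable lborel u"
 shows "locally_integrable (riesz_potential \<alpha> u)"
 unfolding locally_integrable_def set_integrable_def
proof (intro allI impI)
 fix K :: "(real^'n) set" assume K: "compact K"
 have um: "u \<in> borel_measurable borel" using u by auto
 have [measurable]: "riesz_potential \<alpha> u \<in> borel_measurable borel" by (rule riesz_potential_measurable[OF um])
 have [measurable]: "K \<in> sets borel" using K by (rule borel_compact)
 have "integrable lborel (indicator K :: real^'n => real)"
  using K by (intro integrable_real_indicator) (use emeasure_bounded_finite[OF compact_imp_bounded[OF K]] in auto)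
 then have "integrable lborel (\<lambda>x. riesz_potential \<alpha> u x * indicator K x)"
  by (rule riesz_pairing(1)[OF \<alpha> u, where B=1]) (simp add: indicator_def)
 then show "integrable lebesgue (\<lambda>x. indicator K x *\<^sub>R riesz_potential \<alpha> u x)"
  by (subst lebesgue_integral_lborel) (auto simp: mult.commute)
qed


text \<open>
 The gradient is the \<open>L\<^sup>2\<close> limit of the truncated superpositions of gradients of the heat
 flow. They form a Cauchy sequence because the full double integral of the dissipation is
 finite: by \<open>Beta_Tonelli\<close> it is a Beta value times the weighted total dissipation. Pairing
 the limit with a test function gives the distributional gradient. Pairing it with the
 gradient of the heat kernel gives the last conclusion, on which the supremum bound rests.
\<close>

theorem fractional_gradient_exists:
 fixes u :: "real^'n::finite => real"
 assumes \<sigma>: "0 < \<sigma>" "\<sigma> < 1" and u: "integrable lborel u" and u2: "integrable lborel (\<lambda>x. (u x)\<^sup>2)"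
  and fin: "gagliardo \<sigma> u < \<infinity>"
 obtains G where "sq_integrable G" "has_sigma_gradient \<sigma> u G"
  "ennreal (LINT x|lebesgue. (norm (G x))\<^sup>2) = ennreal (energy_const (real CARD('n)) \<sigma>) * gagliardo \<sigma> u"
  "\<forall>s>0. \<forall>z. (LINT x|lebesgue. G x \<bullet> heat_grad s (x - z)) = - (grad_const (real CARD('n)) \<sigma> *
   (LBINT t. pos t * t powr ((1 - \<sigma>) / 2 - 1) * (LBINT y. u y * heat_dt (s + t) (y - z))))"
proof -
 have [measurable]: "u \<in> borel_measurable borel" using u by auto
 define n where "n = real CARD('n)"
 define \<beta> where "\<beta> = (1 - \<sigma>) / 2"
 have \<beta>: "0 < \<beta>" "\<beta> < 1" using \<sigma> by (auto simp: \<beta>_def)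
 define B where "B = Beta \<beta> \<beta>"
 define k where "k = \<sigma> * subordination_const n (- \<sigma>) / 2"
 have k: "k > 0" unfolding k_def n_def using \<sigma> by (intro divide_pos_pos mult_pos_pos subordination_const) auto
 have B0: "B >= 0" unfolding B_def using \<beta> by (intro Beta_nonneg)
 obtain E where E: "E >= 0" "gagliardo \<sigma> u = ennreal E" using fin by (cases "gagliardo \<sigma> u") auto
 define w where "w t = pos t * t powr (\<beta> - 1)" for t :: real
 have [measurable]: "w \<in> borel_measurable borel" unfolding w_def by measurable
 have w0: "w t >= 0" for t by (simp add: w_def)
 let ?P = "lborel \<Otimes>\<^sub>M lborel :: (real \<times> real) measure"
 define full where "full = (\<lambda>(t, s). ennreal (w t) * ennreal (w s) * ennreal (dissipation u (t + s)))"
 have [measurable]: "full \<in> borel_measurable ?P" unfolding full_def by measurable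
 have full: "(\<integral>\<^sup>+p. full p \<partial>?P) = ennreal (B * k * E)"
 proof -
  have "(\<integral>\<^sup>+p. full p \<partial>?P) = (NN t s. ennreal (w t) * ennreal (w s) * ennreal (dissipation u (t + s)))"
   by (subst lborel.nn_integral_fst[symmetric]) (auto simp: full_def)
  also have "... = (NN r. ennreal (pos r * (B * r powr (\<beta> + \<beta> - 1))) * ennreal (dissipation u r))"
   unfolding w_def B_def by (rule Beta_Tonelli[OF \<beta>(1) \<beta>(1)]) measurable
  also have "... = (NN r. ennreal B * (ennreal (pos r * r powr (- \<sigma>)) * ennreal (dissipation u r)))"
  proof (intro nn_integral_cong)
   fix r :: real
   have e: "\<beta> + \<beta> - 1 = - \<sigma>" by (simp add: \<beta>_def)
   show "ennreal (pos r * (B * r powr (\<beta> + \<beta> - 1))) * ennreal (dissipation u r) =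
     ennreal B * (ennreal (pos r * r powr (- \<sigma>)) * ennreal (dissipation u r))"
    unfolding e using B0 by (cases "r > 0") (simp_all add: ennreal_mult mult.assoc)
  qed
  also have "... = ennreal B * (ennreal k * ennreal E)"
   using dissipation_gagliardo[OF u u2 \<sigma>(1) fin] by (simp add: nn_integral_cmult k_def n_def E)
  also have "... = ennreal (B * k * E)" using B0 k E by (simp add: ennreal_mult mult.assoc)
  finally show ?thesis .
 qed
 define I where "I m = {1 / real (Suc m)..real (Suc m)}" for m
 define c where "c m t = indicator (I m) t * t powr (\<beta> - 1)" for m t
 define V where "V m x = (LBINT t. c m t *\<^sub>R flow_grad u t x)" for m x
 have I0: "t > 0" if "t \<in> I m" for t m
 proof -
  have "1 / real (Suc m) > 0" by simp
  then show ?thesis using that unfolding I_def by (metis atLeastAtMost_iff less_le_trans)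
 qed
 have Imono: "I m \<subseteq> I l" if "m <= l" for m l
  unfolding I_def using that by (auto simp: field_simps intro: order_trans)
 have Iev: "eventually (\<lambda>m. t \<in> I m) sequentially" if "t > 0" for t
 proof -
  obtain m where "max t (1 / t) <= real m" using real_arch_simple by blast
  then have "t \<in> I m" using that by (auto simp: I_def field_simps)
  then show ?thesis using Imono eventually_sequentially by blast
 qed
 have [measurable]: "c m \<in> borel_measurable borel" for m unfolding c_def I_def by measurable
 have c_w: "c m t = indicator (I m) t * w t" for m t using I0[of t m] by (auto simp: c_def w_def indicator_def)
 have c0: "0 <= c m t" "c m t <= w t" for m t using w0 by (auto simp: c_w indicator_def)
 have c_out: "c m t = 0" if "t \<notin> I m" for m t using that by (simp add: c_def)
 have c_lim: "(\<lambda>m. c m t) ----> w t" for t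
 proof (cases "t > 0")
  case True
  have "eventually (\<lambda>m. c m t = w t) sequentially"
   using Iev[OF True] by eventually_elim (simp add: c_w)
  then show ?thesis by (rule tendsto_eventually)
 next
  case False
  then have "c m t = 0" for m using I0[of t m] c_out by blast
  then show ?thesis using False by (simp add: w_def)
 qed
 have c_le: "\<bar>c m t\<bar> <= (1 / real (Suc m)) powr (\<beta> - 1)" for m t
  unfolding c_def I_def using \<beta> by (auto simp: indicator_def intro!: powr_mono2')
 have [measurable]: "V m \<in> borel_measurable borel" for m unfolding V_def by measurable
 note S = heat_flow_superposition[OF u _ _ _ c_le, where a="1 / real (Suc m)" and b="real (Suc m)" for m]
 have S1: "integrable lborel (\<lambda>t. c m t *\<^sub>R flow_grad u t x)" for m x
  by (rule S(1)) (auto intro: c_out simp: I_def)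
 have V2: "integrable lborel (\<lambda>x. V m x \<bullet> V m x)" for m unfolding V_def by (rule S(2)) (auto intro: c_out simp: I_def)
 have VV: "(LBINT x. V m x \<bullet> V m x) = (LBINT t. LBINT s. c m t * c m s * dissipation u (t + s))" for m
  unfolding V_def by (rule S(3)) (auto intro: c_out simp: I_def)
 have S4: "integrable ?P (\<lambda>(t, s). c m t * c m s * dissipation u (t + s))" for m
  by (rule S(4)) (auto intro: c_out simp: I_def)
 have S5: "integrable lborel2 (\<lambda>(t, x). c m t * norm (flow_grad u t x))" for m
  by (rule S(5)) (auto intro: c_out simp: I_def)
 have Vsq: "sq_integrable (V m)" for m
  using V2[of m] by (simp add: sq_integrable_def measurable_completion lebesgue_integral_lborel power2_norm_eq_inner)
 have diss0: "dissipation u (t + s) >= 0" if "t > 0" "s > 0" for t s using dissipation_nonneg[OF u] that by simp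
 have cc0: "0 <= c m t * c m s * dissipation u (t + s)" for m t s
 proof (cases "t \<in> I m \<and> s \<in> I m")
  case True then show ?thesis using diss0 I0 c0 by (intro mult_nonneg_nonneg) auto
 next
  case False then have "c m t * c m s = 0" using c_out by auto
  then show ?thesis by auto
 qed
 have energy_m: "ennreal (LINT x|lebesgue. (norm (V m x))\<^sup>2) = (\<integral>\<^sup>+p. (case p of (t, s) => ennreal (c m t * c m s * dissipation u (t + s))) \<partial>?P)" for m
 proof -
  have "(LINT x|lebesgue. (norm (V m x))\<^sup>2) = (LINT p|?P. (case p of (t, s) => c m t * c m s * dissipation u (t + s)))"
   using integrable_pair_fst(3)[OF S4[of m]] VV[of m] by (simp add: lebesgue_integral_lborel power2_norm_eq_inner)
  moreover have "(\<integral>\<^sup>+p. ennreal (case p of (t, s) => c m t * c m s * dissipation u (t + s)) \<partial>?P) =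
    ennreal (LINT p|?P. (case p of (t, s) => c m t * c m s * dissipation u (t + s)))"
   using S4[of m] cc0 by (intro nn_integral_eq_integral) auto
  ultimately show ?thesis by (simp add: case_prod_beta')
 qed
 have "(\<lambda>m. \<integral>\<^sup>+p. (case p of (t, s) => ennreal (c m t * c m s * dissipation u (t + s))) \<partial>?P) ----> (\<integral>\<^sup>+p. full p \<partial>?P)"
 proof (rule nn_integral_dominated_convergence[where w=full])
  show "AE p in ?P. (case p of (t, s) => ennreal (c m t * c m s * dissipation u (t + s))) <= full p" for m
  proof (intro AE_I2, clarify)
   fix t s :: real
   show "ennreal (c m t * c m s * dissipation u (t + s)) <= full (t, s)"
   proof (cases "t \<in> I m \<and> s \<in> I m")
    case True
    have "c m t * c m s * dissipation u (t + s) <= w t * w s * dissipation u (t + s)"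
     using True diss0 I0 c0 w0 by (intro mult_right_mono mult_mono) auto
    then have "ennreal (c m t * c m s * dissipation u (t + s)) <= ennreal (w t * w s * dissipation u (t + s))"
     by (rule ennreal_leI)
    then show ?thesis using w0 by (simp add: full_def ennreal_mult')
   next
    case False then have "c m t * c m s = 0" using c_out by auto
    then show ?thesis by auto
   qed
  qed
  show "AE p in ?P. (\<lambda>m. case p of (t, s) => ennreal (c m t * c m s * dissipation u (t + s))) ----> full p"
  proof (intro AE_I2, clarify)
   fix t s :: real
   have "(\<lambda>m. ennreal (c m t * c m s * dissipation u (t + s))) ----> ennreal (w t * w s * dissipation u (t + s))"
    by (intro tendsto_ennrealI tendsto_intros c_lim)
   then show "(\<lambda>m. ennreal (c m t * c m s * dissipation u (t + s))) ----> full (t, s)"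
    using w0 by (simp add: full_def ennreal_mult')
  qed
 qed (use full in \<open>auto simp: case_prod_beta'\<close>)
 then have "(\<lambda>m. ennreal (LINT x|lebesgue. (norm (V m x))\<^sup>2)) ----> ennreal (B * k * E)"
  unfolding energy_m full .
 then have lim_energy: "(\<lambda>m. LINT x|lebesgue. (norm (V m x))\<^sup>2) ----> B * k * E"
  using B0 k E by (intro tendsto_ennrealD) (auto intro!: mult_nonneg_nonneg)
 (* a difference of two truncations lives on pairs of times outside the smaller interval *)
 define tail where "tail m = (\<lambda>(t, s). if t \<notin> I m \<and> s \<notin> I m then full (t, s) else 0)" for m
 have tail_m [measurable]: "tail m \<in> borel_measurable ?P" for m
  unfolding tail_def full_def I_def by measurable
 have tail_lim: "(\<lambda>m. \<integral>\<^sup>+p. tail m p \<partial>?P) ----> (\<integral>\<^sup>+p. 0 \<partial>?P)"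
 proof (rule nn_integral_dominated_convergence[where w=full])
  show "AE p in ?P. tail m p <= full p" for m by (intro AE_I2) (auto simp: tail_def)
  show "AE p in ?P. (\<lambda>m. tail m p) ----> 0"
  proof (intro AE_I2, clarify)
   fix t s :: real
   show "(\<lambda>m. tail m (t, s)) ----> 0"
   proof (cases "t > 0")
    case True
    have "eventually (\<lambda>m. tail m (t, s) = 0) sequentially"
     using Iev[OF True] by eventually_elim (simp add: tail_def)
    then show ?thesis by (rule tendsto_eventually)
   next
    case False
    then have "tail m (t, s) = 0" for m by (simp add: tail_def full_def w_def)
    then show ?thesis by simp
   qed
  qed
 qed (use full in auto)
 have diff_le: "ennreal (LINT x|lebesgue. (norm (V i x - V j x))\<^sup>2) <= (\<integral>\<^sup>+p. tail m p \<partial>?P)" if ij: "i >= m" "j >= m" for i j m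
 proof -
  define N where "N = max i j"
  define d where "d t = c i t - c j t" for t
  have [measurable]: "d \<in> borel_measurable borel" unfolding d_def by measurable
  have d_out: "d t = 0" if "t \<notin> I N" for t
  proof -
   have "I i \<subseteq> I N" "I j \<subseteq> I N" by (auto intro!: Imono simp: N_def)
   then have "t \<notin> I i" "t \<notin> I j" using that by blast+
   then show ?thesis by (simp add: d_def c_out)
  qed
  have d_in: "d t = 0" if "t \<in> I m" for t
  proof -
   have "t \<in> I i" "t \<in> I j" using that Imono[OF ij(1)] Imono[OF ij(2)] by blast+
   then show ?thesis by (simp add: d_def c_def)
  qed
  have d_w: "\<bar>d t\<bar> <= w t" for t using c0[where t=t] unfolding d_def by (smt (verit))
  have d_le: "\<bar>d t\<bar> <= (1 / real (Suc i)) powr (\<beta> - 1) + (1 / real (Suc j)) powr (\<beta> - 1)" for t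
   using c_le[of i t] c_le[of j t] unfolding d_def by linarith
  have "V i x - V j x = (LBINT t. d t *\<^sub>R flow_grad u t x)" for x
   unfolding V_def d_def scaleR_diff_left by (rule Bochner_Integration.integral_diff[symmetric]) (rule S1)+
  then have "(LINT x|lebesgue. (norm (V i x - V j x))\<^sup>2) = (LBINT x.
    (LBINT t. d t *\<^sub>R flow_grad u t x) \<bullet> (LBINT t. d t *\<^sub>R flow_grad u t x))"
   by (subst lebesgue_integral_lborel) (auto simp: power2_norm_eq_inner)
  also have "... = (LBINT t. LBINT s. d t * d s * dissipation u (t + s))"
   by (rule heat_flow_superposition(3)[OF u _ _ _ d_le, where a="1 / real (Suc N)" and b="real (Suc N)"])
    (auto intro: d_out simp: I_def)
  also have "... = (LINT p|?P. (case p of (t, s) => d t * d s * dissipation u (t + s)))"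
   by (rule integrable_pair_fst(3), rule heat_flow_superposition(4)[OF u _ _ _ d_le, where a="1 / real (Suc N)" and b="real (Suc N)"])
    (auto intro: d_out simp: I_def)
  finally have eq: "(LINT x|lebesgue. (norm (V i x - V j x))\<^sup>2) = (LINT p|?P. (case p of (t, s) => d t * d s * dissipation u (t + s)))" .
  have "ennreal (LINT x|lebesgue. (norm (V i x - V j x))\<^sup>2) <= ennreal (norm (LINT p|?P. (case p of (t, s) => d t * d s * dissipation u (t + s))))"
   unfolding eq by (intro ennreal_leI) simp
  also have "... <= (\<integral>\<^sup>+p. ennreal (norm (case p of (t, s) => d t * d s * dissipation u (t + s))) \<partial>?P)"
   by (rule integral_norm_bound_ennreal, rule heat_flow_superposition(4)[OF u _ _ _ d_le, where a="1 / real (Suc N)" and b="real (Suc N)"])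
    (auto intro: d_out simp: I_def)
  also have "... <= (\<integral>\<^sup>+p. tail m p \<partial>?P)"
  proof (intro nn_integral_mono, clarify)
   fix t s :: real
   show "ennreal (norm (d t * d s * dissipation u (t + s))) <= tail m (t, s)"
   proof (cases "t \<in> I m \<or> s \<in> I m \<or> t \<notin> I N \<or> s \<notin> I N")
    case True
    then have "d t * d s = 0" using d_in d_out by auto
    then show ?thesis by auto
   next
    case False
    then have ts: "t > 0" "s > 0" using I0 by auto
    have "\<bar>d t * d s * dissipation u (t + s)\<bar> <= w t * w s * dissipation u (t + s)"
     using diss0[OF ts] d_w[of t] d_w[of s] by (simp add: abs_mult mult_right_mono mult_mono w0)
    then have "ennreal (norm (d t * d s * dissipation u (t + s))) <= ennreal (w t * w s * dissipation u (t + s))"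
     by (intro ennreal_leI) simp
    then show ?thesis using False w0 by (simp add: tail_def full_def ennreal_mult')
   qed
  qed
  finally show ?thesis .
 qed
 have cauchy: "\<exists>N. \<forall>i\<ge>N. \<forall>j\<ge>N. (LINT x|lebesgue. (norm (V i x - V j x))\<^sup>2) < \<epsilon>" if \<epsilon>: "\<epsilon> > 0" for \<epsilon>
 proof -
  have "eventually (\<lambda>m. (\<integral>\<^sup>+p. tail m p \<partial>?P) < ennreal \<epsilon>) sequentially"
   using order_tendstoD(2)[OF tail_lim, of "ennreal \<epsilon>"] \<epsilon> by simp
  then obtain m where m: "(\<integral>\<^sup>+p. tail m p \<partial>?P) < ennreal \<epsilon>" by (auto simp: eventually_sequentially)
  have "(LINT x|lebesgue. (norm (V i x - V j x))\<^sup>2) < \<epsilon>" if "i >= m" "j >= m" for i j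
   using le_less_trans[OF diff_le[OF that] m] by (simp add: ennreal_less_iff)
  then show ?thesis by blast
 qed
 obtain G r where G: "sq_integrable G" "(\<lambda>m. LINT x|lebesgue. (norm (V m x - G x))\<^sup>2) ----> 0"
  using riesz_fischer[OF Vsq cauchy] by blast
 note limG = tendsto_abs_L2[OF Vsq G]
 have normG: "(LINT x|lebesgue. (norm (G x))\<^sup>2) = B * k * E"
 proof -
  have "(\<lambda>m. (norm (abs_L2 (V m)))\<^sup>2) ----> (norm (abs_L2 G))\<^sup>2" by (intro tendsto_intros limG)
  then have "(\<lambda>m. LINT x|lebesgue. (norm (V m x))\<^sup>2) ----> (LINT x|lebesgue. (norm (G x))\<^sup>2)"
   by (simp add: norm_abs_L2 Vsq G(1))
  with lim_energy show ?thesis using LIMSEQ_unique by blast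
 qed
 have pair: "(LINT x|lebesgue. G x \<bullet> \<Psi> x) = (LBINT t. w t * (LBINT y. u y * (LBINT x. heat_grad t (x - y) \<bullet> \<Psi> x)))"
  if \<Psi>I: "integrable lborel \<Psi>" and M: "\<And>x. norm (\<Psi> x) <= M"
   and JI: "integrable lborel (\<lambda>t. w t * (LBINT y. u y * (LBINT x. heat_grad t (x - y) \<bullet> \<Psi> x)))" for \<Psi> M
 proof -
  have [measurable]: "\<Psi> \<in> borel_measurable borel" using \<Psi>I by auto
  have M0: "M >= 0" using M[of 0] norm_ge_zero[of "\<Psi> 0"] by linarith
  define J where "J t = w t * (LBINT y. u y * (LBINT x. heat_grad t (x - y) \<bullet> \<Psi> x))" for t
  have JI: "integrable lborel J" using JI by (simp add: J_def[abs_def])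
  have Jeq: "J t = w t * (LBINT x. flow_grad u t x \<bullet> \<Psi> x)" for t
  proof (cases "t > 0")
   case True
   have "(LBINT x. flow_grad u t x \<bullet> \<Psi> x) = (LBINT y. u y * (LBINT x. heat_grad t (x - y) \<bullet> \<Psi> x))"
    unfolding flow_grad_def by (rule convolution_pairing[OF u \<Psi>I _ heat_grad_le[OF True]]) measurable
   then show ?thesis by (simp add: J_def)
  qed (simp add: J_def w_def)
  have lim1: "(\<lambda>m. LBINT t. indicator (I m) t * J t) ----> (LBINT t. J t)"
  proof (rule integral_dominated_convergence[where w="\<lambda>t. \<bar>J t\<bar>"])
   show "AE t in lborel. (\<lambda>m. indicator (I m) t * J t) ----> J t"
   proof (intro AE_I2)
    fix t :: real
    show "(\<lambda>m. indicator (I m) t * J t) ----> J t"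
    proof (cases "t > 0")
     case True
     have "eventually (\<lambda>m. indicator (I m) t * J t = J t) sequentially" using Iev[OF True] by eventually_elim simp
     then show ?thesis by (rule tendsto_eventually)
    qed (simp add: J_def w_def)
   qed
   show "(\<lambda>t. indicator (I m) t * J t) \<in> borel_measurable lborel" for m using JI unfolding I_def by measurable
  qed (use JI in \<open>auto simp: indicator_def\<close>)
  have trunc: "(LBINT t. indicator (I m) t * J t) = (LINT x|lebesgue. V m x \<bullet> \<Psi> x)" for m
  proof -
   define f where "f t x = (c m t *\<^sub>R flow_grad u t x) \<bullet> \<Psi> x" for t x
   have fI: "integrable lborel2 (\<lambda>(t, x). f t x)"
   proof (rule bochner_bound)
    show "integrable lborel2 (\<lambda>p. M * (case p of (t, x) => c m t * norm (flow_grad u t x)))"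
     using S5 by (intro integrable_mult_right)
    show "AE p in lborel \<Otimes>\<^sub>M lborel. norm (case p of (t, x) => f t x) <= norm (M * (case p of (t, x) => c m t * norm (flow_grad u t x)))"
    proof (intro AE_I2, clarify)
     fix t x
     have "\<bar>f t x\<bar> <= norm (c m t *\<^sub>R flow_grad u t x) * M"
      unfolding f_def by (rule order_trans[OF Cauchy_Schwarz_ineq2]) (intro mult_left_mono M norm_ge_zero)
     then show "norm (f t x) <= norm (M * (c m t * norm (flow_grad u t x)))"
      using M0 by (simp add: abs_mult mult_ac)
    qed
   qed (unfold f_def, measurable)
   have Vf: "(LBINT t. f t x) = V m x \<bullet> \<Psi> x" for x
    unfolding f_def V_def by (rule integral_inner_left) (use S1 in simp)
   have "(LBINT t. indicator (I m) t * J t) = (LBINT t. LBINT x. f t x)"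
    unfolding Jeq f_def by (simp add: c_w mult.assoc)
   also have "... = (LBINT x. V m x \<bullet> \<Psi> x)" using integrable_pair_fst(4)[OF fI] by (simp add: Vf)
   also have "... = (LINT x|lebesgue. V m x \<bullet> \<Psi> x)" by (subst lebesgue_integral_lborel) auto
   finally show ?thesis .
  qed
  have \<Psi>: "sq_integrable \<Psi>"
  proof -
   have "integrable lborel (\<lambda>x. (norm (\<Psi> x))\<^sup>2)"
   proof (rule bochner_bound)
    show "integrable lborel (\<lambda>x. M * norm (\<Psi> x))" using \<Psi>I by simp
    show "AE x in lborel. norm ((norm (\<Psi> x))\<^sup>2) <= norm (M * norm (\<Psi> x))"
     using M M0 by (intro AE_I2) (simp add: power2_eq_square mult_right_mono)
   qed simp
   then show ?thesis unfolding sq_integrable_def by (simp add: measurable_completion lebesgue_integral_lborel)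
  qed
  have lim2: "(\<lambda>m. LINT x|lebesgue. V m x \<bullet> \<Psi> x) ----> (LINT x|lebesgue. G x \<bullet> \<Psi> x)"
  proof -
   have "(\<lambda>m. abs_L2 (V m) \<bullet> abs_L2 \<Psi>) ----> abs_L2 G \<bullet> abs_L2 \<Psi>" by (intro tendsto_inner limG tendsto_const)
   then show ?thesis by (simp add: inner_abs_L2 Vsq G(1) \<Psi>)
  qed
  show ?thesis using LIMSEQ_unique[OF lim1[unfolded trunc] lim2] by (simp add: J_def[abs_def])
 qed
 define C where "C = grad_const n \<sigma>"
 have \<alpha>: "0 < 1 - \<sigma>" "1 - \<sigma> < 1" using \<sigma> by auto
 show ?thesis
 proof (rule that)
  show CG: "sq_integrable (\<lambda>x. C *\<^sub>R G x)" by (rule sq_integrable_scaleR[OF G(1)])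
  have "(LINT x|lebesgue. (norm (C *\<^sub>R G x))\<^sup>2) = C\<^sup>2 * (B * k * E)"
   by (simp add: power_mult_distrib normG)
  also have "... = energy_const n \<sigma> * E"
   by (simp add: energy_const_def C_def B_def \<beta>_def k_def)
  finally show "ennreal (LINT x|lebesgue. (norm (C *\<^sub>R G x))\<^sup>2) = ennreal (energy_const (real CARD('n)) \<sigma>) * gagliardo \<sigma> u"
   using energy_const_pos[OF \<sigma>, of n] E by (simp add: n_def ennreal_mult Suc_leI)
  show "has_sigma_gradient \<sigma> u (\<lambda>x. C *\<^sub>R G x)"
   unfolding has_sigma_gradient_def has_distributional_gradient_def
  proof (intro conjI ballI allI)
   show "locally_integrable (riesz_potential (1 - \<sigma>) u)" by (rule riesz_potential_locally_integrable[OF \<alpha> u])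
   show "locally_integrable (\<lambda>x. C *\<^sub>R G x)" by (rule sq_integrable_locally_integrable[OF CG])
   fix \<phi> :: "real^'n => real" and j assume \<phi>: "\<phi> \<in> test_functions UNIV"
   note \<phi>' = test_function_partial_deriv[OF \<phi>, of j]
   note \<phi>I = test_function_integrable[OF \<phi>] test_function_integrable[OF \<phi>']
   have [measurable]: "partial_deriv j \<phi> \<in> borel_measurable borel" "riesz_potential (1 - \<sigma>) u \<in> borel_measurable borel"
    using test_function_borel[OF \<phi>'] riesz_potential_measurable[of u] by auto
   obtain M where M: "M >= 0" "\<And>x. \<bar>\<phi> x\<bar> <= M" using test_function_bounded[OF \<phi>] by blast
   obtain M' where M': "\<And>x. \<bar>partial_deriv j \<phi> x\<bar> <= M'" using test_function_bounded[OF \<phi>'] by blast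
   note rp = riesz_pairing[OF \<alpha> u \<phi>I(2) M']
   define \<Psi> where "\<Psi> x = \<phi> x *\<^sub>R (axis j 1 :: real^'n)" for x
   have \<Psi>i: "a \<bullet> \<Psi> x = (a $ j) * \<phi> x" for a x by (simp add: \<Psi>_def inner_axis mult.commute)
   have eq: "pos t * (t powr ((1 - \<sigma>) / 2 - 1) * (LBINT y. u y * (LBINT x. heat t (x - y) * partial_deriv j \<phi> x))) =
     - (w t * (LBINT y. u y * (LBINT x. heat_grad t (x - y) \<bullet> \<Psi> x)))" for t
    by (simp add: heat_test_by_parts[OF \<phi>] w_def \<beta>_def \<Psi>i)
   have "(LINT x|lebesgue. G x \<bullet> \<Psi> x) = (LBINT t. w t * (LBINT y. u y * (LBINT x. heat_grad t (x - y) \<bullet> \<Psi> x)))"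
   proof (rule pair)
    show "integrable lborel \<Psi>" using \<phi>I(1) by (simp add: \<Psi>_def[abs_def])
    show "norm (\<Psi> x) <= M" for x using M(2) by (simp add: \<Psi>_def norm_axis_1)
    show "integrable lborel (\<lambda>t. w t * (LBINT y. u y * (LBINT x. heat_grad t (x - y) \<bullet> \<Psi> x)))"
     using rp(2) unfolding eq by simp
   qed
   then have "(LBINT x. riesz_potential (1 - \<sigma>) u x * partial_deriv j \<phi> x) = - (C * (LINT x|lebesgue. G x \<bullet> \<Psi> x))"
    unfolding rp(3) eq by (simp add: C_def grad_const_def n_def)
   moreover have "(LINT x|lebesgue. ((C *\<^sub>R G x) $ j) * \<phi> x) = C * (LINT x|lebesgue. G x \<bullet> \<Psi> x)"
    by (simp add: \<Psi>_def inner_axis mult_ac)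
   ultimately show "(LINT x|lebesgue. riesz_potential (1 - \<sigma>) u x * partial_deriv j \<phi> x) = - (LINT x|lebesgue. ((C *\<^sub>R G x) $ j) * \<phi> x)"
    by (subst lebesgue_integral_lborel) auto
  qed
  show "\<forall>s>0. \<forall>z. (LINT x|lebesgue. (C *\<^sub>R G x) \<bullet> heat_grad s (x - z)) = - (grad_const (real CARD('n)) \<sigma> *
   (LBINT t. pos t * t powr ((1 - \<sigma>) / 2 - 1) * (LBINT y. u y * heat_dt (s + t) (y - z))))"
  proof (intro allI impI)
   fix s :: real and z :: "real^'n" assume s: "s > 0"
   have q: "integrable lborel (\<lambda>x::real^'n. heat_dt s (x - z))"
    using lborel_integral_translate(2)[of "heat_dt s" z] heat_dt_integrable[OF s, where 'n='n] by simp
   define L where "L t = pos t * t powr ((1 - \<sigma>) / 2 - 1) * (LBINT y. u y * heat_dt (s + t) (y - z))" for t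
   have e1: "pos t * (t powr ((1 - \<sigma>) / 2 - 1) * (LBINT y. u y * (LBINT x. heat t (x - y) * heat_dt s (x - z)))) = L t" for t
    by (cases "t > 0") (simp_all add: L_def heat_convolution_dt s add.commute)
   have e2: "w t * (LBINT y. u y * (LBINT x. heat_grad t (x - y) \<bullet> heat_grad s (x - z))) = - L t" for t
    by (cases "t > 0") (simp_all add: L_def w_def \<beta>_def heat_convolution_grad s add.commute)
   have "(LINT x|lebesgue. G x \<bullet> heat_grad s (x - z)) = (LBINT t. - L t)" unfolding e2[symmetric]
   proof (rule pair)
    show "integrable lborel (\<lambda>x::real^'n. heat_grad s (x - z))"
     using lborel_integral_translate(2)[of "heat_grad s" z] heat_grad_integrable[OF s, where 'n='n] by simp
    show "norm (heat_grad s (x - z)) <= s powr (- real CARD('n) / 2 - 1 / 2)" for x by (rule heat_grad_le[OF s])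
    show "integrable lborel (\<lambda>t. w t * (LBINT y. u y * (LBINT x. heat_grad t (x - y) \<bullet> heat_grad s (x - z))))"
     using riesz_pairing(2)[OF \<alpha> u q heat_dt_le[OF s]] unfolding e1 e2 by simp
   qed
   then show "(LINT x|lebesgue. (C *\<^sub>R G x) \<bullet> heat_grad s (x - z)) = - (grad_const (real CARD('n)) \<sigma> *
    (LBINT t. pos t * t powr ((1 - \<sigma>) / 2 - 1) * (LBINT y. u y * heat_dt (s + t) (y - z))))"
    unfolding L_def[symmetric] by (simp add: C_def n_def)
  qed
 qed
qed

section \<open>The supremum bound\<close>

lemma abs_integral_le_nn:
 fixes f :: "'a => real"
 assumes "(\<integral>\<^sup>+t. ennreal \<bar>f t\<bar> \<partial>M) <= ennreal c" "c >= 0"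
 shows "\<bar>LINT t|M. f t\<bar> <= c"
proof (cases "integrable M f")
 case True
 have "ennreal \<bar>LINT t|M. f t\<bar> <= ennreal c"
  using integral_norm_bound_ennreal[OF True] assms(1) by simp
 then show ?thesis using assms(2) by (simp add: ennreal_le_iff)
next
 case False then show ?thesis using assms(2) by (simp add: not_integrable_integral_eq)
qed

lemma abs_integral_le_powers:
 fixes f :: "real => real"
 assumes a: "a > -1" and b: "b < -1" and AB: "A >= 0" "B >= 0"
  and le: "\<And>t. \<bar>f t\<bar> <= A * (indicator {0<..<1} t * t powr a) + B * (indicator {1..} t * t powr b)"
 shows "\<bar>LBINT t. f t\<bar> <= A / (a + 1) + B / (- (b + 1))"
proof (rule abs_integral_le_nn)
 have "(NN t. ennreal \<bar>f t\<bar>) <=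
   (NN t. ennreal A * ennreal (indicator {0<..<1} t * t powr a) + ennreal B * ennreal (indicator {1..} t * t powr b))"
  using le AB by (intro nn_integral_mono) (simp add: ennreal_mult[symmetric] ennreal_plus[symmetric] ennreal_leI del: ennreal_plus)
 also have "... <= ennreal A * ennreal (1 / (a + 1)) + ennreal B * ennreal (1 / (- (b + 1)))"
  by (rule nn_integral_powers_le[OF a b])
 also have "... = ennreal (A / (a + 1) + B / (- (b + 1)))"
  using a b AB by (simp add: ennreal_mult[symmetric] ennreal_plus[symmetric] del: ennreal_plus)
 finally show "(NN t. ennreal \<bar>f t\<bar>) <= ennreal (A / (a + 1) + B / (- (b + 1)))" .
 have "0 <= A / (a + 1)" "0 <= B / (- (b + 1))" using a b AB by (auto intro!: divide_nonneg_nonneg)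
 then show "0 <= A / (a + 1) + B / (- (b + 1))" by (rule add_nonneg_nonneg)
qed

text \<open>
 The inversion of the Abel transform when \<open>a + b = 1\<close>.
\<close>

lemma Beta_Fubini:
 fixes h :: "real => real"
 assumes a: "a > 0" and b: "b > 0" and [measurable]: "h \<in> borel_measurable borel"
  and fin: "(NN r. ennreal (pos r * (Beta a b * r powr (a + b - 1))) * ennreal \<bar>h r\<bar>) < \<infinity>"
 shows "(LBINT t. pos t * t powr (a - 1) * (LBINT s. pos s * s powr (b - 1) * h (t + s))) =
  Beta a b * (LBINT r. pos r * r powr (a + b - 1) * h r)"
proof -
 define c where "c x y = pos y * y powr (x - 1)" for x y :: real
 have c0: "c x y >= 0" for x y by (simp add: c_def)
 have [measurable]: "c x \<in> borel_measurable borel" for x unfolding c_def by measurable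
 define f where "f t r = c a t * (c b (r - t) * h r)" for t r
 have f: "integrable lborel2 (case_prod f)"
 proof (rule integrable_pairI)
  show "case_prod f \<in> borel_measurable lborel2" unfolding f_def by measurable
  have "(NN r. ennreal \<bar>f t r\<bar>) = (NN s. ennreal (c a t) * ennreal (c b s) * ennreal \<bar>h (t + s)\<bar>)" for t
  proof -
   have "(NN s. ennreal (c a t) * ennreal (c b s) * ennreal \<bar>h (t + s)\<bar>) =
     (NN r. ennreal (c a t) * ennreal (c b (r - t)) * ennreal \<bar>h (t + (r - t))\<bar>)"
    by (rule nn_integral_translate[symmetric]) measurable
   also have "... = (NN r. ennreal \<bar>f t r\<bar>)"
    using c0 by (simp add: f_def abs_mult ennreal_mult mult.assoc)
   finally show ?thesis by simp
  qed
  then show "(NN t r. ennreal \<bar>f t r\<bar>) < \<infinity>"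
   using Beta_Tonelli[OF a b, of "\<lambda>r. ennreal \<bar>h r\<bar>"] fin by (simp add: c_def)
 qed
 have "(LBINT t. c a t * (LBINT s. c b s * h (t + s))) = (LBINT t. LBINT r. f t r)"
 proof (rule Bochner_Integration.integral_cong[OF refl])
  fix t
  have "(LBINT s. c b s * h (t + s)) = (LBINT r. c b (r - t) * h (t + (r - t)))"
   by (rule lborel_integral_translate(1)[symmetric]) measurable
  then show "c a t * (LBINT s. c b s * h (t + s)) = (LBINT r. f t r)" by (simp add: f_def)
 qed
 also have "... = (LBINT r. LBINT t. f t r)" using integrable_pair_fst(4)[OF f] by simp
 also have "... = (LBINT r. Beta a b * (pos r * r powr (a + b - 1) * h r))"
 proof (rule Bochner_Integration.integral_cong[OF refl])
  fix r
  have "(LBINT t. c a t * c b (r - t)) = pos r * (Beta a b * r powr (a + b - 1))"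
  proof (cases "r > 0")
   case True
   have "c a t * c b (r - t) = indicator {0<..<r} t * (t powr (a - 1) * (r - t) powr (b - 1))" for t
    by (auto simp: c_def indicator_def)
   then have "(NN t. ennreal (c a t * c b (r - t))) = ennreal (Beta a b * r powr (a + b - 1))"
    using nn_integral_Beta[OF a b True] by simp
   then show ?thesis using c0 True Beta_nonneg[OF a b] by (subst integral_eq_nn_integral) auto
  next
   case False
   then have "(\<lambda>t. c a t * c b (r - t)) = (\<lambda>t. 0)" by (intro ext) (auto simp: c_def indicator_def)
   then show ?thesis using False by (simp only: integral_zero) simp
  qed
  moreover have "(LBINT t. f t r) = (LBINT t. c a t * c b (r - t)) * h r"
   by (simp add: f_def mult.assoc[symmetric])
  ultimately show "(LBINT t. f t r) = Beta a b * (pos r * r powr (a + b - 1) * h r)" by simp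
 qed
 finally show ?thesis by (simp add: c_def)
qed

lemma nn_integral_powr_shift:
 fixes b r :: real
 assumes b: "b < -1" and r: "r > 0"
 shows "(NN t. ennreal (pos t * (r + t) powr b)) < \<infinity>"
proof -
 define W where "W t = ennreal (indicator {r..} t * t powr b)" for t
 have [measurable]: "W \<in> borel_measurable borel" unfolding W_def by measurable
 have "(NN t. ennreal (pos t * (r + t) powr b)) <= (NN t. W (t - (- r)))"
  unfolding W_def by (intro nn_integral_mono ennreal_leI) (auto simp: indicator_def add.commute)
 also have "... = (NN t. W t)" by (rule nn_integral_translate) measurable
 also have "... < \<infinity>" unfolding W_def using nn_integral_powr_inf[OF b r] by simp
 finally show ?thesis .
qed

lemma heat_dt_integral_inf:
 fixes z :: "real^'n::finite"
 assumes r: "r > 0"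
 shows "integrable lborel (\<lambda>t. pos t * heat_dt (r + t) z)"
  and "(LBINT t. pos t * heat_dt (r + t) z) = - heat r z"
proof -
 define n where "n = real CARD('n)"
 have n: "n > 0" by (simp add: n_def)
 show I: "integrable lborel (\<lambda>t. pos t * heat_dt (r + t) z)"
 proof (rule integrableI_bounded)
  have "(NN t. ennreal (norm (pos t * heat_dt (r + t) z))) <=
    (NN t. ennreal (1 + n / 2) * ennreal (pos t * (r + t) powr (- n / 2 - 1)))"
  proof (intro nn_integral_mono)
   fix t
   have "norm (pos t * heat_dt (r + t) z) <= (1 + n / 2) * (pos t * (r + t) powr (- n / 2 - 1))"
    using heat_dt_le[of "r + t" z] r n by (auto simp: indicator_def n_def)
   from ennreal_leI[OF this] n show "ennreal (norm (pos t * heat_dt (r + t) z)) <=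
     ennreal (1 + n / 2) * ennreal (pos t * (r + t) powr (- n / 2 - 1))"
    by (subst (asm) ennreal_mult) auto
  qed
  also have "... < \<infinity>"
   using nn_integral_powr_shift[of "- n / 2 - 1" r] r n by (subst nn_integral_cmult) (auto simp: ennreal_mult_less_top)
  finally show "(NN t. ennreal (norm (pos t * heat_dt (r + t) z))) < \<infinity>" .
 qed simp
 have "(LBINT t=0..\<infinity>. heat_dt (r + t) z) = 0 - heat r z"
 proof (rule interval_integral_FTC_integrable)
  fix t assume t: "0 < ereal t" "ereal t < \<infinity>"
  then have rt: "r + t > 0" using r by simp
  have "((\<lambda>t. r + t) has_real_derivative 1) (at t)" by (auto intro!: derivative_eq_intros)
  from DERIV_chain2[OF heat_has_dt[OF rt] this]
  show "((\<lambda>t. heat (r + t) z) has_vector_derivative heat_dt (r + t) z) (at t)"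
   by (simp add: has_real_derivative_iff_has_vector_derivative)
  show "isCont (\<lambda>t. heat_dt (r + t) z) t"
   by (rule isCont_o2[where g="\<lambda>t. heat_dt t z"]) (use isCont_heat_dt[OF rt] in auto)
 next
  show "set_integrable lborel (einterval 0 \<infinity>) (\<lambda>t. heat_dt (r + t) z)"
   using I by (simp add: set_integrable_def einterval_def greaterThan_def)
  have "isCont (\<lambda>t. heat (r + t) z) 0"
   by (rule isCont_o2[where g="\<lambda>t. heat t z"]) (use DERIV_isCont[OF heat_has_dt[OF r]] in auto)
  then have "((\<lambda>t. heat (r + t) z) \<longlongrightarrow> heat (r + 0) z) (at 0)" by (rule isContD)
  then have "((\<lambda>t. heat (r + t) z) \<longlongrightarrow> heat r z) (at_right 0)" using tendsto_within_subset by fastforce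
  then show "(((\<lambda>t. heat (r + t) z) \<circ> real_of_ereal) \<longlongrightarrow> heat r z) (at_right 0)"
   unfolding zero_ereal_def by (simp add: ereal_tendsto_simps)
  have "((\<lambda>t. (r + t) powr (- n / 2)) \<longlongrightarrow> 0) at_top"
   using n by (intro tendsto_neg_powr filterlim_tendsto_add_at_top[OF tendsto_const filterlim_ident]) auto
  moreover have "\<forall>\<^sub>F t in at_top. norm (heat (r + t) z) <= (r + t) powr (- n / 2)"
   using eventually_gt_at_top[of 0]
  proof eventually_elim
   case (elim t) then show ?case using heat_le[of "r + t" z] r by (simp add: n_def)
  qed
  ultimately have "((\<lambda>t. heat (r + t) z) \<longlongrightarrow> 0) at_top" by (rule Lim_null_comparison[rotated])
  then show "(((\<lambda>t. heat (r + t) z) \<circ> real_of_ereal) \<longlongrightarrow> 0) (at_left \<infinity>)" by (simp add: ereal_tendsto_simps)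
 qed auto
 then show "(LBINT t. pos t * heat_dt (r + t) z) = - heat r z"
  by (simp add: interval_lebesgue_integral_def set_lebesgue_integral_def einterval_def greaterThan_def)
qed

text \<open>
 The heat flow tends to \<open>0\<close> as time tends to infinity, so it is recovered from its time
 derivative.
\<close>

lemma heat_flow_dt_integral:
 fixes v :: "real^'n::finite => real" and x0 :: "real^'n"
 assumes v: "integrable lborel v" and r: "r > 0"
 defines "k \<equiv> \<lambda>t. LBINT y. v y * heat_dt t (y - x0)"
 shows "(LBINT t. pos t * k (r + t)) = - (LBINT y. v y * heat r (y - x0))"
  and "(NN t. ennreal (pos t * \<bar>k (r + t)\<bar>)) < \<infinity>"
proof -
 have [measurable]: "v \<in> borel_measurable borel" using v by auto
 define n where "n = real CARD('n)"
 have n: "n > 0" by (simp add: n_def)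
 define f where "f t y = pos t * (v y * heat_dt (r + t) (y - x0))" for t y
 define w where "w t = (1 + n / 2) * (pos t * (r + t) powr (- n / 2 - 1))" for t
 have w: "(NN t. ennreal (w t)) < \<infinity>"
 proof -
  have "(NN t. ennreal (w t)) = ennreal (1 + n / 2) * (NN t. ennreal (pos t * (r + t) powr (- n / 2 - 1)))"
   unfolding w_def using n by (subst ennreal_mult, simp, simp, subst nn_integral_cmult) auto
  also have "... < \<infinity>" using nn_integral_powr_shift[of "- n / 2 - 1" r] r n by (auto simp: ennreal_mult_less_top)
  finally show ?thesis .
 qed
 have w0: "w t >= 0" for t using n by (simp add: w_def)
 have fw: "\<bar>f t y\<bar> <= w t * \<bar>v y\<bar>" for t y
 proof -
  have "pos t * \<bar>heat_dt (r + t) (y - x0)\<bar> <= w t"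
   using heat_dt_le[of "r + t" "y - x0"] r n by (auto simp: indicator_def n_def w_def)
  from mult_right_mono[OF this abs_ge_zero[of "v y"]] show ?thesis by (simp add: f_def abs_mult mult_ac)
 qed
 have [measurable]: "w \<in> borel_measurable borel" unfolding w_def by measurable
 have V: "(NN y. ennreal \<bar>v y\<bar>) = ennreal (LBINT y. \<bar>v y\<bar>)" using v by (intro nn_integral_eq_integral) auto
 have fI: "(NN t y. ennreal \<bar>f t y\<bar>) < \<infinity>"
 proof -
  have "(NN t y. ennreal \<bar>f t y\<bar>) <= (NN t y. ennreal (w t) * ennreal \<bar>v y\<bar>)"
   using fw w0 by (intro nn_integral_mono) (simp add: ennreal_mult[symmetric] ennreal_leI)
  also have "... = (NN t. ennreal (w t)) * ennreal (LBINT y. \<bar>v y\<bar>)"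
   by (simp add: nn_integral_cmult nn_integral_multc V)
  also have "... < \<infinity>" using w by (simp add: ennreal_mult_less_top)
  finally show ?thesis .
 qed
 have f: "integrable lborel2 (case_prod f)"
 proof (rule integrable_pairI[OF _ fI])
  show "case_prod f \<in> borel_measurable lborel2" unfolding f_def by measurable
 qed
 have fk: "(LBINT y. f t y) = pos t * k (r + t)" for t by (simp add: f_def k_def)
 have "(LBINT t. pos t * k (r + t)) = (LBINT y. LBINT t. f t y)"
  unfolding fk[symmetric] using integrable_pair_fst(4)[OF f] by simp
 also have "... = (LBINT y. - (v y * heat r (y - x0)))"
 proof (rule Bochner_Integration.integral_cong[OF refl])
  fix y
  have "(LBINT t. f t y) = (LBINT t. v y * (pos t * heat_dt (r + t) (y - x0)))"
   by (simp add: f_def mult_ac)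
  also have "... = - (v y * heat r (y - x0))" using heat_dt_integral_inf[OF r, of "y - x0"] by simp
  finally show "(LBINT t. f t y) = - (v y * heat r (y - x0))" .
 qed
 finally show "(LBINT t. pos t * k (r + t)) = - (LBINT y. v y * heat r (y - x0))" by simp
 have "integrable lborel (\<lambda>t. pos t * k (r + t))" using integrable_pair_fst(1)[OF f] by (simp add: fk)
 then have "(NN t. ennreal (norm (pos t * k (r + t)))) < \<infinity>" by (simp add: integrable_iff_bounded)
 then show "(NN t. ennreal (pos t * \<bar>k (r + t)\<bar>)) < \<infinity>" by (simp add: abs_mult)
qed

text \<open>
 Let \<open>k\<close> be the time derivative of the heat flow of \<open>v\<close> at \<open>x0\<close>, and \<open>\<Phi>\<close> its Abel transform
 with exponent \<open>\<beta>\<close>. Up to a constant \<open>\<Phi> s\<close> is the pairing of \<open>Dv\<close> with the gradient of the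
 heat kernel, hence at most a multiple of \<open>M s\<^bsup>-1/2\<^esup>\<close>; for large \<open>s\<close> it is at most a
 multiple of \<open>\<parallel>v\<parallel>\<^sub>1 / s\<close>. The complementary Abel transform of \<open>\<Phi>\<close> is minus the heat flow,
 and it converges at \<open>0\<close> because \<open>\<beta> + 1/2 < 1\<close>.
\<close>

lemma heat_flow_bound:
 fixes v :: "real^'n::finite => real"
 assumes \<sigma>: "0 < \<sigma>" "\<sigma> < 1" and v: "integrable lborel v" and v2: "integrable lborel (\<lambda>x. (v x)\<^sup>2)"
  and fin: "gagliardo \<sigma> v < \<infinity>" and G: "has_sigma_gradient \<sigma> v G"
  and M: "AE x in lebesgue. norm (G x) <= M" and M0: "M >= 0" and r: "r > 0"
 defines "n \<equiv> real CARD('n)" and "\<beta> \<equiv> (1 - \<sigma>) / 2"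
 shows "Beta (1 - \<beta>) \<beta> * \<bar>LBINT y. v y * heat r (y - x0)\<bar> <=
  M * ((n + 1) / grad_const n \<sigma>) / (1 / 2 - \<beta>) +
  (1 + n / 2) * (LBINT y. \<bar>v y\<bar>) * (1 / \<beta> + 1 / (1 / 2 - \<beta>)) / \<beta>"
proof -
 have [measurable]: "v \<in> borel_measurable borel" using v by auto
 have n: "n >= 1" by (simp add: n_def Suc_leI)
 have \<beta>: "0 < \<beta>" "\<beta> < 1 / 2" using \<sigma> by (auto simp: \<beta>_def)
 define V where "V = (LBINT y. \<bar>v y\<bar>)"
 have V0: "V >= 0" by (simp add: V_def)
 define k where "k t = (LBINT y. v y * heat_dt t (y - x0))" for t
 have [measurable]: "k \<in> borel_measurable borel" unfolding k_def by measurable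
 obtain H where H: "sq_integrable H" "has_sigma_gradient \<sigma> v H"
  "ennreal (LINT x|lebesgue. (norm (H x))\<^sup>2) = ennreal (energy_const (real CARD('n)) \<sigma>) * gagliardo \<sigma> v"
  "\<forall>s>0. \<forall>z. (LINT x|lebesgue. H x \<bullet> heat_grad s (x - z)) = - (grad_const (real CARD('n)) \<sigma> *
   (LBINT t. pos t * t powr ((1 - \<sigma>) / 2 - 1) * (LBINT y. v y * heat_dt (s + t) (y - z))))"
  by (rule fractional_gradient_exists[OF \<sigma> v v2 fin])
 have HM: "AE x in lebesgue. norm (H x) <= M"
  using M distributional_gradient_unique[OF G[unfolded has_sigma_gradient_def] H(2)[unfolded has_sigma_gradient_def]]
  by eventually_elim simp
 define \<Phi> where "\<Phi> s = (LBINT t. pos t * t powr (\<beta> - 1) * k (s + t))" for s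
 have k_le: "\<bar>k t\<bar> <= (1 + n / 2) * V * t powr (- n / 2 - 1)" if t: "t > 0" for t
 proof (unfold k_def, rule abs_integral_le_nn)
  have "(NN y. ennreal \<bar>v y * heat_dt t (y - x0)\<bar>) <= (NN y. ennreal ((1 + n / 2) * t powr (- n / 2 - 1)) * ennreal \<bar>v y\<bar>)"
  proof (intro nn_integral_mono)
   fix y
   have "\<bar>v y\<bar> * \<bar>heat_dt t (y - x0)\<bar> <= \<bar>v y\<bar> * ((1 + n / 2) * t powr (- n / 2 - 1))"
    unfolding n_def by (intro mult_left_mono heat_dt_le t) auto
   then show "ennreal \<bar>v y * heat_dt t (y - x0)\<bar> <= ennreal ((1 + n / 2) * t powr (- n / 2 - 1)) * ennreal \<bar>v y\<bar>"
    using n by (simp add: ennreal_mult[symmetric] ennreal_leI abs_mult mult.commute)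
  qed
  also have "... = ennreal ((1 + n / 2) * t powr (- n / 2 - 1)) * ennreal V"
   using v by (simp add: nn_integral_cmult V_def nn_integral_eq_integral)
  also have "... = ennreal ((1 + n / 2) * V * t powr (- n / 2 - 1))"
   using n V0 by (simp add: ennreal_mult[symmetric] mult_ac)
  finally show "(NN y. ennreal \<bar>v y * heat_dt t (y - x0)\<bar>) <= ennreal ((1 + n / 2) * V * t powr (- n / 2 - 1))" .
 qed (use n V0 in simp)
 have \<Phi>1: "\<bar>\<Phi> s\<bar> <= M * ((n + 1) / grad_const n \<sigma>) * s powr (- 1 / 2)" if s: "s > 0" for s
 proof -
  have hgI: "integrable lebesgue (\<lambda>x::real^'n. norm (heat_grad s (x - x0)))"
   using lborel_integral_translate(2)[of "\<lambda>z. norm (heat_grad s z)" x0] heat_grad_integrable[OF s, where 'n='n]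
   by (subst lebesgue_integral_lborel) auto
  have "grad_const n \<sigma> * \<bar>\<Phi> s\<bar> = \<bar>LINT x|lebesgue. H x \<bullet> heat_grad s (x - x0)\<bar>"
   using H(4) s grad_const_pos[OF \<sigma> n] by (simp add: \<Phi>_def k_def \<beta>_def n_def abs_mult)
  also have "... <= (LINT x|lebesgue. \<bar>H x \<bullet> heat_grad s (x - x0)\<bar>)" by (rule integral_abs_bound)
  also have "... <= (LINT x|lebesgue. M * norm (heat_grad s (x - x0)))"
  proof (rule integral_mono_AE')
   show "AE x in lebesgue. \<bar>H x \<bullet> heat_grad s (x - x0)\<bar> <= M * norm (heat_grad s (x - x0))"
    using HM
   proof eventually_elim
    case (elim x)
    then show ?case by (intro order_trans[OF Cauchy_Schwarz_ineq2] mult_right_mono) auto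
   qed
  qed (use hgI M0 in auto)
  also have "... = M * (LBINT x. norm (heat_grad s (x - x0)))" by (simp add: lebesgue_integral_lborel)
  also have "(LBINT x. norm (heat_grad s (x - x0))) = (LBINT z. norm (heat_grad s (z::real^'n)))"
   by (rule lborel_integral_translate(1)[of "\<lambda>z. norm (heat_grad s z)"]) simp
  also have "M * ... <= M * ((n + 1) / sqrt s)"
  proof (intro mult_left_mono M0)
   have "ennreal (LBINT z. norm (heat_grad s (z::real^'n))) <= ennreal ((n + 1) / sqrt s)"
    using heat_grad_nn_integral[OF s, where 'n='n] heat_grad_integrable[OF s, where 'n='n]
    by (subst nn_integral_eq_integral[symmetric]) (auto simp: n_def)
   then show "(LBINT z. norm (heat_grad s (z::real^'n))) <= (n + 1) / sqrt s"
    using s by (subst (asm) ennreal_le_iff) (auto simp: n_def)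
  qed
  finally have "\<bar>\<Phi> s\<bar> <= M * ((n + 1) / sqrt s) / grad_const n \<sigma>"
   by (subst pos_le_divide_eq[OF grad_const_pos[OF \<sigma> n]]) (simp only: mult.commute)
  also have "... = M * ((n + 1) / grad_const n \<sigma>) * s powr (- 1 / 2)"
   using s by (simp add: powr_minus_divide powr_half_sqrt)
  finally show ?thesis .
 qed
 (* (s + t) powr (-3/2) is at most (1/s) * t powr (-1/2), which is integrable at infinity
  against t powr (beta - 1) because beta < 1/2 *)
 have \<Phi>2: "\<bar>\<Phi> s\<bar> <= (1 + n / 2) * V * (1 / \<beta> + 1 / (1 / 2 - \<beta>)) * s powr (- 1)" if s: "s >= 1" for s
 proof -
  define c where "c = (1 + n / 2) * V * s powr (- 1)"
  have c0: "c >= 0" using n V0 by (simp add: c_def)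
  have "\<bar>\<Phi> s\<bar> <= c / (\<beta> - 1 + 1) + c / (- (\<beta> - 3 / 2 + 1))" unfolding \<Phi>_def
  proof (rule abs_integral_le_powers)
   fix t :: real
   show "\<bar>pos t * t powr (\<beta> - 1) * k (s + t)\<bar> <= c * (indicator {0<..<1} t * t powr (\<beta> - 1)) + c * (indicator {1..} t * t powr (\<beta> - 3 / 2))"
   proof (cases "t > 0")
    case True
    have "(s + t) powr (- n / 2 - 1) <= (s + t) powr (- 1 + - 1 / 2)" using s True n by (intro powr_mono) auto
    also have "... = (s + t) powr (- 1) * (s + t) powr (- 1 / 2)" by (rule powr_add)
    also have "... <= s powr (- 1) * (max 1 t) powr (- 1 / 2)"
     using s True by (intro mult_mono powr_mono2') auto
    finally have "(1 + n / 2) * V * (s + t) powr (- n / 2 - 1) <= (1 + n / 2) * V * (s powr (- 1) * (max 1 t) powr (- 1 / 2))"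
     using n V0 by (intro mult_left_mono) auto
    then have "\<bar>k (s + t)\<bar> <= c * (max 1 t) powr (- 1 / 2)" using k_le[of "s + t"] s True by (simp add: c_def mult.assoc)
    then have kk: "t powr (\<beta> - 1) * \<bar>k (s + t)\<bar> <= t powr (\<beta> - 1) * (c * (max 1 t) powr (- 1 / 2))" by (intro mult_left_mono) auto
    show ?thesis
    proof (cases "t < 1")
     case True then show ?thesis using kk \<open>t > 0\<close> by (simp add: abs_mult mult_ac)
    next
     case False
     have "t powr (\<beta> - 1) * (c * t powr (- 1 / 2)) = c * (t powr (\<beta> - 1) * t powr (- 1 / 2))" by simp
     also have "t powr (\<beta> - 1) * t powr (- 1 / 2) = t powr (\<beta> - 3 / 2)" by (simp add: powr_add[symmetric])
     finally have "t powr (\<beta> - 1) * \<bar>k (s + t)\<bar> <= c * t powr (\<beta> - 3 / 2)" using kk False by (simp only: max_def not_less if_True)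
     then show ?thesis using False by (simp add: abs_mult)
    qed
   qed simp
  qed (use \<beta> c0 in auto)
  also have "... = (1 + n / 2) * V * (1 / \<beta> + 1 / (1 / 2 - \<beta>)) * s powr (- 1)"
  proof -
   have "\<beta> - 1 + 1 = \<beta>" "- (\<beta> - 3 / 2 + 1) = 1 / 2 - \<beta>" by auto
   moreover have "c / \<beta> + c / (1 / 2 - \<beta>) = c * (1 / \<beta> + 1 / (1 / 2 - \<beta>))" by (simp add: distrib_left)
   ultimately show ?thesis by (simp only: c_def mult_ac)
  qed
  finally show ?thesis .
 qed
 have fin: "(NN t. ennreal (pos t * (Beta (1 - \<beta>) \<beta> * t powr (1 - \<beta> + \<beta> - 1))) * ennreal \<bar>k (r + t)\<bar>) < \<infinity>"
 proof -
  have "(NN t. ennreal (pos t * (Beta (1 - \<beta>) \<beta> * t powr (1 - \<beta> + \<beta> - 1))) * ennreal \<bar>k (r + t)\<bar>) <=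
    (NN t. ennreal (Beta (1 - \<beta>) \<beta>) * ennreal (pos t * \<bar>k (r + t)\<bar>))"
   using Beta_nonneg[of "1 - \<beta>" \<beta>] \<beta> by (intro nn_integral_mono) (auto simp: ennreal_mult[symmetric] indicator_def)
  also have "... < \<infinity>"
   using heat_flow_dt_integral(2)[OF v r, of x0] by (subst nn_integral_cmult) (simp_all add: k_def ennreal_mult_less_top)
  finally show ?thesis .
 qed
 have "(LBINT t. pos t * t powr (1 - \<beta> - 1) * (LBINT s. pos s * s powr (\<beta> - 1) * k (r + (t + s)))) =
   Beta (1 - \<beta>) \<beta> * (LBINT t. pos t * t powr (1 - \<beta> + \<beta> - 1) * k (r + t))"
  using \<beta> fin by (intro Beta_Fubini[where h="\<lambda>t. k (r + t)"]) auto
 moreover have "(LBINT t. pos t * t powr (1 - \<beta> + \<beta> - 1) * k (r + t)) = (LBINT t. pos t * k (r + t))"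
  by (rule Bochner_Integration.integral_cong[OF refl]) (auto simp: indicator_def)
 ultimately have "Beta (1 - \<beta>) \<beta> * - (LBINT y. v y * heat r (y - x0)) =
   (LBINT t. pos t * t powr (- \<beta>) * \<Phi> (r + t))"
  using heat_flow_dt_integral(1)[OF v r, of x0] by (simp add: k_def \<Phi>_def add.assoc)
 then have "\<bar>Beta (1 - \<beta>) \<beta> * - (LBINT y. v y * heat r (y - x0))\<bar> = \<bar>LBINT t. pos t * t powr (- \<beta>) * \<Phi> (r + t)\<bar>"
  by (simp only:)
 also have "... <= M * ((n + 1) / grad_const n \<sigma>) / (- \<beta> - 1 / 2 + 1) +
   (1 + n / 2) * V * (1 / \<beta> + 1 / (1 / 2 - \<beta>)) / (- (- \<beta> - 1 + 1))"
 proof (rule abs_integral_le_powers)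
  define A where "A = M * ((n + 1) / grad_const n \<sigma>)"
  define B where "B = (1 + n / 2) * V * (1 / \<beta> + 1 / (1 / 2 - \<beta>))"
  show A0: "0 <= M * ((n + 1) / grad_const n \<sigma>)" using M0 n grad_const_pos[OF \<sigma> n] by simp
  show B0: "0 <= (1 + n / 2) * V * (1 / \<beta> + 1 / (1 / 2 - \<beta>))" using n V0 \<beta> by simp
  fix t :: real
  have "\<bar>pos t * t powr (- \<beta>) * \<Phi> (r + t)\<bar> <= A * (indicator {0<..<1} t * t powr (- \<beta> - 1 / 2)) + B * (indicator {1..} t * t powr (- \<beta> - 1))"
  proof (cases "t > 0")
   case True
   show ?thesis
   proof (cases "t < 1")
    case t1: True
    have "\<bar>\<Phi> (r + t)\<bar> <= A * (r + t) powr (- 1 / 2)" using \<Phi>1[of "r + t"] r True by (simp add: A_def)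
    also have "... <= A * t powr (- 1 / 2)" using A0 r True by (intro mult_left_mono powr_mono2') (auto simp: A_def)
    finally have "t powr (- \<beta>) * \<bar>\<Phi> (r + t)\<bar> <= t powr (- \<beta>) * (A * t powr (- 1 / 2))" by (intro mult_left_mono) auto
    also have "... = A * (t powr (- \<beta>) * t powr (- 1 / 2))" by simp
    also have "t powr (- \<beta>) * t powr (- 1 / 2) = t powr (- \<beta> - 1 / 2)" by (simp add: powr_add[symmetric])
    finally show ?thesis using True t1 by (simp add: abs_mult)
   next
    case t1: False
    have "\<bar>\<Phi> (r + t)\<bar> <= B * (r + t) powr (- 1)" using \<Phi>2[of "r + t"] r t1 by (simp add: B_def)
    also have "... <= B * t powr (- 1)" using B0 r True by (intro mult_left_mono powr_mono2') (auto simp: B_def)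
    finally have "t powr (- \<beta>) * \<bar>\<Phi> (r + t)\<bar> <= t powr (- \<beta>) * (B * t powr (- 1))" by (intro mult_left_mono) auto
    also have "... = B * (t powr (- \<beta>) * t powr (- 1))" by simp
    also have "t powr (- \<beta>) * t powr (- 1) = t powr (- \<beta> - 1)" by (simp only: powr_add[symmetric] diff_conv_add_uminus)
    finally show ?thesis using True t1 by (simp add: abs_mult)
   qed
  qed simp
  then show "\<bar>pos t * t powr (- \<beta>) * \<Phi> (r + t)\<bar> <= M * ((n + 1) / grad_const n \<sigma>) * (indicator {0<..<1} t * t powr (- \<beta> - 1 / 2)) +
    (1 + n / 2) * V * (1 / \<beta> + 1 / (1 / 2 - \<beta>)) * (indicator {1..} t * t powr (- \<beta> - 1))"
   by (simp only: A_def B_def)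
 qed (use \<beta> in auto)
 finally show ?thesis using Beta_nonneg[of "1 - \<beta>" \<beta>] \<beta> by (simp add: abs_mult V_def)
qed

text \<open>
 Integrate \<open>a\<^sup>2 >= 2 c a - c\<^sup>2\<close> with \<open>a = v x - v y\<close> and \<open>c\<close> its mean.
\<close>

lemma jensen_heat:
 fixes v :: "real^'n::finite => real"
 assumes v: "integrable lborel v" and r: "r > 0"
 shows "ennreal ((v x - (LBINT y. v y * heat r (y - x)))\<^sup>2) <= (NN y. ennreal ((v x - v y)\<^sup>2 * heat r (x - y)))"
proof -
 have [measurable]: "v \<in> borel_measurable borel" using v by auto
 define p where "p = (LBINT y. v y * heat r (y - x))"
 define c where "c = v x - p"
 have H: "integrable lborel (\<lambda>y. heat r (y - x))" "(LBINT y. heat r (y - x)) = 1"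
  using lborel_integral_translate[of "heat r" x] heat_integrable[OF r, where 'n='n] heat_integral[OF r, where 'n='n] by auto
 have hv: "integrable lborel (\<lambda>y. v y * heat r (y - x))"
 proof (rule bochner_bound)
  show "integrable lborel (\<lambda>y. r powr (- real CARD('n) / 2) * v y)" using v by simp
  have "\<bar>v y\<bar> * \<bar>heat r (y - x)\<bar> <= \<bar>v y\<bar> * r powr (- real CARD('n) / 2)" for y
   using heat_le[OF r, of "y - x"] by (intro mult_left_mono) (auto simp: heat_def)
  then show "AE y in lborel. norm (v y * heat r (y - x)) <= norm (r powr (- real CARD('n) / 2) * v y)"
   by (intro AE_I2) (simp add: abs_mult mult.commute)
 qed measurable
 define g where "g y = (2 * c * v x - c\<^sup>2) * heat r (y - x) - (2 * c) * (v y * heat r (y - x))" for y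
 have gI: "integrable lborel g" unfolding g_def using H(1) hv by simp
 have "(LBINT y. g y) = (2 * c * v x - c\<^sup>2) - (2 * c) * p" unfolding g_def using H hv by (simp add: p_def)
 also have "... = c\<^sup>2" by (simp add: c_def power2_eq_square algebra_simps)
 finally have "ennreal (c\<^sup>2) = ennreal (LBINT y. g y)" by simp
 also have "... <= ennreal (LBINT y. max 0 (g y))" using gI by (intro ennreal_leI integral_mono) auto
 also have "... = (NN y. ennreal (max 0 (g y)))" using gI by (intro nn_integral_eq_integral[symmetric]) auto
 also have "... <= (NN y. ennreal ((v x - v y)\<^sup>2 * heat r (x - y)))"
 proof (intro nn_integral_mono ennreal_leI)
  fix y
  have "0 <= (v x - v y - c)\<^sup>2" by simp
  then have "2 * c * v x - c\<^sup>2 - 2 * c * v y <= (v x - v y)\<^sup>2" by (simp add: power2_eq_square algebra_simps)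
  then have "(2 * c * v x - c\<^sup>2 - 2 * c * v y) * heat r (y - x) <= (v x - v y)\<^sup>2 * heat r (y - x)"
   by (intro mult_right_mono) (auto simp: heat_def)
  then have "g y <= (v x - v y)\<^sup>2 * heat r (x - y)" unfolding heat_commute[of r x y] by (simp add: g_def algebra_simps)
  moreover have "0 <= (v x - v y)\<^sup>2 * heat r (x - y)" by (simp add: heat_def)
  ultimately show "max 0 (g y) <= (v x - v y)\<^sup>2 * heat r (x - y)" by simp
 qed
 finally show ?thesis by (simp add: c_def p_def)
qed

text \<open>
 The heat flow of \<open>v\<close> is bounded by \<open>K\<close> at all positive times, and by \<open>jensen_heat\<close> the
 square of the \<open>L\<^sup>2\<close> norm of the part of \<open>\<bar>v\<bar>\<close> above \<open>K\<close> is at most twice the defect, which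
 vanishes at time \<open>0\<close>.
\<close>

lemma bounded_sigma_gradient_imp_bounded:
 assumes \<sigma>: "0 < \<sigma>" "\<sigma> < 1"
 obtains C where "C >= 0" "\<And>(v :: real^'n::finite => real) G M. integrable lborel v ==> integrable lborel (\<lambda>x. (v x)\<^sup>2) ==>
  gagliardo \<sigma> v < \<infinity> ==> has_sigma_gradient \<sigma> v G ==> AE x in lebesgue. norm (G x) <= M ==> M >= 0 ==>
  AE x in lborel. \<bar>v x\<bar> <= C * (M + (LBINT y. \<bar>v y\<bar>))"
proof -
 define n where "n = real CARD('n)"
 define \<beta> where "\<beta> = (1 - \<sigma>) / 2"
 have n: "n >= 1" by (simp add: n_def Suc_leI)
 have \<beta>: "0 < \<beta>" "\<beta> < 1 / 2" using \<sigma> by (auto simp: \<beta>_def)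
 define B where "B = Beta (1 - \<beta>) \<beta>"
 have B: "B > 0" unfolding B_def Beta_def using \<beta> by (intro divide_pos_pos mult_pos_pos Gamma_real_pos) auto
 define a where "a = (n + 1) / grad_const n \<sigma> / (1 / 2 - \<beta>)"
 define b where "b = (1 + n / 2) * (1 / \<beta> + 1 / (1 / 2 - \<beta>)) / \<beta>"
 have a: "a >= 0" unfolding a_def using n \<beta> grad_const_pos[OF \<sigma> n] by simp
 have b: "b >= 0" unfolding b_def using n \<beta> by simp
 define C where "C = (a + b) / B"
 show ?thesis
 proof (rule that[of C])
  show "C >= 0" using a b B by (simp add: C_def)
  fix v :: "real^'n => real" and G M
  assume v: "integrable lborel v" "integrable lborel (\<lambda>x. (v x)\<^sup>2)" and fin: "gagliardo \<sigma> v < \<infinity>"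
   and G: "has_sigma_gradient \<sigma> v G" and M: "AE x in lebesgue. norm (G x) <= M" "M >= 0"
  have [measurable]: "v \<in> borel_measurable borel" using v by auto
  define V where "V = (LBINT y. \<bar>v y\<bar>)"
  have V0: "V >= 0" by (simp add: V_def)
  define K where "K = C * (M + V)"
  have p: "\<bar>LBINT y. v y * heat r (y - x)\<bar> <= K" if r: "r > 0" for r x
  proof -
   have "B * \<bar>LBINT y. v y * heat r (y - x)\<bar> <= M * a + V * b"
    using heat_flow_bound[OF \<sigma> v fin G M r, of x] by (simp add: B_def a_def b_def \<beta>_def n_def V_def mult_ac)
   also have "... <= M * (a + b) + V * (a + b)" using a b M V0 by (intro add_mono mult_left_mono) auto
   also have "... = B * K"
   proof -
    have "B * K = (B * C) * (M + V)" by (simp add: K_def)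
    also have "B * C = a + b" using B by (simp add: C_def)
    finally show ?thesis by (simp only: distrib_left mult.commute)
   qed
   finally show ?thesis using B by simp
  qed
  obtain D where D: "\<And>r. r > 0 ==> defect v r <= D * r powr \<sigma>" using defect_powr_bound[OF v \<sigma>(1) fin] by blast
  define I where "I = (NN x. ennreal ((max 0 (\<bar>v x\<bar> - K))\<^sup>2))"
  have le: "I <= ennreal (2 * (D * r powr \<sigma>))" if r: "r > 0" for r
  proof -
   have "I <= (NN x y. ennreal ((v x - v y)\<^sup>2 * heat r (x - y)))" unfolding I_def
   proof (intro nn_integral_mono)
    fix x
    have "max 0 (\<bar>v x\<bar> - K) <= \<bar>v x - (LBINT y. v y * heat r (y - x))\<bar>" using p[OF r, of x] by linarith
    then have "(max 0 (\<bar>v x\<bar> - K))\<^sup>2 <= (v x - (LBINT y. v y * heat r (y - x)))\<^sup>2"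
     by (subst abs_le_square_iff[symmetric]) simp
    then show "ennreal ((max 0 (\<bar>v x\<bar> - K))\<^sup>2) <= (NN y. ennreal ((v x - v y)\<^sup>2 * heat r (x - y)))"
     using order_trans[OF ennreal_leI jensen_heat[OF v(1) r]] by blast
   qed
   also have "... <= ennreal (2 * (D * r powr \<sigma>))" using defect_eq(1)[OF v r] D[OF r] by (simp add: ennreal_leI)
   finally show ?thesis .
  qed
  have "((\<lambda>r. ennreal (2 * (D * r powr \<sigma>))) \<longlongrightarrow> ennreal (2 * (D * 0))) (at_right 0)"
  proof (intro tendsto_ennrealI tendsto_mult tendsto_const)
   show "((\<lambda>r. r powr \<sigma>) \<longlongrightarrow> 0) (at_right 0)"
    using \<sigma> by (intro tendsto_eq_rhs[OF tendsto_powr'[OF tendsto_ident_at tendsto_const[of \<sigma>]]]) (auto simp: eventually_at_filter)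
  qed
  then have "I <= ennreal (2 * (D * 0))"
   by (rule tendsto_lowerbound) (use le in \<open>auto simp: eventually_at_filter\<close>)
  then have "I = 0" by simp
  then have "AE x in lborel. ennreal ((max 0 (\<bar>v x\<bar> - K))\<^sup>2) = 0" unfolding I_def by (subst (asm) nn_integral_0_iff_AE) auto
  then show "AE x in lborel. \<bar>v x\<bar> <= C * (M + (LBINT y. \<bar>v y\<bar>))"
   by eventually_elim (auto simp: K_def V_def)
 qed
qed

section \<open>Fractional Sobolev functions vanishing outside a bounded set\<close>

lemma Hsigma_sqnorm_eq: "Hsigma_sqnorm \<sigma> u = (NN x. ennreal (\<bar>u x\<bar>\<^sup>2)) + gagliardo \<sigma> u"
 unfolding Hsigma_sqnorm_def gagliardo_def nn_integral_completion by simp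

lemma Hsigma_sqnorm_cong:
 fixes u v :: "real^'n::finite => real"
 assumes "AE x in lborel. u x = v x"
 shows "Hsigma_sqnorm \<sigma> u = Hsigma_sqnorm \<sigma> v"
proof -
 have "(NN x. ennreal (\<bar>u x\<bar>\<^sup>2)) = (NN x. ennreal (\<bar>v x\<bar>\<^sup>2))"
  using assms by (intro nn_integral_cong_AE) (auto elim: eventually_mono)
 moreover have "gagliardo \<sigma> u = gagliardo \<sigma> v" unfolding gagliardo_def
 proof (rule nn_integral_cong_AE)
  show "AE x in lborel. (NN y. ennreal (\<bar>u x - u y\<bar>\<^sup>2 / norm (x - y) powr (real CARD('n) + 2 * \<sigma>))) =
    (NN y. ennreal (\<bar>v x - v y\<bar>\<^sup>2 / norm (x - y) powr (real CARD('n) + 2 * \<sigma>)))"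
   using assms
  proof eventually_elim
   case (elim x)
   show ?case
   proof (rule nn_integral_cong_AE)
    show "AE y in lborel. ennreal (\<bar>u x - u y\<bar>\<^sup>2 / norm (x - y) powr (real CARD('n) + 2 * \<sigma>)) =
      ennreal (\<bar>v x - v y\<bar>\<^sup>2 / norm (x - y) powr (real CARD('n) + 2 * \<sigma>))"
     using assms by eventually_elim (simp add: elim)
   qed
  qed
 qed
 ultimately show ?thesis by (simp add: Hsigma_sqnorm_eq)
qed

lemma has_sigma_gradient_cong:
 fixes u v :: "real^'n::finite => real"
 assumes [measurable]: "u \<in> borel_measurable lebesgue" "v \<in> borel_measurable lebesgue" and "AE x in lebesgue. u x = v x"
 shows "has_sigma_gradient \<sigma> u = has_sigma_gradient \<sigma> v"
proof -
 have "(LINT y|lebesgue. u y / norm (x - y) powr c) = (LINT y|lebesgue. v y / norm (x - y) powr c)" for x c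
 proof (rule integral_cong_AE)
  have k: "(\<lambda>y. norm (x - y) powr c) \<in> borel_measurable lebesgue" by (rule measurable_completion) measurable
  show "(\<lambda>y. u y / norm (x - y) powr c) \<in> borel_measurable lebesgue" "(\<lambda>y. v y / norm (x - y) powr c) \<in> borel_measurable lebesgue"
   using assms k by (auto intro: borel_measurable_divide)
  show "AE y in lebesgue. u y / norm (x - y) powr c = v y / norm (x - y) powr c"
   using assms(3) by eventually_elim simp
 qed
 then show ?thesis by (simp add: has_sigma_gradient_def fun_eq_iff riesz_potential_def[abs_def])
qed

text \<open>
 Borel representatives remain Borel on product spaces, so that Fubini's theorem applies to
 them.
\<close>

lemma borel_representative:
 fixes u :: "real^'n::finite => real"
 assumes u: "u \<in> borel_measurable lebesgue"
 obtains v where "v \<in> borel_measurable borel" "AE x in lborel. u x = v x" "\<And>\<sigma>. Hsigma_sqnorm \<sigma> u = Hsigma_sqnorm \<sigma> v"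
  "\<And>\<sigma>. has_sigma_gradient \<sigma> u = has_sigma_gradient \<sigma> v"
proof -
 obtain v where v: "v \<in> borel_measurable lborel" "AE x in lborel. u x = v x"
  using completion_ex_borel_measurable_real[OF u] by blast
 have "v \<in> borel_measurable lebesgue" using v(1) by (rule measurable_completion)
 then show ?thesis using that[of v] v Hsigma_sqnorm_cong[OF v(2)] has_sigma_gradient_cong[OF u _ AE_completion[OF v(2)]] by auto
qed

lemma square_lincomb_le: "(a * s + b * t)\<^sup>2 <= 2 * a\<^sup>2 * s\<^sup>2 + 2 * b\<^sup>2 * (t :: real)\<^sup>2"
proof -
 have "0 <= (a * s - b * t)\<^sup>2" by simp
 then show ?thesis by (simp add: power2_eq_square algebra_simps)
qed

lemma ennreal_lincomb_le:
 assumes "x <= A * p + B * q" "A >= 0" "B >= 0" "p >= 0" "q >= 0"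
 shows "ennreal x <= ennreal A * ennreal p + ennreal B * ennreal q"
 using ennreal_leI[OF assms(1)] assms(2-) by (simp add: ennreal_mult)

lemma Hsigma_sqnorm_lincomb:
 fixes u v :: "real^'n::finite => real"
 assumes u: "u \<in> borel_measurable lebesgue" and v: "v \<in> borel_measurable lebesgue"
 shows "Hsigma_sqnorm \<sigma> (\<lambda>x. a * u x + b * v x) <= ennreal (2 * a\<^sup>2) * Hsigma_sqnorm \<sigma> u + ennreal (2 * b\<^sup>2) * Hsigma_sqnorm \<sigma> v"
proof -
 obtain u' where u': "u' \<in> borel_measurable borel" "AE x in lborel. u x = u' x" "Hsigma_sqnorm \<sigma> u = Hsigma_sqnorm \<sigma> u'"
  using borel_representative[OF u] by metis
 obtain v' where v': "v' \<in> borel_measurable borel" "AE x in lborel. v x = v' x" "Hsigma_sqnorm \<sigma> v = Hsigma_sqnorm \<sigma> v'"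
  using borel_representative[OF v] by metis
 note [measurable] = u'(1) v'(1)
 have "AE x in lborel. a * u x + b * v x = a * u' x + b * v' x" using u'(2) v'(2) by eventually_elim simp
 then have eq: "Hsigma_sqnorm \<sigma> (\<lambda>x. a * u x + b * v x) = Hsigma_sqnorm \<sigma> (\<lambda>x. a * u' x + b * v' x)" by (rule Hsigma_sqnorm_cong)
 let ?a = "ennreal (2 * a\<^sup>2)" and ?b = "ennreal (2 * b\<^sup>2)"
 have "(NN x. ennreal (\<bar>a * u' x + b * v' x\<bar>\<^sup>2)) <= (NN x. ?a * ennreal (\<bar>u' x\<bar>\<^sup>2) + ?b * ennreal (\<bar>v' x\<bar>\<^sup>2))"
 proof (intro nn_integral_mono)
  fix x
  show "ennreal (\<bar>a * u' x + b * v' x\<bar>\<^sup>2) <= ?a * ennreal (\<bar>u' x\<bar>\<^sup>2) + ?b * ennreal (\<bar>v' x\<bar>\<^sup>2)"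
   using ennreal_leI[OF square_lincomb_le[of a "u' x" b "v' x"]] by (simp add: ennreal_mult)
 qed
 also have "... = ?a * (NN x. ennreal (\<bar>u' x\<bar>\<^sup>2)) + ?b * (NN x. ennreal (\<bar>v' x\<bar>\<^sup>2))"
  by (subst nn_integral_add) (auto simp: nn_integral_cmult)
 finally have 1: "(NN x. ennreal (\<bar>a * u' x + b * v' x\<bar>\<^sup>2)) <=
   ?a * (NN x. ennreal (\<bar>u' x\<bar>\<^sup>2)) + ?b * (NN x. ennreal (\<bar>v' x\<bar>\<^sup>2))" .
 define k where "k x y = norm (x - y) powr (real CARD('n) + 2 * \<sigma>)" for x y :: "real^'n"
 have [measurable]: "(\<lambda>(x, y). k x y) \<in> borel_measurable (borel \<Otimes>\<^sub>M borel)" unfolding k_def by measurable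
 have k0: "k x y >= 0" for x y by (simp add: k_def)
 have "gagliardo \<sigma> (\<lambda>x. a * u' x + b * v' x) <=
   (NN x y. ?a * ennreal (\<bar>u' x - u' y\<bar>\<^sup>2 / k x y) + ?b * ennreal (\<bar>v' x - v' y\<bar>\<^sup>2 / k x y))"
  unfolding gagliardo_def k_def[symmetric]
 proof (intro nn_integral_mono)
  fix x y
  have "(a * (u' x - u' y) + b * (v' x - v' y))\<^sup>2 / k x y <= (2 * a\<^sup>2 * (u' x - u' y)\<^sup>2 + 2 * b\<^sup>2 * (v' x - v' y)\<^sup>2) / k x y"
   by (intro divide_right_mono square_lincomb_le k0)
  then have "\<bar>a * u' x + b * v' x - (a * u' y + b * v' y)\<bar>\<^sup>2 / k x y <=
    2 * a\<^sup>2 * ((u' x - u' y)\<^sup>2 / k x y) + 2 * b\<^sup>2 * ((v' x - v' y)\<^sup>2 / k x y)"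
   by (simp add: add_divide_distrib right_diff_distrib algebra_simps)
  then show "ennreal (\<bar>a * u' x + b * v' x - (a * u' y + b * v' y)\<bar>\<^sup>2 / k x y) <=
    ?a * ennreal (\<bar>u' x - u' y\<bar>\<^sup>2 / k x y) + ?b * ennreal (\<bar>v' x - v' y\<bar>\<^sup>2 / k x y)"
   using k0[of x y] by (intro ennreal_lincomb_le) auto
 qed
 also have "... = ?a * gagliardo \<sigma> u' + ?b * gagliardo \<sigma> v'"
  unfolding gagliardo_def k_def[symmetric] by (simp add: nn_integral_add nn_integral_cmult)
 finally have 2: "gagliardo \<sigma> (\<lambda>x. a * u' x + b * v' x) <= ?a * gagliardo \<sigma> u' + ?b * gagliardo \<sigma> v'" .
 show ?thesis unfolding eq u'(3) v'(3) unfolding Hsigma_sqnorm_eq using add_mono[OF 1 2] by (simp add: distrib_left ac_simps)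
qed

lemma ennreal_quarter:
 fixes \<epsilon> :: ennreal
 assumes "\<epsilon> > 0" obtains \<delta> where "\<delta> > 0" "\<And>x y. x < \<delta> ==> y < \<delta> ==> ennreal 2 * x + ennreal 2 * y < \<epsilon>"
proof -
 obtain c where c: "0 < c" "c < \<epsilon>" using dense[OF assms] by blast
 then have "c < top" using less_trans[of c \<epsilon> top] by (metis less_top not_less_iff_gr_or_eq top.not_eq_extremum)
 then obtain r where r: "c = ennreal r" "r > 0" using c(1) by (cases c) auto
 show ?thesis
 proof (rule that[of "ennreal (r / 4)"])
  show "ennreal (r / 4) > 0" using r by simp
  fix x y assume "x < ennreal (r / 4)" "y < ennreal (r / 4)"
  then have "ennreal 2 * x + ennreal 2 * y <= ennreal 2 * ennreal (r / 4) + ennreal 2 * ennreal (r / 4)"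
   by (intro add_mono mult_left_mono) auto
  also have "... = c"
  proof -
   have "ennreal (2 * (r / 4)) = ennreal 2 * ennreal (r / 4)" using r by (intro ennreal_mult) auto
   moreover have "ennreal (2 * (r / 4) + 2 * (r / 4)) = ennreal (2 * (r / 4)) + ennreal (2 * (r / 4))"
    using r by (intro ennreal_plus) auto
   moreover have "2 * (r / 4) + 2 * (r / 4) = r" by simp
   ultimately show ?thesis by (simp only: r(1))
  qed
  finally show "ennreal 2 * x + ennreal 2 * y < \<epsilon>" using c(2) by simp
 qed
qed

lemma Hsigma_sqnorm_diff:
 fixes u v :: "real^'n::finite => real"
 assumes "u \<in> borel_measurable lebesgue" "v \<in> borel_measurable lebesgue" "w \<in> borel_measurable lebesgue"
 shows "Hsigma_sqnorm \<sigma> (\<lambda>x. u x - w x) <= ennreal 2 * Hsigma_sqnorm \<sigma> (\<lambda>x. u x - v x) + ennreal 2 * Hsigma_sqnorm \<sigma> (\<lambda>x. v x - w x)"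
 using Hsigma_sqnorm_lincomb[of "\<lambda>x. u x - v x" "\<lambda>x. v x - w x" \<sigma> 1 1] assms by simp

lemma test_function_lebesgue: "\<phi> \<in> test_functions S ==> \<phi> \<in> borel_measurable lebesgue"
 by (rule measurable_completion) (simp add: test_function_borel)

lemma Hsigma0_closed:
 fixes u :: "real^'n::finite => real"
 assumes u: "u \<in> Hsigma \<sigma>" and approx: "\<And>\<epsilon>. \<epsilon> > 0 ==> \<exists>v\<in>Hsigma0 \<sigma> \<Omega>. Hsigma_sqnorm \<sigma> (\<lambda>x. u x - v x) < \<epsilon>"
 shows "u \<in> Hsigma0 \<sigma> \<Omega>"
 unfolding Hsigma0_def
proof (intro CollectI conjI u allI impI)
 fix \<epsilon> :: ennreal assume "\<epsilon> > 0"
 then obtain \<delta> where \<delta>: "\<delta> > 0" "\<And>x y. x < \<delta> ==> y < \<delta> ==> ennreal 2 * x + ennreal 2 * y < \<epsilon>"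
  using ennreal_quarter by metis
 obtain v where v: "v \<in> Hsigma0 \<sigma> \<Omega>" "Hsigma_sqnorm \<sigma> (\<lambda>x. u x - v x) < \<delta>" using approx[OF \<delta>(1)] by blast
 obtain \<phi> where \<phi>: "\<phi> \<in> test_functions \<Omega>" "Hsigma_sqnorm \<sigma> (\<lambda>x. v x - \<phi> x) < \<delta>"
  using v(1) \<delta>(1) unfolding Hsigma0_def by blast
 have "Hsigma_sqnorm \<sigma> (\<lambda>x. u x - \<phi> x) <= ennreal 2 * Hsigma_sqnorm \<sigma> (\<lambda>x. u x - v x) + ennreal 2 * Hsigma_sqnorm \<sigma> (\<lambda>x. v x - \<phi> x)"
  using u v(1) test_function_lebesgue[OF \<phi>(1)] by (intro Hsigma_sqnorm_diff) (auto simp: Hsigma0_def Hsigma_def)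
 also have "... < \<epsilon>" by (rule \<delta>(2)[OF v(2) \<phi>(2)])
 finally show "\<exists>\<phi>\<in>test_functions \<Omega>. Hsigma_sqnorm \<sigma> (\<lambda>x. u x - \<phi> x) < \<epsilon>" using \<phi>(1) by blast
qed

lemma Hsigma0_measurable: "u \<in> Hsigma0 \<sigma> \<Omega> ==> u \<in> borel_measurable lebesgue"
 and Hsigma0_finite: "u \<in> Hsigma0 \<sigma> \<Omega> ==> Hsigma_sqnorm \<sigma> u < \<infinity>"
 by (auto simp: Hsigma0_def Hsigma_def)

lemma Hsigma0_lincomb:
 fixes u v :: "real^'n::finite => real"
 assumes u: "u \<in> Hsigma0 \<sigma> \<Omega>" and v: "v \<in> Hsigma0 \<sigma> \<Omega>"
 shows "(\<lambda>x. a * u x + b * v x) \<in> Hsigma0 \<sigma> \<Omega>"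
proof -
 note m = Hsigma0_measurable[OF u] Hsigma0_measurable[OF v]
 have "Hsigma_sqnorm \<sigma> (\<lambda>x. a * u x + b * v x) <= ennreal (2 * a\<^sup>2) * Hsigma_sqnorm \<sigma> u + ennreal (2 * b\<^sup>2) * Hsigma_sqnorm \<sigma> v"
  by (rule Hsigma_sqnorm_lincomb[OF m])
 also have "... < \<infinity>" using Hsigma0_finite[OF u] Hsigma0_finite[OF v] by (simp add: ennreal_mult_less_top)
 finally have H: "(\<lambda>x. a * u x + b * v x) \<in> Hsigma \<sigma>" using m by (simp add: Hsigma_def)
 show ?thesis unfolding Hsigma0_def
 proof (intro CollectI conjI H allI impI)
  fix \<epsilon> :: ennreal assume \<epsilon>: "\<epsilon> > 0"
  obtain e where e: "0 < e" "e < \<epsilon>" using dense[OF \<epsilon>] by blast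
  then have "e < top" by (metis less_top not_less_iff_gr_or_eq top.not_eq_extremum)
  then obtain r where r: "e = ennreal r" "r > 0" using e(1) by (cases e) auto
  define d where "d = r / (2 * a\<^sup>2 + 2 * b\<^sup>2 + 1)"
  have q: "2 * a\<^sup>2 + 2 * b\<^sup>2 + 1 > 0" by (intro add_nonneg_pos) auto
  have d: "d > 0" using r q by (simp add: d_def)
  have dr: "2 * a\<^sup>2 * d + 2 * b\<^sup>2 * d <= r"
  proof -
   have "(2 * a\<^sup>2 + 2 * b\<^sup>2 + 1) * d = r" using q by (simp add: d_def)
   then show ?thesis using d by (simp add: distrib_right)
  qed
  obtain \<phi> where \<phi>: "\<phi> \<in> test_functions \<Omega>" "Hsigma_sqnorm \<sigma> (\<lambda>x. u x - \<phi> x) < ennreal d"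
   using u d unfolding Hsigma0_def by force
  obtain \<psi> where \<psi>: "\<psi> \<in> test_functions \<Omega>" "Hsigma_sqnorm \<sigma> (\<lambda>x. v x - \<psi> x) < ennreal d"
   using v d unfolding Hsigma0_def by force
  have "Hsigma_sqnorm \<sigma> (\<lambda>x. (a * u x + b * v x) - (a * \<phi> x + b * \<psi> x)) = Hsigma_sqnorm \<sigma> (\<lambda>x. a * (u x - \<phi> x) + b * (v x - \<psi> x))"
   by (simp add: algebra_simps)
  also have "... <= ennreal (2 * a\<^sup>2) * Hsigma_sqnorm \<sigma> (\<lambda>x. u x - \<phi> x) + ennreal (2 * b\<^sup>2) * Hsigma_sqnorm \<sigma> (\<lambda>x. v x - \<psi> x)"
   using m test_function_lebesgue[OF \<phi>(1)] test_function_lebesgue[OF \<psi>(1)] by (intro Hsigma_sqnorm_lincomb) auto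
  also have "... <= ennreal (2 * a\<^sup>2) * ennreal d + ennreal (2 * b\<^sup>2) * ennreal d"
   using \<phi>(2) \<psi>(2) by (intro add_mono mult_left_mono) auto
  also have "... = ennreal (2 * a\<^sup>2 * d + 2 * b\<^sup>2 * d)" using d by (simp add: ennreal_mult)
  also have "... <= e" unfolding r(1) by (rule ennreal_leI[OF dr])
  also have "... < \<epsilon>" by (rule e(2))
  finally show "\<exists>\<phi>\<in>test_functions \<Omega>. Hsigma_sqnorm \<sigma> (\<lambda>x. (a * u x + b * v x) - \<phi> x) < \<epsilon>"
   using test_functions_lincomb[OF \<phi>(1) \<psi>(1)] by (intro bexI[of _ "\<lambda>x. a * \<phi> x + b * \<psi> x"])
 qed
qed

lemma Hsigma0_0: "(\<lambda>x::real^'n::finite. 0) \<in> Hsigma0 \<sigma> \<Omega>"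
proof -
 have "Hsigma_sqnorm \<sigma> (\<lambda>x::real^'n. 0) = 0" by (simp add: Hsigma_sqnorm_def)
 moreover have "foldr partial_deriv js (\<lambda>x::real^'n. 0 :: real) = (\<lambda>x. 0)" for js :: "'n list"
  by (induction js) (auto simp: partial_deriv_def)
 then have "(\<lambda>x::real^'n. 0) \<in> test_functions \<Omega>" by (simp add: test_functions_def smooth_def)
 ultimately show ?thesis unfolding Hsigma0_def Hsigma_def
  by (intro CollectI conjI allI impI bexI[of _ "\<lambda>x. 0"]) auto
qed

text \<open>
 Test functions vanish outside the domain, and so do their \<open>L\<^sup>2\<close> limits.
\<close>

lemma Hsigma0_eq_0_outside:
 fixes u :: "real^'n::finite => real"
 assumes u: "u \<in> Hsigma0 \<sigma> \<Omega>" and \<Omega>: "open \<Omega>"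
 shows "AE x in lebesgue. x \<notin> \<Omega> --> u x = 0"
proof -
 have um: "u \<in> borel_measurable lebesgue" by (rule Hsigma0_measurable[OF u])
 have \<Omega>m: "- \<Omega> \<in> sets lebesgue" using \<Omega> by (simp add: borel_open)
 define I where "I = (\<integral>\<^sup>+x. ennreal (indicator (- \<Omega>) x * \<bar>u x\<bar>\<^sup>2) \<partial>lebesgue)"
 have "I <= \<epsilon>" if \<epsilon>: "\<epsilon> > 0" for \<epsilon>
 proof -
  obtain \<phi> where \<phi>: "\<phi> \<in> test_functions \<Omega>" "Hsigma_sqnorm \<sigma> (\<lambda>x. u x - \<phi> x) < \<epsilon>"
   using u \<epsilon> unfolding Hsigma0_def by blast
  have "\<phi> x = 0" if "x \<notin> \<Omega>" for x
   using \<phi>(1) that closure_subset[of "{x. \<phi> x \<noteq> 0}"] unfolding test_functions_def by auto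
  then have "I <= (\<integral>\<^sup>+x. ennreal (\<bar>u x - \<phi> x\<bar>\<^sup>2) \<partial>lebesgue)" unfolding I_def
   by (intro nn_integral_mono ennreal_leI) (auto simp: indicator_def)
  also have "... <= Hsigma_sqnorm \<sigma> (\<lambda>x. u x - \<phi> x)" unfolding Hsigma_sqnorm_def by simp
  finally show ?thesis using \<phi>(2) by simp
 qed
 then have "I = 0" using dense[of 0 I] by (metis leD not_gr_zero)
 then have "AE x in lebesgue. ennreal (indicator (- \<Omega>) x * \<bar>u x\<bar>\<^sup>2) = 0"
  unfolding I_def using um \<Omega>m by (subst (asm) nn_integral_0_iff_AE) auto
 then show ?thesis by eventually_elim (auto simp: indicator_def)
qed

text \<open>
 On a bounded set, square integrability implies integrability, as \<open>\<bar>v\<bar> <= 1 + v\<^sup>2\<close>.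
\<close>

lemma Hsigma0_representative:
 fixes u :: "real^'n::finite => real"
 assumes u: "u \<in> Hsigma0 \<sigma> \<Omega>" and \<Omega>: "open \<Omega>" "bounded \<Omega>"
 obtains v where "integrable lborel v" "integrable lborel (\<lambda>x. (v x)\<^sup>2)" "gagliardo \<sigma> v < \<infinity>"
  "AE x in lborel. u x = v x" "AE x in lborel. x \<notin> \<Omega> --> v x = 0"
  "Hsigma_sqnorm \<sigma> u = Hsigma_sqnorm \<sigma> v" "has_sigma_gradient \<sigma> u = has_sigma_gradient \<sigma> v"
proof -
 obtain v where v: "v \<in> borel_measurable borel" "AE x in lborel. u x = v x" "Hsigma_sqnorm \<sigma> u = Hsigma_sqnorm \<sigma> v"
  "has_sigma_gradient \<sigma> u = has_sigma_gradient \<sigma> v"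
  using borel_representative[OF Hsigma0_measurable[OF u]] by metis
 note [measurable] = v(1)
 have fin: "Hsigma_sqnorm \<sigma> v < \<infinity>" using Hsigma0_finite[OF u] v(3) by simp
 then have v2: "integrable lborel (\<lambda>x. (v x)\<^sup>2)"
  by (intro integrableI_bounded) (auto simp: Hsigma_sqnorm_eq)
 have out: "AE x in lborel. x \<notin> \<Omega> --> v x = 0"
  using Hsigma0_eq_0_outside[OF u \<Omega>(1), unfolded AE_completion_iff] v(2) by eventually_elim simp
 have "integrable lborel v"
 proof (rule bochner_bound)
  have "integrable lborel (indicator \<Omega> :: real^'n => real)"
   using \<Omega> emeasure_bounded_finite[OF \<Omega>(2)] by (intro integrable_real_indicator) (auto simp: borel_open)
  then show "integrable lborel (\<lambda>x. indicator \<Omega> x + (v x)\<^sup>2)" using v2 by (rule Bochner_Integration.integrable_add)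
  show "AE x in lborel. norm (v x) <= norm (indicator \<Omega> x + (v x)\<^sup>2)"
   using out
  proof eventually_elim
   case (elim x)
   have "\<bar>v x\<bar> <= 1 + (v x)\<^sup>2"
   proof -
    have "0 <= (\<bar>v x\<bar> - 1)\<^sup>2" by simp
    then have "2 * \<bar>v x\<bar> <= 1 + (v x)\<^sup>2" by (simp add: power2_eq_square algebra_simps)
    then show ?thesis by simp
   qed
   then show ?case using elim by (cases "x \<in> \<Omega>") auto
  qed
 qed simp
 moreover have "gagliardo \<sigma> v < \<infinity>" using fin by (simp add: Hsigma_sqnorm_eq)
 ultimately show ?thesis using that v v2 out by blast
qed

section \<open>Linearity of the fractional gradient\<close>

text \<open>
 Linearity holds after pairing with test functions, where the potentials are absolutely
 convergent.
\<close>

lemma riesz_pairing_lincomb: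
 fixes u v w :: "real^'n::finite => real"
 assumes \<alpha>: "0 < \<alpha>" "\<alpha> < 1" and u: "integrable lborel u" and v: "integrable lborel v"
  and w: "integrable lborel w" and B: "\<And>x. \<bar>w x\<bar> <= B"
 shows "(LBINT x. riesz_potential \<alpha> (\<lambda>x. a * u x + b * v x) x * w x) =
  a * (LBINT x. riesz_potential \<alpha> u x * w x) + b * (LBINT x. riesz_potential \<alpha> v x * w x)"
proof -
 have [measurable]: "u \<in> borel_measurable borel" "v \<in> borel_measurable borel" "w \<in> borel_measurable borel" using u v w by auto
 have uv: "integrable lborel (\<lambda>x. a * u x + b * v x)" using u v by simp
 have B0: "B >= 0" using B[of 0] by (meson abs_ge_zero order_trans)
 define k where "k t y = (LBINT x. heat t (x - y) * w x)" for t and y :: "real^'n"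
 have kI: "integrable lborel (\<lambda>y. h y * k t y)" if h: "integrable lborel h" and t: "t > 0" for h t
 proof (rule bochner_bound)
  show "integrable lborel (\<lambda>y. t powr (- real CARD('n) / 2) * (LBINT x. \<bar>w x\<bar>) * h y)" using h by simp
  have [measurable]: "h \<in> borel_measurable borel" using h by auto
  show "(\<lambda>y. h y * k t y) \<in> borel_measurable lborel" unfolding k_def by measurable
  have "\<bar>k t y\<bar> <= t powr (- real CARD('n) / 2) * (LBINT x. \<bar>w x\<bar>)" for y
  proof -
   have "\<bar>k t y\<bar> <= (LBINT x. \<bar>heat t (x - y) * w x\<bar>)" unfolding k_def by (rule integral_abs_bound)
   also have "... <= (LBINT x. t powr (- real CARD('n) / 2) * \<bar>w x\<bar>)"
   proof (rule integral_mono')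
    show "integrable lborel (\<lambda>x. t powr (- real CARD('n) / 2) * \<bar>w x\<bar>)" using w by simp
    fix x
    show "\<bar>heat t (x - y) * w x\<bar> <= t powr (- real CARD('n) / 2) * \<bar>w x\<bar>"
     using heat_le[OF t, of "x - y"] by (simp add: abs_mult heat_def mult_right_mono)
   qed simp
   finally show ?thesis by simp
  qed
  from mult_left_mono[OF this abs_ge_zero[of "h _"]]
  show "AE y in lborel. norm (h y * k t y) <= norm (t powr (- real CARD('n) / 2) * (LBINT x. \<bar>w x\<bar>) * h y)"
   by (intro AE_I2) (simp add: abs_mult mult.commute)
 qed
 define J where "J h t = pos t * (t powr (\<alpha> / 2 - 1) * (LBINT y. h y * k t y))" for h :: "real^'n => real" and t
 have Jlin: "J (\<lambda>x. a * u x + b * v x) t = a * J u t + b * J v t" for t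
 proof (cases "t > 0")
  case True
  have "(LBINT y. (a * u y + b * v y) * k t y) = (LBINT y. a * (u y * k t y) + b * (v y * k t y))"
   by (intro Bochner_Integration.integral_cong refl) (simp add: distrib_right)
  also have "... = a * (LBINT y. u y * k t y) + b * (LBINT y. v y * k t y)"
   using kI[OF u True] kI[OF v True] by simp
  finally show ?thesis using True by (simp add: J_def algebra_simps)
 qed (simp add: J_def)
 have JI: "integrable lborel (J u)" "integrable lborel (J v)"
  unfolding J_def[abs_def] k_def using riesz_pairing(2)[OF \<alpha> u w B] riesz_pairing(2)[OF \<alpha> v w B] by auto
 show ?thesis
  unfolding riesz_pairing(3)[OF \<alpha> uv w B] riesz_pairing(3)[OF \<alpha> u w B] riesz_pairing(3)[OF \<alpha> v w B]
  unfolding k_def[symmetric] unfolding J_def[symmetric] unfolding Jlin using JI by (simp add: distrib_left add_divide_distrib mult_ac)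
qed

lemma has_sigma_gradient_lincomb:
 fixes u v :: "real^'n::finite => real"
 assumes \<sigma>: "0 < \<sigma>" "\<sigma> < 1" and u: "integrable lborel u" and v: "integrable lborel v"
  and G: "has_sigma_gradient \<sigma> u G" and H: "has_sigma_gradient \<sigma> v H"
 shows "has_sigma_gradient \<sigma> (\<lambda>x. a * u x + b * v x) (\<lambda>x. a *\<^sub>R G x + b *\<^sub>R H x)"
 unfolding has_sigma_gradient_def has_distributional_gradient_def
proof (intro conjI ballI allI)
 have \<alpha>: "0 < 1 - \<sigma>" "1 - \<sigma> < 1" using \<sigma> by auto
 have uv: "integrable lborel (\<lambda>x. a * u x + b * v x)" using u v by simp
 have [measurable]: "u \<in> borel_measurable borel" "v \<in> borel_measurable borel" using u v by auto
 show "locally_integrable (riesz_potential (1 - \<sigma>) (\<lambda>x. a * u x + b * v x))"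
  by (rule riesz_potential_locally_integrable[OF \<alpha> uv])
 have GH: "locally_integrable G" "locally_integrable H"
  using G H by (auto simp: has_sigma_gradient_def has_distributional_gradient_def)
 then show "locally_integrable (\<lambda>x. a *\<^sub>R G x + b *\<^sub>R H x)" by (rule locally_integrable_lincomb)
 fix \<phi> :: "real^'n => real" and j assume \<phi>: "\<phi> \<in> test_functions UNIV"
 note \<phi>' = test_function_partial_deriv[OF \<phi>, of j]
 obtain B where B: "\<And>x. \<bar>partial_deriv j \<phi> x\<bar> <= B" using test_function_bounded[OF \<phi>'] by blast
 note [measurable] = test_function_borel[OF \<phi>']
 have leb: "(LINT x|lebesgue. riesz_potential (1 - \<sigma>) h x * partial_deriv j \<phi> x) = (LBINT x. riesz_potential (1 - \<sigma>) h x * partial_deriv j \<phi> x)"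
  if [measurable]: "h \<in> borel_measurable borel" for h
 proof (rule lebesgue_integral_lborel(1))
  have [measurable]: "riesz_potential (1 - \<sigma>) h \<in> borel_measurable borel" by (rule riesz_potential_measurable[OF that])
  show "(\<lambda>x. riesz_potential (1 - \<sigma>) h x * partial_deriv j \<phi> x) \<in> borel_measurable borel" by measurable
 qed
 have "(LINT x|lebesgue. riesz_potential (1 - \<sigma>) (\<lambda>x. a * u x + b * v x) x * partial_deriv j \<phi> x) =
   a * (LINT x|lebesgue. riesz_potential (1 - \<sigma>) u x * partial_deriv j \<phi> x) + b * (LINT x|lebesgue. riesz_potential (1 - \<sigma>) v x * partial_deriv j \<phi> x)"
  using riesz_pairing_lincomb[OF \<alpha> u v test_function_integrable[OF \<phi>'] B, of a b] by (simp add: leb)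
 also have "... = a * - (LINT x|lebesgue. (G x $ j) * \<phi> x) + b * - (LINT x|lebesgue. (H x $ j) * \<phi> x)"
  using G H \<phi> by (auto simp: has_sigma_gradient_def has_distributional_gradient_def)
 also have "... = - (LINT x|lebesgue. a * ((G x $ j) * \<phi> x) + b * ((H x $ j) * \<phi> x))"
  using locally_integrable_times_test[OF locally_integrable_nth[OF GH(1)] \<phi>, of j]
   locally_integrable_times_test[OF locally_integrable_nth[OF GH(2)] \<phi>, of j] by simp
 also have "(LINT x|lebesgue. a * ((G x $ j) * \<phi> x) + b * ((H x $ j) * \<phi> x)) = (LINT x|lebesgue. ((a *\<^sub>R G x + b *\<^sub>R H x) $ j) * \<phi> x)"
  by (intro Bochner_Integration.integral_cong refl) (simp add: algebra_simps)
 finally show "(LINT x|lebesgue. riesz_potential (1 - \<sigma>) (\<lambda>x. a * u x + b * v x) x * partial_deriv j \<phi> x) =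
   - (LINT x|lebesgue. ((a *\<^sub>R G x + b *\<^sub>R H x) $ j) * \<phi> x)" .
qed

lemma has_sigma_gradient_AE_unique:
 "has_sigma_gradient \<sigma> u G ==> has_sigma_gradient \<sigma> u H ==> AE x in lebesgue. G x = H x"
 unfolding has_sigma_gradient_def by (rule distributional_gradient_unique)

lemma has_sigma_gradient_cong_AE:
 fixes u :: "real^'n::finite => real"
 assumes G: "has_sigma_gradient \<sigma> u G" and H: "H \<in> borel_measurable lebesgue" and eq: "AE x in lebesgue. G x = H x"
 shows "has_sigma_gradient \<sigma> u H"
 unfolding has_sigma_gradient_def has_distributional_gradient_def
proof (intro conjI ballI allI)
 have GG: "locally_integrable G" using G by (auto simp: has_sigma_gradient_def has_distributional_gradient_def)
 note Gm = locally_integrable_measurable[OF GG]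
 show "locally_integrable (riesz_potential (1 - \<sigma>) u)" using G by (auto simp: has_sigma_gradient_def has_distributional_gradient_def)
 show "locally_integrable H" unfolding locally_integrable_def set_integrable_def
 proof (intro allI impI)
  fix K :: "(real^'n) set" assume K: "compact K"
  then have Km: "K \<in> sets lebesgue" by (simp add: borel_compact)
  have "integrable lebesgue (\<lambda>x. indicator K x *\<^sub>R G x)" using GG K by (auto simp: locally_integrable_def set_integrable_def)
  moreover have "AE x in lebesgue. indicator K x *\<^sub>R G x = indicator K x *\<^sub>R H x" using eq by eventually_elim simp
  moreover have "(\<lambda>x. indicator K x *\<^sub>R H x) \<in> borel_measurable lebesgue"
   using Km H by (intro borel_measurable_scaleR borel_measurable_indicator)
  ultimately show "integrable lebesgue (\<lambda>x. indicator K x *\<^sub>R H x)" using integrable_cong_AE_imp by blast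
 qed
 fix \<phi> :: "real^'n => real" and j assume \<phi>: "\<phi> \<in> test_functions UNIV"
 have "(LINT x|lebesgue. (G x $ j) * \<phi> x) = (LINT x|lebesgue. (H x $ j) * \<phi> x)"
 proof (rule integral_cong_AE)
  show "(\<lambda>x. (G x $ j) * \<phi> x) \<in> borel_measurable lebesgue" "(\<lambda>x. (H x $ j) * \<phi> x) \<in> borel_measurable lebesgue"
   using borel_measurable_times[OF borel_measurable_vec_nth[OF Gm] test_function_lebesgue[OF \<phi>]]
    borel_measurable_times[OF borel_measurable_vec_nth[OF H] test_function_lebesgue[OF \<phi>]] by auto
  show "AE x in lebesgue. (G x $ j) * \<phi> x = (H x $ j) * \<phi> x" using eq by eventually_elim simp
 qed
 then show "(LINT x|lebesgue. riesz_potential (1 - \<sigma>) u x * partial_deriv j \<phi> x) = - (LINT x|lebesgue. (H x $ j) * \<phi> x)"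
  using G \<phi> by (auto simp: has_sigma_gradient_def has_distributional_gradient_def)
qed

section \<open>The Poincare inequality\<close>

text \<open>
 Some ball of radius \<open>1\<close> lies outside the domain at bounded distance. Restricting the inner
 integral of the seminorm to this ball, where the function vanishes, bounds it below by a
 multiple of \<open>\<bar>u x\<bar>\<^sup>2\<close>.
\<close>

lemma poincare_gagliardo:
 fixes \<Omega> :: "(real^'n::finite) set"
 assumes \<sigma>: "0 < \<sigma>" and \<Omega>: "bounded \<Omega>"
 obtains P where "P >= 0" "\<And>u. u \<in> borel_measurable borel ==> AE x in lborel. x \<notin> \<Omega> --> u x = 0 ==>
  (NN x. ennreal (\<bar>u x\<bar>\<^sup>2)) <= ennreal P * gagliardo \<sigma> u"
proof -
 obtain R where R: "R > 0" "\<And>x. x \<in> \<Omega> ==> norm x <= R" using \<Omega> bounded_pos by blast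
 define c :: "real^'n" where "c = (R + 1) *\<^sub>R axis undefined 1"
 have nc: "norm c = R + 1" using R by (simp add: c_def norm_axis_1)
 (* a ball of radius 1 just outside the ball of radius R that contains the domain *)
 define B where "B = ball c 1"
 have BR: "R < norm y" "norm y < R + 2" if "y \<in> B" for y
 proof -
  have "norm (c - y) < 1" using that by (simp add: B_def dist_norm)
  then show "R < norm y" "norm y < R + 2" using norm_triangle_ineq2[of c y] norm_triangle_ineq2[of y c] nc
   by (auto simp: norm_minus_commute)
 qed
 define e where "e = real CARD('n) + 2 * \<sigma>"
 have e: "e > 0" using \<sigma> by (simp add: e_def add_nonneg_pos)
 define D where "D = (2 * R + 2) powr e"
 have D: "D > 0" using R by (simp add: D_def)
 define m where "m = measure lborel B"
 have m: "m > 0" unfolding m_def B_def by (rule content_ball_pos) simp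
 have em: "emeasure lborel B = ennreal m"
  unfolding m_def B_def using emeasure_lborel_ball_finite[of c 1] by (intro emeasure_eq_ennreal_measure) auto
 show ?thesis
 proof (rule that[of "D / m"])
  show "D / m >= 0" using D m by simp
  fix u :: "real^'n => real" assume [measurable]: "u \<in> borel_measurable borel" and out: "AE x in lborel. x \<notin> \<Omega> --> u x = 0"
  have Bm [measurable]: "B \<in> sets borel" by (simp add: B_def)
  have key: "ennreal (\<bar>u x\<bar>\<^sup>2) <= ennreal (D / m) * (NN y. ennreal (\<bar>u x - u y\<bar>\<^sup>2 / norm (x - y) powr e))"
   if x: "x \<notin> \<Omega> --> u x = 0" for x
  proof (cases "x \<in> \<Omega>")
   case True
   have "ennreal (\<bar>u x\<bar>\<^sup>2) = ennreal (D / m) * (ennreal (\<bar>u x\<bar>\<^sup>2 / D) * emeasure lborel B)"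
    using D m by (simp add: em ennreal_mult[symmetric])
   also have "ennreal (\<bar>u x\<bar>\<^sup>2 / D) * emeasure lborel B = (NN y. ennreal (\<bar>u x\<bar>\<^sup>2 / D) * indicator B y)" by (simp add: nn_integral_cmult_indicator)
   also have "... <= (NN y. ennreal (\<bar>u x - u y\<bar>\<^sup>2 / norm (x - y) powr e))"
   proof (rule nn_integral_mono_AE)
    show "AE y in lborel. ennreal (\<bar>u x\<bar>\<^sup>2 / D) * indicator B y <= ennreal (\<bar>u x - u y\<bar>\<^sup>2 / norm (x - y) powr e)"
     using out
    proof eventually_elim
     case (elim y)
     show ?case
     proof (cases "y \<in> B")
      case yB: True
      have "u y = 0" using elim BR(1)[OF yB] R(2)[of y] by force
      have ne: "norm (x - y) > 0" using BR(1)[OF yB] R(2)[OF True] by force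
      have "norm (x - y) <= 2 * R + 2" using norm_triangle_ineq4[of x y] BR(2)[OF yB] R(2)[OF True] by linarith
      then have "norm (x - y) powr e <= D" unfolding D_def using e by (intro powr_mono2) auto
      then have "\<bar>u x\<bar>\<^sup>2 / D <= \<bar>u x\<bar>\<^sup>2 / norm (x - y) powr e" using ne D by (intro divide_left_mono) auto
      then show ?thesis using yB \<open>u y = 0\<close> by (simp add: ennreal_leI)
     qed simp
    qed
   qed
   finally show ?thesis by (simp add: mult_left_mono)
  qed (use x in simp)
  have "(NN x. ennreal (\<bar>u x\<bar>\<^sup>2)) <= (NN x. ennreal (D / m) * (NN y. ennreal (\<bar>u x - u y\<bar>\<^sup>2 / norm (x - y) powr e)))"
   using out by (intro nn_integral_mono_AE) (rule eventually_mono[OF _ key])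
  also have "... = ennreal (D / m) * gagliardo \<sigma> u" unfolding gagliardo_def e_def by (rule nn_integral_cmult) measurable
  finally show "(NN x. ennreal (\<bar>u x\<bar>\<^sup>2)) <= ennreal (D / m) * gagliardo \<sigma> u" .
 qed
qed

text \<open>
 The energy identity and the Poincare inequality make \<open>\<parallel>Du\<parallel>\<close> an equivalent norm.
\<close>

theorem Hsigma0_gradient:
 fixes \<Omega> :: "(real^'n::finite) set"
 assumes \<sigma>: "0 < \<sigma>" "\<sigma> < 1" and \<Omega>: "open \<Omega>" "bounded \<Omega>"
 obtains P E where "P >= 0" "E >= 0" "\<forall>u\<in>Hsigma0 \<sigma> \<Omega>. \<exists>G. has_sigma_gradient \<sigma> u G"
  "\<forall>u\<in>Hsigma0 \<sigma> \<Omega>. \<forall>G. has_sigma_gradient \<sigma> u G --> sq_integrable G"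
  "\<forall>u\<in>Hsigma0 \<sigma> \<Omega>. \<forall>G. has_sigma_gradient \<sigma> u G --> Hsigma_sqnorm \<sigma> u <= ennreal (P * (LINT x|lebesgue. (norm (G x))\<^sup>2))"
  "\<forall>u\<in>Hsigma0 \<sigma> \<Omega>. \<forall>G. has_sigma_gradient \<sigma> u G --> ennreal (LINT x|lebesgue. (norm (G x))\<^sup>2) <= ennreal E * Hsigma_sqnorm \<sigma> u"
proof -
 obtain P where P: "P >= 0" "\<And>u. u \<in> borel_measurable borel ==> AE x in lborel. x \<notin> \<Omega> --> u x = 0 ==>
  (NN x. ennreal (\<bar>u x\<bar>\<^sup>2)) <= ennreal P * gagliardo \<sigma> u"
  using poincare_gagliardo[OF \<sigma>(1) \<Omega>(2)] by blast
 define E where "E = energy_const (real CARD('n)) \<sigma>"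
 have n1: "real CARD('n) >= 1" by (simp add: Suc_leI)
 have E: "E > 0" unfolding E_def by (rule energy_const_pos[OF \<sigma> n1])
 have main: "\<exists>G0. has_sigma_gradient \<sigma> u G0 \<and> sq_integrable G0 \<and>
   ennreal (LINT x|lebesgue. (norm (G0 x))\<^sup>2) <= ennreal E * Hsigma_sqnorm \<sigma> u \<and>
   Hsigma_sqnorm \<sigma> u <= ennreal ((P + 1) / E * (LINT x|lebesgue. (norm (G0 x))\<^sup>2))" if u: "u \<in> Hsigma0 \<sigma> \<Omega>" for u
 proof -
  obtain v where v: "integrable lborel v" "integrable lborel (\<lambda>x. (v x)\<^sup>2)" "gagliardo \<sigma> v < \<infinity>"
   "AE x in lborel. u x = v x" "AE x in lborel. x \<notin> \<Omega> --> v x = 0"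
   "Hsigma_sqnorm \<sigma> u = Hsigma_sqnorm \<sigma> v" "has_sigma_gradient \<sigma> u = has_sigma_gradient \<sigma> v"
   by (rule Hsigma0_representative[OF u \<Omega>])
  obtain G0 where G0: "sq_integrable G0" "has_sigma_gradient \<sigma> v G0"
   "ennreal (LINT x|lebesgue. (norm (G0 x))\<^sup>2) = ennreal E * gagliardo \<sigma> v"
   by (rule fractional_gradient_exists[OF \<sigma> v(1-3), folded E_def]) (rule that)
  define I where "I = (LINT x|lebesgue. (norm (G0 x))\<^sup>2)"
  have I0: "I >= 0" by (simp add: I_def)
  have vm: "v \<in> borel_measurable borel" using v(1) by auto
  obtain c where c: "gagliardo \<sigma> v = ennreal c" "c >= 0" using v(3) by (cases "gagliardo \<sigma> v") auto
  have "ennreal I = ennreal (E * c)" using G0(3) c E by (simp add: I_def ennreal_mult)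
  then have Ic: "I = E * c" using I0 c E by (subst (asm) ennreal_inj) auto
  have "Hsigma_sqnorm \<sigma> u <= ennreal P * ennreal c + ennreal c"
   unfolding v(6) unfolding Hsigma_sqnorm_eq using P(2)[OF vm v(5)] c(1) by (simp add: add_right_mono)
  also have "... = ennreal ((P + 1) / E * I)"
  proof -
   have "(P + 1) / E * I = P * c + c" 
   proof -
    have "(P + 1) / E * I = (P + 1) * c" using E by (simp add: Ic)
    then show ?thesis by (simp add: distrib_right)
   qed
   then show ?thesis using P(1) c(2) by (simp add: ennreal_mult)
  qed
  finally have "Hsigma_sqnorm \<sigma> u <= ennreal ((P + 1) / E * I)" .
  moreover have "ennreal I <= ennreal E * Hsigma_sqnorm \<sigma> u"
   using G0(3) unfolding v(6) unfolding Hsigma_sqnorm_eq I_def by (simp add: mult_left_mono)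
  ultimately show ?thesis using G0(1,2) v(7) unfolding I_def by auto
 qed
 have any: "sq_integrable G \<and> ennreal (LINT x|lebesgue. (norm (G x))\<^sup>2) <= ennreal E * Hsigma_sqnorm \<sigma> u \<and>
   Hsigma_sqnorm \<sigma> u <= ennreal ((P + 1) / E * (LINT x|lebesgue. (norm (G x))\<^sup>2))"
  if u: "u \<in> Hsigma0 \<sigma> \<Omega>" and G: "has_sigma_gradient \<sigma> u G" for u G
 proof -
  obtain G0 where G0: "has_sigma_gradient \<sigma> u G0" "sq_integrable G0"
   "ennreal (LINT x|lebesgue. (norm (G0 x))\<^sup>2) <= ennreal E * Hsigma_sqnorm \<sigma> u"
   "Hsigma_sqnorm \<sigma> u <= ennreal ((P + 1) / E * (LINT x|lebesgue. (norm (G0 x))\<^sup>2))" using main[OF u] by blast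
  have eq: "AE x in lebesgue. G0 x = G x" by (rule has_sigma_gradient_AE_unique[OF G0(1) G])
  have Gm: "G \<in> borel_measurable lebesgue"
   using G locally_integrable_measurable by (auto simp: has_sigma_gradient_def has_distributional_gradient_def)
  have "(LINT x|lebesgue. (norm (G x))\<^sup>2) = (LINT x|lebesgue. (norm (G0 x))\<^sup>2)"
   using Gm sq_integrable_measurable[OF G0(2)] eq by (intro integral_cong_AE) (auto elim!: eventually_mono)
  then show ?thesis using G0 sq_integrable_cong_AE[OF G0(2) Gm eq] by simp
 qed
 show ?thesis
 proof (rule that[of "(P + 1) / E" E])
  show "(P + 1) / E >= 0" "E >= 0" using P E by auto
  show "\<forall>u\<in>Hsigma0 \<sigma> \<Omega>. \<exists>G. has_sigma_gradient \<sigma> u G" using main by blast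
 qed (use any in auto)
qed

section \<open>Completeness\<close>

text \<open>
 Fatou's lemma for both parts of the norm separately; the factor two is harmless for
 convergence to \<open>0\<close>.
\<close>

lemma Hsigma_sqnorm_Fatou:
 fixes v :: "nat => real^'n::finite => real" and w :: "real^'n => real"
 assumes v: "\<And>n. v n \<in> borel_measurable lebesgue" and w: "w \<in> borel_measurable lebesgue"
  and lim: "AE x in lebesgue. (\<lambda>n. v n x) ----> w x" and bound: "\<And>n. Hsigma_sqnorm \<sigma> (v n) <= c"
 shows "Hsigma_sqnorm \<sigma> w <= c + c"
proof -
 have "\<exists>v'. v' \<in> borel_measurable borel \<and> (AE x in lborel. v n x = v' x) \<and> Hsigma_sqnorm \<sigma> (v n) = Hsigma_sqnorm \<sigma> v'" for n
  using borel_representative[OF v[of n]] by metis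
 then obtain v' where v': "\<And>n. v' n \<in> borel_measurable borel" "\<And>n. AE x in lborel. v n x = v' n x"
  "\<And>n. Hsigma_sqnorm \<sigma> (v n) = Hsigma_sqnorm \<sigma> (v' n)" by metis
 obtain w' where w': "w' \<in> borel_measurable borel" "AE x in lborel. w x = w' x" "Hsigma_sqnorm \<sigma> w = Hsigma_sqnorm \<sigma> w'"
  using borel_representative[OF w] by metis
 note [measurable] = v'(1) w'(1)
 have "AE x in lborel. \<forall>n. v n x = v' n x" using v'(2) by (simp add: AE_all_countable)
 then have L: "AE x in lborel. (\<lambda>n. v' n x) ----> w' x" using w'(2) lim[unfolded AE_completion_iff] by eventually_elim simp
 have b: "(NN x. ennreal (\<bar>v' n x\<bar>\<^sup>2)) <= c" "gagliardo \<sigma> (v' n) <= c" for n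
  using bound[of n] unfolding v'(3) unfolding Hsigma_sqnorm_eq by (auto intro: order_trans[OF _ bound[of n]] elim: order_trans[rotated])
 have "(NN x. ennreal (\<bar>w' x\<bar>\<^sup>2)) = (NN x. liminf (\<lambda>n. ennreal (\<bar>v' n x\<bar>\<^sup>2)))"
 proof (rule nn_integral_cong_AE)
  show "AE x in lborel. ennreal (\<bar>w' x\<bar>\<^sup>2) = liminf (\<lambda>n. ennreal (\<bar>v' n x\<bar>\<^sup>2))"
   using L by eventually_elim (intro lim_imp_Liminf[symmetric] tendsto_ennrealI tendsto_intros, auto)
 qed
 also have "... <= liminf (\<lambda>n. (NN x. ennreal (\<bar>v' n x\<bar>\<^sup>2)))" by (rule nn_integral_liminf) measurable
 also have "... <= c" by (intro Liminf_le eventuallyI b) auto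
 finally have 1: "(NN x. ennreal (\<bar>w' x\<bar>\<^sup>2)) <= c" .
 define k where "k x y = norm (x - y) powr (real CARD('n) + 2 * \<sigma>)" for x y :: "real^'n"
 have [measurable]: "(\<lambda>(x, y). k x y) \<in> borel_measurable (borel \<Otimes>\<^sub>M borel)" unfolding k_def by measurable
 have [measurable]: "(\<lambda>y. k x y) \<in> borel_measurable borel" for x unfolding k_def by measurable
 have "gagliardo \<sigma> w' <= (NN x. liminf (\<lambda>n. (NN y. ennreal (\<bar>v' n x - v' n y\<bar>\<^sup>2 / k x y))))"
  unfolding gagliardo_def k_def[symmetric]
 proof (rule nn_integral_mono_AE)
  show "AE x in lborel. (NN y. ennreal (\<bar>w' x - w' y\<bar>\<^sup>2 / k x y)) <= liminf (\<lambda>n. (NN y. ennreal (\<bar>v' n x - v' n y\<bar>\<^sup>2 / k x y)))"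
   using L
  proof eventually_elim
   case (elim x)
   have "(NN y. ennreal (\<bar>w' x - w' y\<bar>\<^sup>2 / k x y)) = (NN y. liminf (\<lambda>n. ennreal (\<bar>v' n x - v' n y\<bar>\<^sup>2 / k x y)))"
   proof (rule nn_integral_cong_AE)
    show "AE y in lborel. ennreal (\<bar>w' x - w' y\<bar>\<^sup>2 / k x y) = liminf (\<lambda>n. ennreal (\<bar>v' n x - v' n y\<bar>\<^sup>2 / k x y))"
     using L
    proof eventually_elim
     case y: (elim y)
     have "(\<lambda>n. \<bar>v' n x - v' n y\<bar>\<^sup>2 * inverse (k x y)) ----> \<bar>w' x - w' y\<bar>\<^sup>2 * inverse (k x y)"
      by (intro tendsto_intros elim y)
     then show ?case by (intro lim_imp_Liminf[symmetric] tendsto_ennrealI) (auto simp: divide_inverse)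
    qed
   qed
   also have "... <= liminf (\<lambda>n. (NN y. ennreal (\<bar>v' n x - v' n y\<bar>\<^sup>2 / k x y)))" by (rule nn_integral_liminf) measurable
   finally show ?case .
  qed
 qed
 also have "... <= liminf (\<lambda>n. gagliardo \<sigma> (v' n))" unfolding gagliardo_def k_def[symmetric] by (rule nn_integral_liminf) measurable
 also have "... <= c" by (intro Liminf_le eventuallyI b) auto
 finally show ?thesis using 1 unfolding w'(3) unfolding Hsigma_sqnorm_eq by (intro add_mono)
qed

lemma L2_convergent_subsequence:
 fixes G :: "nat => 'a::euclidean_space => 'b::euclidean_space"
 assumes G: "\<And>n. sq_integrable (G n)" and H: "sq_integrable H" and lim: "(\<lambda>n. abs_L2 (G n)) ----> abs_L2 H"
 obtains r where "strict_mono r" "AE x in lebesgue. (\<lambda>n. G (r n) x) ----> H x"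
proof -
 have "Cauchy (\<lambda>n. abs_L2 (G n))" using lim by (rule LIMSEQ_imp_Cauchy)
 have c: "\<exists>N. \<forall>m\<ge>N. \<forall>n\<ge>N. (LINT x|lebesgue. (norm (G m x - G n x))\<^sup>2) < \<epsilon>" if \<epsilon>: "\<epsilon> > 0" for \<epsilon>
 proof -
  obtain N where N: "\<And>m n. m >= N ==> n >= N ==> dist (abs_L2 (G m)) (abs_L2 (G n)) < sqrt \<epsilon>"
   using metric_CauchyD[OF \<open>Cauchy _\<close>, of "sqrt \<epsilon>"] \<epsilon> by auto
  have "(LINT x|lebesgue. (norm (G m x - G n x))\<^sup>2) < \<epsilon>" if "m >= N" "n >= N" for m n
  proof -
   have "(norm (abs_L2 (G m) - abs_L2 (G n)))\<^sup>2 < (sqrt \<epsilon>)\<^sup>2"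
    using N[OF that] by (intro power_strict_mono) (auto simp: dist_norm)
   then show ?thesis using \<epsilon> by (simp add: norm_abs_L2_diff G)
  qed
  then show ?thesis by blast
 qed
 obtain F r where F: "sq_integrable F" "strict_mono r" "AE x in lebesgue. (\<lambda>n. G (r n) x) ----> F x"
  "(\<lambda>n. LINT x|lebesgue. (norm (G n x - F x))\<^sup>2) ----> 0"
  by (rule riesz_fischer[OF G c])
 have "(\<lambda>n. abs_L2 (G n)) ----> abs_L2 F" by (rule tendsto_abs_L2[OF G F(1,4)])
 then have "abs_L2 F = abs_L2 H" using lim LIMSEQ_unique by blast
 then have "AE x in lebesgue. F x = H x" using abs_L2_eq_iff[OF F(1) H] by simp
 with F(3) have "AE x in lebesgue. (\<lambda>n. G (r n) x) ----> H x" by eventually_elim simp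
 then show ?thesis using that F(2) by blast
qed

lemma has_sigma_gradient_measurable: "has_sigma_gradient \<sigma> u G ==> G \<in> borel_measurable lebesgue"
 using locally_integrable_measurable unfolding has_sigma_gradient_def has_distributional_gradient_def by blast

lemma sigma_gradient_exists:
 fixes u :: "real^'n::finite => real"
 assumes \<sigma>: "0 < \<sigma>" "\<sigma> < 1" and \<Omega>: "open \<Omega>" "bounded \<Omega>" and u: "u \<in> Hsigma0 \<sigma> \<Omega>"
 shows "\<exists>G. has_sigma_gradient \<sigma> u G"
proof -
 have "\<forall>u\<in>Hsigma0 \<sigma> \<Omega>. \<exists>G. has_sigma_gradient \<sigma> u G" by (rule Hsigma0_gradient[OF \<sigma> \<Omega>])
 then show ?thesis using u by blast
qed

lemma Hsigma0_gradient_lincomb: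
 fixes u v :: "real^'n::finite => real"
 assumes \<sigma>: "0 < \<sigma>" "\<sigma> < 1" and \<Omega>: "open \<Omega>" "bounded \<Omega>" and u: "u \<in> Hsigma0 \<sigma> \<Omega>" and v: "v \<in> Hsigma0 \<sigma> \<Omega>"
  and G: "has_sigma_gradient \<sigma> u G" and H: "has_sigma_gradient \<sigma> v H"
 shows "has_sigma_gradient \<sigma> (\<lambda>x. a * u x + b * v x) (\<lambda>x. a *\<^sub>R G x + b *\<^sub>R H x)"
proof -
 obtain u' where u': "integrable lborel u'" "integrable lborel (\<lambda>x. (u' x)\<^sup>2)" "gagliardo \<sigma> u' < \<infinity>"
  "AE x in lborel. u x = u' x" "AE x in lborel. x \<notin> \<Omega> --> u' x = 0"
  "Hsigma_sqnorm \<sigma> u = Hsigma_sqnorm \<sigma> u'" "has_sigma_gradient \<sigma> u = has_sigma_gradient \<sigma> u'"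
  by (rule Hsigma0_representative[OF u \<Omega>])
 obtain v' where v': "integrable lborel v'" "integrable lborel (\<lambda>x. (v' x)\<^sup>2)" "gagliardo \<sigma> v' < \<infinity>"
  "AE x in lborel. v x = v' x" "AE x in lborel. x \<notin> \<Omega> --> v' x = 0"
  "Hsigma_sqnorm \<sigma> v = Hsigma_sqnorm \<sigma> v'" "has_sigma_gradient \<sigma> v = has_sigma_gradient \<sigma> v'"
  by (rule Hsigma0_representative[OF v \<Omega>])
 have 1: "has_sigma_gradient \<sigma> (\<lambda>x. a * u' x + b * v' x) (\<lambda>x. a *\<^sub>R G x + b *\<^sub>R H x)"
  using G H unfolding u'(7) v'(7) by (rule has_sigma_gradient_lincomb[OF \<sigma> u'(1) v'(1)])
 have "has_sigma_gradient \<sigma> (\<lambda>x. a * u x + b * v x) = has_sigma_gradient \<sigma> (\<lambda>x. a * u' x + b * v' x)"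
 proof (rule has_sigma_gradient_cong)
  show "(\<lambda>x. a * u x + b * v x) \<in> borel_measurable lebesgue" by (rule Hsigma0_measurable[OF Hsigma0_lincomb[OF u v]])
  have "(\<lambda>x. a * u' x + b * v' x) \<in> borel_measurable lborel" using u'(1) v'(1) by simp
  then show "(\<lambda>x. a * u' x + b * v' x) \<in> borel_measurable lebesgue" by (rule measurable_completion)
  show "AE x in lebesgue. a * u x + b * v x = a * u' x + b * v' x"
   unfolding AE_completion_iff using u'(4) v'(4) by eventually_elim simp
 qed
 then show ?thesis using 1 by simp
qed

text \<open>
 The functions form a Cauchy sequence by the equivalence of norms. A subsequence converges
 almost everywhere, Fatou's lemma upgrades this to convergence in \<open>H\<^sup>\<sigma>\<close>, and the gradient
 of the limit is the limit of the gradients.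
\<close>

theorem Hsigma0_gradient_closed:
 fixes v :: "nat => real^'n::finite => real" and G :: "nat => real^'n => real^'n"
 assumes \<sigma>: "0 < \<sigma>" "\<sigma> < 1" and \<Omega>: "open \<Omega>" "bounded \<Omega>"
  and v: "\<And>n. v n \<in> Hsigma0 \<sigma> \<Omega>" and G: "\<And>n. has_sigma_gradient \<sigma> (v n) (G n)"
  and H: "sq_integrable H" and lim: "(\<lambda>n. abs_L2 (G n)) ----> abs_L2 H"
 shows "\<exists>u\<in>Hsigma0 \<sigma> \<Omega>. has_sigma_gradient \<sigma> u H"
proof -
 obtain P E where P: "P >= 0" "E >= 0" "\<forall>u\<in>Hsigma0 \<sigma> \<Omega>. \<exists>G. has_sigma_gradient \<sigma> u G"
  "\<forall>u\<in>Hsigma0 \<sigma> \<Omega>. \<forall>G. has_sigma_gradient \<sigma> u G --> sq_integrable G"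
  "\<forall>u\<in>Hsigma0 \<sigma> \<Omega>. \<forall>G. has_sigma_gradient \<sigma> u G --> Hsigma_sqnorm \<sigma> u <= ennreal (P * (LINT x|lebesgue. (norm (G x))\<^sup>2))"
  "\<forall>u\<in>Hsigma0 \<sigma> \<Omega>. \<forall>G. has_sigma_gradient \<sigma> u G --> ennreal (LINT x|lebesgue. (norm (G x))\<^sup>2) <= ennreal E * Hsigma_sqnorm \<sigma> u"
  by (rule Hsigma0_gradient[OF \<sigma> \<Omega>])
 have Gs: "sq_integrable (G n)" for n by (rule P(4)[rule_format, OF v G])
 have vm: "v n \<in> borel_measurable lebesgue" for n by (rule Hsigma0_measurable[OF v])
 have cauchy: "\<exists>N. \<forall>m\<ge>N. \<forall>n\<ge>N. Hsigma_sqnorm \<sigma> (\<lambda>x. v m x - v n x) <= ennreal \<epsilon>" if \<epsilon>: "\<epsilon> > 0" for \<epsilon>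
 proof -
  define d where "d = sqrt (\<epsilon> / (P + 1))"
  have d: "d > 0" using \<epsilon> P(1) by (simp add: d_def)
  obtain N where N: "\<And>m n. m >= N ==> n >= N ==> dist (abs_L2 (G m)) (abs_L2 (G n)) < d"
   using metric_CauchyD[OF LIMSEQ_imp_Cauchy[OF lim] d] by blast
  have "Hsigma_sqnorm \<sigma> (\<lambda>x. v m x - v n x) <= ennreal \<epsilon>" if "m >= N" "n >= N" for m n
  proof -
   have "has_sigma_gradient \<sigma> (\<lambda>x. 1 * v m x + (-1) * v n x) (\<lambda>x. 1 *\<^sub>R G m x + (-1) *\<^sub>R G n x)"
    by (rule Hsigma0_gradient_lincomb[OF \<sigma> \<Omega> v v G G])
   moreover have "(\<lambda>x. 1 * v m x + (-1) * v n x) \<in> Hsigma0 \<sigma> \<Omega>" by (rule Hsigma0_lincomb[OF v v])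
   ultimately have "Hsigma_sqnorm \<sigma> (\<lambda>x. v m x - v n x) <= ennreal (P * (LINT x|lebesgue. (norm (G m x - G n x))\<^sup>2))"
    using P(5)[rule_format, of "\<lambda>x. 1 * v m x + (-1) * v n x" "\<lambda>x. 1 *\<^sub>R G m x + (-1) *\<^sub>R G n x"] by simp
   also have "P * (LINT x|lebesgue. (norm (G m x - G n x))\<^sup>2) <= \<epsilon>"
   proof -
    have "(norm (abs_L2 (G m) - abs_L2 (G n)))\<^sup>2 <= d\<^sup>2"
     using N[OF that] by (intro power_mono) (auto simp: dist_norm)
    also have "d\<^sup>2 = \<epsilon> / (P + 1)" using \<epsilon> P(1) by (simp add: d_def)
    finally have "P * (LINT x|lebesgue. (norm (G m x - G n x))\<^sup>2) <= P * (\<epsilon> / (P + 1))"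
     unfolding norm_abs_L2_diff[OF Gs Gs] using P(1) by (rule mult_left_mono)
    also have "... <= (P + 1) * (\<epsilon> / (P + 1))" using P(1) \<epsilon> by (intro mult_right_mono) auto
    also have "... = \<epsilon>" using P(1) by simp
    finally show ?thesis .
   qed
   finally show ?thesis by (simp add: ennreal_leI)
  qed
  then show ?thesis by blast
 qed
 have vs: "sq_integrable (v n)" for n
  using Hsigma0_finite[OF v[of n]] by (intro sq_integrable_nn vm) (auto simp: Hsigma_sqnorm_def)
 have c: "\<exists>N. \<forall>m\<ge>N. \<forall>n\<ge>N. (LINT x|lebesgue. (norm (v m x - v n x))\<^sup>2) < \<epsilon>" if \<epsilon>: "\<epsilon> > 0" for \<epsilon>
 proof -
  obtain N where N: "\<And>m n. m >= N ==> n >= N ==> Hsigma_sqnorm \<sigma> (\<lambda>x. v m x - v n x) <= ennreal (\<epsilon> / 2)"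
   using cauchy[of "\<epsilon> / 2"] \<epsilon> by auto
  have "(LINT x|lebesgue. (norm (v m x - v n x))\<^sup>2) < \<epsilon>" if "m >= N" "n >= N" for m n
  proof -
   have "ennreal (LINT x|lebesgue. (norm (v m x - v n x))\<^sup>2) = (\<integral>\<^sup>+x. ennreal ((norm (v m x - v n x))\<^sup>2) \<partial>lebesgue)"
    by (rule nn_integral_sq_integrable[symmetric, OF sq_integrable_diff[OF vs vs]])
   also have "... <= Hsigma_sqnorm \<sigma> (\<lambda>x. v m x - v n x)" unfolding Hsigma_sqnorm_def by simp
   also have "... <= ennreal (\<epsilon> / 2)" by (rule N[OF that])
   finally have "(LINT x|lebesgue. (norm (v m x - v n x))\<^sup>2) <= \<epsilon> / 2" using \<epsilon> by (simp add: ennreal_le_iff)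
   then show ?thesis using \<epsilon> by simp
  qed
  then show ?thesis by blast
 qed
 obtain F r where F: "sq_integrable F" "strict_mono r" "AE x in lebesgue. (\<lambda>n. v (r n) x) ----> F x"
  by (rule riesz_fischer[OF vs c])
 have Fm: "F \<in> borel_measurable lebesgue" by (rule sq_integrable_measurable[OF F(1)])
 have vF: "\<exists>N. \<forall>m\<ge>N. Hsigma_sqnorm \<sigma> (\<lambda>x. v m x - F x) <= ennreal \<epsilon> + ennreal \<epsilon>" if \<epsilon>: "\<epsilon> > 0" for \<epsilon>
 proof -
  obtain N where N: "\<And>m n. m >= N ==> n >= N ==> Hsigma_sqnorm \<sigma> (\<lambda>x. v m x - v n x) <= ennreal \<epsilon>"
   using cauchy[OF \<epsilon>] by blast
  have "Hsigma_sqnorm \<sigma> (\<lambda>x. v m x - F x) <= ennreal \<epsilon> + ennreal \<epsilon>" if m: "m >= N" for m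
  proof (rule Hsigma_sqnorm_Fatou[where v="\<lambda>n x. v m x - v (r (n + N)) x"])
   show "AE x in lebesgue. (\<lambda>n. v m x - v (r (n + N)) x) ----> v m x - F x"
    using F(3) by eventually_elim (intro tendsto_diff tendsto_const LIMSEQ_ignore_initial_segment)
   have "r (n + N) >= N" for n using seq_suble[OF F(2), of "n + N"] by simp
   then show "Hsigma_sqnorm \<sigma> (\<lambda>x. v m x - v (r (n + N)) x) <= ennreal \<epsilon>" for n using N[OF m] by blast
  qed (use vm Fm in auto)
  then show ?thesis by blast
 qed
 obtain N where "Hsigma_sqnorm \<sigma> (\<lambda>x. v N x - F x) <= ennreal 1 + ennreal 1" using vF[of 1] by auto
 moreover have "Hsigma_sqnorm \<sigma> (\<lambda>x. 1 * v N x + (-1) * (v N x - F x)) <= ennreal (2 * 1\<^sup>2) * Hsigma_sqnorm \<sigma> (v N) + ennreal (2 * (-1)\<^sup>2) * Hsigma_sqnorm \<sigma> (\<lambda>x. v N x - F x)"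
  using vm Fm by (intro Hsigma_sqnorm_lincomb) auto
 moreover have "ennreal (2 * 1\<^sup>2) * Hsigma_sqnorm \<sigma> (v N) + ennreal (2 * (-1)\<^sup>2) * (ennreal 1 + ennreal 1) < \<infinity>"
  using Hsigma0_finite[OF v[of N]] by (simp add: ennreal_mult_less_top)
 ultimately have "Hsigma_sqnorm \<sigma> (\<lambda>x. 1 * v N x + (-1) * (v N x - F x)) < \<infinity>"
  by (meson add_left_mono le_less_trans mult_left_mono order_trans zero_le)
 then have "Hsigma_sqnorm \<sigma> F < \<infinity>" by simp
 then have FH: "F \<in> Hsigma \<sigma>" using Fm by (simp add: Hsigma_def)
 have F0: "F \<in> Hsigma0 \<sigma> \<Omega>"
 proof (rule Hsigma0_closed[OF FH])
  fix \<epsilon> :: ennreal assume "\<epsilon> > 0"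
  then obtain \<delta> where \<delta>: "\<delta> > 0" "\<And>x y. x < \<delta> ==> y < \<delta> ==> ennreal 2 * x + ennreal 2 * y < \<epsilon>" using ennreal_quarter by metis
  obtain e where e: "0 < e" "e < \<delta>" using dense[OF \<delta>(1)] by blast
  then have "e < top" by (metis less_top not_less_iff_gr_or_eq top.not_eq_extremum)
  then obtain s where s: "e = ennreal s" "s > 0" using e(1) by (cases e) auto
  obtain M where "Hsigma_sqnorm \<sigma> (\<lambda>x. v M x - F x) <= e + e" using vF[OF s(2)] s(1) by blast
  also have "e + e <= ennreal 2 * e + ennreal 2 * e"
  proof -
   have "e <= ennreal 2 * e" using mult_right_mono[of 1 "ennreal 2" e] by simp
   then show ?thesis by (intro add_mono)
  qed
  also have "... < \<epsilon>" using \<delta>(2)[OF e(2) e(2)] .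
  finally have "Hsigma_sqnorm \<sigma> (\<lambda>x. v M x - F x) < \<epsilon>" .
  moreover have "Hsigma_sqnorm \<sigma> (\<lambda>x. F x - v M x) = Hsigma_sqnorm \<sigma> (\<lambda>x. v M x - F x)"
  proof -
   have "\<bar>F x - v M x - (F y - v M y)\<bar> = \<bar>v M x - F x - (v M y - F y)\<bar>" "\<bar>F x - v M x\<bar> = \<bar>v M x - F x\<bar>" for x y by linarith+
   then show ?thesis unfolding Hsigma_sqnorm_def by (simp only:)
  qed
  ultimately have "Hsigma_sqnorm \<sigma> (\<lambda>x. F x - v M x) < \<epsilon>" by simp
  then show "\<exists>w\<in>Hsigma0 \<sigma> \<Omega>. Hsigma_sqnorm \<sigma> (\<lambda>x. F x - w x) < \<epsilon>" using v by blast
 qed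
 obtain L where L: "has_sigma_gradient \<sigma> F L" using P(3)[rule_format, OF F0] by blast
 have Ls: "sq_integrable L" by (rule P(4)[rule_format, OF F0 L])
 have "(\<lambda>n. abs_L2 (G n)) ----> abs_L2 L"
 proof (rule LIMSEQ_I)
  fix \<epsilon> :: real assume \<epsilon>: "\<epsilon> > 0"
  define d where "d = (\<epsilon>\<^sup>2 / 4) / (E + 1)"
  have d: "d > 0" using \<epsilon> P(2) by (simp add: d_def)
  obtain N where N: "\<And>m. m >= N ==> Hsigma_sqnorm \<sigma> (\<lambda>x. v m x - F x) <= ennreal d + ennreal d" using vF[OF d] by blast
  have "norm (abs_L2 (G m) - abs_L2 L) < \<epsilon>" if m: "m >= N" for m
  proof -
   have "has_sigma_gradient \<sigma> (\<lambda>x. 1 * v m x + (-1) * F x) (\<lambda>x. 1 *\<^sub>R G m x + (-1) *\<^sub>R L x)"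
    by (rule Hsigma0_gradient_lincomb[OF \<sigma> \<Omega> v F0 G L])
   moreover have "(\<lambda>x. 1 * v m x + (-1) * F x) \<in> Hsigma0 \<sigma> \<Omega>" by (rule Hsigma0_lincomb[OF v F0])
   ultimately have "ennreal (LINT x|lebesgue. (norm (G m x - L x))\<^sup>2) <= ennreal E * Hsigma_sqnorm \<sigma> (\<lambda>x. v m x - F x)"
    using P(6)[rule_format, of "\<lambda>x. 1 * v m x + (-1) * F x" "\<lambda>x. 1 *\<^sub>R G m x + (-1) *\<^sub>R L x"] by simp
   also have "... <= ennreal E * (ennreal d + ennreal d)" by (intro mult_left_mono N m) simp
   also have "... = ennreal (E * (d + d))" 
   proof -
    have "ennreal (d + d) = ennreal d + ennreal d" using d by (intro ennreal_plus) auto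
    moreover have "ennreal (E * (d + d)) = ennreal E * ennreal (d + d)" using P(2) d by (intro ennreal_mult) auto
    ultimately show ?thesis by (simp only:)
   qed
   finally have "(norm (abs_L2 (G m) - abs_L2 L))\<^sup>2 <= E * (d + d)" using P(2) d by (simp add: norm_abs_L2_diff[OF Gs Ls] ennreal_le_iff)
   also have "... <= (E + 1) * (d + d)" using d by (intro mult_right_mono) auto
   also have "... = \<epsilon>\<^sup>2 / 2"
   proof -
    have "E + 1 \<noteq> 0" using P(2) by simp
    then have "(E + 1) * (\<epsilon>\<^sup>2 / 4) / (E + 1) = \<epsilon>\<^sup>2 / 4" by (rule nonzero_mult_div_cancel_left)
    then have "(E + 1) * d = \<epsilon>\<^sup>2 / 4" unfolding d_def times_divide_eq_right[of "E + 1" "\<epsilon>\<^sup>2 / 4" "E + 1"] .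
    then show ?thesis by (simp add: distrib_left)
   qed
   also have "... < \<epsilon>\<^sup>2" using \<epsilon> by simp
   finally show ?thesis using \<epsilon> by (intro power_less_imp_less_base[of _ 2 \<epsilon>]) auto
  qed
  then show "\<exists>N. \<forall>n\<ge>N. norm (abs_L2 (G n) - abs_L2 L) < \<epsilon>" by blast
 qed
 then have "abs_L2 L = abs_L2 H" using lim LIMSEQ_unique by blast
 then have "AE x in lebesgue. L x = H x" using abs_L2_eq_iff[OF Ls H] by simp
 then have "has_sigma_gradient \<sigma> F H" by (rule has_sigma_gradient_cong_AE[OF L sq_integrable_measurable[OF H]])
 then show ?thesis using F0 by blast
qed

section \<open>Bounds for functions with bounded gradient\<close>

text \<open>
 Cauchy--Schwarz on the bounded domain, followed by the Poincare inequality.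
\<close>

lemma Hsigma0_integral_abs_le:
 fixes \<Omega> :: "(real^'n::finite) set"
 assumes \<sigma>: "0 < \<sigma>" "\<sigma> < 1" and \<Omega>: "open \<Omega>" "bounded \<Omega>"
 obtains C where "C >= 0" "\<And>v G. v \<in> Hsigma0 \<sigma> \<Omega> ==> has_sigma_gradient \<sigma> v G ==>
  sq_integrable G \<and> integrable lebesgue v \<and> (LINT x|lebesgue. \<bar>v x\<bar>) <= C * norm (abs_L2 G)"
proof -
 obtain P E where P: "P >= 0" "E >= 0" "\<forall>u\<in>Hsigma0 \<sigma> \<Omega>. \<exists>G. has_sigma_gradient \<sigma> u G"
  "\<forall>u\<in>Hsigma0 \<sigma> \<Omega>. \<forall>G. has_sigma_gradient \<sigma> u G --> sq_integrable G"
  "\<forall>u\<in>Hsigma0 \<sigma> \<Omega>. \<forall>G. has_sigma_gradient \<sigma> u G --> Hsigma_sqnorm \<sigma> u <= ennreal (P * (LINT x|lebesgue. (norm (G x))\<^sup>2))"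
  "\<forall>u\<in>Hsigma0 \<sigma> \<Omega>. \<forall>G. has_sigma_gradient \<sigma> u G --> ennreal (LINT x|lebesgue. (norm (G x))\<^sup>2) <= ennreal E * Hsigma_sqnorm \<sigma> u"
  by (rule Hsigma0_gradient[OF \<sigma> \<Omega>])
 define i where "i = (\<lambda>x. indicator \<Omega> x :: real)"
 have \<Omega>m: "\<Omega> \<in> sets lebesgue" using \<Omega> by (simp add: borel_open)
 have "\<Omega> \<in> lmeasurable" by (rule lmeasurable_open[OF \<Omega>(2,1)])
 then have "integrable lebesgue (indicator \<Omega> :: real^'n => real)" by (simp add: lmeasurable_iff_integrable)
 moreover have "(norm (i x))\<^sup>2 = indicator \<Omega> x" for x by (simp add: i_def indicator_def)
 ultimately have iS: "sq_integrable i" unfolding sq_integrable_def using \<Omega>m by (simp add: i_def)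
 define V where "V = sqrt (LINT x|lebesgue. (norm (i x))\<^sup>2)"
 show ?thesis
 proof (rule that[of "sqrt P * V"])
  show "0 <= sqrt P * V" using P(1) by (simp add: V_def)
  fix v G assume v: "v \<in> Hsigma0 \<sigma> \<Omega>" and G: "has_sigma_gradient \<sigma> v G"
  have Gs: "sq_integrable G" by (rule P(4)[rule_format, OF v G])
  have vm: "v \<in> borel_measurable lebesgue" by (rule Hsigma0_measurable[OF v])
  have vs: "sq_integrable (\<lambda>x. \<bar>v x\<bar>)"
   using Hsigma0_finite[OF v] vm by (intro sq_integrable_nn) (auto simp: Hsigma_sqnorm_def)
  have eq: "AE x in lebesgue. \<bar>v x\<bar> \<bullet> i x = \<bar>v x\<bar>"
   using Hsigma0_eq_0_outside[OF v \<Omega>(1)] by eventually_elim (auto simp: i_def indicator_def)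
  have vi: "integrable lebesgue (\<lambda>x. \<bar>v x\<bar> \<bullet> i x)" by (rule sq_integrable_inner[OF vs iS])
  have "integrable lebesgue (\<lambda>x. \<bar>v x\<bar>)" using vm by (intro integrable_cong_AE_imp[OF vi _ eq]) simp
  then have vI: "integrable lebesgue v" using vm by (simp add: integrable_abs_iff)
  have "(LINT x|lebesgue. \<bar>v x\<bar>) = (LINT x|lebesgue. \<bar>v x\<bar> \<bullet> i x)"
   using vm \<Omega>m eq by (intro integral_cong_AE) (auto simp: i_def elim: eventually_mono)
  also have "... <= sqrt (LINT x|lebesgue. (norm \<bar>v x\<bar>)\<^sup>2) * V"
   using sq_integrable_cauchy_schwarz[OF vs iS] by (simp add: V_def)
  also have "... <= sqrt P * norm (abs_L2 G) * V"
  proof (intro mult_right_mono)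
   have "ennreal (LINT x|lebesgue. (norm \<bar>v x\<bar>)\<^sup>2) = (\<integral>\<^sup>+x. ennreal ((norm \<bar>v x\<bar>)\<^sup>2) \<partial>lebesgue)"
    by (rule nn_integral_sq_integrable[symmetric, OF vs])
   also have "... <= Hsigma_sqnorm \<sigma> v" unfolding Hsigma_sqnorm_def by simp
   also have "... <= ennreal (P * (norm (abs_L2 G))\<^sup>2)" unfolding norm_abs_L2[OF Gs] by (rule P(5)[rule_format, OF v G])
   finally have "(LINT x|lebesgue. (norm \<bar>v x\<bar>)\<^sup>2) <= P * (norm (abs_L2 G))\<^sup>2" using P(1) by (simp add: ennreal_le_iff)
   then have "sqrt (LINT x|lebesgue. (norm \<bar>v x\<bar>)\<^sup>2) <= sqrt (P * (norm (abs_L2 G))\<^sup>2)" by (rule real_sqrt_le_mono)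
   also have "... = sqrt P * norm (abs_L2 G)" by (simp add: real_sqrt_mult)
   finally show "sqrt (LINT x|lebesgue. (norm \<bar>v x\<bar>)\<^sup>2) <= sqrt P * norm (abs_L2 G)" .
  qed (simp add: V_def)
  finally show "sq_integrable G \<and> integrable lebesgue v \<and> (LINT x|lebesgue. \<bar>v x\<bar>) <= sqrt P * V * norm (abs_L2 G)"
   using Gs vI by (simp add: mult_ac)
 qed
qed

lemma Hsigma0_sup_bound:
 fixes \<Omega> :: "(real^'n::finite) set"
 assumes \<sigma>: "0 < \<sigma>" "\<sigma> < 1" and \<Omega>: "open \<Omega>" "bounded \<Omega>"
 obtains C where "C >= 0" "\<And>v G M. v \<in> Hsigma0 \<sigma> \<Omega> ==> has_sigma_gradient \<sigma> v G ==>
  AE x in lebesgue. norm (G x) <= M ==> M >= 0 ==> AE x in lebesgue. \<bar>v x\<bar> <= C * (M + norm (abs_L2 G))"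
proof -
 obtain C1 where C1: "C1 >= 0" "\<And>v G. v \<in> Hsigma0 \<sigma> \<Omega> ==> has_sigma_gradient \<sigma> v G ==>
  sq_integrable G \<and> integrable lebesgue v \<and> (LINT x|lebesgue. \<bar>v x\<bar>) <= C1 * norm (abs_L2 G)"
  using Hsigma0_integral_abs_le[OF \<sigma> \<Omega>] by blast
 obtain C2 where C2: "C2 >= 0" "\<And>(v :: real^'n => real) G M. integrable lborel v ==> integrable lborel (\<lambda>x. (v x)\<^sup>2) ==>
  gagliardo \<sigma> v < \<infinity> ==> has_sigma_gradient \<sigma> v G ==> AE x in lebesgue. norm (G x) <= M ==> M >= 0 ==>
  AE x in lborel. \<bar>v x\<bar> <= C2 * (M + (LBINT y. \<bar>v y\<bar>))"
  using bounded_sigma_gradient_imp_bounded[OF \<sigma>] by blast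
 show ?thesis
 proof (rule that[of "C2 * (1 + C1)"])
  show "C2 * (1 + C1) >= 0" using C1(1) C2(1) by simp
  fix v G M assume v: "v \<in> Hsigma0 \<sigma> \<Omega>" and G: "has_sigma_gradient \<sigma> v G"
   and M: "AE x in lebesgue. norm (G x) <= M" "M >= 0"
  obtain w where w: "integrable lborel w" "integrable lborel (\<lambda>x. (w x)\<^sup>2)" "gagliardo \<sigma> w < \<infinity>"
   "AE x in lborel. v x = w x" "AE x in lborel. x \<notin> \<Omega> --> w x = 0"
   "Hsigma_sqnorm \<sigma> v = Hsigma_sqnorm \<sigma> w" "has_sigma_gradient \<sigma> v = has_sigma_gradient \<sigma> w"
   by (rule Hsigma0_representative[OF v \<Omega>])
  have wm: "w \<in> borel_measurable borel" using w(1) by auto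
  have "(LBINT y. \<bar>w y\<bar>) = (LINT y|lebesgue. \<bar>w y\<bar>)" using wm by (intro lebesgue_integral_lborel(1)[symmetric]) simp
  also have "... = (LINT y|lebesgue. \<bar>v y\<bar>)"
  proof (rule integral_cong_AE)
   have "w \<in> borel_measurable lebesgue" by (rule measurable_completion) (simp add: wm)
   then show "(\<lambda>y. \<bar>w y\<bar>) \<in> borel_measurable lebesgue" by simp
   show "(\<lambda>y. \<bar>v y\<bar>) \<in> borel_measurable lebesgue" using Hsigma0_measurable[OF v] by simp
   show "AE y in lebesgue. \<bar>w y\<bar> = \<bar>v y\<bar>" using AE_completion[OF w(4)] by eventually_elim simp
  qed
  also have "... <= C1 * norm (abs_L2 G)" using C1(2)[OF v G] by blast
  finally have le: "(LBINT y. \<bar>w y\<bar>) <= C1 * norm (abs_L2 G)" .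
  have "C2 * (M + (LBINT y. \<bar>w y\<bar>)) <= C2 * (1 + C1) * (M + norm (abs_L2 G))"
  proof -
   have "M + (LBINT y. \<bar>w y\<bar>) <= (1 + C1) * (M + norm (abs_L2 G))"
   proof -
    have "(1 + C1) * (M + Z) = M + Z + C1 * M + C1 * Z" for Z by (simp add: algebra_simps)
    then show ?thesis using le mult_nonneg_nonneg[OF C1(1) M(2)] norm_ge_zero[of "abs_L2 G"] by (smt (verit))
   qed
   from mult_left_mono[OF this C2(1)] show ?thesis by (simp only: mult.assoc)
  qed
  moreover have "AE x in lborel. \<bar>w x\<bar> <= C2 * (M + (LBINT y. \<bar>w y\<bar>))"
   by (rule C2(2)[OF w(1-3) _ M]) (use G w(7) in simp)
  ultimately have "AE x in lborel. \<bar>v x\<bar> <= C2 * (1 + C1) * (M + norm (abs_L2 G))"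
   using w(4) by (auto elim!: eventually_elim2)
  then show "AE x in lebesgue. \<bar>v x\<bar> <= C2 * (1 + C1) * (M + norm (abs_L2 G))" by (rule AE_completion)
 qed
qed


section \<open>The variational inequality\<close>

lemma vec_nth_measurable: "f \<in> borel_measurable M ==> (\<lambda>x. f x $ i :: 'b::euclidean_space) \<in> borel_measurable M"
 by (rule measurable_compose[OF _ borel_measurable_continuous_onI[OF linear_continuous_on[OF bounded_linear_vec_nth]]])

lemma matrix_vector_measurable:
 fixes A :: "'m => real^'n::finite^'n" and G :: "'m => real^'n"
 assumes A: "A \<in> borel_measurable M" and G: "G \<in> borel_measurable M"
 shows "(\<lambda>x. A x *v G x) \<in> borel_measurable M"
proof (rule borel_measurable_euclidean_space[THEN iffD2], intro ballI)
 fix b :: "real^'n" assume "b \<in> Basis"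
 then obtain k where b: "b = axis k 1" by (auto simp: Basis_vec_def)
 have "(\<lambda>x. (A x *v G x) \<bullet> b) = (\<lambda>x. \<Sum>j\<in>UNIV. A x $ k $ j * G x $ j)"
  by (simp add: b inner_axis matrix_vector_mult_def)
 moreover have "(\<lambda>x. \<Sum>j\<in>UNIV. A x $ k $ j * G x $ j) \<in> borel_measurable M"
  by (intro borel_measurable_sum borel_measurable_times vec_nth_measurable A G)
 ultimately show "(\<lambda>x. (A x *v G x) \<bullet> b) \<in> borel_measurable M" by simp
qed

lemma elliptic_bound:
 fixes A :: "real^'n::finite => real^'n^'n"
 assumes A: "bounded_measurable_elliptic a_low a_up A"
 shows "AE x in lebesgue. \<forall>\<xi>. norm (A x *v \<xi>) <= a_up * norm \<xi> \<and> a_low * (norm \<xi>)\<^sup>2 <= (A x *v \<xi>) \<bullet> \<xi>"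
proof -
 have "AE x in lebesgue. \<forall>\<xi> \<eta>. a_low * (norm \<xi>)\<^sup>2 <= (A x *v \<xi>) \<bullet> \<xi> \<and> (A x *v \<xi>) \<bullet> \<eta> <= a_up * norm \<xi> * norm \<eta>"
  using A by (simp add: bounded_measurable_elliptic_def)
 then show ?thesis
 proof eventually_elim
  case (elim x)
  have "norm (A x *v \<xi>) <= a_up * norm \<xi>" for \<xi>
  proof (cases "A x *v \<xi> = 0")
   case True
   have "0 <= a_up * norm \<xi> * norm (axis undefined (1::real) :: real^'n)"
    using elim[rule_format, of \<xi> "axis undefined 1"] True by simp
   then show ?thesis using True by simp
  next
   case False
   have "norm (A x *v \<xi>) * norm (A x *v \<xi>) <= a_up * norm \<xi> * norm (A x *v \<xi>)"
    using elim[rule_format, of \<xi> "A x *v \<xi>"] by (simp add: power2_norm_eq_inner[symmetric] power2_eq_square)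
   then show ?thesis using False by (simp only: mult_le_cancel_right) auto
  qed
  then show ?case using elim by blast
 qed
qed

lemma elliptic_sq_integrable:
 fixes A :: "real^'n::finite => real^'n^'n"
 assumes A: "bounded_measurable_elliptic a_low a_up A" and G: "sq_integrable G"
 shows "sq_integrable (\<lambda>x. A x *v G x)"
  and "0 <= a_up ==> norm (abs_L2 (\<lambda>x. A x *v G x)) <= a_up * norm (abs_L2 G)"
  and "a_low * (norm (abs_L2 G))\<^sup>2 <= abs_L2 (\<lambda>x. A x *v G x) \<bullet> abs_L2 G"
proof -
 have m: "(\<lambda>x. A x *v G x) \<in> borel_measurable lebesgue"
  using A sq_integrable_measurable[OF G] by (intro matrix_vector_measurable) (auto simp: bounded_measurable_elliptic_def)
 have G2: "integrable lebesgue (\<lambda>x. (norm (G x))\<^sup>2)" using G by (simp add: sq_integrable_def)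
 have le: "AE x in lebesgue. (norm (A x *v G x))\<^sup>2 <= a_up\<^sup>2 * (norm (G x))\<^sup>2"
  using elliptic_bound[OF A]
 proof eventually_elim
  case (elim x)
  have "(norm (A x *v G x))\<^sup>2 <= (a_up * norm (G x))\<^sup>2" using elim by (intro power_mono) auto
  then show ?case by (simp add: power_mult_distrib)
 qed
 show s: "sq_integrable (\<lambda>x. A x *v G x)" unfolding sq_integrable_def
 proof (rule conjI[OF m], rule bochner_bound)
  show "integrable lebesgue (\<lambda>x. a_up\<^sup>2 * (norm (G x))\<^sup>2)" using G2 by simp
  show "(\<lambda>x. (norm (A x *v G x))\<^sup>2) \<in> borel_measurable lebesgue" using m by simp
  show "AE x in lebesgue. norm ((norm (A x *v G x))\<^sup>2) <= norm (a_up\<^sup>2 * (norm (G x))\<^sup>2)"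
   using le by eventually_elim auto
 qed
 show "norm (abs_L2 (\<lambda>x. A x *v G x)) <= a_up * norm (abs_L2 G)" if "0 <= a_up"
 proof (rule power2_le_imp_le)
  have "(LINT x|lebesgue. (norm (A x *v G x))\<^sup>2) <= (LINT x|lebesgue. a_up\<^sup>2 * (norm (G x))\<^sup>2)"
   using s G2 le by (intro integral_mono_AE) (auto simp: sq_integrable_def)
  then show "(norm (abs_L2 (\<lambda>x. A x *v G x)))\<^sup>2 <= (a_up * norm (abs_L2 G))\<^sup>2"
   by (simp add: norm_abs_L2[OF s] norm_abs_L2[OF G] power_mult_distrib)
 qed (use that in simp)
 have "(LINT x|lebesgue. a_low * (norm (G x))\<^sup>2) <= (LINT x|lebesgue. (A x *v G x) \<bullet> G x)"
  using elliptic_bound[OF A] G2 sq_integrable_inner[OF s G] by (intro integral_mono_AE) (auto elim: eventually_mono)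
 then show "a_low * (norm (abs_L2 G))\<^sup>2 <= abs_L2 (\<lambda>x. A x *v G x) \<bullet> abs_L2 G"
  by (simp add: norm_abs_L2[OF G] inner_abs_L2[OF s G])
qed

lemma integrable_times_ess_bounded:
 fixes F v :: "'a::euclidean_space => real"
 assumes F: "integrable lebesgue F" and v: "v \<in> borel_measurable lebesgue" and S: "AE x in lebesgue. \<bar>v x\<bar> <= S"
 shows "integrable lebesgue (\<lambda>x. F x * v x)" "\<bar>LINT x|lebesgue. F x * v x\<bar> <= S * (LINT x|lebesgue. \<bar>F x\<bar>)"
proof -
 have le: "AE x in lebesgue. \<bar>F x * v x\<bar> <= S * \<bar>F x\<bar>"
  using S
 proof eventually_elim
  case (elim x)
  have "\<bar>F x\<bar> * \<bar>v x\<bar> <= \<bar>F x\<bar> * S" using elim by (intro mult_left_mono) auto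
  then show ?case by (simp add: abs_mult mult.commute)
 qed
 show I: "integrable lebesgue (\<lambda>x. F x * v x)"
 proof (rule bochner_bound)
  show "integrable lebesgue (\<lambda>x. S * \<bar>F x\<bar>)" using F by simp
  show "AE x in lebesgue. norm (F x * v x) <= norm (S * \<bar>F x\<bar>)" using le by eventually_elim auto
 qed (use F v in auto)
 have "\<bar>LINT x|lebesgue. F x * v x\<bar> <= (LINT x|lebesgue. \<bar>F x * v x\<bar>)" by (rule integral_abs_bound)
 also have "... <= (LINT x|lebesgue. S * \<bar>F x\<bar>)" using I F le by (intro integral_mono_AE) auto
 finally show "\<bar>LINT x|lebesgue. F x * v x\<bar> <= S * (LINT x|lebesgue. \<bar>F x\<bar>)" by simp
qed

text \<open>
 Cutting \<open>F\<close> at a high level leaves a remainder of small integral, which meets a bounded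
 \<open>w\<close>, and a bounded part, which meets a \<open>w\<close> of small integral. This replaces the continuity
 that \<open>F \<in> L\<^sup>2\<close> would give.
\<close>

lemma integral_times_small:
 fixes F :: "'a::euclidean_space => real"
 assumes F: "integrable lebesgue F" and \<epsilon>: "\<epsilon> > 0" and S: "S >= 0"
 obtains \<delta> where "\<delta> > 0" "\<And>w. integrable lebesgue w ==> AE x in lebesgue. \<bar>w x\<bar> <= S ==>
  (LINT x|lebesgue. \<bar>w x\<bar>) < \<delta> ==> \<bar>LINT x|lebesgue. F x * w x\<bar> < \<epsilon>"
proof -
 have Fm: "F \<in> borel_measurable lebesgue" using F by simp
 have "(\<lambda>k. LINT x|lebesgue. max 0 (\<bar>F x\<bar> - real k)) ----> (LINT x|(lebesgue::'a measure). 0)"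
 proof (rule integral_dominated_convergence[where w="\<lambda>x. \<bar>F x\<bar>"])
  show "AE x in lebesgue. (\<lambda>k. max 0 (\<bar>F x\<bar> - real k)) ----> 0"
  proof (intro AE_I2 tendsto_eventually)
   fix x
   obtain N where "\<bar>F x\<bar> <= real N" using real_arch_simple by blast
   then have "max 0 (\<bar>F x\<bar> - real k) = 0" if "k >= N" for k using that by (simp add: max_def)
   then show "\<forall>\<^sub>F k in sequentially. max 0 (\<bar>F x\<bar> - real k) = 0" by (rule eventually_sequentiallyI)
  qed
 qed (use F Fm in auto)
 then have lim: "(\<lambda>k. LINT x|lebesgue. max 0 (\<bar>F x\<bar> - real k)) ----> 0" by simp
 have "\<epsilon> / (2 * (S + 1)) > 0" using \<epsilon> S by simp
 from order_tendstoD(2)[OF lim this] obtain k where k: "(LINT x|lebesgue. max 0 (\<bar>F x\<bar> - real k)) < \<epsilon> / (2 * (S + 1))"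
  using eventually_sequentially by auto
 have kI: "integrable lebesgue (\<lambda>x. max 0 (\<bar>F x\<bar> - real k))"
  by (rule bochner_bound[OF integrable_abs[OF F]]) (use Fm in auto)
 show ?thesis
 proof (rule that[of "\<epsilon> / (2 * (real k + 1))"])
  show "\<epsilon> / (2 * (real k + 1)) > 0" using \<epsilon> by simp
  fix w :: "'a => real"
  assume w: "integrable lebesgue w" and wS: "AE x in lebesgue. \<bar>w x\<bar> <= S" and w1: "(LINT x|lebesgue. \<bar>w x\<bar>) < \<epsilon> / (2 * (real k + 1))"
  have wm: "w \<in> borel_measurable lebesgue" using w by simp
  note Fw = integrable_times_ess_bounded(1)[OF F wm wS]
  have "\<bar>LINT x|lebesgue. F x * w x\<bar> <= (LINT x|lebesgue. \<bar>F x * w x\<bar>)" by (rule integral_abs_bound)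
  also have "... <= (LINT x|lebesgue. S * max 0 (\<bar>F x\<bar> - real k) + real k * \<bar>w x\<bar>)"
  proof (rule integral_mono_AE)
   show "AE x in lebesgue. \<bar>F x * w x\<bar> <= S * max 0 (\<bar>F x\<bar> - real k) + real k * \<bar>w x\<bar>"
    using wS
   proof eventually_elim
    case (elim x)
    have "\<bar>F x\<bar> * \<bar>w x\<bar> <= (max 0 (\<bar>F x\<bar> - real k) + real k) * \<bar>w x\<bar>" by (intro mult_right_mono) auto
    also have "... = max 0 (\<bar>F x\<bar> - real k) * \<bar>w x\<bar> + real k * \<bar>w x\<bar>" by (rule distrib_right)
    also have "max 0 (\<bar>F x\<bar> - real k) * \<bar>w x\<bar> <= max 0 (\<bar>F x\<bar> - real k) * S" using elim by (intro mult_left_mono) auto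
    finally show ?case by (simp add: abs_mult mult.commute)
   qed
  qed (use Fw kI w in auto)
  also have "... = S * (LINT x|lebesgue. max 0 (\<bar>F x\<bar> - real k)) + real k * (LINT x|lebesgue. \<bar>w x\<bar>)"
   using kI w by simp
  also have "... < \<epsilon>"
  proof -
   have "S * (LINT x|lebesgue. max 0 (\<bar>F x\<bar> - real k)) <= S * (\<epsilon> / (2 * (S + 1)))" using k S by (intro mult_left_mono) auto
   also have "... < (S + 1) * (\<epsilon> / (2 * (S + 1)))" using \<epsilon> S by (intro mult_strict_right_mono) auto
   also have "... = \<epsilon> / 2" using S by (simp add: field_simps)
   finally have 1: "S * (LINT x|lebesgue. max 0 (\<bar>F x\<bar> - real k)) < \<epsilon> / 2" .
   have "real k * (LINT x|lebesgue. \<bar>w x\<bar>) <= (real k + 1) * (LINT x|lebesgue. \<bar>w x\<bar>)" by (intro mult_right_mono) auto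
   also have "... < (real k + 1) * (\<epsilon> / (2 * (real k + 1)))" using w1 by (intro mult_strict_left_mono) auto
   also have "... = \<epsilon> / 2" by (simp add: field_simps)
   finally show ?thesis using 1 by simp
  qed
  finally show "\<bar>LINT x|lebesgue. F x * w x\<bar> < \<epsilon>" .
 qed
qed

text \<open>
 Stampacchia's theorem is applied to the set of admissible gradients in \<open>L\<^sup>2\<close>. A gradient
 determines its potential almost everywhere by the Poincare inequality, so the linear term
 is a function of the gradient.
\<close>

theorem gradient_constraint_variational_inequality:
 fixes \<Omega> :: "(real^'n::finite) set" and A :: "real^'n => real^'n^'n" and F g :: "real^'n => real"
 assumes \<sigma>: "0 < \<sigma>" "\<sigma> < 1" and \<Omega>: "open \<Omega>" "bounded \<Omega>"
  and a: "0 < a_low" "0 < a_up" "bounded_measurable_elliptic a_low a_up A"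
  and g: "AE x in lebesgue. 0 <= g x" "AE x in lebesgue. g x <= M" and M0: "M >= 0" and F: "integrable lebesgue F"
 shows "\<exists>u\<in>Hsigma0 \<sigma> \<Omega>. \<exists>G. has_sigma_gradient \<sigma> u G \<and> (AE x in lebesgue. norm (G x) <= g x) \<and>
  (\<forall>v\<in>Hsigma0 \<sigma> \<Omega>. \<forall>W. has_sigma_gradient \<sigma> v W --> (AE x in lebesgue. norm (W x) <= g x) -->
   (LINT x|lebesgue. F x * v x) - (LINT x|lebesgue. F x * u x) <= (LINT x|lebesgue. (A x *v G x) \<bullet> (W x - G x)))"
proof -
 define H where "H = Hsigma0 \<sigma> \<Omega>"
 define adm where "adm v G \<longleftrightarrow> v \<in> H \<and> has_sigma_gradient \<sigma> v G \<and> (AE x in lebesgue. norm (G x) <= g x)" for v G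
 obtain C1 where C1: "C1 >= 0" "\<And>v G. v \<in> Hsigma0 \<sigma> \<Omega> ==> has_sigma_gradient \<sigma> v G ==>
  sq_integrable G \<and> integrable lebesgue v \<and> (LINT x|lebesgue. \<bar>v x\<bar>) <= C1 * norm (abs_L2 G)"
  using Hsigma0_integral_abs_le[OF \<sigma> \<Omega>] by blast
 obtain C2 where C2: "C2 >= 0" "\<And>v G M. v \<in> Hsigma0 \<sigma> \<Omega> ==> has_sigma_gradient \<sigma> v G ==>
  AE x in lebesgue. norm (G x) <= M ==> M >= 0 ==> AE x in lebesgue. \<bar>v x\<bar> <= C2 * (M + norm (abs_L2 G))"
  using Hsigma0_sup_bound[OF \<sigma> \<Omega>] by blast
 have sq: "sq_integrable G" if "v \<in> H" "has_sigma_gradient \<sigma> v G" for v G using C1(2) that unfolding H_def by blast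
 have vI: "integrable lebesgue v" if "v \<in> H" "has_sigma_gradient \<sigma> v G" for v G using C1(2) that unfolding H_def by blast
 have comb: "(\<lambda>x. s * v x + t * w x) \<in> H \<and> has_sigma_gradient \<sigma> (\<lambda>x. s * v x + t * w x) (\<lambda>x. s *\<^sub>R G x + t *\<^sub>R W x) \<and>
   abs_L2 (\<lambda>x. s *\<^sub>R G x + t *\<^sub>R W x) = s *\<^sub>R abs_L2 G + t *\<^sub>R abs_L2 W"
  if "v \<in> H" "has_sigma_gradient \<sigma> v G" "w \<in> H" "has_sigma_gradient \<sigma> w W" for v G w W s t
 proof -
  have "abs_L2 (\<lambda>x. s *\<^sub>R G x + t *\<^sub>R W x) = s *\<^sub>R abs_L2 G + t *\<^sub>R abs_L2 W"
   using sq that by (simp add: abs_L2_scaleR abs_L2_add sq_integrable_scaleR)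
  then show ?thesis using Hsigma0_lincomb[of v \<sigma> \<Omega> w s t] Hsigma0_gradient_lincomb[OF \<sigma> \<Omega>, of v w G W s t] that unfolding H_def by blast
 qed
 have dist1: "integrable lebesgue (\<lambda>x. v x - w x) \<and> (LINT x|lebesgue. \<bar>v x - w x\<bar>) <= C1 * norm (abs_L2 G - abs_L2 W)"
  if "v \<in> H" "has_sigma_gradient \<sigma> v G" "w \<in> H" "has_sigma_gradient \<sigma> w W" for v G w W
 proof -
  note c = comb[OF that, of 1 "-1"]
  have "integrable lebesgue (\<lambda>x. 1 * v x + (-1) * w x) \<and>
    (LINT x|lebesgue. \<bar>1 * v x + (-1) * w x\<bar>) <= C1 * norm (abs_L2 (\<lambda>x. 1 *\<^sub>R G x + (-1) *\<^sub>R W x))"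
   using C1(2) c unfolding H_def by blast
  then show ?thesis using c by simp
 qed
 have bnd: "AE x in lebesgue. \<bar>v x\<bar> <= C2 * (M + norm (abs_L2 G))" if "adm v G" for v G
 proof -
  have "AE x in lebesgue. norm (G x) <= M" using that g(2) unfolding adm_def by (auto elim: eventually_elim2)
  then show ?thesis using C2(2) that M0 unfolding adm_def H_def by blast
 qed
 have vm: "v \<in> borel_measurable lebesgue" if "v \<in> H" for v using that Hsigma0_measurable unfolding H_def by blast
 have cong: "has_sigma_gradient \<sigma> v (rep_L2 (abs_L2 G))" if "v \<in> H" "has_sigma_gradient \<sigma> v G" for v G
 proof (rule has_sigma_gradient_cong_AE[OF that(2) sq_integrable_measurable[OF rep_L2_sq_integrable]])
  show "AE x in lebesgue. G x = rep_L2 (abs_L2 G) x" using rep_abs_L2[OF sq[OF that]] by eventually_elim simp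
 qed
 (* any potential may be chosen, as two potentials of one gradient agree almost everywhere *)
 define l where "l X = (LINT x|lebesgue. F x * (SOME v. v \<in> H \<and> has_sigma_gradient \<sigma> v (rep_L2 X)) x)" for X
 have l_eq: "l (abs_L2 G) = (LINT x|lebesgue. F x * v x)" if v: "v \<in> H" "has_sigma_gradient \<sigma> v G" for v G
 proof -
  define w where "w = (SOME w. w \<in> H \<and> has_sigma_gradient \<sigma> w (rep_L2 (abs_L2 G)))"
  have w: "w \<in> H" "has_sigma_gradient \<sigma> w (rep_L2 (abs_L2 G))"
   using someI[of "\<lambda>w. w \<in> H \<and> has_sigma_gradient \<sigma> w (rep_L2 (abs_L2 G))" v] v cong[OF v] unfolding w_def by auto
  note d = dist1[OF w v(1) cong[OF v]]
  then have "(LINT x|lebesgue. \<bar>w x - v x\<bar>) = 0" by (simp add: order_antisym)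
  then have "AE x in lebesgue. \<bar>w x - v x\<bar> = 0" using d by (subst (asm) integral_nonneg_eq_0_iff_AE) auto
  then have "AE x in lebesgue. F x * w x = F x * v x" by eventually_elim simp
  then have "(LINT x|lebesgue. F x * w x) = (LINT x|lebesgue. F x * v x)"
   using F vm[OF w(1)] vm[OF v(1)] by (intro integral_cong_AE) auto
  then show ?thesis by (simp add: l_def w_def)
 qed
 define K where "K = {abs_L2 G | G. \<exists>v. adm v G}"
 have KE: "\<exists>v G. X = abs_L2 G \<and> adm v G" if "X \<in> K" for X using that unfolding K_def by blast
 have adm_comb: "adm (\<lambda>x. (1 - t) * v x + t * w x) (\<lambda>x. (1 - t) *\<^sub>R G x + t *\<^sub>R W x)"
  if "adm v G" "adm w W" and t: "0 <= t" "t <= 1" for v G w W t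
 proof -
  have "AE x in lebesgue. norm (G x) <= g x" "AE x in lebesgue. norm (W x) <= g x" using that unfolding adm_def by auto
  then have "AE x in lebesgue. norm ((1 - t) *\<^sub>R G x + t *\<^sub>R W x) <= g x"
  proof eventually_elim
   case (elim x)
   have "norm ((1 - t) *\<^sub>R G x + t *\<^sub>R W x) <= (1 - t) * norm (G x) + t * norm (W x)"
    using norm_triangle_ineq[of "(1 - t) *\<^sub>R G x" "t *\<^sub>R W x"] t by simp
   also have "... <= (1 - t) * g x + t * g x" using elim t by (intro add_mono mult_left_mono) auto
   finally show ?case by (simp add: algebra_simps)
  qed
  then show ?thesis using comb[of v G w W "1 - t" t] that unfolding adm_def by blast
 qed
 have K0: "K \<noteq> {}"
 proof -
  have 0: "(\<lambda>x. 0) \<in> H" unfolding H_def by (rule Hsigma0_0)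
  obtain G :: "real^'n => real^'n" where G: "has_sigma_gradient \<sigma> (\<lambda>x. 0) G"
   using sigma_gradient_exists[OF \<sigma> \<Omega>] 0 unfolding H_def by blast
  have "adm (\<lambda>x. 0) (\<lambda>x. 0 *\<^sub>R G x + 0 *\<^sub>R G x)" using comb[OF 0 G 0 G, of 0 0] g(1) unfolding adm_def by simp
  then show ?thesis unfolding K_def by blast
 qed
 have Kconv: "convex K" unfolding convex_alt
 proof (intro ballI allI impI)
  fix X Y t assume X: "X \<in> K" "Y \<in> K" and t: "0 <= t \<and> t <= (1::real)"
  obtain v G where v: "X = abs_L2 G" "adm v G" using KE[OF X(1)] by blast
  obtain w W where w: "Y = abs_L2 W" "adm w W" using KE[OF X(2)] by blast
  have "(1 - t) *\<^sub>R X + t *\<^sub>R Y = abs_L2 (\<lambda>x. (1 - t) *\<^sub>R G x + t *\<^sub>R W x)"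
   using comb[of v G w W "1 - t" t] v w by (simp add: adm_def)
  then show "(1 - t) *\<^sub>R X + t *\<^sub>R Y \<in> K" using adm_comb[OF v(2) w(2)] t unfolding K_def by blast
 qed
 have Kclosed: "closed K" unfolding closed_sequential_limits
 proof (intro allI impI)
  fix X Y assume XY: "(\<forall>n. X n \<in> K) \<and> X ----> Y"
  then have "\<forall>n. \<exists>v G. X n = abs_L2 G \<and> adm v G" using KE by blast
  then obtain v G where vG: "\<And>n. X n = abs_L2 (G n)" "\<And>n. adm (v n) (G n)" by metis
  define Z where "Z = rep_L2 Y"
  have Z: "sq_integrable Z" "abs_L2 Z = Y" by (auto simp: Z_def rep_L2_sq_integrable abs_rep_L2)
  have "X = (\<lambda>n. abs_L2 (G n))" by (intro ext) (rule vG(1))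
  then have lim: "(\<lambda>n. abs_L2 (G n)) ----> abs_L2 Z" using XY Z(2) by simp
  have v: "v n \<in> Hsigma0 \<sigma> \<Omega>" "has_sigma_gradient \<sigma> (v n) (G n)" for n using vG(2)[of n] by (auto simp: adm_def H_def)
  have Gs: "sq_integrable (G n)" for n using sq v unfolding H_def by blast
  obtain u where u: "u \<in> H" "has_sigma_gradient \<sigma> u Z" using Hsigma0_gradient_closed[OF \<sigma> \<Omega> v Z(1) lim] unfolding H_def by blast
  obtain r where r: "AE x in lebesgue. (\<lambda>n. G (r n) x) ----> Z x" using L2_convergent_subsequence[OF Gs Z(1) lim] by blast
  have "AE x in lebesgue. \<forall>n. norm (G n x) <= g x" using vG(2) by (simp add: AE_all_countable adm_def)
  then have "AE x in lebesgue. norm (Z x) <= g x"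
   using r by eventually_elim (rule LIMSEQ_le_const2[OF tendsto_norm], auto)
  then have "adm u Z" using u by (simp add: adm_def)
  then show "Y \<in> K" using Z(2) unfolding K_def by blast
 qed
 have Fv: "integrable lebesgue (\<lambda>x. F x * v x)" if "adm v G" for v G
  using integrable_times_ess_bounded(1)[OF F vm bnd[OF that]] that by (simp add: adm_def)
 have l_affine: "l ((1 - t) *\<^sub>R X + t *\<^sub>R Y) = (1 - t) * l X + t * l Y" if X: "X \<in> K" "Y \<in> K" and t: "0 <= t" "t <= 1" for X Y t
 proof -
  obtain v G where v: "X = abs_L2 G" "adm v G" using KE[OF X(1)] by blast
  obtain w W where w: "Y = abs_L2 W" "adm w W" using KE[OF X(2)] by blast
  note c = comb[of v G w W "1 - t" t]
  have "(1 - t) *\<^sub>R X + t *\<^sub>R Y = abs_L2 (\<lambda>x. (1 - t) *\<^sub>R G x + t *\<^sub>R W x)" using c v w by (simp add: adm_def)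
  moreover have "l (abs_L2 (\<lambda>x. (1 - t) *\<^sub>R G x + t *\<^sub>R W x)) = (LINT x|lebesgue. F x * ((1 - t) * v x + t * w x))"
   by (rule l_eq) (use c v w in \<open>auto simp: adm_def\<close>)
  ultimately have "l ((1 - t) *\<^sub>R X + t *\<^sub>R Y) = (LINT x|lebesgue. F x * ((1 - t) * v x + t * w x))" by simp
  also have "... = (LINT x|lebesgue. (1 - t) * (F x * v x) + t * (F x * w x))"
   by (intro Bochner_Integration.integral_cong refl) (simp add: algebra_simps)
  also have "... = (1 - t) * (LINT x|lebesgue. F x * v x) + t * (LINT x|lebesgue. F x * w x)"
   using Fv[OF v(2)] Fv[OF w(2)] by simp
  finally show ?thesis using l_eq[of v G] l_eq[of w W] v w by (simp add: adm_def)
 qed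
 define F1 where "F1 = (LINT x|lebesgue. \<bar>F x\<bar>)"
 have l_bound: "l X <= C2 * M * F1 + C2 * F1 * norm X" if X: "X \<in> K" for X
 proof -
  obtain v G where v: "X = abs_L2 G" "adm v G" using KE[OF X] by blast
  have "\<bar>LINT x|lebesgue. F x * v x\<bar> <= C2 * (M + norm (abs_L2 G)) * F1"
   using integrable_times_ess_bounded(2)[OF F vm bnd[OF v(2)]] v(2) unfolding adm_def F1_def by blast
  then have "\<bar>l X\<bar> <= C2 * (M + norm (abs_L2 G)) * F1" using l_eq[of v G] v by (simp add: adm_def)
  then show ?thesis unfolding v(1) by (simp add: algebra_simps)
 qed
 have l_cont: "continuous_on K l" unfolding continuous_on_iff
 proof (intro ballI allI impI)
  fix X and \<epsilon> :: real assume X: "X \<in> K" and \<epsilon>: "0 < \<epsilon>"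
  (* gradients within distance 1 of X have potentials with a common supremum bound *)
  define S where "S = C2 * (M + (norm X + 1)) + C2 * (M + norm X)"
  have S0: "S >= 0" using C2(1) M0 by (simp add: S_def)
  obtain \<delta> where \<delta>: "\<delta> > 0" "\<And>w. integrable lebesgue w ==> AE x in lebesgue. \<bar>w x\<bar> <= S ==>
    (LINT x|lebesgue. \<bar>w x\<bar>) < \<delta> ==> \<bar>LINT x|lebesgue. F x * w x\<bar> < \<epsilon>"
   using integral_times_small[OF F \<epsilon> S0] by blast
  obtain v G where v: "X = abs_L2 G" "adm v G" using KE[OF X] by blast
  have "dist (l Y) (l X) < \<epsilon>" if Y: "Y \<in> K" and d: "dist Y X < min 1 (\<delta> / (C1 + 1))" for Y
  proof -
   obtain w W where w: "Y = abs_L2 W" "adm w W" using KE[OF Y] by blast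
   have d1: "norm (Y - X) < 1" "norm (Y - X) < \<delta> / (C1 + 1)" using d by (auto simp: dist_norm)
   have "norm Y <= norm X + 1" using norm_triangle_ineq2[of Y X] d1(1) by linarith
   then have YX: "C2 * (M + norm Y) <= C2 * (M + (norm X + 1))" using C2(1) by (intro mult_left_mono) auto
   have b: "AE x in lebesgue. \<bar>w x - v x\<bar> <= S"
    using bnd[OF w(2)] bnd[OF v(2)] unfolding w(1)[symmetric] v(1)[symmetric]
   proof eventually_elim
    case (elim x)
    have "\<bar>w x - v x\<bar> <= \<bar>w x\<bar> + \<bar>v x\<bar>" by (rule abs_triangle_ineq4)
    then show ?case using elim YX unfolding S_def by linarith
   qed
   have D: "integrable lebesgue (\<lambda>x. w x - v x)" "(LINT x|lebesgue. \<bar>w x - v x\<bar>) <= C1 * norm (Y - X)"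
    using dist1[of w W v G] v w unfolding adm_def by auto
   have "C1 * norm (Y - X) <= (C1 + 1) * norm (Y - X)" by (intro mult_right_mono) auto
   also have "... < \<delta>" using d1(2) C1(1) by (simp add: pos_less_divide_eq mult.commute)
   finally have "\<bar>LINT x|lebesgue. F x * (w x - v x)\<bar> < \<epsilon>" using \<delta>(2)[OF D(1) b] D(2) by simp
   moreover have "(LINT x|lebesgue. F x * (w x - v x)) = l Y - l X"
    using Fv[OF w(2)] Fv[OF v(2)] l_eq[of w W] l_eq[of v G] v w by (simp add: right_diff_distrib adm_def)
   ultimately show ?thesis by (simp add: dist_real_def)
  qed
  moreover have "min 1 (\<delta> / (C1 + 1)) > 0" using \<delta>(1) C1(1) by simp
  ultimately show "\<exists>d>0. \<forall>Y\<in>K. dist Y X < d --> dist (l Y) (l X) < \<epsilon>" by blast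
 qed
 define T where "T X = abs_L2 (\<lambda>x. A x *v rep_L2 X x)" for X :: "(real^'n, real^'n) L2"
 have Ts: "sq_integrable (\<lambda>x. A x *v rep_L2 X x)" for X :: "(real^'n, real^'n) L2"
  by (rule elliptic_sq_integrable(1)[OF a(3) rep_L2_sq_integrable])
 have T_abs: "T (abs_L2 G) = abs_L2 (\<lambda>x. A x *v G x)" if G: "sq_integrable G" for G
  unfolding T_def using rep_abs_L2[OF G]
  by (subst abs_L2_eq_iff[OF Ts elliptic_sq_integrable(1)[OF a(3) G]]) (auto elim: eventually_mono)
 have T_lin: "linear T"
 proof (rule linearI)
  fix X Y :: "(real^'n, real^'n) L2" and c :: real
  have "X + Y = abs_L2 (\<lambda>x. rep_L2 X x + rep_L2 Y x)"
   using abs_L2_add[OF rep_L2_sq_integrable rep_L2_sq_integrable, of X Y] by (simp add: abs_rep_L2)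
  then show "T (X + Y) = T X + T Y"
   unfolding T_def[of X] T_def[of Y] abs_L2_add[OF Ts Ts]
   by (simp add: T_abs sq_integrable_add rep_L2_sq_integrable matrix_vector_right_distrib)
  have "c *\<^sub>R X = abs_L2 (\<lambda>x. c *\<^sub>R rep_L2 X x)" using abs_L2_scaleR[OF rep_L2_sq_integrable, of c X] by (simp add: abs_rep_L2)
  then show "T (c *\<^sub>R X) = c *\<^sub>R T X"
   unfolding T_def[of X] abs_L2_scaleR[OF Ts]
   by (simp add: T_abs sq_integrable_scaleR rep_L2_sq_integrable matrix_vector_mult_scaleR)
 qed
 (* the bound has to be at least the coercivity constant, hence the maximum *)
 have T1: "norm (T X) <= max a_low a_up * norm X" for X
 proof -
  have "norm (T X) <= a_up * norm X"
   using elliptic_sq_integrable(2)[OF a(3) rep_L2_sq_integrable[of X]] a(2) by (simp add: T_def abs_rep_L2)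
  also have "... <= max a_low a_up * norm X" by (intro mult_right_mono) auto
  finally show ?thesis .
 qed
 have T2: "a_low * (norm X)\<^sup>2 <= T X \<bullet> X" for X
  using elliptic_sq_integrable(3)[OF a(3) rep_L2_sq_integrable[of X]] by (simp add: T_def abs_rep_L2)
 obtain X where X: "X \<in> K" "\<And>Y. Y \<in> K ==> l Y - l X <= T X \<bullet> (Y - X)"
  using stampacchia[OF K0 Kclosed Kconv T_lin T1 T2 a(1) _ l_affine l_cont l_bound] by auto
 obtain u G where u: "X = abs_L2 G" "adm u G" using KE[OF X(1)] by blast
 have Gs: "sq_integrable G" using sq u(2) unfolding adm_def by blast
 have "(LINT x|lebesgue. F x * v x) - (LINT x|lebesgue. F x * u x) <= (LINT x|lebesgue. (A x *v G x) \<bullet> (W x - G x))"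
  if v: "adm v W" for v W
 proof -
  have Ws: "sq_integrable W" using sq v unfolding adm_def by blast
  have "abs_L2 W \<in> K" using v unfolding K_def by blast
  from X(2)[OF this] have "l (abs_L2 W) - l (abs_L2 G) <= T (abs_L2 G) \<bullet> (abs_L2 W - abs_L2 G)" unfolding u(1) .
  then show ?thesis
   using l_eq[of v W] l_eq[of u G] u(2) v
   by (simp add: adm_def T_abs[OF Gs] abs_L2_diff[OF Ws Gs] inner_abs_L2[OF elliptic_sq_integrable(1)[OF a(3) Gs] sq_integrable_diff[OF Ws Gs]])
 qed
 then show ?thesis using u(2) unfolding adm_def H_def by blast
qed

section \<open>The multiplier\<close>

text \<open>
 In each of the three cases the datum is therefore integrable on the bounded domain.
\<close>

lemma two_sharp_ge_1:
 assumes "0 < \<sigma>" "1 < q" "N >= 1" shows "two_sharp N \<sigma> q >= 1"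
 using assms by (auto simp: two_sharp_def pos_le_divide_eq add_pos_pos)

lemma Lp_imp_integrable:
 assumes f: "f \<in> Lp p S" and p: "p >= 1" and S: "S \<in> lmeasurable"
 shows "integrable lebesgue (\<lambda>x. indicator S x * f x)"
proof -
 interpret finite_measure "lebesgue_on S" by (rule finite_measure_lebesgue_on[OF S])
 have "integrable (lebesgue_on S) f"
 proof (rule bochner_bound)
  show "integrable (lebesgue_on S) (\<lambda>x. 1 + \<bar>f x\<bar> powr p)" using f by (simp add: Lp_def)
  show "AE x in lebesgue_on S. norm (f x) <= norm (1 + \<bar>f x\<bar> powr p)"
  proof (intro AE_I2)
   fix x
   have "\<bar>f x\<bar> <= 1 + \<bar>f x\<bar> powr p"
   proof (cases "\<bar>f x\<bar> <= 1")
    case False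
    then have "\<bar>f x\<bar> powr 1 <= \<bar>f x\<bar> powr p" using p by (intro powr_mono) auto
    then show ?thesis using False by simp
   qed (use powr_ge_zero[of "\<bar>f x\<bar>" p] in linarith)
   then show "norm (f x) <= norm (1 + \<bar>f x\<bar> powr p)" by simp
  qed
 qed (use f in \<open>simp add: Lp_def\<close>)
 then show ?thesis using S by (simp add: integrable_restrict_space fmeasurableD)
qed

lemma Linf_dual_add: "\<Lambda> \<in> Linf_dual ==> v \<in> Linf ==> w \<in> Linf ==> \<Lambda> (\<lambda>x. v x + w x) = \<Lambda> v + \<Lambda> w"
 and Linf_dual_scaleR: "\<Lambda> \<in> Linf_dual ==> w \<in> Linf ==> \<Lambda> (\<lambda>x. c *\<^sub>R w x) = c * \<Lambda> w"
 by (simp_all add: Linf_dual_def)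

lemma Linf_dual_mono:
 assumes \<Lambda>: "\<Lambda> \<in> Linf_dual" "dual_nonneg \<Lambda>" and v: "v \<in> Linf" and w: "w \<in> Linf"
  and le: "AE x in lebesgue. v x <= (w x :: real)"
 shows "\<Lambda> v <= \<Lambda> w"
proof -
 have n: "(\<lambda>x. (-1) *\<^sub>R v x) \<in> Linf" by (rule Linf_scaleR[OF v])
 then have m: "(\<lambda>x. w x + (-1) *\<^sub>R v x) \<in> Linf" by (rule Linf_add[OF w])
 have ge: "AE x in lebesgue. 0 <= w x + (-1) *\<^sub>R v x" using le by eventually_elim simp
 have "0 <= \<Lambda> (\<lambda>x. w x + (-1) *\<^sub>R v x)"
  by (rule mp[OF bspec[OF \<Lambda>(2)[unfolded dual_nonneg_def] m] ge])
 also have "... = \<Lambda> w + \<Lambda> (\<lambda>x. (-1) *\<^sub>R v x)" by (rule Linf_dual_add[OF \<Lambda>(1) w n])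
 also have "\<Lambda> (\<lambda>x. (-1) *\<^sub>R v x) = (-1) * \<Lambda> v" by (rule Linf_dual_scaleR[OF \<Lambda>(1) v])
 finally show ?thesis by simp
qed

lemma Linf_dual_cong_AE:
 assumes \<Lambda>: "\<Lambda> \<in> Linf_dual" "dual_nonneg \<Lambda>" and v: "v \<in> Linf" and w: "w \<in> Linf"
  and eq: "AE x in lebesgue. v x = (w x :: real)"
 shows "\<Lambda> v = \<Lambda> w"
 by (intro antisym Linf_dual_mono[OF \<Lambda> v w] Linf_dual_mono[OF \<Lambda> w v]) (use eq in \<open>auto elim: eventually_mono\<close>)

lemma Upsilon_inf_sigma_gradient:
 assumes v: "v \<in> Upsilon_inf \<sigma> \<Omega>"
 shows "v \<in> Hsigma0 \<sigma> \<Omega>" "has_sigma_gradient \<sigma> v (sigma_gradient \<sigma> v)" "sigma_gradient \<sigma> v \<in> Linf"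
proof -
 obtain G where G: "G \<in> Linf" "has_sigma_gradient \<sigma> v G" and H: "v \<in> Hsigma0 \<sigma> \<Omega>" using v by (auto simp: Upsilon_inf_def)
 show "v \<in> Hsigma0 \<sigma> \<Omega>" by (rule H)
 show g: "has_sigma_gradient \<sigma> v (sigma_gradient \<sigma> v)" unfolding sigma_gradient_def by (rule someI[of "has_sigma_gradient \<sigma> v", OF G(2)])
 show "sigma_gradient \<sigma> v \<in> Linf"
 proof (rule LinfI)
  show "sigma_gradient \<sigma> v \<in> borel_measurable lebesgue" by (rule has_sigma_gradient_measurable[OF g])
  show "AE x in lebesgue. norm (sigma_gradient \<sigma> v x) <= enn2real (Linf_norm G)"
   using Linf_AE_bound[OF G(1)] has_sigma_gradient_AE_unique[OF G(2) g] by eventually_elim simp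
 qed
qed

lemma Upsilon_inf_lincomb:
 fixes \<Omega> :: "(real^'n::finite) set"
 assumes \<sigma>: "0 < \<sigma>" "\<sigma> < 1" and \<Omega>: "open \<Omega>" "bounded \<Omega>" and v: "v \<in> Upsilon_inf \<sigma> \<Omega>" and w: "w \<in> Upsilon_inf \<sigma> \<Omega>"
 shows "(\<lambda>x. s * v x + t * w x) \<in> Upsilon_inf \<sigma> \<Omega>"
  and "AE x in lebesgue. sigma_gradient \<sigma> (\<lambda>x. s * v x + t * w x) x = s *\<^sub>R sigma_gradient \<sigma> v x + t *\<^sub>R sigma_gradient \<sigma> w x"
proof -
 note v = Upsilon_inf_sigma_gradient[OF v] and w = Upsilon_inf_sigma_gradient[OF w]
 have g: "has_sigma_gradient \<sigma> (\<lambda>x. s * v x + t * w x) (\<lambda>x. s *\<^sub>R sigma_gradient \<sigma> v x + t *\<^sub>R sigma_gradient \<sigma> w x)"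
  by (rule Hsigma0_gradient_lincomb[OF \<sigma> \<Omega> v(1) w(1) v(2) w(2)])
 have "(\<lambda>x. s *\<^sub>R sigma_gradient \<sigma> v x + t *\<^sub>R sigma_gradient \<sigma> w x) \<in> Linf"
  by (rule Linf_add[OF Linf_scaleR[OF v(3)] Linf_scaleR[OF w(3)]])
 then show U: "(\<lambda>x. s * v x + t * w x) \<in> Upsilon_inf \<sigma> \<Omega>"
  using g Hsigma0_lincomb[OF v(1) w(1)] unfolding Upsilon_inf_def by blast
 show "AE x in lebesgue. sigma_gradient \<sigma> (\<lambda>x. s * v x + t * w x) x = s *\<^sub>R sigma_gradient \<sigma> v x + t *\<^sub>R sigma_gradient \<sigma> w x"
  by (rule has_sigma_gradient_AE_unique[OF Upsilon_inf_sigma_gradient(2)[OF U] g])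
qed

lemma quadratic_nonneg_imp_linear_0:
 fixes b c :: real
 assumes "\<And>t. 0 <= t * b + t\<^sup>2 * c" shows "b = 0"
proof (rule ccontr)
 assume b: "b \<noteq> 0"
 define k where "k = \<bar>c\<bar> + 1"
 have k: "k > 0" "c <= k" by (auto simp: k_def)
 define t where "t = - b / (2 * k)"
 have tk: "t * k = - b / 2" using k by (simp add: t_def)
 have "t * b + t\<^sup>2 * c <= t * b + t\<^sup>2 * k" using k by (intro add_left_mono mult_left_mono) auto
 also have "... = t * (b + t * k)" by (simp add: power2_eq_square algebra_simps)
 also have "... = - (b * b) / (4 * k)" unfolding tk by (simp add: t_def)
 also have "... < 0" using b k by (intro divide_neg_pos) (auto simp: zero_less_mult_iff)
 finally show False using assms[of t] by simp
qed

theorem theorem3p1: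
 fixes \<Omega> :: "(real^'n::finite) set"
  and A :: "real^'n \<Rightarrow> real^'n^'n"
  and f g :: "real^'n \<Rightarrow> real"
  and \<sigma> \<nu> q a_low a_up :: real
 assumes "0 < \<sigma>" and "\<sigma> < 1"
  and "bounded_lipschitz_domain \<Omega>"
  and "0 < a_low" and "0 < a_up" and "bounded_measurable_elliptic a_low a_up A"
  and "1 < q"
  and "0 < \<nu>" and "g \<in> Linf_ge \<nu>"
  and "f \<in> Lp (two_sharp CARD('n) \<sigma> q) \<Omega>"
 shows "\<exists>\<Lambda> \<in> Linf_dual. \<exists>u \<in> Upsilon_inf \<sigma> \<Omega>.
  (\<forall>v \<in> Upsilon_inf \<sigma> \<Omega>.
    dual_vec_mult \<Lambda> (sigma_gradient \<sigma> u) (sigma_gradient \<sigma> v)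
    + (LINT x|lebesgue. (A x *v sigma_gradient \<sigma> u x) \<bullet> sigma_gradient \<sigma> v x)
    = (LINT x|lebesgue_on \<Omega>. f x * v x)) \<and>
  (AE x in lebesgue. norm (sigma_gradient \<sigma> u x) \<le> g x) \<and>
  dual_nonneg \<Lambda> \<and>
  dual_eq_zero (dual_mult \<Lambda> (\<lambda>x. norm (sigma_gradient \<sigma> u x) - g x))"
proof -
 note \<sigma> = assms(1,2) and A = assms(6)
 have \<Omega>: "open \<Omega>" "bounded \<Omega>" using assms(3) by (auto simp: bounded_lipschitz_domain_def)
 have \<Omega>m: "\<Omega> \<in> lmeasurable" by (rule lmeasurable_open[OF \<Omega>(2,1)])
 define U where "U = Upsilon_inf \<sigma> \<Omega>"
 define D where "D = (sigma_gradient \<sigma> :: (real^'n => real) => _)"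
 have gL: "g \<in> Linf" and g\<nu>: "AE x in lebesgue. \<nu> <= g x" using assms(9) by (auto simp: Linf_ge_def)
 define M where "M = enn2real (Linf_norm g)"
 have gM: "AE x in lebesgue. g x <= M" using Linf_AE_bound[OF gL] unfolding M_def by eventually_elim auto
 have g0: "AE x in lebesgue. 0 <= g x" using g\<nu> assms(8) by (auto elim: eventually_mono)
 have gm: "g \<in> borel_measurable lebesgue" using gL by (simp add: Linf_def)
 define F where "F x = indicator \<Omega> x * f x" for x
 have F: "integrable lebesgue F"
  unfolding F_def using two_sharp_ge_1[OF \<sigma>(1) assms(7), of "CARD('n)"] by (intro Lp_imp_integrable[OF assms(10) _ \<Omega>m]) (simp add: Suc_leI)
 have F_eq: "(LINT x|lebesgue_on \<Omega>. f x * v x) = (LINT x|lebesgue. F x * v x)" for v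
  using \<Omega>m by (subst integral_restrict_space) (auto simp: F_def fmeasurableD mult.assoc)
 obtain u G where u: "u \<in> Hsigma0 \<sigma> \<Omega>" "has_sigma_gradient \<sigma> u G" "AE x in lebesgue. norm (G x) <= g x"
  and vi: "\<And>v W. v \<in> Hsigma0 \<sigma> \<Omega> ==> has_sigma_gradient \<sigma> v W ==> AE x in lebesgue. norm (W x) <= g x ==>
   (LINT x|lebesgue. F x * v x) - (LINT x|lebesgue. F x * u x) <= (LINT x|lebesgue. (A x *v G x) \<bullet> (W x - G x))"
  using gradient_constraint_variational_inequality[OF \<sigma> \<Omega> assms(4,5) A g0 gM _ F] by (auto simp: M_def)
 have "AE x in lebesgue. norm (G x) <= M" using u(3) gM by eventually_elim simp
 then have "G \<in> Linf" by (rule LinfI[OF has_sigma_gradient_measurable[OF u(2)]])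
 then have uU: "u \<in> U" using u by (auto simp: U_def Upsilon_inf_def)
 note Ug = Upsilon_inf_sigma_gradient[of _ \<sigma> \<Omega>, folded U_def D_def]
 note Uc = Upsilon_inf_lincomb[OF \<sigma> \<Omega>, folded U_def D_def]
 have GD: "AE x in lebesgue. G x = D u x" by (rule has_sigma_gradient_AE_unique[OF u(2) Ug(2)[OF uU]])
 have Dg: "AE x in lebesgue. norm (D u x) <= g x" using u(3) GD by eventually_elim simp
 obtain C1 where C1: "C1 >= 0" "\<And>v G. v \<in> Hsigma0 \<sigma> \<Omega> ==> has_sigma_gradient \<sigma> v G ==>
  sq_integrable G \<and> integrable lebesgue v \<and> (LINT x|lebesgue. \<bar>v x\<bar>) <= C1 * norm (abs_L2 G)"
  using Hsigma0_integral_abs_le[OF \<sigma> \<Omega>] by blast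
 have Ds: "sq_integrable (D v)" if v: "v \<in> U" for v using C1(2)[OF Ug(1,2)[OF v]] by blast
 have Dm: "D v \<in> borel_measurable lebesgue" if v: "v \<in> U" for v by (rule sq_integrable_measurable[OF Ds[OF v]])
 obtain C2 where C2: "C2 >= 0" "\<And>v G M. v \<in> Hsigma0 \<sigma> \<Omega> ==> has_sigma_gradient \<sigma> v G ==>
  AE x in lebesgue. norm (G x) <= M ==> M >= 0 ==> AE x in lebesgue. \<bar>v x\<bar> <= C2 * (M + norm (abs_L2 G))"
  using Hsigma0_sup_bound[OF \<sigma> \<Omega>] by blast
 have Fv: "integrable lebesgue (\<lambda>x. F x * v x)" if v: "v \<in> U" for v
  by (rule integrable_times_ess_bounded(1)[OF F Hsigma0_measurable[OF Ug(1)[OF v]] C2(2)[OF Ug(1,2)[OF v] Linf_AE_bound[OF Ug(3)[OF v]]]]) simp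
 have ADs: "sq_integrable (\<lambda>x. A x *v D u x)" by (rule elliptic_sq_integrable(1)[OF A Ds[OF uU]])
 define e where "e v = (LINT x|lebesgue. (A x *v D u x) \<bullet> D v x) - (LINT x|lebesgue. F x * v x)" for v
 have e_lin: "e (\<lambda>x. s * v x + t * w x) = s * e v + t * e w" if v: "v \<in> U" and w: "w \<in> U" for v w s t
 proof -
  note c = Uc[OF v w, of s t]
  have "(LINT x|lebesgue. (A x *v D u x) \<bullet> D (\<lambda>x. s * v x + t * w x) x) =
    (LINT x|lebesgue. s * ((A x *v D u x) \<bullet> D v x) + t * ((A x *v D u x) \<bullet> D w x))"
  proof (rule integral_cong_AE)
   show "AE x in lebesgue. (A x *v D u x) \<bullet> D (\<lambda>x. s * v x + t * w x) x = s * ((A x *v D u x) \<bullet> D v x) + t * ((A x *v D u x) \<bullet> D w x)"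
    using c(2) by eventually_elim (simp add: inner_add_right)
   show "(\<lambda>x. (A x *v D u x) \<bullet> D (\<lambda>x. s * v x + t * w x) x) \<in> borel_measurable lebesgue"
    using sq_integrable_inner[OF ADs Ds[OF c(1)]] by simp
   show "(\<lambda>x. s * ((A x *v D u x) \<bullet> D v x) + t * ((A x *v D u x) \<bullet> D w x)) \<in> borel_measurable lebesgue"
    using sq_integrable_inner[OF ADs Ds[OF v]] sq_integrable_inner[OF ADs Ds[OF w]] by simp
  qed
  moreover have "(LINT x|lebesgue. F x * (s * v x + t * w x)) = (LINT x|lebesgue. s * (F x * v x) + t * (F x * w x))"
   by (intro Bochner_Integration.integral_cong refl) (simp add: algebra_simps)
  ultimately show ?thesis
   using Fv[OF v] Fv[OF w] sq_integrable_inner[OF ADs Ds[OF v]] sq_integrable_inner[OF ADs Ds[OF w]]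
   by (simp add: e_def algebra_simps)
 qed
 define cost where "cost v = e v - e u" for v
 define cons where "cons v x = ((norm (D v x))\<^sup>2 - (g x)\<^sup>2) / 2" for v x
 have cons_Linf: "cons v \<in> Linf" if v: "v \<in> U" for v
 proof -
  have nD: "(\<lambda>x. norm (D v x)) \<in> Linf" by (rule Linf_norm[OF Ug(3)[OF v]])
  have "(\<lambda>x. (1/2) *\<^sub>R (norm (D v x) * norm (D v x)) + (- (1/2)) *\<^sub>R (g x * g x)) \<in> Linf"
   by (intro Linf_add Linf_scaleR Linf_mult nD gL)
  moreover have "(\<lambda>x. (1/2) *\<^sub>R (norm (D v x) * norm (D v x)) + (- (1/2)) *\<^sub>R (g x * g x)) = cons v"
   by (simp add: fun_eq_iff cons_def power2_eq_square diff_divide_distrib)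
  ultimately show ?thesis by simp
 qed
 obtain \<Lambda> where \<Lambda>: "\<Lambda> \<in> Linf_dual" "dual_nonneg \<Lambda>" and \<Lambda>_cost: "\<And>v. v \<in> U ==> 0 <= cost v + \<Lambda> (cons v)"
 proof (rule slater_multiplier[where V=U and cost=cost and cons=cons and ?v0.0="\<lambda>x. 0 * u x + 0 * u x" and \<epsilon>="\<nu>\<^sup>2 / 2" and u=u])
  fix v w and s t :: real assume v: "v \<in> U" and w: "w \<in> U" and st: "s > 0" "t > 0" "s + t = 1"
  note c = Uc[OF v w, of s t]
  have "cost (\<lambda>x. s * v x + t * w x) = s * e v + t * e w - (s + t) * e u" using st by (simp add: cost_def e_lin[OF v w])
  also have "... = s * cost v + t * cost w" by (simp add: cost_def algebra_simps)
  finally have 1: "cost (\<lambda>x. s * v x + t * w x) <= s * cost v + t * cost w" by simp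
  have "AE x in lebesgue. cons (\<lambda>x. s * v x + t * w x) x <= s * cons v x + t * cons w x"
   using c(2)
  proof eventually_elim
   case (elim x)
   have "(norm (s *\<^sub>R D v x + t *\<^sub>R D w x))\<^sup>2 <= (s * norm (D v x) + t * norm (D w x))\<^sup>2"
    using norm_triangle_ineq[of "s *\<^sub>R D v x" "t *\<^sub>R D w x"] st by (intro power_mono) auto
   also have "... = s * (norm (D v x))\<^sup>2 + t * (norm (D w x))\<^sup>2 - s * t * (norm (D v x) - norm (D w x))\<^sup>2"
   proof -
    have "(s * a + t * b)\<^sup>2 = (s + t) * (s * a\<^sup>2 + t * b\<^sup>2) - s * t * (a - b)\<^sup>2" for a b
     by (simp add: power2_eq_square algebra_simps)
    then show ?thesis by (simp only: st(3) mult_1_left)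
   qed
   also have "... <= s * (norm (D v x))\<^sup>2 + t * (norm (D w x))\<^sup>2" using st by simp
   finally have "(norm (D (\<lambda>x. s * v x + t * w x) x))\<^sup>2 - (s + t) * (g x)\<^sup>2 <= s * (norm (D v x))\<^sup>2 + t * (norm (D w x))\<^sup>2 - (s + t) * (g x)\<^sup>2"
    using elim by simp
   then have "((norm (D (\<lambda>x. s * v x + t * w x) x))\<^sup>2 - (s + t) * (g x)\<^sup>2) / 2 <= (s * (norm (D v x))\<^sup>2 + t * (norm (D w x))\<^sup>2 - (s + t) * (g x)\<^sup>2) / 2"
    by (rule divide_right_mono) simp
   moreover have "(s * (norm (D v x))\<^sup>2 + t * (norm (D w x))\<^sup>2 - (s + t) * (g x)\<^sup>2) / 2 = s * cons v x + t * cons w x"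
    by (simp add: cons_def field_simps)
   ultimately show ?case using st(3) by (simp only: cons_def mult_1_left)
  qed
  then show "\<exists>z\<in>U. cost z <= s * cost v + t * cost w \<and> (AE x in lebesgue. cons z x <= s * cons v x + t * cons w x)"
   using 1 c(1) by blast
 next
  show "(\<lambda>x. 0 * u x + 0 * u x) \<in> U" by (rule Uc(1)[OF uU uU])
  show "\<nu>\<^sup>2 / 2 > 0" using assms(8) by simp
  show "AE x in lebesgue. cons (\<lambda>x. 0 * u x + 0 * u x) x <= - (\<nu>\<^sup>2 / 2)"
   using Uc(2)[OF uU uU, of 0 0] g\<nu>
  proof eventually_elim
   case (elim x)
   have "\<nu>\<^sup>2 <= (g x)\<^sup>2" using elim(2) assms(8) by (intro power_mono) auto
   then show ?case using elim(1) by (simp add: cons_def)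
  qed
 next
  show "cost u <= 0" by (simp add: cost_def)
  show "AE x in lebesgue. cons u x <= 0"
   using Dg by eventually_elim (auto simp: cons_def intro!: power_mono)
 next
  fix v assume v: "v \<in> U" and le: "AE x in lebesgue. cons v x <= 0"
  have "AE x in lebesgue. norm (D v x) <= g x"
   using le g0
  proof eventually_elim
   case (elim x)
   then have "(norm (D v x))\<^sup>2 <= (g x)\<^sup>2" by (simp add: cons_def)
   then show ?case using elim(2) by (rule power2_le_imp_le)
  qed
  from vi[OF Ug(1,2)[OF v] this]
  have "(LINT x|lebesgue. F x * v x) - (LINT x|lebesgue. F x * u x) <= (LINT x|lebesgue. (A x *v G x) \<bullet> (D v x - G x))" .
  also have "... = (LINT x|lebesgue. (A x *v D u x) \<bullet> D v x - (A x *v D u x) \<bullet> D u x)"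
  proof (rule integral_cong_AE)
   have Gs: "sq_integrable G" using C1(2)[OF u(1,2)] by blast
   show "(\<lambda>x. (A x *v G x) \<bullet> (D v x - G x)) \<in> borel_measurable lebesgue"
    using sq_integrable_inner[OF elliptic_sq_integrable(1)[OF A Gs] sq_integrable_diff[OF Ds[OF v] Gs]] by simp
   show "(\<lambda>x. (A x *v D u x) \<bullet> D v x - (A x *v D u x) \<bullet> D u x) \<in> borel_measurable lebesgue"
    using sq_integrable_inner[OF ADs Ds[OF v]] sq_integrable_inner[OF ADs Ds[OF uU]] by simp
   show "AE x in lebesgue. (A x *v G x) \<bullet> (D v x - G x) = (A x *v D u x) \<bullet> D v x - (A x *v D u x) \<bullet> D u x"
    using GD by eventually_elim (simp add: inner_diff_right)
  qed
  also have "... = (LINT x|lebesgue. (A x *v D u x) \<bullet> D v x) - (LINT x|lebesgue. (A x *v D u x) \<bullet> D u x)"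
   using sq_integrable_inner[OF ADs Ds[OF v]] sq_integrable_inner[OF ADs Ds[OF uU]] by simp
  finally show "0 <= cost v" by (simp add: cost_def e_def)
 qed (use uU cons_Linf in auto)
 note \<Lambda>_add = Linf_dual_add[OF \<Lambda>(1)] and \<Lambda>_mult = Linf_dual_scaleR[OF \<Lambda>(1)]
 have \<Lambda>0: "\<Lambda> (\<lambda>x. 0) = 0" using \<Lambda>_mult[OF Linf_const[of "0::real"], where c=0] by simp
 have cons_u: "AE x in lebesgue. cons u x <= 0" using Dg by eventually_elim (auto simp: cons_def intro!: power_mono)
 have \<Lambda>u: "\<Lambda> (cons u) = 0"
 proof (rule antisym)
  show "\<Lambda> (cons u) <= 0" using Linf_dual_mono[OF \<Lambda> cons_Linf[OF uU] Linf_const cons_u] \<Lambda>0 by simp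
  show "0 <= \<Lambda> (cons u)" using \<Lambda>_cost[OF uU] by (simp add: cost_def)
 qed
 have eqn: "dual_vec_mult \<Lambda> (D u) (D v) + (LINT x|lebesgue. (A x *v D u x) \<bullet> D v x) = (LINT x|lebesgue_on \<Omega>. f x * v x)"
  if v: "v \<in> U" for v
 proof -
  define p where "p x = D u x \<bullet> D v x" for x
  define r where "r x = norm (D v x) * norm (D v x)" for x
  have p: "p \<in> Linf" unfolding p_def by (rule Linf_inner[OF Ug(3)[OF uU] Ug(3)[OF v]])
  have r: "r \<in> Linf" unfolding r_def by (intro Linf_mult Linf_norm Ug(3)[OF v])
  have "0 <= t * (e v + \<Lambda> p) + t\<^sup>2 * (\<Lambda> r / 2)" for t
  proof -
   (* the inequality for u + t v is a quadratic polynomial in t without constant term *)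
   note c = Uc[OF uU v, of 1 t]
   have s1: "(\<lambda>x. t *\<^sub>R p x + (t\<^sup>2 / 2) *\<^sub>R r x) \<in> Linf" by (intro Linf_add Linf_scaleR p r)
   have s2: "(\<lambda>x. cons u x + (t *\<^sub>R p x + (t\<^sup>2 / 2) *\<^sub>R r x)) \<in> Linf" by (rule Linf_add[OF cons_Linf[OF uU] s1])
   have "\<Lambda> (cons (\<lambda>x. 1 * u x + t * v x)) = \<Lambda> (\<lambda>x. cons u x + (t *\<^sub>R p x + (t\<^sup>2 / 2) *\<^sub>R r x))"
   proof (rule Linf_dual_cong_AE[OF \<Lambda> cons_Linf[OF c(1)] s2])
    show "AE x in lebesgue. cons (\<lambda>x. 1 * u x + t * v x) x = cons u x + (t *\<^sub>R p x + (t\<^sup>2 / 2) *\<^sub>R r x)"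
     using c(2)
    proof eventually_elim
     case (elim x)
     have "(norm (D u x + t *\<^sub>R D v x))\<^sup>2 = (norm (D u x))\<^sup>2 + 2 * t * p x + t\<^sup>2 * r x"
      unfolding power2_norm_eq_inner p_def r_def power2_eq_square[of "norm _", symmetric]
      by (simp add: inner_add_left inner_add_right inner_commute power2_eq_square algebra_simps)
     then show ?case using elim by (simp add: cons_def add_divide_distrib diff_divide_distrib)
    qed
   qed
   also have "... = t * \<Lambda> p + (t\<^sup>2 / 2) * \<Lambda> r"
    using \<Lambda>_add[OF cons_Linf[OF uU] s1] \<Lambda>_add[OF Linf_scaleR[OF p] Linf_scaleR[OF r], of t "t\<^sup>2 / 2"] \<Lambda>u
    by (simp only: \<Lambda>_mult[OF p] \<Lambda>_mult[OF r] add_0_left)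
   finally have "0 <= cost (\<lambda>x. 1 * u x + t * v x) + (t * \<Lambda> p + (t\<^sup>2 / 2) * \<Lambda> r)" using \<Lambda>_cost[OF c(1)] by simp
   moreover have "cost (\<lambda>x. 1 * u x + t * v x) = t * e v" unfolding cost_def e_lin[OF uU v] by simp
   ultimately show ?thesis by (simp add: algebra_simps)
  qed
  then have "e v + \<Lambda> p = 0" by (rule quadratic_nonneg_imp_linear_0)
  then show ?thesis unfolding F_eq by (simp add: e_def dual_vec_mult_def p_def[abs_def])
 qed
 have compl: "dual_eq_zero (dual_mult \<Lambda> (\<lambda>x. norm (D u x) - g x))" unfolding dual_eq_zero_def dual_mult_def
 proof
  fix w :: "real^'n => real" assume w: "w \<in> Linf"
  define h where "h x = norm (D u x) + (-1) *\<^sub>R g x" for x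
  have h: "h \<in> Linf" unfolding h_def by (intro Linf_add Linf_scaleR Linf_norm Ug(3)[OF uU] gL)
  have hw: "(\<lambda>x. h x * w x) \<in> Linf" by (rule Linf_mult[OF h w])
  (* g + |Du| is at least nu, so g - |Du| is at most 2 / nu times the negative constraint *)
  define k where "k = enn2real (Linf_norm w) * (2 / \<nu>)"
  have k: "AE x in lebesgue. \<bar>h x * w x\<bar> <= (- k) *\<^sub>R cons u x"
   using Dg g\<nu> Linf_AE_bound[OF w]
  proof eventually_elim
   case (elim x)
   have hx: "\<bar>h x\<bar> = g x - norm (D u x)" using elim(1) by (simp add: h_def)
   have "\<nu> <= g x + norm (D u x)" using elim(2) norm_ge_zero[of "D u x"] by linarith
   then have "\<nu> * (g x - norm (D u x)) <= (g x + norm (D u x)) * (g x - norm (D u x))"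
    using elim(1) by (intro mult_right_mono) auto
   also have "... = (g x)\<^sup>2 - (norm (D u x))\<^sup>2" by (simp add: power2_eq_square algebra_simps)
   also have "... = 2 * - cons u x"
   proof -
    have "2 * - (y / 2) = - y" for y :: real by simp
    then show ?thesis by (simp only: cons_def minus_diff_eq)
   qed
   finally have "\<bar>h x\<bar> <= (2 / \<nu>) * - cons u x" unfolding hx using assms(8) by (simp add: field_simps)
   then have "\<bar>w x\<bar> * \<bar>h x\<bar> <= enn2real (Linf_norm w) * ((2 / \<nu>) * - cons u x)"
    using elim(3) by (intro mult_mono) auto
   then show ?case by (simp add: abs_mult k_def mult_ac)
  qed
  have kc: "(\<lambda>x. (- k) *\<^sub>R cons u x) \<in> Linf" "(\<lambda>x. k *\<^sub>R cons u x) \<in> Linf" by (rule Linf_scaleR[OF cons_Linf[OF uU]])+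
  have "\<Lambda> (\<lambda>x. h x * w x) <= \<Lambda> (\<lambda>x. (- k) *\<^sub>R cons u x)"
   using k by (intro Linf_dual_mono[OF \<Lambda> hw kc(1)]) (auto elim!: eventually_mono)
  moreover have "\<Lambda> (\<lambda>x. k *\<^sub>R cons u x) <= \<Lambda> (\<lambda>x. h x * w x)"
   using k by (intro Linf_dual_mono[OF \<Lambda> kc(2) hw]) (auto elim!: eventually_mono)
  ultimately have "\<Lambda> (\<lambda>x. h x * w x) = 0" using \<Lambda>u by (simp only: \<Lambda>_mult[OF cons_Linf[OF uU]])
  then show "\<Lambda> (\<lambda>x. (norm (D u x) - g x) * w x) = 0" by (simp add: h_def[abs_def])
 qed
 show ?thesis using \<Lambda> uU eqn Dg compl unfolding U_def D_def by blast
qed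

end
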